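(* Let $a,b,s\in\mathbb{R}$ with $s\neq0$ and $\xi_p\in[0,1]$. Consider either the pointwise measurement (D) $y_m(t)=y(t,\xi_p)$, with $c_{1,n}=\phi_{1,n}^1(\xi_p)$ and $c_{2,m}=\phi_{2,m}^1(\xi_p)$, or the pointwise measurement (N) $y_m(t)=\partial_xy(t,\xi_p)$, with $c_{1,n}=(\phi_{1,n}^1)'(\xi_p)$ and $c_{2,m}=(\phi_{2,m}^1)'(\xi_p)$. Let $\delta>0$ be arbitrary. Let $N_0,M_0\geq0$ be integers such that $\lambda_{1,N_0+1}<-\delta$, $\lambda_{2,M_0+1}<-\delta$, $N_0\geq\max\Delta_1(a,b)$ and $M_0\geq\max\Delta_2(a,b)$. Assume that $\Theta(a,b)\cap\{0,\ldots,N_0\}=\emptyset$, that $c_{1,n}\neq0$ for all $0\leq n\leq N_0$, and that $c_{2,m}\neq0$ for all $m\in\{0,1,\ldots,M_0\}\setminus\Delta_2(a,b)$. Let $K=\begin{bmatrix}K_x&k_u\end{bmatrix}\in\mathbb{R}^{1\times(N_0+M_0+3)}$ (with $K_x\in\mathbb{R}^{1\times(N_0+M_0+2)}$, $k_u\in\mathbb{R}$) and $L\in\mathbb{R}^{N_0+M_0+2}$ be matrices such that $A_{1,a}-B_{1,a}K$ and $A_1-LC_1$ are Hurwitz with eigenvalues of real part less than $-\delta$. Then, for any integers $N\geq N_0$ and $M\geq M_0$ chosen sufficiently large, there exists $C>0$ such that, for all initial conditions $y_0,z_0\in H^2(0,1)$ and $u(0)=u_0\in\mathbb{R}$ with $y_0(1)=z_0'(1)=0$,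 $y_0'(0)=sz_0(0)$ and $z_0'(0)=u(0)$, and all $\hat X_1(0)\in\mathbb{R}^{N_0+M_0+2}$, $\hat x_{1,n}(0),\hat x_{2,m}(0)\in\mathbb{R}$ ($N_0+1\le n\le N$, $M_0+1\le m\le M$), the solutions of the system $$\partial_t y=\partial_{xx}y+ay,\quad \partial_t z=\partial_{xx}z+bz,\quad \partial_x y(t,0)=s\,z(t,0),\quad y(t,1)=\partial_x z(t,1)=0,\quad \partial_x z(t,0)=u(t),$$ $$y(0,x)=y_0(x),\quad z(0,x)=z_0(x)\qquad(t>0,\ x\in(0,1)),$$ in closed loop with the output-feedback controller $$\dot u=v,\qquad v=-K_x\hat X_1-k_uu,$$ $$\dot{\hat X}_1=A_1\hat X_1+B_{1,u}u+B_{1,v}v-L\Big\{C_1\hat X_1+\sum_{n=N_0+1}^Nc_{1,n}\hat x_{1,n}+\sum_{m=M_0+1}^Mc_{2,m}\hat x_{2,m}-y_m(t)\Big\},$$ $$\dot{\hat x}_{1,n}=\lambda_{1,n}\hat x_{1,n}+\alpha_{1,n}u+\beta_{1,n}v\ \ (N_0+1\le n\le N),\qquad \dot{\hat x}_{2,m}=\lambda_{2,m}\hat x_{2,m}+\alpha_{2,m}u+\beta_{2,m}v\ \ (M_0+1\le m\le M),$$ satisfy, for every $t\geq0$, $$\Vert(y(t,\cdot),z(t,\cdot))\Vert_{\mathcal{H}^1}^2+u(t)^2+\Vert\hat X_1(t)\Vert^2+\sum_{n=N_0+1}^N\hat x_{1,n}(t)^2+\sum_{m=M_0+1}^M\hat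 x_{2,m}(t)^2$$ $$\leq Ce^{-2\delta t}\Big(\Vert(y_0,z_0)\Vert_{\mathcal{H}^1}^2+u_0^2+\Vert\hat X_1(0)\Vert^2+\sum_{n=N_0+1}^N\hat x_{1,n}(0)^2+\sum_{m=M_0+1}^M\hat x_{2,m}(0)^2\Big).$$
   Context: $\mathbb{N}=\{0,1,2,\ldots\}$. Spaces. $\mathcal{H}^0=L^2(0,1)\times L^2(0,1)$ with inner product $\langle(f_1,g_1),(f_2,g_2)\rangle=\int_0^1(f_1f_2+g_1g_2)\,dx$. $H^1_{(1)}(0,1)=\{f\in H^1(0,1)\mid f(1)=0\}$ with inner product $\int_0^1 f_1'f_2'\,dx$; $\mathcal{H}^1=H^1_{(1)}(0,1)\times H^1(0,1)$ with inner product $\int_0^1(f_1'f_2'+g_1g_2+g_1'g_2')\,dx$. Below $\langle\cdot,\cdot\rangle$ is the inner product of $\mathcal{H}^0$. Eigenvalues and index sets. For $n,m\in\mathbb{N}$: $\lambda_{1,n}=a-(n+1/2)^2\pi^2$, $\lambda_{2,m}=b-m^2\pi^2$. $\Delta(a,b)=\{(n,m)\in\mathbb{N}^2\mid 4(b-a)=(4m^2-(2n+1)^2)\pi^2\}$ (a finite set, equivalently the set of $(n,m)$ with $\lambda_{1,n}=\lambda_{2,m}$); $\Delta_1(a,b)$ and $\Delta_2(a,b)$ are its projections on the first and second coordinate (the conditions $N_0\ge\max\Delta_1(a,b)$, $M_0\ge\max\Delta_2(a,b)$ are vacuous if these sets are empty). $\Theta(a,b)=\{n\in\mathbb{N}\mid\exists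 k\in\mathbb{N},\ 4(b-a)=((2k+1)^2-(2n+1)^2)\pi^2\}$. $\mu_0=1$ and $\mu_m=\sqrt2$ for $m\geq1$. Functions $\phi_{i,k}^1$. $\phi_{1,n}^1(x)=\sqrt2\cos((n+1/2)\pi x)$. For $m\notin\Delta_2(a,b)$ with $b-a=m^2\pi^2$: $\phi_{2,m}^1(x)=s\mu_m(-1+x)$. For $m\notin\Delta_2(a,b)$ with $b-a\neq m^2\pi^2$: $\phi_{2,m}^1(x)=-\frac{s\mu_m}{r_m\cosh(r_m)}\sinh(r_m(1-x))$ where $r_m$ is one of the two (complex) square roots of $b-a-m^2\pi^2$. For $m\in\Delta_2(a,b)$ with $(k,m)\in\Delta(a,b)$: $\phi_{2,m}^1(x)=\frac{s\mu_m}{(k+1/2)\pi}(1-x)\sin((k+1/2)\pi x)$. Functions $\psi_{i,k}=(\psi_{i,k}^1,\psi_{i,k}^2)$. $\psi_{2,m}^1=0$ and $\psi_{2,m}^2(x)=\mu_m\cos(m\pi x)$. $\psi_{1,n}^1(x)=\sqrt2\cos((n+1/2)\pi x)$, and: if $n\notin\Delta_1(a,b)$, $\psi_{1,n}^2(x)=-\frac{\sqrt2 s}{r_n^*\sinh(r_n^* )}\cosh(r_n^*(1-x))$ where $r_n^*$ is one of the two (complex) square roots of $\lambda_{1,n}-b$; if $(n,0)\in\Delta(a,b)$, $\psi_{1,n}^2(x)=c_0+\sqrt2 s x-\frac{\sqrt2}{2}s x^2$ with $c_0=-s\sqrt2\left(\frac13+\frac1{(2n+1)^2\pi^2}\right)$;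 if $(n,k)\in\Delta(a,b)$ with $k\geq1$, $\psi_{1,n}^2(x)=\frac{\sqrt2 s}{k\pi}(1-x)\sin(k\pi x)+c_n\sqrt2\cos(k\pi x)$ with $c_n=-\frac{2s}{\pi^2}\left(\frac1{(2n+1)^2}+\frac1{4k^2}\right)$. Homogenized state. $\varphi(x)=x-x^2/2$, $\alpha=\varphi''+b\varphi$, $\beta=-\varphi$, $\tilde z(t,x)=z(t,x)-\varphi(x)u(t)$, $\tilde{\mathcal X}(t)=(y(t,\cdot),\tilde z(t,\cdot))$, $v=\dot u$. The system is equivalent to $\frac{d}{dt}\tilde{\mathcal X}=\mathcal{A}\tilde{\mathcal X}+(0,\alpha)u+(0,\beta)v$, $\dot u=v$, where $\mathcal{A}(f,g)=(f''+af,g''+bg)$ on $D(\mathcal{A})=\{(f,g)\in H^2(0,1)^2\mid f(1)=g'(0)=g'(1)=0,\ f'(0)=s g(0)\}$; solutions are classical solutions, with $\tilde{\mathcal X}(t)\in D(\mathcal{A})$. Set $\alpha_{i,k}=\langle(0,\alpha),\psi_{i,k}\rangle$, $\beta_{i,k}=\langle(0,\beta),\psi_{i,k}\rangle$. Matrices. Let $N_\Delta=\mathrm{Card}(\Delta(a,b))$ and write $\Delta(a,b)=\{(\theta_1(i),\theta_2(i))\mid 0\le i\le N_\Delta-1\}$ with $\theta_1,\theta_2$ increasing. Let $\varphi_1$ be the permutation of $\{0,\ldots,N_0\}$ with $\varphi_1(i)=\theta_1(i)$ for $0\le i\le N_\Delta-1$ and $\varphi_1$ increasing on $\{N_\Delta,\ldots,N_0\}$;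 let $\varphi_2$ be the permutation of $\{0,\ldots,M_0\}$ with $\varphi_2(i)=\theta_2(i)$ for $0\le i\le N_\Delta-1$ and $\varphi_2$ increasing on $\{N_\Delta,\ldots,M_0\}$. For a family $w=(w_{i,k})$ write $[w]$ for the column vector of $\mathbb{R}^{N_0+M_0+2}$ with successive entries $w_{1,\varphi_1(0)},w_{2,\varphi_2(0)},\ldots,w_{1,\varphi_1(N_\Delta-1)},w_{2,\varphi_2(N_\Delta-1)},\ w_{1,\varphi_1(N_\Delta)},\ldots,w_{1,\varphi_1(N_0)},\ w_{2,\varphi_2(N_\Delta)},\ldots,w_{2,\varphi_2(M_0)}$. For $(n,m)\in\Delta(a,b)$ with $\lambda=\lambda_{1,n}=\lambda_{2,m}$ let $M_n=\begin{bmatrix}\lambda&-\sqrt2 s\mu_m\\0&\lambda\end{bmatrix}$. Set $B_{1,u}=[\alpha]$ (entries $\alpha_{i,k}$), $B_{1,v}=[\beta]$ (entries $\beta_{i,k}$), $C_1=[c]^\top$ (entries $c_{i,k}$), $A_1$ the block-diagonal matrix with successive diagonal blocks $M_{\varphi_1(0)},\ldots,M_{\varphi_1(N_\Delta-1)},\lambda_{1,\varphi_1(N_\Delta)},\ldots,\lambda_{1,\varphi_1(N_0)},\lambda_{2,\varphi_2(N_\Delta)},\ldots,\lambda_{2,\varphi_2(M_0)}$, and $$A_{1,a}=\begin{bmatrix}A_1&B_{1,u}\\0&0\end{bmatrix},\quad B_{1,a}=\begin{bmatrix}B_{1,v}\\1\end{bmatrix}.$$ *)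

theory Defs
  imports "HOL-Analysis.Analysis" "Jordan_Normal_Form.Spectral_Radius"
begin

unbundle no vec_syntax
unbundle no inner_syntax

text \<open>Functions on [0,1] are total functions on the reals of which only the values on [0,1] matter.
  Elements of $H^1$ and $H^2$ are represented by their continuous (resp. $C^1$) representative, so
  that evaluation at a point makes sense.\<close>

abbreviation unit_interval_measure :: "real measure" where
  "unit_interval_measure \<equiv> lebesgue_on {0..1}"

definition L2_space :: "(real \<Rightarrow> real) set" where
  "L2_space = {f. f \<in> borel_measurable unit_interval_measure \<and>
                  integrable unit_interval_measure (\<lambda>x. (f x)\<^sup>2)}"

definition norm_L2 :: "(real \<Rightarrow> real) \<Rightarrow> real" where
  "norm_L2 f = sqrt (LINT x|unit_interval_measure. (f x)\<^sup>2)"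

text \<open>The derivative relative to [0,1], one-sided at the end points. For a function in $H^1$ it
  exists almost everywhere and is its weak derivative.\<close>

definition Dx :: "(real \<Rightarrow> real) \<Rightarrow> real \<Rightarrow> real" where
  "Dx f x = vector_derivative f (at x within {0..1})"

definition H1_space :: "(real \<Rightarrow> real) set" where
  "H1_space = {f. \<exists>g \<in> L2_space. \<forall>x \<in> {0..1}. f x = f 0 + (LINT r|lebesgue_on {0..x}. g r)}"

definition H2_space :: "(real \<Rightarrow> real) set" where
  "H2_space = {f. (\<forall>x \<in> {0..1}. f differentiable (at x within {0..1})) \<and> Dx f \<in> H1_space}"

type_synonym state = "(real \<Rightarrow> real) \<times> (real \<Rightarrow> real)"

definition inner_H0 :: "state \<Rightarrow> state \<Rightarrow> real" where
  "inner_H0 p q = (LINT x|unit_interval_measure. fst p x * fst q x + snd p x * snd q x)"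

definition inner_H1 :: "state \<Rightarrow> state \<Rightarrow> real" where
  "inner_H1 p q = (LINT x|unit_interval_measure.
     Dx (fst p) x * Dx (fst q) x + snd p x * snd q x + Dx (snd p) x * Dx (snd q) x)"

definition norm_H1 :: "state \<Rightarrow> real" where
  "norm_H1 p = sqrt (inner_H1 p p)"

definition lam1 :: "real \<Rightarrow> nat \<Rightarrow> real" where
  "lam1 a n = a - (real n + 1/2)\<^sup>2 * pi\<^sup>2"

definition lam2 :: "real \<Rightarrow> nat \<Rightarrow> real" where
  "lam2 b m = b - (real m)\<^sup>2 * pi\<^sup>2"

definition Delta :: "real \<Rightarrow> real \<Rightarrow> (nat \<times> nat) set" where
  "Delta a b = {(n, m). 4 * (b - a) = (4 * (real m)\<^sup>2 - (2 * real n + 1)\<^sup>2) * pi\<^sup>2}"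

definition Delta1 :: "real \<Rightarrow> real \<Rightarrow> nat set" where
  "Delta1 a b = fst ` Delta a b"

definition Delta2 :: "real \<Rightarrow> real \<Rightarrow> nat set" where
  "Delta2 a b = snd ` Delta a b"

definition Theta :: "real \<Rightarrow> real \<Rightarrow> nat set" where
  "Theta a b = {n. \<exists>k::nat. 4 * (b - a) = ((2 * real k + 1)\<^sup>2 - (2 * real n + 1)\<^sup>2) * pi\<^sup>2}"

lemma Delta_iff: "(n, m) \<in> Delta a b \<longleftrightarrow> lam1 a n = lam2 b m"
  by (auto simp: Delta_def lam1_def lam2_def power2_eq_square algebra_simps)

lemma Delta_fst_unique:
  assumes "(n, m) \<in> Delta a b" "(n', m) \<in> Delta a b"
  shows "n = n'"
proof -
  have "(2 * real n + 1)\<^sup>2 = (2 * real n' + 1)\<^sup>2"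
    using assms by (simp add: Delta_def)
  then show ?thesis by simp
qed

lemma Delta_snd_unique:
  assumes "(n, m) \<in> Delta a b" "(n, m') \<in> Delta a b"
  shows "m = m'"
  using assms by (simp add: Delta_def)

lemma Delta_mono:
  assumes "(n, m) \<in> Delta a b" "(n', m') \<in> Delta a b" "n < n'"
  shows "m < m'"
proof -
  have "(4 * (real m)\<^sup>2 - (2 * real n + 1)\<^sup>2) * pi\<^sup>2 = (4 * (real m')\<^sup>2 - (2 * real n' + 1)\<^sup>2) * pi\<^sup>2"
    using assms by (simp add: Delta_def)
  then have *: "4 * (real m)\<^sup>2 - (2 * real n + 1)\<^sup>2 = 4 * (real m')\<^sup>2 - (2 * real n' + 1)\<^sup>2"
    by simp
  have "(2 * real n + 1)\<^sup>2 < (2 * real n' + 1)\<^sup>2"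
    using assms(3) by (intro power_strict_mono) auto
  with * have "(real m)\<^sup>2 < (real m')\<^sup>2" by linarith
  then show ?thesis using power_less_imp_less_base[of "real m" 2 "real m'"] by simp
qed

lemma finite_Delta: "finite (Delta a b)"
proof (cases "Delta a b = {}")
  case False
  then obtain n0 m0 where 0: "(n0, m0) \<in> Delta a b" by auto
  define c where "c = 4 * (int m0)\<^sup>2 - (2 * int n0 + 1)\<^sup>2"
  have "n \<le> nat \<bar>c\<bar> \<and> m \<le> nat \<bar>c\<bar>" if nm: "(n, m) \<in> Delta a b" for n m
  proof -
    have "(4 * (real m)\<^sup>2 - (2 * real n + 1)\<^sup>2) * pi\<^sup>2 = (4 * (real m0)\<^sup>2 - (2 * real n0 + 1)\<^sup>2) * pi\<^sup>2"
      using 0 nm by (simp add: Delta_def)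
    then have "4 * (real m)\<^sup>2 - (2 * real n + 1)\<^sup>2 = 4 * (real m0)\<^sup>2 - (2 * real n0 + 1)\<^sup>2"
      by simp
    then have "real_of_int (4 * (int m)\<^sup>2 - (2 * int n + 1)\<^sup>2) = real_of_int c"
      by (simp add: c_def)
    then have "4 * (int m)\<^sup>2 - (2 * int n + 1)\<^sup>2 = c"
      using of_int_eq_iff by blast
    then have "c = (2 * int m - 2 * int n - 1) * (2 * int m + 2 * int n + 1)"
      by (simp add: power2_eq_square algebra_simps)
    then have "\<bar>c\<bar> = \<bar>2 * int m - 2 * int n - 1\<bar> * (2 * int m + 2 * int n + 1)"
      by (simp add: abs_mult)
    moreover have "1 \<le> \<bar>2 * int m - 2 * int n - 1\<bar>" by presburger
    ultimately have "1 * (2 * int m + 2 * int n + 1) \<le> \<bar>c\<bar>"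
      by (metis mult_right_mono of_nat_0_le_iff add_nonneg_nonneg zero_le_mult_iff
          zero_le_numeral zero_le_one)
    then show ?thesis by auto
  qed
  then have "Delta a b \<subseteq> {..nat \<bar>c\<bar>} \<times> {..nat \<bar>c\<bar>}" by auto
  then show ?thesis by (rule finite_subset) auto
qed simp

definition mu :: "nat \<Rightarrow> real" where
  "mu m = (if m = 0 then 1 else sqrt 2)"

definition phi1 :: "nat \<Rightarrow> real \<Rightarrow> real" where
  "phi1 n x = sqrt 2 * cos ((real n + 1/2) * pi * x)"

text \<open>The complex expressions below are even in the square root and real-valued, whence the choice
  of \<^const>\<open>csqrt\<close> and the use of \<^const>\<open>Re\<close>; see the lemmas that follow.\<close>

definition phi2 :: "real \<Rightarrow> real \<Rightarrow> real \<Rightarrow> nat \<Rightarrow> real \<Rightarrow> real" where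
  "phi2 a b s m x =
     (if m \<in> Delta2 a b then
        let k = (THE k. (k, m) \<in> Delta a b)
        in s * mu m / ((real k + 1/2) * pi) * (1 - x) * sin ((real k + 1/2) * pi * x)
      else if b - a = (real m)\<^sup>2 * pi\<^sup>2 then s * mu m * (- 1 + x)
      else
        let r = csqrt (of_real (b - a - (real m)\<^sup>2 * pi\<^sup>2))
        in Re (- (of_real (s * mu m) / (r * cosh r)) * sinh (r * of_real (1 - x))))"

definition psi1_snd :: "real \<Rightarrow> real \<Rightarrow> real \<Rightarrow> nat \<Rightarrow> real \<Rightarrow> real" where
  "psi1_snd a b s n x =
     (if n \<in> Delta1 a b then
        let k = (THE k. (n, k) \<in> Delta a b) in
        if k = 0 then
          - s * sqrt 2 * (1/3 + 1 / ((2 * real n + 1)\<^sup>2 * pi\<^sup>2)) + sqrt 2 * s * x - sqrt 2 / 2 * s * x\<^sup>2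
        else
          sqrt 2 * s / (real k * pi) * (1 - x) * sin (real k * pi * x)
          + (- (2 * s / pi\<^sup>2) * (1 / (2 * real n + 1)\<^sup>2 + 1 / (4 * (real k)\<^sup>2))) * sqrt 2 * cos (real k * pi * x)
      else
        let r = csqrt (of_real (lam1 a n - b))
        in Re (- (of_real (sqrt 2 * s) / (r * sinh r)) * cosh (r * of_real (1 - x))))"

lemma csqrt_eq_or_minus:
  assumes "r\<^sup>2 = z"
  shows "r = csqrt z \<or> r = - csqrt z"
  using assms by (metis power2_csqrt power2_eq_iff)

lemma csqrt_real_cases:
  "csqrt (of_real d) = of_real (sqrt d) \<or> csqrt (of_real d) = \<i> * of_real (sqrt (- d))"
proof (cases "d \<ge> 0")
  case True
  then show ?thesis by (simp add: csqrt_of_real_nonneg)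
next
  case False
  then show ?thesis by (simp add: csqrt_of_real_nonpos)
qed

lemma phi2_root:
  assumes "m \<notin> Delta2 a b" "b - a \<noteq> (real m)\<^sup>2 * pi\<^sup>2"
    and "r\<^sup>2 = complex_of_real (b - a - (real m)\<^sup>2 * pi\<^sup>2)"
  shows "complex_of_real (phi2 a b s m x) =
           - (of_real (s * mu m) / (r * cosh r)) * sinh (r * of_real (1 - x))"
proof -
  define q where "q = csqrt (of_real (b - a - (real m)\<^sup>2 * pi\<^sup>2))"
  define F where "F = (\<lambda>r. - (of_real (s * mu m) / (r * cosh r)) * sinh (r * complex_of_real (1 - x)))"
  have "F q \<in> \<real>"
    using csqrt_real_cases[of "b - a - (real m)\<^sup>2 * pi\<^sup>2"]
  proof
    assume "csqrt (of_real (b - a - (real m)\<^sup>2 * pi\<^sup>2)) = of_real (sqrt (b - a - (real m)\<^sup>2 * pi\<^sup>2))"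
    then obtain w where w: "q = complex_of_real w" unfolding q_def by blast
    have "F q = of_real (- (s * mu m / (w * cosh w)) * sinh (w * (1 - x)))"
      unfolding F_def w by (simp add: sinh_def cosh_def exp_of_real scaleR_conv_of_real flip: exp_of_real)
    then show ?thesis by simp
  next
    assume "csqrt (of_real (b - a - (real m)\<^sup>2 * pi\<^sup>2)) = \<i> * of_real (sqrt (- (b - a - (real m)\<^sup>2 * pi\<^sup>2)))"
    then obtain w where w: "q = \<i> * complex_of_real w" unfolding q_def by blast
    have "F q = of_real (- (s * mu m / (w * cos w)) * sin (w * (1 - x)))"
      unfolding F_def w by (simp add: sinh_conv_sin cosh_conv_cos mult.assoc[symmetric] flip: sin_of_real cos_of_real)
    then show ?thesis by simp
  qed
  moreover have "phi2 a b s m x = Re (F q)"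
    using assms by (simp add: phi2_def F_def q_def Let_def)
  moreover have "F r = F q"
    using csqrt_eq_or_minus[OF assms(3)] by (auto simp: F_def q_def)
  ultimately show ?thesis by (simp add: F_def of_real_Re)
qed

lemma psi1_snd_root:
  assumes "n \<notin> Delta1 a b" and "r\<^sup>2 = complex_of_real (lam1 a n - b)"
  shows "complex_of_real (psi1_snd a b s n x) =
           - (of_real (sqrt 2 * s) / (r * sinh r)) * cosh (r * of_real (1 - x))"
proof -
  define q where "q = csqrt (of_real (lam1 a n - b))"
  define F where "F = (\<lambda>r. - (of_real (sqrt 2 * s) / (r * sinh r)) * cosh (r * complex_of_real (1 - x)))"
  have "F q \<in> \<real>"
    using csqrt_real_cases[of "lam1 a n - b"]
  proof
    assume "csqrt (of_real (lam1 a n - b)) = of_real (sqrt (lam1 a n - b))"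
    then obtain w where w: "q = complex_of_real w" unfolding q_def by blast
    have "F q = of_real (- (sqrt 2 * s / (w * sinh w)) * cosh (w * (1 - x)))"
      unfolding F_def w by (simp add: sinh_def cosh_def exp_of_real scaleR_conv_of_real flip: exp_of_real)
    then show ?thesis by simp
  next
    assume "csqrt (of_real (lam1 a n - b)) = \<i> * of_real (sqrt (- (lam1 a n - b)))"
    then obtain w where w: "q = \<i> * complex_of_real w" unfolding q_def by blast
    have 1: "q * sinh q = - complex_of_real (w * sin w)"
      unfolding w sinh_conv_sin by (simp add: sin_of_real complex_eq_iff)
    have 2: "cosh (q * complex_of_real (1 - x)) = of_real (cos (w * (1 - x)))"
      unfolding w cosh_conv_cos by (simp add: mult.assoc[symmetric] flip: cos_of_real)
    have "F q = of_real ((sqrt 2 * s / (w * sin w)) * cos (w * (1 - x)))"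
      unfolding F_def 1 2 by simp
    then show ?thesis by simp
  qed
  moreover have "psi1_snd a b s n x = Re (F q)"
    using assms by (simp add: psi1_snd_def F_def q_def Let_def)
  moreover have "F r = F q"
    using csqrt_eq_or_minus[OF assms(2)] by (auto simp: F_def q_def)
  ultimately show ?thesis by (simp add: F_def of_real_Re)
qed

definition psi1 :: "real \<Rightarrow> real \<Rightarrow> real \<Rightarrow> nat \<Rightarrow> state" where
  "psi1 a b s n = ((\<lambda>x. sqrt 2 * cos ((real n + 1/2) * pi * x)), psi1_snd a b s n)"

definition psi2 :: "nat \<Rightarrow> state" where
  "psi2 m = ((\<lambda>x. 0), (\<lambda>x. mu m * cos (real m * pi * x)))"

definition varphi :: "real \<Rightarrow> real" where
  "varphi x = x - x\<^sup>2 / 2"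

definition alpha :: "real \<Rightarrow> real \<Rightarrow> real" where
  "alpha b x = deriv (deriv varphi) x + b * varphi x"

definition beta :: "real \<Rightarrow> real" where
  "beta x = - varphi x"

definition alpha1 :: "real \<Rightarrow> real \<Rightarrow> real \<Rightarrow> nat \<Rightarrow> real" where
  "alpha1 a b s n = inner_H0 (\<lambda>x. 0, alpha b) (psi1 a b s n)"

definition alpha2 :: "real \<Rightarrow> nat \<Rightarrow> real" where
  "alpha2 b m = inner_H0 (\<lambda>x. 0, alpha b) (psi2 m)"

definition beta1 :: "real \<Rightarrow> real \<Rightarrow> real \<Rightarrow> nat \<Rightarrow> real" where
  "beta1 a b s n = inner_H0 (\<lambda>x. 0, beta) (psi1 a b s n)"

definition beta2 :: "nat \<Rightarrow> real" where
  "beta2 m = inner_H0 (\<lambda>x. 0, beta) (psi2 m)"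

datatype measurement = Dirichlet | Neumann

fun measure_at :: "measurement \<Rightarrow> real \<Rightarrow> (real \<Rightarrow> real) \<Rightarrow> real" where
  "measure_at Dirichlet \<xi> f = f \<xi>"
| "measure_at Neumann \<xi> f = Dx f \<xi>"

definition c1 :: "measurement \<Rightarrow> real \<Rightarrow> nat \<Rightarrow> real" where
  "c1 meas \<xi> n = measure_at meas \<xi> (phi1 n)"

definition c2 :: "measurement \<Rightarrow> real \<Rightarrow> real \<Rightarrow> real \<Rightarrow> real \<Rightarrow> nat \<Rightarrow> real" where
  "c2 meas \<xi> a b s m = measure_at meas \<xi> (phi2 a b s m)"

definition N_Delta :: "real \<Rightarrow> real \<Rightarrow> nat" where
  "N_Delta a b = card (Delta a b)"

text \<open>The permutations are given as the lists of their values. By the monotonicity lemma for \<^const>\<open>Delta\<close> above, the second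
  components of \<^const>\<open>Delta\<close> increase with the first ones, so both lists of
  length \<^const>\<open>N_Delta\<close> below enumerate \<^const>\<open>Delta\<close> in the same order.\<close>

definition perm1 :: "real \<Rightarrow> real \<Rightarrow> nat \<Rightarrow> nat list" where
  "perm1 a b N0 = sorted_list_of_set (Delta1 a b) @ sorted_list_of_set ({0..N0} - Delta1 a b)"

definition perm2 :: "real \<Rightarrow> real \<Rightarrow> nat \<Rightarrow> nat list" where
  "perm2 a b M0 = sorted_list_of_set (Delta2 a b) @ sorted_list_of_set ({0..M0} - Delta2 a b)"

definition stack :: "real \<Rightarrow> real \<Rightarrow> nat \<Rightarrow> nat \<Rightarrow> (nat \<Rightarrow> real) \<Rightarrow> (nat \<Rightarrow> real) \<Rightarrow> real Matrix.vec" where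
  "stack a b N0 M0 w1 w2 = vec_of_list
     (concat (map (\<lambda>i. [w1 (perm1 a b N0 ! i), w2 (perm2 a b M0 ! i)]) [0..<N_Delta a b])
      @ map (\<lambda>i. w1 (perm1 a b N0 ! i)) [N_Delta a b..<N0 + 1]
      @ map (\<lambda>i. w2 (perm2 a b M0 ! i)) [N_Delta a b..<M0 + 1])"

definition jordan_block_M :: "real \<Rightarrow> real \<Rightarrow> nat \<Rightarrow> nat \<Rightarrow> real Matrix.mat" where
  "jordan_block_M a s n m = mat_of_rows_list 2
     [[lam1 a n, - sqrt 2 * s * mu m],
      [0,        lam1 a n]]"

definition A1 :: "real \<Rightarrow> real \<Rightarrow> real \<Rightarrow> nat \<Rightarrow> nat \<Rightarrow> real Matrix.mat" where
  "A1 a b s N0 M0 = diag_block_mat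
     (map (\<lambda>i. jordan_block_M a s (perm1 a b N0 ! i) (perm2 a b M0 ! i)) [0..<N_Delta a b]
      @ map (\<lambda>i. mat_of_rows_list 1 [[lam1 a (perm1 a b N0 ! i)]]) [N_Delta a b..<N0 + 1]
      @ map (\<lambda>i. mat_of_rows_list 1 [[lam2 b (perm2 a b M0 ! i)]]) [N_Delta a b..<M0 + 1])"

definition B1u :: "real \<Rightarrow> real \<Rightarrow> real \<Rightarrow> nat \<Rightarrow> nat \<Rightarrow> real Matrix.vec" where
  "B1u a b s N0 M0 = stack a b N0 M0 (alpha1 a b s) (alpha2 b)"

definition B1v :: "real \<Rightarrow> real \<Rightarrow> real \<Rightarrow> nat \<Rightarrow> nat \<Rightarrow> real Matrix.vec" where
  "B1v a b s N0 M0 = stack a b N0 M0 (beta1 a b s) beta2"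

definition C1 :: "measurement \<Rightarrow> real \<Rightarrow> real \<Rightarrow> real \<Rightarrow> real \<Rightarrow> nat \<Rightarrow> nat \<Rightarrow> real Matrix.mat" where
  "C1 meas \<xi> a b s N0 M0 = mat_of_row (stack a b N0 M0 (c1 meas \<xi>) (c2 meas \<xi> a b s))"

definition col_mat :: "real Matrix.vec \<Rightarrow> real Matrix.mat" where
  "col_mat v = mat_of_cols (dim_vec v) [v]"

definition A1a :: "real \<Rightarrow> real \<Rightarrow> real \<Rightarrow> nat \<Rightarrow> nat \<Rightarrow> real Matrix.mat" where
  "A1a a b s N0 M0 = four_block_mat
     (A1 a b s N0 M0)               (col_mat (B1u a b s N0 M0))
     (0\<^sub>m 1 (N0 + M0 + 2)) (0\<^sub>m 1 1)"

definition B1a :: "real \<Rightarrow> real \<Rightarrow> real \<Rightarrow> nat \<Rightarrow> nat \<Rightarrow> real Matrix.mat" where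
  "B1a a b s N0 M0 = col_mat (B1v a b s N0 M0 @\<^sub>v vec_of_list [1])"

definition gain_K :: "real Matrix.vec \<Rightarrow> real \<Rightarrow> real Matrix.mat" where
  "gain_K Kx ku = mat_of_row (Kx @\<^sub>v vec_of_list [ku])"

definition eigenvalues_left_of :: "real \<Rightarrow> real Matrix.mat \<Rightarrow> bool" where
  "eigenvalues_left_of r A \<longleftrightarrow> (\<forall>ev \<in> spectrum (map_mat complex_of_real A). Re ev < r)"

definition L2_tendsto :: "(real \<Rightarrow> real \<Rightarrow> real) \<Rightarrow> (real \<Rightarrow> real) \<Rightarrow> real filter \<Rightarrow> bool" where
  "L2_tendsto w f F \<longleftrightarrow> ((\<lambda>t. norm_L2 (\<lambda>x. w t x - f x)) \<longlongrightarrow> 0) F"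

text \<open>Classical solution of $\dot w = w'$ in $L^2(0,1)$: continuous for $t \ge 0$, continuously
  differentiable for $t > 0$, with derivative $w'$. Continuity for $t > 0$ follows from
  differentiability.\<close>

definition L2_classical :: "(real \<Rightarrow> real \<Rightarrow> real) \<Rightarrow> (real \<Rightarrow> real \<Rightarrow> real) \<Rightarrow> bool" where
  "L2_classical w w' \<longleftrightarrow>
     L2_tendsto w (w 0) (at_right 0) \<and>
     (\<forall>t>0. L2_tendsto (\<lambda>h x. (w (t + h) x - w t x) / h) (w' t) (at 0)) \<and>
     (\<forall>t>0. L2_tendsto w' (w' t) (at t))"

text \<open>Written in the original coordinates. The homogenized state $(y, z - \varphi u)$ lies in the domain of
  the operator iff $y, z \in H^2$ and the boundary conditions hold, and for continuously
  differentiable $u$ it is a classical solution iff $(y, z)$ is one.\<close>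

definition plant_solution ::
  "real \<Rightarrow> real \<Rightarrow> real \<Rightarrow> (real \<Rightarrow> real) \<Rightarrow> (real \<Rightarrow> real) \<Rightarrow>
   (real \<Rightarrow> real) \<Rightarrow> (real \<Rightarrow> real \<Rightarrow> real) \<Rightarrow> (real \<Rightarrow> real \<Rightarrow> real) \<Rightarrow> bool" where
  "plant_solution a b s y0 z0 u y z \<longleftrightarrow>
     (\<forall>x\<in>{0..1}. y 0 x = y0 x \<and> z 0 x = z0 x) \<and>
     (\<forall>t\<ge>0. y t \<in> H2_space \<and> z t \<in> H2_space \<and>
        Dx (y t) 0 = s * z t 0 \<and> y t 1 = 0 \<and> Dx (z t) 1 = 0 \<and> Dx (z t) 0 = u t) \<and>
     L2_classical y (\<lambda>t x. Dx (Dx (y t)) x + a * y t x) \<and>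
     L2_classical z (\<lambda>t x. Dx (Dx (z t)) x + b * z t x)"

definition C0_C1_solution :: "(real \<Rightarrow> real) \<Rightarrow> (real \<Rightarrow> real) \<Rightarrow> bool" where
  "C0_C1_solution w w' \<longleftrightarrow>
     continuous_on {0..} w \<and> (\<forall>t>0. (w has_real_derivative w' t) (at t)) \<and> continuous_on {0<..} w'"

definition controller_solution ::
  "measurement \<Rightarrow> real \<Rightarrow> real \<Rightarrow> real \<Rightarrow> real \<Rightarrow> nat \<Rightarrow> nat \<Rightarrow> nat \<Rightarrow> nat \<Rightarrow>
   real Matrix.vec \<Rightarrow> real \<Rightarrow> real Matrix.vec \<Rightarrow> (real \<Rightarrow> real) \<Rightarrow> (real \<Rightarrow> real) \<Rightarrow>
   (real \<Rightarrow> real Matrix.vec) \<Rightarrow> (nat \<Rightarrow> real \<Rightarrow> real) \<Rightarrow> (nat \<Rightarrow> real \<Rightarrow> real) \<Rightarrow> bool" where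
  "controller_solution meas \<xi> a b s N0 M0 N M Kx ku L ym u X x1 x2 \<longleftrightarrow>
     (let v = (\<lambda>t. - (Kx \<bullet> X t) - ku * u t);
          e = (\<lambda>t. (C1 meas \<xi> a b s N0 M0 *\<^sub>v X t) $ 0
                   + (\<Sum>n = N0 + 1..N. c1 meas \<xi> n * x1 n t)
                   + (\<Sum>m = M0 + 1..M. c2 meas \<xi> a b s m * x2 m t) - ym t)
      in
        C0_C1_solution u v \<and>
        (\<forall>t\<ge>0. X t \<in> carrier_vec (N0 + M0 + 2)) \<and>
        (\<forall>i < N0 + M0 + 2. C0_C1_solution (\<lambda>t. X t $ i)
           (\<lambda>t. (A1 a b s N0 M0 *\<^sub>v X t + u t \<cdot>\<^sub>v B1u a b s N0 M0 + v t \<cdot>\<^sub>v B1v a b s N0 M0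
                 - e t \<cdot>\<^sub>v L) $ i)) \<and>
        (\<forall>n \<in> {N0 + 1..N}. C0_C1_solution (x1 n)
           (\<lambda>t. lam1 a n * x1 n t + alpha1 a b s n * u t + beta1 a b s n * v t)) \<and>
        (\<forall>m \<in> {M0 + 1..M}. C0_C1_solution (x2 m)
           (\<lambda>t. lam2 b m * x2 m t + alpha2 b m * u t + beta2 m * v t)))"

end

theory Submission
  imports Defs
begin

text \<open>The homogenized state \<open>(y, zt)\<close>, \<open>zt = z - varphi * u\<close>, has the coordinates
\<open>X1 n = <(y, zt), psi_1n>\<close> and \<open>X2 m = <(y, zt), psi_2m>\<close>. The functions \<open>psi\<close> are generalized
eigenvectors of the adjoint of the generator, so pairing the equation with them turns it into scalar
equations, \<open>X2' = lam2 X2 + alpha2 u + beta2 v\<close> and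
\<open>X1' = lam1 X1 - resonance * X2 + alpha1 u + beta1 v\<close>, in which the resonance term occurs only for the
finitely many pairs of equal eigenvalues (\<open>X1_ode\<close>, \<open>X2_ode\<close>). Three facts
make these coordinates as good as the state itself. The measurement is the sum of the series of the
coordinates with coefficients \<open>c1\<close>, \<open>c2\<close> (\<open>expansion1\<close>, \<open>expansion2\<close>; they rest on the completeness of two
cosine systems and on \<open>biorthogonal\<close>). The norm of the state in \<open>H^1\<close> is equivalent to
\<open>sqrt (\<Sum> ((n + 1) X1 n)^2 + \<Sum> ((m + 1) X2 m)^2)\<close> (\<open>H1_lower\<close>, \<open>H1_upper\<close>). The
input coefficients satisfy \<open>alpha1, beta1 = O(1/n)\<close>, the output coefficients \<open>c1 = O(n)\<close>, and the remaining
ones are bounded.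

The slow coordinates (\<open>n \<le> N0\<close>, \<open>m \<le> M0\<close>) and the controller form a finite-dimensional system. Let \<open>E\<close>
be the difference between the vector of slow coordinates and its estimate, and let \<open>Z\<close> be the estimate
together with \<open>u\<close>. Then \<open>E' = (A1 - L C1) E - L g\<close> and \<open>Z' = (A1a - B1a K) Z + (L (C1 E + g), 0)\<close>, where \<open>g\<close> is
the part of the measurement that the observer does not account for. Both matrices have their spectrum to
the left of \<open>-\<delta>\<close>, so both systems decay at the rate \<open>\<delta>\<close> up to a multiple of a suitably measured size
of \<open>g\<close>; Schur triangulation reduces this to scalar equations solved from the bottom up (\<open>matrix_decay\<close>).

The residual \<open>g\<close> has two sources. For \<open>N0 < n \<le> N\<close> the coordinate and its copy in the observer satisfy the
same equation, so their difference decays on its own. For \<open>n > N\<close> the coordinate is driven by \<open>u\<close> and \<open>v\<close>,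
hence by \<open>Z\<close>, and contributes \<open>|c n| * |input coefficient| / (- lam n - \<delta>) = O(1/n^2)\<close> times the size
of \<open>Z\<close>. The initial values contribute \<open>\<Sum> |c n| |X n 0| exp (lam n * t)\<close>, which need not be bounded as
\<open>t\<close> tends to 0 but, divided by \<open>exp (-\<delta> t)\<close>, has a finite integral over time. This is why forcing terms are
measured by their integral (\<open>forcing_profile\<close>). Thus \<open>g\<close> is bounded by an integrable term plus
\<open>tail_gain\<close> times the size of \<open>Z\<close> (\<open>g_bound\<close>), and \<open>tail_gain\<close> is the tail of a convergent series: for large \<open>N\<close>
and \<open>M\<close> the loop closes by a small-gain argument (\<open>small_gain\<close>), with constants that do not depend on \<open>N\<close> and \<open>M\<close>
in the smallness condition. Decay of \<open>Z\<close> then forces decay of all fast coordinates, and the norm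
equivalence turns this into the estimate in \<open>H^1\<close>.\<close>

section \<open>The inner product of square-integrable functions\<close>

definition ip :: "(real \<Rightarrow> real) \<Rightarrow> (real \<Rightarrow> real) \<Rightarrow> real" where
  "ip f g = (LINT x|unit_interval_measure. f x * g x)"

lemma integrable_ip:
  assumes "f \<in> L2_space" "g \<in> L2_space"
  shows "integrable unit_interval_measure (\<lambda>x. f x * g x)"
proof (rule Bochner_Integration.integrable_bound)
  show "integrable unit_interval_measure (\<lambda>x. (f x)\<^sup>2 + (g x)\<^sup>2)"
    using assms by (auto simp: L2_space_def)
  show "(\<lambda>x. f x * g x) \<in> borel_measurable unit_interval_measure"
    using assms by (auto simp: L2_space_def)
  have "\<bar>p * q\<bar> \<le> p\<^sup>2 + q\<^sup>2" for p q :: real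
  proof -
    have "0 \<le> (\<bar>p\<bar> - \<bar>q\<bar>)\<^sup>2" by simp
    then have "2 * (\<bar>p\<bar> * \<bar>q\<bar>) \<le> p\<^sup>2 + q\<^sup>2" by (simp add: power2_diff)
    moreover have "0 \<le> \<bar>p\<bar> * \<bar>q\<bar>" by simp
    ultimately show ?thesis unfolding abs_mult by linarith
  qed
  then show "AE x in unit_interval_measure. norm (f x * g x) \<le> norm ((f x)\<^sup>2 + (g x)\<^sup>2)"
    by auto
qed

lemma L2_space_continuous:
  assumes "continuous_on {0..1} f"
  shows "f \<in> L2_space"
proof -
  have "integrable unit_interval_measure (\<lambda>x. (f x)\<^sup>2)"
    using assms by (intro continuous_imp_integrable_real continuous_intros)
  moreover have "f \<in> borel_measurable unit_interval_measure"
    using continuous_imp_integrable_real[OF assms] by auto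
  ultimately show ?thesis by (simp add: L2_space_def)
qed

lemma L2_space_add [intro]:
  assumes "f \<in> L2_space" "g \<in> L2_space"
  shows "(\<lambda>x. f x + g x) \<in> L2_space"
proof -
  have "integrable unit_interval_measure (\<lambda>x. (f x)\<^sup>2 + (g x)\<^sup>2 + 2 * (f x * g x))"
    using assms integrable_ip[OF assms] by (auto simp: L2_space_def)
  then show ?thesis using assms
    by (auto simp: L2_space_def power2_sum algebra_simps)
qed

lemma L2_space_scale [intro]:
  assumes "f \<in> L2_space" shows "(\<lambda>x. c * f x) \<in> L2_space"
  using assms by (auto simp: L2_space_def power_mult_distrib)

lemma L2_space_diff [intro]:
  assumes "f \<in> L2_space" "g \<in> L2_space"
  shows "(\<lambda>x. f x - g x) \<in> L2_space"
  using L2_space_add[OF assms(1) L2_space_scale[OF assms(2), of "-1"]] by simp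

lemma L2_space_zero [simp, intro]: "(\<lambda>x. 0) \<in> L2_space"
  by (simp add: L2_space_continuous)

lemma L2_space_sum [intro]:
  assumes "\<And>i. i \<in> S \<Longrightarrow> f i \<in> L2_space"
  shows "(\<lambda>x. \<Sum>i\<in>S. f i x) \<in> L2_space"
  using assms by (induction S rule: infinite_finite_induct) auto


lemma ip_commute: "ip f g = ip g f"
  by (simp add: ip_def mult.commute)

lemma ip_add_left:
  "f \<in> L2_space \<Longrightarrow> g \<in> L2_space \<Longrightarrow> h \<in> L2_space \<Longrightarrow> ip (\<lambda>x. f x + g x) h = ip f h + ip g h"
  by (simp add: ip_def distrib_right integrable_ip)

lemma ip_diff_left:
  "f \<in> L2_space \<Longrightarrow> g \<in> L2_space \<Longrightarrow> h \<in> L2_space \<Longrightarrow> ip (\<lambda>x. f x - g x) h = ip f h - ip g h"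
  by (simp add: ip_def left_diff_distrib integrable_ip)

lemma ip_scale_left: "ip (\<lambda>x. c * f x) h = c * ip f h"
  by (simp add: ip_def mult.assoc)

lemma ip_scale_right: "ip h (\<lambda>x. c * f x) = c * ip h f"
  by (simp add: ip_def mult.left_commute)

lemma ip_add_right:
  "f \<in> L2_space \<Longrightarrow> g \<in> L2_space \<Longrightarrow> h \<in> L2_space \<Longrightarrow> ip h (\<lambda>x. f x + g x) = ip h f + ip h g"
  by (simp add: ip_commute[of h] ip_add_left)

lemma ip_diff_right:
  "f \<in> L2_space \<Longrightarrow> g \<in> L2_space \<Longrightarrow> h \<in> L2_space \<Longrightarrow> ip h (\<lambda>x. f x - g x) = ip h f - ip h g"
  by (simp add: ip_commute[of h] ip_diff_left)

lemma ip_sum_left: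
  "(\<And>i. i \<in> S \<Longrightarrow> f i \<in> L2_space) \<Longrightarrow> h \<in> L2_space \<Longrightarrow>
    ip (\<lambda>x. \<Sum>i\<in>S. f i x) h = (\<Sum>i\<in>S. ip (f i) h)"
proof (induction S rule: infinite_finite_induct)
  case (insert i S)
  then show ?case by (simp add: ip_add_left L2_space_sum)
qed (auto simp: ip_def)

lemma ip_cong:
  assumes "\<And>x. x \<in> {0..1} \<Longrightarrow> f x = f' x" "\<And>x. x \<in> {0..1} \<Longrightarrow> g x = g' x"
  shows "ip f g = ip f' g'"
  unfolding ip_def using assms by (intro Bochner_Integration.integral_cong) auto

lemma ip_nonneg: "0 \<le> ip f f"
  unfolding ip_def by (intro Bochner_Integration.integral_nonneg) auto

lemma norm_L2_conv_ip: "norm_L2 f = sqrt (ip f f)"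
  by (simp add: norm_L2_def ip_def power2_eq_square)

lemma norm_L2_power2: "(norm_L2 f)\<^sup>2 = ip f f"
  by (simp add: norm_L2_conv_ip ip_nonneg)

lemma norm_L2_nonneg [simp]: "0 \<le> norm_L2 f"
  by (simp add: norm_L2_conv_ip ip_nonneg)

lemma ip_Cauchy_Schwarz:
  assumes "f \<in> L2_space" "g \<in> L2_space"
  shows "\<bar>ip f g\<bar> \<le> norm_L2 f * norm_L2 g"
proof -
  have *: "0 \<le> p\<^sup>2 * ip f f - 2 * p * q * ip f g + q\<^sup>2 * ip g g" for p q
  proof -
    let ?h = "\<lambda>x. p * f x - q * g x"
    have "0 \<le> ip ?h ?h" by (rule ip_nonneg)
    also have "ip ?h ?h = p\<^sup>2 * ip f f - 2 * p * q * ip f g + q\<^sup>2 * ip g g"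
      using assms by (simp add: ip_diff_left ip_diff_right ip_scale_left ip_scale_right
          L2_space_scale L2_space_diff ip_commute[of g f] power2_eq_square algebra_simps)
    finally show ?thesis .
  qed
  have "(ip f g)\<^sup>2 \<le> ip f f * ip g g"
  proof (cases "ip g g = 0")
    case True
    have "ip f g = 0"
    proof (rule ccontr)
      assume "ip f g \<noteq> 0"
      with *[of 1 "(ip f f + 1) / (2 * ip f g)"] True show False
        by (simp add: field_simps)
    qed
    then show ?thesis using True by simp
  next
    case False
    then have "0 < ip g g" using ip_nonneg[of g] by linarith
    moreover have "0 \<le> ip g g * (ip g g * ip f f - (ip f g)\<^sup>2)"
      using *[of "ip g g" "ip f g"] by (simp add: power2_eq_square algebra_simps)
    ultimately show ?thesis by (simp add: zero_le_mult_iff mult.commute)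
  qed
  then have "sqrt ((ip f g)\<^sup>2) \<le> sqrt (ip f f * ip g g)" by (rule real_sqrt_le_mono)
  then show ?thesis by (simp add: norm_L2_conv_ip real_sqrt_mult)
qed

lemma ip_bound:
  assumes "\<And>x. x \<in> {0..1} \<Longrightarrow> \<bar>f x\<bar> \<le> B" "continuous_on {0..1} f"
  shows "ip f f \<le> B\<^sup>2"
proof -
  have "(\<integral>x. f x * f x \<partial>unit_interval_measure) \<le> (\<integral>x. B\<^sup>2 \<partial>unit_interval_measure)"
  proof (rule integral_mono_AE)
    show "integrable unit_interval_measure (\<lambda>x. f x * f x)"
      using assms(2) by (intro integrable_ip L2_space_continuous)
    show "integrable unit_interval_measure (\<lambda>x. B\<^sup>2)"
      by (intro continuous_imp_integrable_real continuous_intros)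
    have "f x * f x \<le> B\<^sup>2" if "x \<in> {0..1}" for x
      using power_mono[OF assms(1)[OF that], of 2] by (simp add: power2_eq_square)
    then show "AE x in unit_interval_measure. f x * f x \<le> B\<^sup>2"
      by (auto intro: AE_I2)
  qed
  also have "\<dots> = B\<^sup>2"
    using lebesgue_integral_eq_integral[OF continuous_imp_integrable_real[OF continuous_on_const], of 0 1 "B\<^sup>2"]
    by simp
  finally show ?thesis by (simp add: ip_def)
qed

lemma norm_L2_bound:
  assumes "\<And>x. x \<in> {0..1} \<Longrightarrow> \<bar>f x\<bar> \<le> B" "continuous_on {0..1} f"
  shows "norm_L2 f \<le> B"
proof -
  have "0 \<le> B" using assms(1)[of 0] by auto
  then show ?thesis
    unfolding norm_L2_conv_ip using ip_bound[OF assms] by (simp add: real_le_lsqrt)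
qed

section \<open>Weak derivatives\<close>

text \<open>Absolute continuity on the unit interval with square-integrable derivative \<open>g\<close>. The derivative is an
explicit argument because it is determined only up to null sets; this spares all choices of representatives.\<close>
definition weak_deriv :: "(real \<Rightarrow> real) \<Rightarrow> (real \<Rightarrow> real) \<Rightarrow> bool" where
  "weak_deriv f g \<longleftrightarrow> g \<in> L2_space \<and> (\<forall>x\<in>{0..1}. f x = f 0 + integral {0..x} g)"

definition smooth_on_unit :: "(real \<Rightarrow> real) \<Rightarrow> (real \<Rightarrow> real) \<Rightarrow> bool" where
  "smooth_on_unit f g \<longleftrightarrow>
     (\<forall>x\<in>{0..1}. (f has_real_derivative g x) (at x within {0..1})) \<and> continuous_on {0..1} g"

lemma weak_deriv_eq:
  "weak_deriv f g \<Longrightarrow> x \<in> {0..1} \<Longrightarrow> f x = f 0 + integral {0..x} g"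
  unfolding weak_deriv_def by blast

lemma weak_deriv_L2': "weak_deriv f g \<Longrightarrow> g \<in> L2_space"
  by (simp add: weak_deriv_def)

lemma L2_abs_integrable:
  assumes "g \<in> L2_space"
  shows "g absolutely_integrable_on {0..1}"
proof -
  have "integrable unit_interval_measure (\<lambda>x. g x * 1)"
    using integrable_ip[OF assms L2_space_continuous[OF continuous_on_const]] .
  then have "integrable unit_interval_measure g" by simp
  then show ?thesis
    by (simp add: absolutely_integrable_measurable_real)
qed

lemma ip_conv_integral:
  assumes "f \<in> L2_space" "g \<in> L2_space"
  shows "ip f g = integral {0..1} (\<lambda>x. f x * g x)"
  unfolding ip_def by (intro lebesgue_integral_eq_integral integrable_ip assms) auto

lemma L2_integrable_sub:
  assumes "g \<in> L2_space" "0 \<le> x" "y \<le> 1"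
  shows "g absolutely_integrable_on {x..y}"
  by (rule absolutely_integrable_on_subinterval[OF L2_abs_integrable[OF assms(1)]])
     (use assms(2,3) in auto)

lemma weak_deriv_diff_eq:
  assumes "weak_deriv f g" "0 \<le> x" "x \<le> y" "y \<le> 1"
  shows "f y - f x = integral {x..y} g"
proof -
  have "integral {0..x} g + integral {x..y} g = integral {0..y} g"
    using assms L2_integrable_sub[OF weak_deriv_L2'[OF assms(1)], of 0 y]
    by (intro Henstock_Kurzweil_Integration.integral_combine)
       (auto simp: set_lebesgue_integral_eq_integral(1))
  moreover have "f x = f 0 + integral {0..x} g" "f y = f 0 + integral {0..y} g"
    using assms by (auto intro!: weak_deriv_eq)
  ultimately show ?thesis by linarith
qed

lemma weak_deriv_continuous:
  assumes "weak_deriv f g"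
  shows "continuous_on {0..1} f"
proof -
  have "continuous_on {0..1} (\<lambda>x. f 0 + integral {0..x} g)"
    using L2_integrable_sub[OF weak_deriv_L2'[OF assms], of 0 1]
    by (intro continuous_intros indefinite_integral_continuous_1)
       (auto simp: set_lebesgue_integral_eq_integral(1))
  moreover have "continuous_on {0..1} f \<longleftrightarrow> continuous_on {0..1} (\<lambda>x. f 0 + integral {0..x} g)"
    by (rule continuous_on_cong[OF refl weak_deriv_eq[OF assms]])
  ultimately show ?thesis by simp
qed

lemma weak_deriv_L2: "weak_deriv f g \<Longrightarrow> f \<in> L2_space" "weak_deriv f g \<Longrightarrow> g \<in> L2_space"
  by (rule L2_space_continuous[OF weak_deriv_continuous], assumption) (rule weak_deriv_L2')

lemma smooth_on_unit_continuous: "smooth_on_unit f g \<Longrightarrow> continuous_on {0..1} f"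
  by (auto simp: smooth_on_unit_def intro!: DERIV_continuous_on)

lemma smooth_imp_weak_deriv:
  assumes "smooth_on_unit f g"
  shows "weak_deriv f g"
proof -
  have *: "(g has_integral f x - f 0) {0..x}" if "x \<in> {0..1}" for x
  proof (rule fundamental_theorem_of_calculus)
    show "0 \<le> x" using that by simp
    fix y assume y: "y \<in> {0..x}"
    then have "(f has_vector_derivative g y) (at y within {0..1})"
      using that assms by (simp add: smooth_on_unit_def has_real_derivative_iff_has_vector_derivative)
    then show "(f has_vector_derivative g y) (at y within {0..x})"
      by (rule has_vector_derivative_within_subset) (use that in auto)
  qed
  have "f x = f 0 + integral {0..x} g" if "x \<in> {0..1}" for x
    using integral_unique[OF *[OF that]] by simp
  moreover have "g \<in> L2_space"
    using assms by (simp add: smooth_on_unit_def L2_space_continuous)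
  ultimately show ?thesis
    unfolding weak_deriv_def by blast
qed

lemma weak_deriv_add_scale:
  assumes "weak_deriv f f'" "weak_deriv g g'"
  shows "weak_deriv (\<lambda>x. f x + c * g x) (\<lambda>x. f' x + c * g' x)"
  unfolding weak_deriv_def
proof (intro conjI ballI)
  show "(\<lambda>x. f' x + c * g' x) \<in> L2_space"
    using assms by (intro L2_space_add L2_space_scale weak_deriv_L2)
  fix x :: real assume x: "x \<in> {0..1}"
  have "f' integrable_on {0..x}" "g' integrable_on {0..x}"
    using L2_integrable_sub[OF weak_deriv_L2'[OF assms(1)], of 0 x]
      L2_integrable_sub[OF weak_deriv_L2'[OF assms(2)], of 0 x] x
    by (auto simp: set_lebesgue_integral_eq_integral(1))
  then have "integral {0..x} (\<lambda>x. f' x + c * g' x) = integral {0..x} f' + c * integral {0..x} g'"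
    by (subst Henstock_Kurzweil_Integration.integral_add) (auto intro: integrable_on_mult_right)
  then show "f x + c * g x = f 0 + c * g 0 + integral {0..x} (\<lambda>x. f' x + c * g' x)"
    using weak_deriv_eq[OF assms(1) x] weak_deriv_eq[OF assms(2) x] by (simp add: algebra_simps)
qed

text \<open>Let \<open>d\<close> be the defect of the formula on \<open>{0..x}\<close>. Its increment over \<open>{x..y}\<close> is at most a constant times
\<open>(y - x)\<close> times the increment of \<open>H x = \<integral> |f'|\<close>. Since \<open>H\<close> is continuous, summing over a fine
partition shows that \<open>d\<close> is constant.\<close>
lemma weak_deriv_by_parts:
  assumes f: "weak_deriv f f'" and g: "smooth_on_unit g g'"
  shows "ip f' g = f 1 * g 1 - f 0 * g 0 - ip f g'"
proof -
  have cont: "continuous_on {0..1} f" "continuous_on {0..1} g" "continuous_on {0..1} g'"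
    using f g weak_deriv_continuous smooth_on_unit_continuous by (auto simp: smooth_on_unit_def)
  have L2: "f \<in> L2_space" "f' \<in> L2_space" "g \<in> L2_space" "g' \<in> L2_space"
    using cont f by (auto simp: L2_space_continuous weak_deriv_L2)
  have gw: "weak_deriv g g'" by (rule smooth_imp_weak_deriv[OF g])
  have int: "(\<lambda>r. f' r * g r) integrable_on {x..y}" "(\<lambda>r. f r * g' r) integrable_on {x..y}"
      "f' integrable_on {x..y}" "(\<lambda>r. \<bar>f' r\<bar>) integrable_on {x..y}"
      "(\<lambda>r. f' r * (g r - c)) integrable_on {x..y}"
      "(\<lambda>r. (f r - c) * g' r) integrable_on {x..y}"
      "g' integrable_on {x..y}"
    if "0 \<le> x" "y \<le> 1" for x y c
  proof -
    have *: "(\<lambda>r. p r * q r) integrable_on {x..y}" if "p \<in> L2_space" "q \<in> L2_space" for p q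
    proof -
      have "integrable unit_interval_measure (\<lambda>r. p r * q r)" by (rule integrable_ip[OF that])
      then have "(\<lambda>r. p r * q r) integrable_on {0..1}" by (rule integrable_on_lebesgue_on) auto
      then show ?thesis
        by (rule integrable_subinterval_real) (use \<open>0 \<le> x\<close> \<open>y \<le> 1\<close> in auto)
    qed
    show "(\<lambda>r. f' r * g r) integrable_on {x..y}" "(\<lambda>r. f r * g' r) integrable_on {x..y}"
      using * L2 by auto
    show "(\<lambda>r. f' r * (g r - c)) integrable_on {x..y}" "(\<lambda>r. (f r - c) * g' r) integrable_on {x..y}"
      using cont by (auto intro!: * L2 L2_space_continuous continuous_intros)
    show "f' integrable_on {x..y}" "g' integrable_on {x..y}"
      using L2_integrable_sub[of f' x y] L2_integrable_sub[of g' x y] that L2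
      by (auto simp: set_lebesgue_integral_eq_integral(1))
    show "(\<lambda>r. \<bar>f' r\<bar>) integrable_on {x..y}"
      using L2_integrable_sub[of f' x y] that L2
      by (auto simp: absolutely_integrable_on_def)
  qed
  obtain C where C: "0 < C" "\<And>x. x \<in> {0..1} \<Longrightarrow> \<bar>g' x\<bar> \<le> C"
  proof -
    have "bounded (g ` {0..1})" using cont(2) by (simp add: compact_continuous_image compact_imp_bounded)
    moreover have "bounded (g' ` {0..1})" using cont(3) by (simp add: compact_continuous_image compact_imp_bounded)
    ultimately show ?thesis using that unfolding bounded_pos by (auto simp: real_norm_def)
  qed
  \<comment> \<open>the defect of the formula on {0..x}; it is to be shown that it takes the same values at 0 and 1\<close>
  define d where "d = (\<lambda>x. integral {0..x} (\<lambda>r. f' r * g r) + integral {0..x} (\<lambda>r. f r * g' r) - f x * g x)"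
  define H where "H = (\<lambda>x. integral {0..x} (\<lambda>r. \<bar>f' r\<bar>))"
  have d_diff: "\<bar>d y - d x\<bar> \<le> 2 * C * (y - x) * (H y - H x)" if xy: "0 \<le> x" "x \<le> y" "y \<le> 1" for x y
  proof -
    have comb: "integral {0..y} p - integral {0..x} p = integral {x..y} p"
      if "p integrable_on {0..y}" for p :: "real \<Rightarrow> real"
      using Henstock_Kurzweil_Integration.integral_combine[of 0 x y p] that xy by simp
    have Hxy: "H y - H x = integral {x..y} (\<lambda>r. \<bar>f' r\<bar>)"
      unfolding H_def using xy by (intro comb int) auto
    have fxy: "f y - f x = integral {x..y} f'"
      using weak_deriv_diff_eq[OF f] xy by auto
    have gxy: "g y - g x = integral {x..y} g'"
      using weak_deriv_diff_eq[OF gw] xy by auto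
    have "d y - d x = integral {x..y} (\<lambda>r. f' r * g r) + integral {x..y} (\<lambda>r. f r * g' r)
        - (integral {x..y} f' * g y + f x * integral {x..y} g')"
      using comb[of "\<lambda>r. f' r * g r"] comb[of "\<lambda>r. f r * g' r"] int[of 0 y] xy
      by (simp add: d_def fxy[symmetric] gxy[symmetric] algebra_simps)
    also have "\<dots> = integral {x..y} (\<lambda>r. f' r * (g r - g y)) + integral {x..y} (\<lambda>r. (f r - f x) * g' r)"
    proof -
      have "integral {x..y} (\<lambda>r. f' r * (g r - g y)) = integral {x..y} (\<lambda>r. f' r * g r - f' r * g y)"
        by (simp add: algebra_simps)
      also have "\<dots> = integral {x..y} (\<lambda>r. f' r * g r) - integral {x..y} f' * g y"
        using int[of x y] xy by (subst Henstock_Kurzweil_Integration.integral_diff) (auto intro!: integrable_on_mult_left)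
      finally have 1: "integral {x..y} (\<lambda>r. f' r * (g r - g y)) = integral {x..y} (\<lambda>r. f' r * g r) - integral {x..y} f' * g y" .
      have "integral {x..y} (\<lambda>r. (f r - f x) * g' r) = integral {x..y} (\<lambda>r. f r * g' r - f x * g' r)"
        by (simp add: algebra_simps)
      also have "\<dots> = integral {x..y} (\<lambda>r. f r * g' r) - f x * integral {x..y} g'"
        using int[of x y] xy by (subst Henstock_Kurzweil_Integration.integral_diff) (auto intro!: integrable_on_mult_right)
      finally show ?thesis using 1 by simp
    qed
    finally have eq: "d y - d x = \<dots>" .
    have b1: "\<bar>integral {x..y} (\<lambda>r. f' r * (g r - g y))\<bar> \<le> integral {x..y} (\<lambda>r. \<bar>f' r\<bar> * (C * (y - x)))"
    proof -
      have "\<bar>g r - g y\<bar> \<le> C * (y - x)" if r: "r \<in> {x..y}" for r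
      proof -
        have "g y - g r = integral {r..y} g'"
          using weak_deriv_diff_eq[OF gw] xy r by auto
        moreover have "norm (integral {r..y} g') \<le> C * (y - r)"
          using xy r int[of r y] C(2) cont(3)
          by (intro integral_bound) (auto intro: continuous_on_subset)
        moreover have "C * (y - r) \<le> C * (y - x)" using C(1) r by simp
        ultimately show ?thesis by (simp add: abs_minus_commute)
      qed
      then have "norm (integral {x..y} (\<lambda>r. f' r * (g r - g y))) \<le> integral {x..y} (\<lambda>r. \<bar>f' r\<bar> * (C * (y - x)))"
        using int[of x y] xy
        by (intro integral_norm_bound_integral)
           (auto simp: abs_mult intro!: integrable_on_mult_left mult_left_mono)
      then show ?thesis by simp
    qed
    have b2: "\<bar>integral {x..y} (\<lambda>r. (f r - f x) * g' r)\<bar> \<le> C * (H y - H x) * (y - x)"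
    proof -
      have "\<bar>(f r - f x) * g' r\<bar> \<le> C * (H y - H x)" if r: "r \<in> {x..y}" for r
      proof -
        have "norm (integral {x..r} f') \<le> integral {x..r} (\<lambda>r. \<bar>f' r\<bar>)"
          using r xy int[of x r] by (intro integral_norm_bound_integral) auto
        then have "\<bar>f r - f x\<bar> \<le> integral {x..r} (\<lambda>r. \<bar>f' r\<bar>)"
          using weak_deriv_diff_eq[OF f, of x r] r xy by simp
        also have "\<dots> \<le> H y - H x"
          unfolding Hxy using r xy int[of x r] int[of x y]
          by (intro integral_subset_le) auto
        finally show ?thesis
          using C(2)[of r] r xy C(1) unfolding abs_mult
          by (subst mult.commute) (intro mult_mono, auto)
      qed
      then have "norm (integral {x..y} (\<lambda>r. (f r - f x) * g' r)) \<le> C * (H y - H x) * (y - x)"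
        using xy cont by (intro integral_bound) (auto intro!: continuous_intros intro: continuous_on_subset)
      then show ?thesis by simp
    qed
    have "integral {x..y} (\<lambda>r. \<bar>f' r\<bar> * (C * (y - x))) = C * (y - x) * (H y - H x)"
      unfolding Hxy by simp
    note b1' = order_trans[OF b1 eq_refl[OF this]]
    have "C * (H y - H x) * (y - x) = C * (y - x) * (H y - H x)"
         "2 * C * (y - x) * (H y - H x) = 2 * (C * (y - x) * (H y - H x))"
      by simp_all
    then show ?thesis using b1' b2 eq by linarith
  qed
  have Hcont: "continuous_on {0..1} H"
    unfolding H_def using int[of 0 1] by (intro indefinite_integral_continuous_1) auto
  have "d 1 = d 0"
  proof (rule has_derivative_zero_unique[of "{0..1}" d 1 0])
    fix x :: real assume x: "x \<in> {0..1}"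
    have lim: "((\<lambda>y. 2 * C * \<bar>H y - H x\<bar>) \<longlongrightarrow> 2 * C * \<bar>H x - H x\<bar>) (at x within {0..1})"
      using Hcont x by (intro tendsto_intros) (auto simp: continuous_on_def)
    have "((\<lambda>y. (d y - d x) / (y - x)) \<longlongrightarrow> 0) (at x within {0..1})"
    proof (rule Lim_null_comparison)
      have "\<bar>(d y - d x) / (y - x)\<bar> \<le> 2 * C * \<bar>H y - H x\<bar>" if y: "y \<in> {0..1}" "y \<noteq> x" for y
      proof -
        have "\<bar>d y - d x\<bar> \<le> 2 * C * \<bar>H y - H x\<bar> * \<bar>y - x\<bar>"
        proof (cases "x \<le> y")
          case True
          then have "\<bar>d y - d x\<bar> \<le> (2 * C * (y - x)) * (H y - H x)"
            using d_diff[of x y] x y by simp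
          also have "\<dots> \<le> (2 * C * (y - x)) * \<bar>H y - H x\<bar>"
            using True C(1) by (intro mult_left_mono) auto
          finally show ?thesis using True by (simp add: algebra_simps)
        next
          case False
          then have "\<bar>d x - d y\<bar> \<le> (2 * C * (x - y)) * (H x - H y)"
            using d_diff[of y x] x y by simp
          also have "\<dots> \<le> (2 * C * (x - y)) * \<bar>H y - H x\<bar>"
            using False C(1) by (intro mult_left_mono) auto
          finally show ?thesis using False
            by (subst abs_minus_commute) (simp add: algebra_simps)
        qed
        then show ?thesis using y by (simp add: abs_divide divide_le_eq)
      qed
      then show "\<forall>\<^sub>F y in at x within {0..1}. norm ((d y - d x) / (y - x)) \<le> 2 * C * \<bar>H y - H x\<bar>"
        by (auto simp: eventually_at_filter)
      show "((\<lambda>y. 2 * C * \<bar>H y - H x\<bar>) \<longlongrightarrow> 0) (at x within {0..1})" using lim by simp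
    qed
    then have "(d has_real_derivative 0) (at x within {0..1})"
      by (simp add: has_field_derivative_iff)
    then show "(d has_derivative (\<lambda>h. 0)) (at x within {0..1})"
      by (simp add: has_field_derivative_def lambda_zero)
  qed auto
  then have "integral {0..1} (\<lambda>r. f' r * g r) + integral {0..1} (\<lambda>r. f r * g' r) = f 1 * g 1 - f 0 * g 0"
    by (simp add: d_def)
  then show ?thesis using L2 by (simp add: ip_conv_integral)
qed

section \<open>Sobolev functions on the unit interval\<close>

lemma Dx_eq:
  assumes "(f has_real_derivative d) (at x within {0..1})" "x \<in> {0..1}"
  shows "Dx f x = d"
proof -
  have "(f has_vector_derivative d) (at x within {0..1})"
    using assms(1) by (simp add: has_real_derivative_iff_has_vector_derivative)
  then show ?thesis
    unfolding Dx_def using assms(2)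
    by (intro vector_derivative_within_closed_interval) auto
qed

text \<open>Lebesgue differentiation: almost every point is a Lebesgue point for increments to the right, and
applied to the reflected function also for increments to the left.\<close>
lemma weak_deriv_differentiable_AE:
  assumes "weak_deriv f g"
  obtains N where "negligible N"
    "\<And>x. x \<in> {0..1} - N \<Longrightarrow> (f has_real_derivative g x) (at x within {0..1})"
proof -
  define G where "G = (\<lambda>x. if x \<in> {0..1} then g x else 0)"
  have "g integrable_on {0..1}"
    using L2_abs_integrable[OF weak_deriv_L2'[OF assms]] by (simp add: set_lebesgue_integral_eq_integral(1))
  then have "G integrable_on UNIV"
    unfolding G_def by (simp only: integrable_restrict_UNIV)
  then have G: "G integrable_on cbox a b" for a b
    by (rule integrable_on_subcbox) auto
  have G': "(\<lambda>x. G (- x)) integrable_on cbox a b" for a b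
    using G[of "-b" "-a"] Henstock_Kurzweil_Integration.integrable_reflect_real[where f=G and a="-b" and b="-a"] by (simp add: box_real)
  obtain N1 where N1: "negligible N1" "\<And>x e. \<lbrakk>x \<notin> N1; 0 < e\<rbrakk> \<Longrightarrow>
      \<exists>d>0. \<forall>h. 0 < h \<and> h < d \<longrightarrow> norm (integral (cbox x (x + h *\<^sub>R One)) G /\<^sub>R h ^ DIM(real) - G x) < e"
    using integrable_ccontinuous_explicit[OF G] by metis
  obtain N2 where N2: "negligible N2" "\<And>x e. \<lbrakk>x \<notin> N2; 0 < e\<rbrakk> \<Longrightarrow>
      \<exists>d>0. \<forall>h. 0 < h \<and> h < d \<longrightarrow>
        norm (integral (cbox x (x + h *\<^sub>R One)) (\<lambda>x. G (- x)) /\<^sub>R h ^ DIM(real) - G (- x)) < e"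
    using integrable_ccontinuous_explicit[OF G'] by metis
  define N where "N = N1 \<union> uminus ` N2 \<union> {0, 1}"
  show thesis
  proof (rule that)
    have "negligible (uminus ` N2)"
      by (rule negligible_differentiable_image_negligible[OF _ N2(1)]) (auto simp: differentiable_on_def)
    then show "negligible N"
      unfolding N_def using N1(1) by (intro negligible_Un) (auto intro: negligible_finite)
    fix x assume "x \<in> {0..1} - N"
    then have x: "0 < x" "x < 1" "x \<notin> N1" "- x \<notin> N2"
      unfolding N_def by (auto simp: less_le image_iff)
    have "((\<lambda>y. (f y - f x) / (y - x)) \<longlongrightarrow> g x) (at x within {0..1})"
      unfolding tendsto_iff eventually_at
    proof (intro allI impI)
      fix e :: real assume e: "0 < e"
      obtain d1 where d1: "d1 > 0" "\<And>h. 0 < h \<Longrightarrow> h < d1 \<Longrightarrow> \<bar>integral {x..x + h} G / h - G x\<bar> < e"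
        using N1(2)[OF x(3) e] by (auto simp: divide_inverse mult.commute)
      obtain d2 where d2: "d2 > 0"
        "\<And>h. 0 < h \<Longrightarrow> h < d2 \<Longrightarrow> \<bar>integral {- x..- x + h} (\<lambda>x. G (- x)) / h - G x\<bar> < e"
        using N2(2)[OF x(4) e] by (auto simp: divide_inverse mult.commute)
      have Gx: "G x = g x" using x by (simp add: G_def)
      have Gg: "integral {u..v} G = f v - f u" if "0 \<le> u" "u \<le> v" "v \<le> 1" for u v
      proof -
        have "integral {u..v} G = integral {u..v} g"
          using that by (intro Henstock_Kurzweil_Integration.integral_cong) (auto simp: G_def)
        then show ?thesis using weak_deriv_diff_eq[OF assms that] by simp
      qed
      have "dist ((f y - f x) / (y - x)) (g x) < e"
        if y: "y \<in> {0..1}" "y \<noteq> x" "dist y x < min d1 d2" for y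
      proof (cases "x < y")
        case True
        then have "\<bar>integral {x..x + (y - x)} G / (y - x) - G x\<bar> < e"
          using y by (intro d1(2)) (auto simp: dist_real_def)
        then show ?thesis
          using Gg[of x y] True x y Gx by (simp add: dist_real_def)
      next
        case False
        then have "\<bar>integral {- x..- x + (x - y)} (\<lambda>x. G (- x)) / (x - y) - G x\<bar> < e"
          using y by (intro d2(2)) (auto simp: dist_real_def)
        moreover have "integral {- x..- x + (x - y)} (\<lambda>x. G (- x)) = f x - f y"
          using Henstock_Kurzweil_Integration.integral_reflect_real[where f=G and a=y and b=x] Gg[of y x] False x y by simp
        moreover have "(f x - f y) / (x - y) = (f y - f x) / (y - x)"
          using False y by (simp add: divide_simps) (simp add: algebra_simps)
        ultimately show ?thesis
          using Gx by (simp add: dist_real_def)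
      qed
      then show "\<exists>d>0. \<forall>y\<in>{0..1}. y \<noteq> x \<and> dist y x < d \<longrightarrow> dist ((f y - f x) / (y - x)) (g x) < e"
        using d1(1) d2(1) by (intro exI[of _ "min d1 d2"]) auto
    qed
    then show "(f has_real_derivative g x) (at x within {0..1})"
      by (simp add: has_field_derivative_iff)
  qed
qed

lemma weak_deriv_spike:
  assumes "weak_deriv f g" "negligible N" "\<And>x. x \<in> {0..1} - N \<Longrightarrow> h x = g x"
  shows "weak_deriv f h"
proof -
  have g: "g \<in> L2_space" by (rule weak_deriv_L2'[OF assms(1)])
  have "h absolutely_integrable_on {0..1}"
    by (rule absolutely_integrable_spike[OF L2_abs_integrable[OF g] assms(2)]) (use assms(3) in auto)
  then have "integrable unit_interval_measure h"
    by (rule absolutely_integrable_imp_integrable) auto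
  then have meas: "h \<in> borel_measurable unit_interval_measure" by auto
  have "(\<lambda>x. (g x)\<^sup>2) absolutely_integrable_on {0..1}"
    using g by (auto simp: L2_space_def absolutely_integrable_measurable_real)
  then have "(\<lambda>x. (h x)\<^sup>2) absolutely_integrable_on {0..1}"
    by (rule absolutely_integrable_spike[OF _ assms(2)]) (use assms(3) in auto)
  then have "integrable unit_interval_measure (\<lambda>x. (h x)\<^sup>2)"
    by (rule absolutely_integrable_imp_integrable) auto
  with meas have h: "h \<in> L2_space" by (simp add: L2_space_def)
  have "integral {0..x} h = integral {0..x} g" if "x \<in> {0..1}" for x
    by (rule integral_spike[OF assms(2)]) (use that assms(3) in auto)
  then show ?thesis
    unfolding weak_deriv_def using h weak_deriv_eq[OF assms(1)] by metis
qed

lemma weak_deriv_Dx: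
  assumes "weak_deriv f g"
  shows "weak_deriv f (Dx f)"
proof -
  obtain N where N: "negligible N"
    "\<And>x. x \<in> {0..1} - N \<Longrightarrow> (f has_real_derivative g x) (at x within {0..1})"
    using weak_deriv_differentiable_AE[OF assms] by metis
  show ?thesis
    by (rule weak_deriv_spike[OF assms N(1)]) (use Dx_eq[OF N(2)] in auto)
qed

text \<open>The pointwise derivative \<open>Dx f\<close> agrees almost everywhere with any weak derivative, so it may serve as the
representative in the norm of \<open>H^1\<close>.\<close>
lemma H1_space_weak_deriv:
  assumes "f \<in> H1_space"
  shows "weak_deriv f (Dx f)"
proof -
  obtain g where g: "g \<in> L2_space"
    "\<And>x. x \<in> {0..1} \<Longrightarrow> f x = f 0 + (LINT r|lebesgue_on {0..x}. g r)"
    using assms unfolding H1_space_def by blast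
  have "(LINT r|lebesgue_on {0..x}. g r) = integral {0..x} g" if "x \<in> {0..1}" for x
    using that L2_integrable_sub[OF g(1), of 0 x]
    by (intro lebesgue_integral_eq_integral absolutely_integrable_imp_integrable) auto
  then have "weak_deriv f g"
    unfolding weak_deriv_def using g by metis
  then show ?thesis by (rule weak_deriv_Dx)
qed

lemma H2_space_smooth:
  assumes "f \<in> H2_space"
  shows "smooth_on_unit f (Dx f)" "weak_deriv (Dx f) (Dx (Dx f))"
proof -
  show w: "weak_deriv (Dx f) (Dx (Dx f))"
    using assms by (intro H1_space_weak_deriv) (simp add: H2_space_def)
  have "(f has_vector_derivative Dx f x) (at x within {0..1})" if "x \<in> {0..1}" for x
    using assms that unfolding Dx_def vector_derivative_works[symmetric] H2_space_def by blast
  then show "smooth_on_unit f (Dx f)"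
    using weak_deriv_continuous[OF w]
    by (simp add: smooth_on_unit_def has_real_derivative_iff_has_vector_derivative)
qed

section \<open>Orthonormal trigonometric systems\<close>

definition orthonormal :: "(nat \<Rightarrow> real \<Rightarrow> real) \<Rightarrow> bool" where
  "orthonormal e \<longleftrightarrow> (\<forall>n. continuous_on {0..1} (e n)) \<and>
     (\<forall>m n. ip (e m) (e n) = (if m = n then 1 else 0))"

lemma orthonormal_L2: "orthonormal e \<Longrightarrow> e n \<in> L2_space"
  by (simp add: orthonormal_def L2_space_continuous)

text \<open>The right-hand side minus the left-hand side is the square norm of the residual of the orthogonal projection.\<close>
lemma Bessel_finite:
  assumes "orthonormal e" "f \<in> L2_space" "finite S"
  shows "(\<Sum>i\<in>S. (ip f (e i))\<^sup>2) \<le> ip f f"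
proof -
  let ?p = "\<lambda>x. \<Sum>i\<in>S. ip f (e i) * e i x"
  have L: "(\<lambda>x. ip f (e i) * e i x) \<in> L2_space" for i
    by (intro L2_space_scale orthonormal_L2 assms)
  have p: "?p \<in> L2_space" by (intro L2_space_sum L)
  have pe: "ip ?p (e j) = ip f (e j)" if "j \<in> S" for j
  proof -
    have "ip ?p (e j) = (\<Sum>i\<in>S. ip f (e i) * ip (e i) (e j))"
      using L by (simp add: ip_sum_left ip_scale_left orthonormal_L2[OF assms(1)])
    also have "\<dots> = (\<Sum>i\<in>S. if i = j then ip f (e j) else 0)"
      using assms(1) by (intro sum.cong) (auto simp: orthonormal_def)
    also have "\<dots> = ip f (e j)" using that assms(3) by simp
    finally show ?thesis .
  qed
  have pg: "ip ?p g = (\<Sum>i\<in>S. ip f (e i) * ip g (e i))" if "g \<in> L2_space" for g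
    using L that by (simp add: ip_sum_left ip_scale_left) (simp add: ip_commute)
  have "0 \<le> ip (\<lambda>x. f x - ?p x) (\<lambda>x. f x - ?p x)" by (rule ip_nonneg)
  also have "\<dots> = ip f f - ip ?p f - (ip f ?p - ip ?p ?p)"
    using assms(2) p by (simp add: ip_diff_left ip_diff_right L2_space_diff)
  also have "ip f ?p = ip ?p f" by (rule ip_commute)
  also have "ip ?p f = (\<Sum>i\<in>S. (ip f (e i))\<^sup>2)"
    using pg[OF assms(2)] by (simp add: power2_eq_square)
  also have "ip ?p ?p = (\<Sum>i\<in>S. (ip f (e i))\<^sup>2)"
    using pg[OF p] pe by (simp add: power2_eq_square)
  finally show ?thesis by simp
qed

lemma Bessel:
  assumes "orthonormal e" "f \<in> L2_space"
  shows "summable (\<lambda>i. (ip f (e i))\<^sup>2)" "(\<Sum>i. (ip f (e i))\<^sup>2) \<le> ip f f"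
proof -
  show "summable (\<lambda>i. (ip f (e i))\<^sup>2)"
    by (rule summableI_nonneg_bounded[of _ "ip f f"]) (auto intro: Bessel_finite assms)
  then show "(\<Sum>i. (ip f (e i))\<^sup>2) \<le> ip f f"
    by (rule suminf_le_const) (auto intro: Bessel_finite assms)
qed

lemma unit_interval_series_limit:
  fixes f :: "nat \<Rightarrow> real \<Rightarrow> real"
  assumes "\<And>k. continuous_on {0..1} (f k)" "\<And>k. \<forall>x\<in>{0..1}. \<bar>f k x\<bar> \<le> A k" "summable A"
  shows "uniform_limit {0..1} (\<lambda>n x. \<Sum>k<n. f k x) (\<lambda>x. \<Sum>k. f k x) sequentially"
    and "continuous_on {0..1} (\<lambda>x. \<Sum>k. f k x)"
    and "x \<in> {0..1} \<Longrightarrow> summable (\<lambda>k. f k x)"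
proof -
  show u: "uniform_limit {0..1} (\<lambda>n x. \<Sum>k<n. f k x) (\<lambda>x. \<Sum>k. f k x) sequentially"
    by (rule Weierstrass_m_test[OF _ assms(3)]) (use assms(2) in auto)
  show "continuous_on {0..1} (\<lambda>x. \<Sum>k. f k x)"
    by (rule uniform_limit_theorem[OF _ u]) (auto intro!: always_eventually continuous_on_sum assms(1))
  show "x \<in> {0..1} \<Longrightarrow> summable (\<lambda>k. f k x)"
    by (rule summable_comparison_test'[OF assms(3), of 0]) (use assms(2) in auto)
qed

text \<open>Term-by-term differentiation: the series of derivatives converges uniformly by the Weierstrass test.\<close>
lemma C1_series:
  assumes "\<And>k. smooth_on_unit (f k) (f' k)"
    "\<And>k. \<forall>x\<in>{0..1}. \<bar>f k x\<bar> \<le> A k" "\<And>k. \<forall>x\<in>{0..1}. \<bar>f' k x\<bar> \<le> A k" "summable A"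
  shows "smooth_on_unit (\<lambda>x. \<Sum>k. f k x) (\<lambda>x. \<Sum>k. f' k x)"
proof -
  have c: "continuous_on {0..1} (f' k)" for k
    using assms(1) by (simp add: smooth_on_unit_def)
  note u = unit_interval_series_limit[OF c assms(3,4)]
  have "\<exists>g. \<forall>x\<in>{0..1}. (\<lambda>n. f n x) sums g x \<and>
      (g has_field_derivative (\<Sum>k. f' k x)) (at x within {0..1})"
    using unit_interval_series_limit(3)[OF smooth_on_unit_continuous[OF assms(1)] assms(2,4), of 0]
    by (intro has_field_derivative_series[OF _ _ u(1), of _ 0])
       (use assms(1) in \<open>auto simp: smooth_on_unit_def\<close>)
  then obtain g where g: "\<And>x. x \<in> {0..1} \<Longrightarrow> (\<lambda>n. f n x) sums g x"
      "\<And>x. x \<in> {0..1} \<Longrightarrow> (g has_field_derivative (\<Sum>k. f' k x)) (at x within {0..1})"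
    by blast
  have "((\<lambda>x. \<Sum>k. f k x) has_field_derivative (\<Sum>k. f' k x)) (at x within {0..1})" if "x \<in> {0..1}" for x
    by (rule has_field_derivative_transform_within[OF g(2)[OF that], of 1])
       (use that g(1) in \<open>auto simp: sums_iff\<close>)
  then show ?thesis
    using u(2) by (simp add: smooth_on_unit_def)
qed

lemma ip_series_sums:
  assumes "\<And>k. continuous_on {0..1} (f k)" "\<And>k. \<forall>x\<in>{0..1}. \<bar>f k x\<bar> \<le> A k" "summable A"
    and g: "g \<in> L2_space"
  shows "(\<lambda>k. ip (f k) g) sums ip (\<lambda>x. \<Sum>k. f k x) g"
proof -
  let ?S = "\<lambda>x. \<Sum>k. f k x"
  note u = unit_interval_series_limit[OF assms(1-3)]
  have "(\<lambda>n. ip (\<lambda>x. \<Sum>k<n. f k x) g) \<longlonglongrightarrow> ip ?S g"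
  proof (rule metric_LIMSEQ_I)
    fix r :: real assume r: "0 < r"
    define e where "e = r / (norm_L2 g + 1) / 2"
    have pos: "0 < norm_L2 g + 1" using norm_L2_nonneg[of g] by linarith
    have e: "0 < e" using r pos by (simp add: e_def)
    obtain N where N: "\<And>n x. n \<ge> N \<Longrightarrow> x \<in> {0..1} \<Longrightarrow> \<bar>(\<Sum>k<n. f k x) - ?S x\<bar> < e"
      using u(1) e unfolding uniform_limit_iff eventually_at_top_linorder dist_real_def by blast
    have "dist (ip (\<lambda>x. \<Sum>k<n. f k x) g) (ip ?S g) < r" if n: "n \<ge> N" for n
    proof -
      have c: "continuous_on {0..1} (\<lambda>x. \<Sum>k<n. f k x)" by (intro continuous_on_sum assms(1))
      have "dist (ip (\<lambda>x. \<Sum>k<n. f k x) g) (ip ?S g) = \<bar>ip (\<lambda>x. (\<Sum>k<n. f k x) - ?S x) g\<bar>"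
        using c u(2) g by (simp add: dist_real_def ip_diff_left L2_space_continuous)
      also have "\<dots> \<le> norm_L2 (\<lambda>x. (\<Sum>k<n. f k x) - ?S x) * norm_L2 g"
        by (rule ip_Cauchy_Schwarz[OF L2_space_continuous[OF continuous_on_diff[OF c u(2)]] g])
      also have "\<dots> \<le> e * norm_L2 g"
      proof (intro mult_right_mono norm_L2_bound norm_L2_nonneg)
        show "continuous_on {0..1} (\<lambda>x. (\<Sum>k<n. f k x) - ?S x)"
          by (rule continuous_on_diff[OF c u(2)])
      qed (rule less_imp_le[OF N[OF n]])
      also have "\<dots> \<le> e * (norm_L2 g + 1)" using e by simp
      also have "\<dots> = r / 2" using pos by (simp add: e_def field_simps)
      also have "\<dots> < r" using r by simp
      finally show ?thesis .
    qed
    then show "\<exists>no. \<forall>n\<ge>no. dist (ip (\<lambda>x. \<Sum>k<n. f k x) g) (ip ?S g) < r" by blast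
  qed
  then show ?thesis
    using assms(1) g by (simp add: sums_def ip_sum_left L2_space_continuous)
qed

text \<open>Absolutely summable coefficients make the series converge uniformly, so that pairing with \<open>e n\<close> and with the
sum itself may be carried out term by term. The second part is the Parseval identity for such functions.\<close>
lemma orthonormal_series:
  assumes "orthonormal e" "\<And>k. \<forall>x\<in>{0..1}. \<bar>e k x\<bar> \<le> B" "summable (\<lambda>k. \<bar>a k\<bar>)"
  shows "ip (\<lambda>x. \<Sum>k. a k * e k x) (e n) = a n"
    and "(\<lambda>k. (a k)\<^sup>2) sums ip (\<lambda>x. \<Sum>k. a k * e k x) (\<lambda>x. \<Sum>k. a k * e k x)"
proof -
  have c: "continuous_on {0..1} (\<lambda>x. a k * e k x)" for k
    using assms(1) by (intro continuous_intros) (auto simp: orthonormal_def)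
  have b: "\<forall>x\<in>{0..1}. \<bar>a k * e k x\<bar> \<le> \<bar>a k\<bar> * B" for k
    using assms(2)[of k] by (auto simp: abs_mult intro: mult_left_mono)
  have s: "summable (\<lambda>k. \<bar>a k\<bar> * B)" using assms(3) by (rule summable_mult2)
  note sums = ip_series_sums[OF c b s]
  show *: "ip (\<lambda>x. \<Sum>k. a k * e k x) (e n) = a n" for n
  proof -
    have "(\<lambda>k. ip (\<lambda>x. a k * e k x) (e n)) = (\<lambda>k. if k = n then a n else 0)"
      using assms(1) by (auto simp: ip_scale_left orthonormal_def)
    moreover have "(\<lambda>k. if k = n then a n else 0) sums a n" by (rule sums_single)
    ultimately show ?thesis
      using sums[OF orthonormal_L2[OF assms(1)], of n] sums_unique2 by metis
  qed
  have S: "(\<lambda>x. \<Sum>k. a k * e k x) \<in> L2_space"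
    by (rule L2_space_continuous[OF unit_interval_series_limit(2)[OF c b s]])
  show "(\<lambda>k. (a k)\<^sup>2) sums ip (\<lambda>x. \<Sum>k. a k * e k x) (\<lambda>x. \<Sum>k. a k * e k x)"
    using sums[OF S] * by (simp add: ip_scale_left ip_commute[of "e _"] power2_eq_square)
qed

definition cosm :: "nat \<Rightarrow> real \<Rightarrow> real" where
  "cosm m x = mu m * cos (real m * pi * x)"

text \<open>The systems \<open>sin_half\<close> and \<open>sin_int\<close> are the normalized derivatives of \<open>phi1\<close> and of the nonconstant functions
\<open>cosm\<close>. Their orthonormality converts sums of squared coordinates with weights into norms of derivatives.\<close>
definition sin_half :: "nat \<Rightarrow> real \<Rightarrow> real" where
  "sin_half n x = sqrt 2 * sin ((real n + 1/2) * pi * x)"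

definition sin_int :: "nat \<Rightarrow> real \<Rightarrow> real" where
  "sin_int n x = sqrt 2 * sin ((real n + 1) * pi * x)"

lemma ip_cos_int:
  assumes "k \<in> \<int>"
  shows "ip (\<lambda>x. cos (k * pi * x)) (\<lambda>x. 1) = (if k = 0 then 1 else 0)"
proof -
  have "\<exists>F. smooth_on_unit F (\<lambda>x. cos (k * pi * x)) \<and> F 1 - F 0 = (if k = 0 then 1 else 0)"
  proof (cases "k = 0")
    case True
    then show ?thesis
      by (intro exI[of _ "\<lambda>x. x"]) (auto simp: smooth_on_unit_def intro!: derivative_eq_intros)
  next
    case False
    have "sin (k * pi) = 0" using assms by (simp add: sin_times_pi_eq_0)
    then show ?thesis using False
      by (intro exI[of _ "\<lambda>x. sin (k * pi * x) / (k * pi)"])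
         (auto simp: smooth_on_unit_def intro!: derivative_eq_intros continuous_intros)
  qed
  then obtain F where F: "smooth_on_unit F (\<lambda>x. cos (k * pi * x))" "F 1 - F 0 = (if k = 0 then 1 else 0)"
    by blast
  have "smooth_on_unit (\<lambda>x. 1) (\<lambda>x. 0)" by (simp add: smooth_on_unit_def)
  then have "ip (\<lambda>x. cos (k * pi * x)) (\<lambda>x. 1) = F 1 * 1 - F 0 * 1 - ip F (\<lambda>x. 0)"
    by (rule weak_deriv_by_parts[OF smooth_imp_weak_deriv[OF F(1)]])
  then show ?thesis using F(2) by (simp add: ip_def)
qed

lemma ip_cos_cos:
  assumes "p + q \<in> \<int>" "p - q \<in> \<int>"
  shows "ip (\<lambda>x. cos (p * pi * x)) (\<lambda>x. cos (q * pi * x)) =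
     (if p - q = 0 then 1/2 else 0) + (if p + q = 0 then 1/2 else 0)"
    and "ip (\<lambda>x. sin (p * pi * x)) (\<lambda>x. sin (q * pi * x)) =
     (if p - q = 0 then 1/2 else 0) - (if p + q = 0 then 1/2 else 0)"
proof -
  let ?a = "\<lambda>x. cos ((p - q) * pi * x)" and ?b = "\<lambda>x. cos ((p + q) * pi * x)"
  have L: "?a \<in> L2_space" "?b \<in> L2_space" "(\<lambda>x. 1::real) \<in> L2_space" "(\<lambda>x. 1/2 * ?a x) \<in> L2_space" "(\<lambda>x. 1/2 * ?b x) \<in> L2_space"
    by (auto intro!: L2_space_continuous continuous_intros)
  have "ip (\<lambda>x. cos (p * pi * x)) (\<lambda>x. cos (q * pi * x)) = ip (\<lambda>x. 1/2 * ?a x + 1/2 * ?b x) (\<lambda>x. 1)"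
    unfolding ip_def by (simp add: cos_add cos_diff algebra_simps)
  also have "\<dots> = 1/2 * ip ?a (\<lambda>x. 1) + 1/2 * ip ?b (\<lambda>x. 1)"
    by (subst ip_add_left[OF L(4,5,3)]) (simp only: ip_scale_left)
  finally show "ip (\<lambda>x. cos (p * pi * x)) (\<lambda>x. cos (q * pi * x)) =
     (if p - q = 0 then 1/2 else 0) + (if p + q = 0 then 1/2 else 0)"
    using assms by (simp add: ip_cos_int)
  have "ip (\<lambda>x. sin (p * pi * x)) (\<lambda>x. sin (q * pi * x)) = ip (\<lambda>x. 1/2 * ?a x - 1/2 * ?b x) (\<lambda>x. 1)"
    unfolding ip_def by (simp add: cos_add cos_diff algebra_simps)
  also have "\<dots> = 1/2 * ip ?a (\<lambda>x. 1) - 1/2 * ip ?b (\<lambda>x. 1)"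
    by (subst ip_diff_left[OF L(4,5,3)]) (simp only: ip_scale_left)
  finally show "ip (\<lambda>x. sin (p * pi * x)) (\<lambda>x. sin (q * pi * x)) =
     (if p - q = 0 then 1/2 else 0) - (if p + q = 0 then 1/2 else 0)"
    using assms by (simp add: ip_cos_int)
qed

lemma half_int_add: "real m + 1/2 + (real n + 1/2) \<in> \<int>" "real m + 1/2 - (real n + 1/2) \<in> \<int>"
proof -
  have "real m + 1/2 + (real n + 1/2) = of_nat (m + n + 1)" by simp
  then show "real m + 1/2 + (real n + 1/2) \<in> \<int>" by (metis Ints_of_nat)
  show "real m + 1/2 - (real n + 1/2) \<in> \<int>" by simp
qed

lemma orthonormal_phi1: "orthonormal phi1"
  unfolding orthonormal_def
proof (intro conjI allI)
  show "continuous_on {0..1} (phi1 n)" for n unfolding phi1_def by (intro continuous_intros)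
  fix m n
  have "real m + 1/2 + (real n + 1/2) \<noteq> 0" by (simp add: add_nonneg_eq_0_iff)
  then show "ip (phi1 m) (phi1 n) = (if m = n then 1 else 0)"
    unfolding phi1_def using ip_cos_cos(1)[OF half_int_add, of m n] by (auto simp: ip_scale_left ip_scale_right)
qed

lemma orthonormal_sin_half: "orthonormal sin_half"
  unfolding orthonormal_def
proof (intro conjI allI)
  show "continuous_on {0..1} (sin_half n)" for n unfolding sin_half_def by (intro continuous_intros)
  fix m n
  have "real m + 1/2 + (real n + 1/2) \<noteq> 0" by (simp add: add_nonneg_eq_0_iff)
  then show "ip (sin_half m) (sin_half n) = (if m = n then 1 else 0)"
    unfolding sin_half_def using ip_cos_cos(2)[OF half_int_add, of m n] by (auto simp: ip_scale_left ip_scale_right)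
qed

lemma orthonormal_sin_int: "orthonormal sin_int"
  unfolding orthonormal_def
proof (intro conjI allI)
  show "continuous_on {0..1} (sin_int n)" for n unfolding sin_int_def by (intro continuous_intros)
  fix m n
  have "real m + 1 + (real n + 1) \<noteq> 0" by (simp add: add_nonneg_eq_0_iff)
  then show "ip (sin_int m) (sin_int n) = (if m = n then 1 else 0)"
    unfolding sin_int_def using ip_cos_cos(2)[of "real m + 1" "real n + 1"] by (auto simp: ip_scale_left ip_scale_right)
qed

lemma orthonormal_cosm: "orthonormal cosm"
  unfolding orthonormal_def
proof (intro conjI allI)
  show "continuous_on {0..1} (cosm n)" for n unfolding cosm_def by (intro continuous_intros)
  fix m n
  show "ip (cosm m) (cosm n) = (if m = n then 1 else 0)"
    unfolding cosm_def using ip_cos_cos(1)[of "real m" "real n"] by (auto simp: ip_scale_left ip_scale_right mu_def)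
qed

lemma sqrt2_le: "sqrt 2 \<le> (2::real)"
  by (rule real_le_lsqrt) auto

lemma abs_mu_le: "\<bar>mu m\<bar> \<le> 2"
  using sqrt2_le by (simp add: mu_def)

lemma trig_abs_le: "\<bar>cosm m x\<bar> \<le> 2" "\<bar>phi1 m x\<bar> \<le> 2" "\<bar>sin_half m x\<bar> \<le> 2" "\<bar>sin_int m x\<bar> \<le> 2"
proof -
  have *: "\<bar>c * t\<bar> \<le> 2" if "\<bar>c\<bar> \<le> 2" "\<bar>t\<bar> \<le> 1" for c t :: real
    using mult_mono[OF that] by (simp add: abs_mult)
  show "\<bar>cosm m x\<bar> \<le> 2" "\<bar>phi1 m x\<bar> \<le> 2" "\<bar>sin_half m x\<bar> \<le> 2" "\<bar>sin_int m x\<bar> \<le> 2"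
    unfolding cosm_def phi1_def sin_half_def sin_int_def
    using abs_mu_le[of m] sqrt2_le by (auto intro!: *)
qed

text \<open>The product formula \<open>2 cos x cos (m x) = cos ((m + 1) x) + cos ((m - 1) x)\<close> trades one power of
\<open>cos\<close> for two neighbouring frequencies. With \<open>m = 0\<close> it follows that \<open>f\<close> is orthogonal to all polynomials in
\<open>cos (pi x)\<close>.\<close>
lemma ip_cos_power_zero:
  assumes f: "continuous_on {0..1} f" and z: "\<And>m. ip f (cosm m) = 0"
  shows "ip f (\<lambda>x. cos (pi * x) ^ k * cos (real m * pi * x)) = 0"
proof (induction k arbitrary: m)
  case 0
  have "ip f (cosm m) = mu m * ip f (\<lambda>x. cos (real m * pi * x))"
    unfolding cosm_def by (simp only: ip_scale_right)
  moreover have "mu m \<noteq> 0" by (simp add: mu_def)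
  ultimately show ?case using z[of m] by simp
next
  case (Suc k)
  let ?c = "\<lambda>j x. cos (pi * x) ^ k * cos (real j * pi * x)"
  have L: "?c j \<in> L2_space" "(\<lambda>x. 1/2 * ?c j x) \<in> L2_space" for j
    by (auto intro!: L2_space_continuous continuous_intros)
  show ?case
  proof (cases m)
    case 0
    then have "(\<lambda>x. cos (pi * x) ^ Suc k * cos (real m * pi * x)) = ?c 1"
      by auto
    then show ?thesis using Suc.IH[of 1] by simp
  next
    case (Suc j)
    have "cos (pi * x) ^ Suc k * cos (real m * pi * x) = 1/2 * ?c (j + 2) x + 1/2 * ?c j x" for x
    proof -
      have "cos (real (j + 2) * pi * x) = cos (real m * pi * x) * cos (pi * x) - sin (real m * pi * x) * sin (pi * x)"
        unfolding Suc cos_add[symmetric] by (rule arg_cong[of _ _ cos]) (simp add: algebra_simps)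
      moreover have "cos (real j * pi * x) = cos (real m * pi * x) * cos (pi * x) + sin (real m * pi * x) * sin (pi * x)"
        unfolding Suc cos_diff[symmetric] by (rule arg_cong[of _ _ cos]) (simp add: algebra_simps)
      ultimately show ?thesis by (simp add: distrib_left distrib_right left_diff_distrib right_diff_distrib mult.assoc mult.commute mult.left_commute)
    qed
    then have "ip f (\<lambda>x. cos (pi * x) ^ Suc k * cos (real m * pi * x)) = ip f (\<lambda>x. 1/2 * ?c (j + 2) x + 1/2 * ?c j x)"
      by (simp only:)
    also have "\<dots> = 1/2 * ip f (?c (j + 2)) + 1/2 * ip f (?c j)"
      by (subst ip_add_right[OF L(2) L(2) L2_space_continuous[OF f]]) (simp only: ip_scale_right)
    finally show ?thesis unfolding Suc.IH by simp
  qed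
qed

text \<open>After the substitution \<open>c = cos (pi x)\<close>, which maps the unit interval onto \<open>{-1..1}\<close>, the Weierstrass theorem
approximates \<open>f\<close> uniformly by polynomials in \<open>cos (pi x)\<close>. All of these are orthogonal to \<open>f\<close>, so \<open>f\<close> has norm 0.\<close>
lemma cosm_complete:
  assumes f: "continuous_on {0..1} f" and z: "\<And>m. ip f (cosm m) = 0" and x: "x \<in> {0..1}"
  shows "f x = 0"
proof -
  have fL: "f \<in> L2_space" by (rule L2_space_continuous[OF f])
  have "ip f f \<le> norm_L2 f * \<epsilon>" if \<epsilon>: "0 < \<epsilon>" for \<epsilon>
  proof -
    \<comment> \<open>the function f in the variable c = cos (pi x)\<close>
    have "continuous_on {-1..1} (\<lambda>c. f (arccos c / pi))"
    proof (rule continuous_on_compose2[OF f])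
      show "continuous_on {-1..1} (\<lambda>c. arccos c / pi)" by (intro continuous_intros) auto
      show "(\<lambda>c. arccos c / pi) ` {-1..1} \<subseteq> {0..1}"
        using arccos_lbound arccos_ubound by (auto simp: divide_le_eq)
    qed
    then obtain g where g: "real_polynomial_function g" "\<And>c. c \<in> {-1..1} \<Longrightarrow> \<bar>f (arccos c / pi) - g c\<bar> < \<epsilon>"
      using Stone_Weierstrass_real_polynomial_function[of "{-1..1::real}" "\<lambda>c. f (arccos c / pi)" \<epsilon>] \<epsilon>
      by auto
    then obtain a n where an: "g = (\<lambda>c. \<Sum>i\<le>n. a i * c ^ i)"
      unfolding real_polynomial_function_iff_sum by blast
    let ?p = "\<lambda>x. g (cos (pi * x))"
    have pc: "continuous_on {0..1} ?p" unfolding an by (intro continuous_intros)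
    have close: "\<bar>f x - ?p x\<bar> \<le> \<epsilon>" if "x \<in> {0..1}" for x
    proof -
      have "arccos (cos (pi * x)) = pi * x"
        using that by (intro arccos_cos) (auto simp: mult_le_cancel_left)
      then show ?thesis using g(2)[of "cos (pi * x)"] by simp
    qed
    have L: "(\<lambda>x. a i * cos (pi * x) ^ i) \<in> L2_space" for i
      by (intro L2_space_continuous continuous_intros)
    have "ip ?p f = (\<Sum>i\<le>n. a i * ip f (\<lambda>x. cos (pi * x) ^ i))"
      unfolding an using L fL by (subst ip_sum_left) (auto simp: ip_scale_left ip_commute)
    also have "\<dots> = 0"
      using ip_cos_power_zero[OF f z, of _ 0] by simp
    finally have "ip f f = ip (\<lambda>x. f x - ?p x) f"
      using fL pc by (simp add: ip_diff_left L2_space_continuous)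
    also have "\<dots> \<le> norm_L2 (\<lambda>x. f x - ?p x) * norm_L2 f"
      using ip_Cauchy_Schwarz[of "\<lambda>x. f x - ?p x" f] fL pc
      by (auto simp: L2_space_continuous L2_space_diff)
    also have "\<dots> \<le> \<epsilon> * norm_L2 f"
      using close f pc by (intro mult_right_mono norm_L2_bound continuous_intros) auto
    finally show ?thesis by (simp add: mult.commute)
  qed
  note bound = this
  have "ip f f \<le> 0 + \<epsilon>" if "0 < \<epsilon>" for \<epsilon>
  proof -
    have pos: "0 < norm_L2 f + 1" using norm_L2_nonneg[of f] by linarith
    have "ip f f \<le> norm_L2 f * (\<epsilon> / (norm_L2 f + 1))"
      using that pos by (intro bound) simp
    also have "\<dots> \<le> (norm_L2 f + 1) * (\<epsilon> / (norm_L2 f + 1))"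
      using that pos by (intro mult_right_mono) auto
    also have "\<dots> = \<epsilon>" using pos by simp
    finally show ?thesis by simp
  qed
  then have "ip f f \<le> 0" by (rule field_le_epsilon)
  then have "ip f f = 0" using ip_nonneg[of f] by simp
  then have "integral {0..1} (\<lambda>x. f x * f x) = 0"
    by (simp add: ip_conv_integral fL)
  moreover have "continuous_on {0..1} (\<lambda>x. f x * f x)" using f by (intro continuous_intros)
  ultimately show ?thesis
    using integral_eq_0_iff[of 0 1 "\<lambda>x. f x * f x"] x by auto
qed

text \<open>Multiplication by \<open>cos (pi x / 2)\<close> maps the integer frequencies to sums of half-integer ones, so
\<open>f x * cos (pi x / 2)\<close> is orthogonal to every \<open>cosm m\<close>. The factor vanishes at 1, which is therefore excluded.\<close>
lemma phi1_complete:
  assumes f: "continuous_on {0..1} f" and z: "\<And>n. ip f (phi1 n) = 0" and x: "x \<in> {0..<1}"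
  shows "f x = 0"
proof -
  let ?g = "\<lambda>x. f x * cos (pi * x / 2)"
  have z': "ip f (\<lambda>x. cos ((real n + 1/2) * pi * x)) = 0" for n
    using z[of n] unfolding phi1_def ip_scale_right by simp
  have gz: "ip ?g (cosm m) = 0" for m
  proof -
    have L: "(\<lambda>x. mu m * cos (c * pi * x)) \<in> L2_space" "(\<lambda>x. 1/2 * (mu m * cos (c * pi * x))) \<in> L2_space" for c
      by (auto intro!: L2_space_continuous continuous_intros)
    have "cos (pi * x / 2) * cosm m x =
        1/2 * (mu m * cos ((real m + 1/2) * pi * x)) + 1/2 * (mu m * cos ((real m - 1/2) * pi * x))" for x
    proof -
      have "cos ((real m + 1/2) * pi * x) = cos (real m * pi * x) * cos (pi * x / 2) - sin (real m * pi * x) * sin (pi * x / 2)"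
        unfolding cos_add[symmetric] by (rule arg_cong[of _ _ cos]) (simp add: algebra_simps)
      moreover have "cos ((real m - 1/2) * pi * x) = cos (real m * pi * x) * cos (pi * x / 2) + sin (real m * pi * x) * sin (pi * x / 2)"
        unfolding cos_diff[symmetric] by (rule arg_cong[of _ _ cos]) (simp add: algebra_simps)
      ultimately show ?thesis by (simp add: cosm_def distrib_left distrib_right left_diff_distrib right_diff_distrib mult.assoc mult.commute mult.left_commute)
    qed
    then have "ip ?g (cosm m) = ip f (\<lambda>x. 1/2 * (mu m * cos ((real m + 1/2) * pi * x)) + 1/2 * (mu m * cos ((real m - 1/2) * pi * x)))"
      unfolding ip_def by (simp only: mult.assoc)
    also have "\<dots> = 1/2 * (mu m * ip f (\<lambda>x. cos ((real m + 1/2) * pi * x))) + 1/2 * (mu m * ip f (\<lambda>x. cos ((real m - 1/2) * pi * x)))"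
      by (subst ip_add_right[OF L(2) L(2) L2_space_continuous[OF f]]) (simp only: ip_scale_right)
    also have "ip f (\<lambda>x. cos ((real m - 1/2) * pi * x)) = 0"
    proof (cases m)
      case 0
      have "cos ((0 - 1/2) * pi * x) = cos ((real 0 + 1/2) * pi * x)" for x
        using cos_minus[of "1/2 * pi * x"] by simp
      then show ?thesis using z'[of 0] 0 by simp
    next
      case (Suc j)
      then have "real m - 1/2 = real j + 1/2" by simp
      then show ?thesis using z'[of j] by (simp only:)
    qed
    finally show ?thesis using z'[of m] by simp
  qed
  have gc: "continuous_on {0..1} ?g" using f by (intro continuous_intros) auto
  have "?g x = 0" using x by (intro cosm_complete[OF gc gz]) simp
  moreover have "0 < cos (pi * x / 2)"
  proof (rule cos_gt_zero_pi)
    have "0 \<le> pi * x" "pi * x < pi" using x by simp_all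
    then show "- (pi / 2) < pi * x / 2" "pi * x / 2 < pi / 2" using pi_gt_zero by linarith+
  qed
  ultimately show ?thesis by simp
qed

section \<open>The eigenfunctions as solutions of boundary value problems\<close>

text \<open>The resonance partner: the second index of the pair of equal eigenvalues to which \<open>n\<close> belongs. It is only meaningful for \<open>n\<close> in \<open>Delta1\<close>.\<close>
definition partner1 :: "real \<Rightarrow> real \<Rightarrow> nat \<Rightarrow> nat" where
  "partner1 a b n = (THE k. (n, k) \<in> Delta a b)"

definition partner2 :: "real \<Rightarrow> real \<Rightarrow> nat \<Rightarrow> nat" where
  "partner2 a b m = (THE k. (k, m) \<in> Delta a b)"

lemma partner1_eq: "(n, k) \<in> Delta a b \<Longrightarrow> partner1 a b n = k"
  unfolding partner1_def by (rule the_equality) (auto dest: Delta_snd_unique)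

lemma partner2_eq: "(k, m) \<in> Delta a b \<Longrightarrow> partner2 a b m = k"
  unfolding partner2_def by (rule the_equality) (auto dest: Delta_fst_unique)

lemma partner1_in: "n \<in> Delta1 a b \<Longrightarrow> (n, partner1 a b n) \<in> Delta a b"
  by (auto simp: Delta1_def partner1_eq)

lemma partner2_in: "m \<in> Delta2 a b \<Longrightarrow> (partner2 a b m, m) \<in> Delta a b"
  by (auto simp: Delta2_def partner2_eq)

lemma Delta1I: "lam1 a n = lam2 b m \<Longrightarrow> n \<in> Delta1 a b"
  unfolding Delta1_def by (rule image_eqI[of _ _ "(n, m)"]) (simp_all add: Delta_iff)

lemma Delta2I: "lam1 a n = lam2 b m \<Longrightarrow> m \<in> Delta2 a b"
  unfolding Delta2_def by (rule image_eqI[of _ _ "(n, m)"]) (simp_all add: Delta_iff)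

text \<open>If \<open>cos w\<close> vanished, then \<open>lam2 b m\<close> would coincide with some \<open>lam1 a k\<close>, against nonresonance. The imaginary
square root then turns the hyperbolic formula into this trigonometric one, which covers all large \<open>m\<close>.\<close>
lemma phi2_oscillating:
  assumes "m \<notin> Delta2 a b" "b - a < (real m)\<^sup>2 * pi\<^sup>2"
  defines "w \<equiv> sqrt ((real m)\<^sup>2 * pi\<^sup>2 - (b - a))"
  shows "cos w \<noteq> 0" "phi2 a b s m x = - (s * mu m / (w * cos w)) * sin (w * (1 - x))"
proof -
  have w2: "w\<^sup>2 = (real m)\<^sup>2 * pi\<^sup>2 - (b - a)" and w0: "0 < w"
    using assms(2) by (simp_all add: w_def)
  show "cos w \<noteq> 0"
  proof
    assume "cos w = 0"
    then obtain n where n: "odd n" "w = real n * (pi/2)"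
      using cos_zero_lemma[of w] w0 by auto
    then obtain k where "n = 2 * k + 1" by (auto elim: oddE)
    then have "w = (real k + 1/2) * pi" using n(2) by (simp add: field_simps)
    then have "lam1 a k = lam2 b m"
      using w2 by (simp add: lam1_def lam2_def power_mult_distrib)
    then show False using assms(1) Delta2I by blast
  qed
  have r: "(\<i> * complex_of_real w)\<^sup>2 = complex_of_real (b - a - (real m)\<^sup>2 * pi\<^sup>2)"
    using w2 by (simp add: power_mult_distrib flip: of_real_power)
  have "complex_of_real (phi2 a b s m x) = of_real (- (s * mu m / (w * cos w)) * sin (w * (1 - x)))"
    unfolding phi2_root[OF assms(1) _ r, of s x, OF less_imp_neq[OF assms(2)]]
    by (simp add: sinh_conv_sin cosh_conv_cos mult.assoc[symmetric] flip: sin_of_real cos_of_real)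
  then show "phi2 a b s m x = - (s * mu m / (w * cos w)) * sin (w * (1 - x))"
    unfolding of_real_eq_iff .
qed

lemma DERIV_reflected:
  fixes c w x :: real
  shows "((\<lambda>x. c * sinh (w * (1 - x))) has_real_derivative - (c * w) * cosh (w * (1 - x))) (at x)"
    and "((\<lambda>x. c * cosh (w * (1 - x))) has_real_derivative - (c * w) * sinh (w * (1 - x))) (at x)"
    and "((\<lambda>x. c * sin (w * (1 - x))) has_real_derivative - (c * w) * cos (w * (1 - x))) (at x)"
    and "((\<lambda>x. c * cos (w * (1 - x))) has_real_derivative (c * w) * sin (w * (1 - x))) (at x)"
  by (auto intro!: derivative_eq_intros)

text \<open>The four closed forms of the eigenfunction (resonant, linear, hyperbolic, trigonometric) solve one and the same
boundary value problem. Everything that follows uses only this problem, so the case distinction is made here once.\<close>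
lemma phi2_ode_exists:
  "\<exists>d. (\<forall>x. (phi2 a b s m has_real_derivative d x) (at x)) \<and>
     (\<forall>x. (d has_real_derivative (lam2 b m - a) * phi2 a b s m x
        - (if m \<in> Delta2 a b then sqrt 2 * s * mu m * phi1 (partner2 a b m) x else 0)) (at x)) \<and>
     phi2 a b s m 1 = 0 \<and> d 0 = s * mu m"
proof (cases "m \<in> Delta2 a b")
  case True
  define k where "k = partner2 a b m"
  define w where "w = (real k + 1/2) * pi"
  have w0: "0 < w" by (simp add: w_def add_nonneg_pos)
  have "(k, m) \<in> Delta a b" using True by (simp add: k_def partner2_in)
  then have lam: "lam2 b m - a = - w\<^sup>2"
    by (simp add: Delta_iff lam1_def w_def power_mult_distrib)
  have phi: "phi2 a b s m = (\<lambda>x. s * mu m / w * (1 - x) * sin (w * x))"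
    using True by (intro ext) (simp add: phi2_def k_def w_def partner2_def Let_def)
  have res: ?thesis if "\<And>x. (phi2 a b s m has_real_derivative d x) (at x)"
    "\<And>x. (d has_real_derivative (lam2 b m - a) * phi2 a b s m x
        - (if m \<in> Delta2 a b then sqrt 2 * s * mu m * phi1 (partner2 a b m) x else 0)) (at x)"
    "phi2 a b s m 1 = 0" "d 0 = s * mu m" for d
    using that by (intro exI[of _ d] conjI allI)
  let ?d = "\<lambda>x. s * mu m * ((1 - x) * cos (w * x)) - s * mu m / w * sin (w * x)"
  have "(phi2 a b s m has_real_derivative ?d x) (at x)" for x
    unfolding phi using w0 by (auto intro!: derivative_eq_intros simp: field_simps)
  moreover have "(?d has_real_derivative (lam2 b m - a) * phi2 a b s m x
      - (if m \<in> Delta2 a b then sqrt 2 * s * mu m * phi1 (partner2 a b m) x else 0)) (at x)" for x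
  proof -
    have "sqrt 2 * s * mu m * phi1 (partner2 a b m) x = 2 * s * mu m * cos (w * x)"
      by (simp add: phi1_def w_def k_def)
    moreover have "(?d has_real_derivative - w\<^sup>2 * (s * mu m / w * (1 - x) * sin (w * x)) - 2 * s * mu m * cos (w * x)) (at x)"
      using w0 by (auto intro!: derivative_eq_intros simp: power2_eq_square field_simps)
    ultimately show ?thesis unfolding phi lam using True by (simp only: if_True)
  qed
  moreover have "phi2 a b s m 1 = 0" "?d 0 = s * mu m" using w0 by (simp_all add: phi)
  ultimately show ?thesis
    by (rule res[of ?d])
next
  case False
  define q where "q = b - a - (real m)\<^sup>2 * pi\<^sup>2"
  have lam: "lam2 b m - a = q" by (simp add: lam2_def q_def)
  have res: ?thesis if "\<And>x. (phi2 a b s m has_real_derivative d x) (at x)"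
    "\<And>x. (d has_real_derivative q * phi2 a b s m x) (at x)" "phi2 a b s m 1 = 0" "d 0 = s * mu m" for d
    using that False lam by (intro exI[of _ d]) auto
  consider "q = 0" | "0 < q" | "q < 0" by linarith
  then show ?thesis
  proof cases
    case 1
    have phi: "phi2 a b s m = (\<lambda>x. s * mu m * (- 1 + x))"
      using False 1 by (auto simp: phi2_def q_def)
    show ?thesis
      by (rule res[of "\<lambda>x. s * mu m"]) (auto simp: phi 1 intro!: derivative_eq_intros)
  next
    case 2
    define w where "w = sqrt q"
    have w2: "w\<^sup>2 = q" and w0: "0 < w" using 2 by (simp_all add: w_def)
    have c0: "cosh w \<noteq> 0" by simp
    have r: "(complex_of_real w)\<^sup>2 = complex_of_real (b - a - (real m)\<^sup>2 * pi\<^sup>2)"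
      using w2 by (simp add: q_def flip: of_real_power)
    have ne: "b - a \<noteq> (real m)\<^sup>2 * pi\<^sup>2" using 2 by (simp add: q_def)
    have "complex_of_real (phi2 a b s m x) = of_real (- (s * mu m / (w * cosh w)) * sinh (w * (1 - x)))" for x
      unfolding phi2_root[OF False ne r, of s x]
      by (simp add: sinh_def cosh_def exp_of_real scaleR_conv_of_real flip: exp_of_real)
    then have phi: "phi2 a b s m = (\<lambda>x. - (s * mu m / (w * cosh w)) * sinh (w * (1 - x)))"
      unfolding of_real_eq_iff by (rule ext)
    show ?thesis
    proof (rule res[of "\<lambda>x. s * mu m / cosh w * cosh (w * (1 - x))"])
      show "(phi2 a b s m has_real_derivative s * mu m / cosh w * cosh (w * (1 - x))) (at x)" for x
        unfolding phi by (rule DERIV_cong[OF DERIV_reflected(1)]) (use w0 c0 in simp)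
      show "((\<lambda>x. s * mu m / cosh w * cosh (w * (1 - x))) has_real_derivative q * phi2 a b s m x) (at x)" for x
        unfolding phi w2[symmetric] by (rule DERIV_cong[OF DERIV_reflected(2)]) (use w0 c0 in \<open>simp add: power2_eq_square\<close>)
    qed (auto simp: phi)
  next
    case 3
    then have lt: "b - a < (real m)\<^sup>2 * pi\<^sup>2" by (simp add: q_def)
    define w where "w = sqrt ((real m)\<^sup>2 * pi\<^sup>2 - (b - a))"
    have w2: "q = - w\<^sup>2" and w0: "0 < w" using 3 by (simp_all add: w_def q_def)
    have c0: "cos w \<noteq> 0" using phi2_oscillating(1)[OF False lt] by (simp add: w_def)
    have phi: "phi2 a b s m = (\<lambda>x. - (s * mu m / (w * cos w)) * sin (w * (1 - x)))"
      using phi2_oscillating(2)[OF False lt] by (auto simp: w_def)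
    show ?thesis
    proof (rule res[of "\<lambda>x. s * mu m / cos w * cos (w * (1 - x))"])
      show "(phi2 a b s m has_real_derivative s * mu m / cos w * cos (w * (1 - x))) (at x)" for x
        unfolding phi by (rule DERIV_cong[OF DERIV_reflected(3)]) (use w0 c0 in simp)
      show "((\<lambda>x. s * mu m / cos w * cos (w * (1 - x))) has_real_derivative q * phi2 a b s m x) (at x)" for x
        unfolding phi w2 by (rule DERIV_cong[OF DERIV_reflected(4)]) (use w0 c0 in \<open>simp add: power2_eq_square\<close>)
    qed (use c0 in \<open>auto simp: phi\<close>)
  qed
qed

lemma phi2_ode:
  shows "(phi2 a b s m has_real_derivative deriv (phi2 a b s m) x) (at x)"
    and "(deriv (phi2 a b s m) has_real_derivative (lam2 b m - a) * phi2 a b s m x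
        - (if m \<in> Delta2 a b then sqrt 2 * s * mu m * phi1 (partner2 a b m) x else 0)) (at x)"
    and "phi2 a b s m 1 = 0" and "deriv (phi2 a b s m) 0 = s * mu m"
proof -
  obtain d where d: "\<And>x. (phi2 a b s m has_real_derivative d x) (at x)"
    "\<And>x. (d has_real_derivative (lam2 b m - a) * phi2 a b s m x
        - (if m \<in> Delta2 a b then sqrt 2 * s * mu m * phi1 (partner2 a b m) x else 0)) (at x)"
     "phi2 a b s m 1 = 0" "d 0 = s * mu m"
    using phi2_ode_exists by metis
  have "deriv (phi2 a b s m) = d" using DERIV_imp_deriv[OF d(1)] by (rule ext)
  then show "(phi2 a b s m has_real_derivative deriv (phi2 a b s m) x) (at x)"
    and "(deriv (phi2 a b s m) has_real_derivative (lam2 b m - a) * phi2 a b s m x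
        - (if m \<in> Delta2 a b then sqrt 2 * s * mu m * phi1 (partner2 a b m) x else 0)) (at x)"
    and "phi2 a b s m 1 = 0" and "deriv (phi2 a b s m) 0 = s * mu m"
    using d by metis+
qed

text \<open>Here nonresonance excludes \<open>sin w = 0\<close>.\<close>
lemma psi1_snd_oscillating:
  assumes "n \<notin> Delta1 a b" "lam1 a n < b"
  defines "w \<equiv> sqrt (b - lam1 a n)"
  shows "sin w \<noteq> 0" "psi1_snd a b s n x = sqrt 2 * s / (w * sin w) * cos (w * (1 - x))"
proof -
  have w2: "w\<^sup>2 = b - lam1 a n" and w0: "0 < w"
    using assms(2) by (simp_all add: w_def)
  show "sin w \<noteq> 0"
  proof
    assume "sin w = 0"
    then obtain i where i: "even i" "w = real i * (pi/2)"
      using sin_zero_lemma[of w] w0 by auto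
    then obtain k where "i = 2 * k" by (auto elim: evenE)
    then have "w = real k * pi" using i(2) by simp
    then have "lam1 a n = lam2 b k"
      using w2 by (simp add: lam2_def power_mult_distrib)
    then show False using assms(1) Delta1I by blast
  qed
  have r: "(\<i> * complex_of_real w)\<^sup>2 = complex_of_real (lam1 a n - b)"
    using w2 by (simp add: power_mult_distrib flip: of_real_power)
  have 1: "(\<i> * complex_of_real w) * sinh (\<i> * complex_of_real w) = - complex_of_real (w * sin w)"
    unfolding sinh_conv_sin by (simp add: sin_of_real complex_eq_iff)
  have 2: "cosh ((\<i> * complex_of_real w) * complex_of_real (1 - x)) = of_real (cos (w * (1 - x)))"
    unfolding cosh_conv_cos by (simp add: mult.assoc[symmetric] flip: cos_of_real)
  have "complex_of_real (psi1_snd a b s n x) = of_real (sqrt 2 * s / (w * sin w) * cos (w * (1 - x)))"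
    unfolding psi1_snd_root[OF assms(1) r, of s x] 1 2 by simp
  then show "psi1_snd a b s n x = sqrt 2 * s / (w * sin w) * cos (w * (1 - x))"
    unfolding of_real_eq_iff .
qed

lemma psi1_snd_degenerate:
  assumes "(n, k) \<in> Delta a b"
  shows "psi1_snd a b s n x = (if k = 0 then
          - s * sqrt 2 * (1/3 + 1 / ((2 * real n + 1)\<^sup>2 * pi\<^sup>2)) + sqrt 2 * s * x - sqrt 2 / 2 * s * x\<^sup>2
        else
          sqrt 2 * s / (real k * pi) * (1 - x) * sin (real k * pi * x)
          + (- (2 * s / pi\<^sup>2) * (1 / (2 * real n + 1)\<^sup>2 + 1 / (4 * (real k)\<^sup>2))) * sqrt 2 * cos (real k * pi * x))"
proof -
  have "n \<in> Delta1 a b" using assms by (force simp: Delta1_def)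
  moreover have "(THE k. (n, k) \<in> Delta a b) = k" using partner1_eq[OF assms] by (simp add: partner1_def)
  ultimately show ?thesis by (simp add: psi1_snd_def)
qed

text \<open>As for \<open>phi2\<close>, one boundary value problem replaces all closed forms. The inhomogeneous term in the resonant case is
what makes \<open>psi\<close> a generalized rather than a genuine eigenvector.\<close>
lemma psi1_snd_ode_exists:
  "\<exists>d. (\<forall>x. (psi1_snd a b s n has_real_derivative d x) (at x)) \<and>
     (\<forall>x. (d has_real_derivative (lam1 a n - b) * psi1_snd a b s n x
        - (if n \<in> Delta1 a b then sqrt 2 * s * mu (partner1 a b n) * cosm (partner1 a b n) x else 0)) (at x)) \<and>
     d 1 = 0 \<and> d 0 = sqrt 2 * s"
proof (cases "n \<in> Delta1 a b")
  case True
  define k where "k = partner1 a b n"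
  have nk: "(n, k) \<in> Delta a b" using True by (simp add: k_def partner1_in)
  then have lam: "lam1 a n - b = - (real k * pi)\<^sup>2"
    by (simp add: Delta_iff lam2_def power_mult_distrib)
  have res: ?thesis if "\<And>x. (psi1_snd a b s n has_real_derivative d x) (at x)"
    "\<And>x. (d has_real_derivative - (real k * pi)\<^sup>2 * psi1_snd a b s n x - sqrt 2 * s * mu k * cosm k x) (at x)"
    "d 1 = 0" "d 0 = sqrt 2 * s" for d
    using that True lam by (intro exI[of _ d]) (auto simp: k_def)
  show ?thesis
  proof (cases "k = 0")
    case True
    have psi: "psi1_snd a b s n = (\<lambda>x. - s * sqrt 2 * (1/3 + 1 / ((2 * real n + 1)\<^sup>2 * pi\<^sup>2)) + sqrt 2 * s * x - sqrt 2 / 2 * s * x\<^sup>2)"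
      using psi1_snd_degenerate[OF nk] True by auto
    show ?thesis
      by (rule res[of "\<lambda>x. sqrt 2 * s - sqrt 2 * s * x"])
         (auto simp: psi True mu_def cosm_def intro!: derivative_eq_intros)
  next
    case False
    define w where "w = real k * pi"
    define c where "c = (- (2 * s / pi\<^sup>2) * (1 / (2 * real n + 1)\<^sup>2 + 1 / (4 * (real k)\<^sup>2))) * sqrt 2"
    have w0: "0 < w" using False by (simp add: w_def)
    have sw: "sin w = 0" by (simp add: w_def)
    have psi: "psi1_snd a b s n = (\<lambda>x. sqrt 2 * s / w * (1 - x) * sin (w * x) + c * cos (w * x))"
      using psi1_snd_degenerate[OF nk] False by (auto simp: w_def c_def)
    let ?d = "\<lambda>x. sqrt 2 * s * ((1 - x) * cos (w * x)) - sqrt 2 * s / w * sin (w * x) - c * w * sin (w * x)"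
    show ?thesis
    proof (rule res[of ?d])
      show "(psi1_snd a b s n has_real_derivative ?d x) (at x)" for x
        unfolding psi using w0 by (auto intro!: derivative_eq_intros simp: field_simps)
      have "sqrt 2 * s * mu k * cosm k x = 2 * sqrt 2 * s * cos (w * x)" for x
        using False by (simp add: mu_def cosm_def w_def)
      moreover have "(?d has_real_derivative - w\<^sup>2 * (sqrt 2 * s / w * (1 - x) * sin (w * x) + c * cos (w * x)) - 2 * sqrt 2 * s * cos (w * x)) (at x)" for x
        using w0 by (auto intro!: derivative_eq_intros simp: power2_eq_square field_simps)
      ultimately show "(?d has_real_derivative - (real k * pi)\<^sup>2 * psi1_snd a b s n x - sqrt 2 * s * mu k * cosm k x) (at x)" for x
        unfolding psi w_def[symmetric] by (simp only:)
      show "?d 1 = 0" "?d 0 = sqrt 2 * s" using w0 sw by simp_all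
    qed
  qed
next
  case False
  define q where "q = lam1 a n - b"
  have res: ?thesis if "\<And>x. (psi1_snd a b s n has_real_derivative d x) (at x)"
    "\<And>x. (d has_real_derivative q * psi1_snd a b s n x) (at x)" "d 1 = 0" "d 0 = sqrt 2 * s" for d
    using that False by (intro exI[of _ d]) (auto simp: q_def)
  have "q \<noteq> 0"
  proof
    assume "q = 0"
    then have "lam1 a n = lam2 b 0" by (simp add: q_def lam2_def)
    then show False using False Delta1I by blast
  qed
  then consider "0 < q" | "q < 0" by linarith
  then show ?thesis
  proof cases
    case 1
    define w where "w = sqrt q"
    have w2: "w\<^sup>2 = q" and w0: "0 < w" using 1 by (simp_all add: w_def)
    have c0: "sinh w \<noteq> 0" using w0 by simp
    have r: "(complex_of_real w)\<^sup>2 = complex_of_real (lam1 a n - b)"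
      using w2 by (simp add: q_def flip: of_real_power)
    have "complex_of_real (psi1_snd a b s n x) = of_real (- (sqrt 2 * s / (w * sinh w)) * cosh (w * (1 - x)))" for x
      unfolding psi1_snd_root[OF False r, of s x]
      by (simp add: sinh_def cosh_def exp_of_real scaleR_conv_of_real flip: exp_of_real)
    then have psi: "psi1_snd a b s n = (\<lambda>x. - (sqrt 2 * s / (w * sinh w)) * cosh (w * (1 - x)))"
      unfolding of_real_eq_iff by (rule ext)
    show ?thesis
    proof (rule res[of "\<lambda>x. sqrt 2 * s / sinh w * sinh (w * (1 - x))"])
      show "(psi1_snd a b s n has_real_derivative sqrt 2 * s / sinh w * sinh (w * (1 - x))) (at x)" for x
        unfolding psi by (rule DERIV_cong[OF DERIV_reflected(2)]) (use w0 c0 in simp)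
      show "((\<lambda>x. sqrt 2 * s / sinh w * sinh (w * (1 - x))) has_real_derivative q * psi1_snd a b s n x) (at x)" for x
        unfolding psi w2[symmetric] by (rule DERIV_cong[OF DERIV_reflected(1)]) (use w0 c0 in \<open>simp add: power2_eq_square\<close>)
    qed (use c0 in auto)
  next
    case 2
    then have lt: "lam1 a n < b" by (simp add: q_def)
    define w where "w = sqrt (b - lam1 a n)"
    have w2: "q = - w\<^sup>2" and w0: "0 < w" using 2 by (simp_all add: w_def q_def)
    have c0: "sin w \<noteq> 0" using psi1_snd_oscillating(1)[OF False lt] by (simp add: w_def)
    have psi: "psi1_snd a b s n = (\<lambda>x. sqrt 2 * s / (w * sin w) * cos (w * (1 - x)))"
      using psi1_snd_oscillating(2)[OF False lt] by (auto simp: w_def)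
    show ?thesis
    proof (rule res[of "\<lambda>x. sqrt 2 * s / sin w * sin (w * (1 - x))"])
      show "(psi1_snd a b s n has_real_derivative sqrt 2 * s / sin w * sin (w * (1 - x))) (at x)" for x
        unfolding psi by (rule DERIV_cong[OF DERIV_reflected(4)]) (use w0 c0 in simp)
      show "((\<lambda>x. sqrt 2 * s / sin w * sin (w * (1 - x))) has_real_derivative q * psi1_snd a b s n x) (at x)" for x
        unfolding psi w2 by (rule DERIV_cong[OF DERIV_reflected(3)]) (use w0 c0 in \<open>simp add: power2_eq_square\<close>)
    qed (use c0 in auto)
  qed
qed

lemma psi1_snd_ode:
  shows "(psi1_snd a b s n has_real_derivative deriv (psi1_snd a b s n) x) (at x)"
    and "(deriv (psi1_snd a b s n) has_real_derivative (lam1 a n - b) * psi1_snd a b s n x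
        - (if n \<in> Delta1 a b then sqrt 2 * s * mu (partner1 a b n) * cosm (partner1 a b n) x else 0)) (at x)"
    and "deriv (psi1_snd a b s n) 1 = 0" and "deriv (psi1_snd a b s n) 0 = sqrt 2 * s"
proof -
  obtain d where d: "\<And>x. (psi1_snd a b s n has_real_derivative d x) (at x)"
    "\<And>x. (d has_real_derivative (lam1 a n - b) * psi1_snd a b s n x
        - (if n \<in> Delta1 a b then sqrt 2 * s * mu (partner1 a b n) * cosm (partner1 a b n) x else 0)) (at x)"
     "d 1 = 0" "d 0 = sqrt 2 * s"
    using psi1_snd_ode_exists by metis
  have "deriv (psi1_snd a b s n) = d" using DERIV_imp_deriv[OF d(1)] by (rule ext)
  then show "(psi1_snd a b s n has_real_derivative deriv (psi1_snd a b s n) x) (at x)"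
    and "(deriv (psi1_snd a b s n) has_real_derivative (lam1 a n - b) * psi1_snd a b s n x
        - (if n \<in> Delta1 a b then sqrt 2 * s * mu (partner1 a b n) * cosm (partner1 a b n) x else 0)) (at x)"
    and "deriv (psi1_snd a b s n) 1 = 0" and "deriv (psi1_snd a b s n) 0 = sqrt 2 * s"
    using d by metis+
qed

lemma smooth_on_unitI:
  assumes "\<And>x. (f has_real_derivative g x) (at x)" "\<And>x. (g has_real_derivative h x) (at x)"
  shows "smooth_on_unit f g"
  unfolding smooth_on_unit_def
  using assms by (auto intro!: DERIV_continuous_on intro: has_field_derivative_at_within)

lemma smooth_phi2: "smooth_on_unit (phi2 a b s m) (deriv (phi2 a b s m))"
  by (rule smooth_on_unitI[OF phi2_ode(1,2)])

lemma smooth_psi1_snd: "smooth_on_unit (psi1_snd a b s n) (deriv (psi1_snd a b s n))"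
  by (rule smooth_on_unitI[OF psi1_snd_ode(1,2)])

section \<open>Modal coordinates and the generator\<close>

lemma smooth_cosm: "smooth_on_unit (cosm m) (\<lambda>x. - (real m * pi * (mu m * sin (real m * pi * x))))"
  unfolding smooth_on_unit_def cosm_def
  by (auto intro!: derivative_eq_intros continuous_intros)

lemma smooth_cosm': "smooth_on_unit (\<lambda>x. - (real m * pi * (mu m * sin (real m * pi * x))))
    (\<lambda>x. - (real m * pi)\<^sup>2 * cosm m x)"
  unfolding smooth_on_unit_def cosm_def
  by (auto intro!: derivative_eq_intros continuous_intros simp: power2_eq_square)

lemma smooth_phi1: "smooth_on_unit (phi1 n) (\<lambda>x. - ((real n + 1/2) * pi) * sin_half n x)"
  unfolding smooth_on_unit_def phi1_def sin_half_def
  by (auto intro!: derivative_eq_intros continuous_intros)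

lemma smooth_phi1': "smooth_on_unit (\<lambda>x. - ((real n + 1/2) * pi) * sin_half n x)
    (\<lambda>x. - ((real n + 1/2) * pi)\<^sup>2 * phi1 n x)"
  unfolding smooth_on_unit_def phi1_def sin_half_def
  by (auto intro!: derivative_eq_intros continuous_intros simp: power2_eq_square)

lemma smooth_sin_half: "smooth_on_unit (sin_half n) (\<lambda>x. ((real n + 1/2) * pi) * phi1 n x)"
  unfolding smooth_on_unit_def phi1_def sin_half_def
  by (auto intro!: derivative_eq_intros continuous_intros)

lemma smooth_sin_int: "smooth_on_unit (sin_int j) (\<lambda>x. (real (Suc j) * pi) * cosm (Suc j) x)"
  unfolding smooth_on_unit_def cosm_def sin_int_def
  by (auto intro!: derivative_eq_intros continuous_intros simp: mu_def algebra_simps)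

lemma cos_half_pi_odd: "cos ((real n + 1/2) * pi) = 0" "\<bar>sin ((real n + 1/2) * pi)\<bar> = 1"
proof -
  have "(real n + 1/2) * pi = real n * pi + pi / 2" by (simp add: algebra_simps)
  then show "cos ((real n + 1/2) * pi) = 0" "\<bar>sin ((real n + 1/2) * pi)\<bar> = 1"
    by (simp_all only: cos_add sin_add) simp_all
qed

lemma phi1_at_1: "phi1 n 1 = 0"
  using cos_half_pi_odd(1)[of n] by (simp add: phi1_def)

lemma cosm_at_0: "cosm m 0 = mu m"
  by (simp add: cosm_def)

text \<open>Integration by parts twice; the boundary terms at 0 and 1 without derivatives of \<open>g\<close> vanish because \<open>cosm m\<close> has zero slope there.\<close>
lemma ip_second_deriv_cosm:
  assumes "weak_deriv g g'" "weak_deriv g' g''"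
  shows "ip g'' (cosm m) = g' 1 * cosm m 1 - g' 0 * mu m - (real m * pi)\<^sup>2 * ip g (cosm m)"
  using weak_deriv_by_parts[OF assms(2) smooth_cosm, of m] weak_deriv_by_parts[OF assms(1) smooth_cosm', of m]
  by (simp only: ip_scale_right) (simp add: cosm_at_0)

lemma ip_second_deriv_phi1:
  assumes "weak_deriv y y'" "weak_deriv y' y''" "y 1 = 0"
  shows "ip y'' (phi1 n) = - sqrt 2 * y' 0 - ((real n + 1/2) * pi)\<^sup>2 * ip y (phi1 n)"
proof -
  have "phi1 n 0 = sqrt 2" "sin_half n 0 = 0" by (simp_all add: phi1_def sin_half_def)
  then show ?thesis
    using weak_deriv_by_parts[OF assms(2) smooth_phi1, of n] weak_deriv_by_parts[OF assms(1) smooth_phi1', of n]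
    by (simp only: ip_scale_right phi1_at_1 assms(3)) simp
qed

lemma ip_deriv_sin_half:
  assumes "weak_deriv y y'" "y 1 = 0"
  shows "ip y' (sin_half n) = - ((real n + 1/2) * pi) * ip y (phi1 n)"
proof -
  have "sin_half n 0 = 0" by (simp add: sin_half_def)
  then show ?thesis
    using weak_deriv_by_parts[OF assms(1) smooth_sin_half, of n] assms(2)
    by (simp only: ip_scale_right) simp
qed

lemma ip_deriv_sin_int:
  assumes "weak_deriv g g'"
  shows "ip g' (sin_int j) = - (real (Suc j) * pi) * ip g (cosm (Suc j))"
proof -
  have "(real j + 1) * pi = real (Suc j) * pi" by simp
  then have "sin_int j 0 = 0" "sin_int j 1 = 0"
    unfolding sin_int_def mult_1_right by (simp_all only: sin_npi) simp_all
  then show ?thesis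
    using weak_deriv_by_parts[OF assms(1) smooth_sin_int, of j]
    by (simp only: ip_scale_right) simp
qed

text \<open>The coupling coefficient of the Jordan block of a resonant pair, and 0 for all other indices.\<close>
abbreviation resonance1 :: "real \<Rightarrow> real \<Rightarrow> real \<Rightarrow> nat \<Rightarrow> real" where
  "resonance1 a b s n \<equiv> (if n \<in> Delta1 a b then sqrt 2 * s * mu (partner1 a b n) else 0)"

lemma smooth_psi1_snd':
  "smooth_on_unit (deriv (psi1_snd a b s n))
     (\<lambda>x. (lam1 a n - b) * psi1_snd a b s n x - resonance1 a b s n * cosm (partner1 a b n) x)"
  unfolding smooth_on_unit_def
proof (intro conjI ballI)
  show "(deriv (psi1_snd a b s n) has_real_derivative
    (lam1 a n - b) * psi1_snd a b s n x - resonance1 a b s n * cosm (partner1 a b n) x) (at x within {0..1})" for x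
    by (rule has_field_derivative_at_within, rule DERIV_cong[OF psi1_snd_ode(2)]) simp
  show "continuous_on {0..1} (\<lambda>x. (lam1 a n - b) * psi1_snd a b s n x - resonance1 a b s n * cosm (partner1 a b n) x)"
    using smooth_on_unit_continuous[OF smooth_psi1_snd] smooth_on_unit_continuous[OF smooth_cosm]
    by (intro continuous_intros)
qed

lemma psi1_snd_L2: "psi1_snd a b s n \<in> L2_space"
  by (rule L2_space_continuous[OF smooth_on_unit_continuous[OF smooth_psi1_snd]])

lemma cosm_L2: "cosm m \<in> L2_space" by (rule orthonormal_L2[OF orthonormal_cosm])
lemma phi1_L2: "phi1 m \<in> L2_space" by (rule orthonormal_L2[OF orthonormal_phi1])
lemma phi2_L2: "phi2 a b s m \<in> L2_space"
  by (rule L2_space_continuous[OF smooth_on_unit_continuous[OF smooth_phi2]])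

lemma ip_deriv_psi1_snd:
  assumes "weak_deriv g g'"
  shows "ip g' (deriv (psi1_snd a b s n)) = - sqrt 2 * s * g 0 - (lam1 a n - b) * ip g (psi1_snd a b s n)
     + resonance1 a b s n * ip g (cosm (partner1 a b n))"
proof -
  have gL: "g \<in> L2_space" using assms by (rule weak_deriv_L2)
  have "ip g (\<lambda>x. (lam1 a n - b) * psi1_snd a b s n x - resonance1 a b s n * cosm (partner1 a b n) x)
      = (lam1 a n - b) * ip g (psi1_snd a b s n) - resonance1 a b s n * ip g (cosm (partner1 a b n))"
    by (subst ip_diff_right[OF L2_space_scale[OF psi1_snd_L2] L2_space_scale[OF cosm_L2] gL])
       (simp only: ip_scale_right)
  then show ?thesis
    using weak_deriv_by_parts[OF assms smooth_psi1_snd', of a b s n]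
    by (simp add: psi1_snd_ode(3,4) del: if_distrib)
qed

text \<open>The term with \<open>g 0\<close> is what cancels against the coupled boundary condition \<open>y' 0 = s * g 0\<close> in the generator.\<close>
lemma ip_second_deriv_psi1_snd:
  assumes "weak_deriv g g'" "weak_deriv g' g''" "g' 0 = 0" "g' 1 = 0"
  shows "ip g'' (psi1_snd a b s n) = sqrt 2 * s * g 0 + (lam1 a n - b) * ip g (psi1_snd a b s n)
     - resonance1 a b s n * ip g (cosm (partner1 a b n))"
  using weak_deriv_by_parts[OF assms(2) smooth_psi1_snd, of a b s n] ip_deriv_psi1_snd[OF assms(1), of a b s n] assms(3,4)
  by simp

text \<open>The pairing of the state \<open>(y, g)\<close> with \<open>psi_1n\<close>, whose first component is \<open>phi1 n\<close>.\<close>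
definition mode1 :: "real \<Rightarrow> real \<Rightarrow> real \<Rightarrow> nat \<Rightarrow> (real \<Rightarrow> real) \<Rightarrow> (real \<Rightarrow> real) \<Rightarrow> real" where
  "mode1 a b s n y g = ip y (phi1 n) + ip g (psi1_snd a b s n)"

text \<open>This expresses that \<open>psi_1n\<close> is a (generalized) eigenvector of the adjoint generator. The boundary terms
\<open>- sqrt 2 * y' 0\<close> and \<open>sqrt 2 * s * g 0\<close> cancel.\<close>
lemma mode1_generator:
  assumes "weak_deriv y y'" "weak_deriv y' y''" "y 1 = 0"
    and "weak_deriv g g'" "weak_deriv g' g''" "g' 0 = 0" "g' 1 = 0"
    and "y' 0 = s * g 0"
  shows "mode1 a b s n (\<lambda>x. y'' x + a * y x) (\<lambda>x. g'' x + b * g x)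
     = lam1 a n * mode1 a b s n y g - resonance1 a b s n * ip g (cosm (partner1 a b n))"
proof -
  have L: "y \<in> L2_space" "y'' \<in> L2_space" "g \<in> L2_space" "g'' \<in> L2_space"
    using assms weak_deriv_L2 by blast+
  have 1: "ip (\<lambda>x. y'' x + a * y x) (phi1 n) = ip y'' (phi1 n) + a * ip y (phi1 n)"
    by (subst ip_add_left[OF L(2) L2_space_scale[OF L(1)] phi1_L2]) (simp only: ip_scale_left)
  have 2: "ip (\<lambda>x. g'' x + b * g x) (psi1_snd a b s n) = ip g'' (psi1_snd a b s n) + b * ip g (psi1_snd a b s n)"
    by (subst ip_add_left[OF L(4) L2_space_scale[OF L(3)] psi1_snd_L2]) (simp only: ip_scale_left)
  have 3: "((real n + 1/2) * pi)\<^sup>2 = a - lam1 a n" by (simp add: lam1_def power_mult_distrib)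
  show ?thesis
    unfolding mode1_def 1 2 ip_second_deriv_phi1[OF assms(1-3)] ip_second_deriv_psi1_snd[OF assms(4-7)] 3 assms(8)
    by (simp add: left_diff_distrib distrib_left)
qed

lemma mode2_generator:
  assumes "weak_deriv g g'" "weak_deriv g' g''" "g' 0 = 0" "g' 1 = 0"
  shows "ip (\<lambda>x. g'' x + b * g x) (cosm m) = lam2 b m * ip g (cosm m)"
proof -
  have L: "g \<in> L2_space" "g'' \<in> L2_space"
    using assms weak_deriv_L2 by blast+
  have 2: "ip (\<lambda>x. g'' x + b * g x) (cosm m) = ip g'' (cosm m) + b * ip g (cosm m)"
    by (subst ip_add_left[OF L(2) L2_space_scale[OF L(1)] cosm_L2]) (simp only: ip_scale_left)
  show ?thesis
    unfolding 2 ip_second_deriv_cosm[OF assms(1,2)] assms(3,4)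
    by (simp add: lam2_def power_mult_distrib left_diff_distrib)
qed

lemma ip_linear_sin_cos:
  assumes "p \<noteq> 0" "sin (2 * p) = 0"
  shows "ip (\<lambda>x. (1 - x) * sin (p * x)) (\<lambda>x. cos (p * x)) = 1 / (4 * p)"
proof -
  let ?F = "\<lambda>x. - ((1 - x) * cos (2 * p * x)) / (4 * p) - sin (2 * p * x) / (8 * p\<^sup>2)"
  have "smooth_on_unit ?F (\<lambda>x. 1/2 * ((1 - x) * sin (2 * p * x)))"
    unfolding smooth_on_unit_def using assms(1)
    by (auto intro!: derivative_eq_intros continuous_intros simp: field_simps power2_eq_square)
  from weak_deriv_eq[OF smooth_imp_weak_deriv[OF this], of 1]
  have "integral {0..1} (\<lambda>x. 1/2 * ((1 - x) * sin (2 * p * x))) = 1 / (4 * p)"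
    using assms by simp
  moreover have h: "(\<lambda>x. 1/2 * ((1 - x) * sin (2 * p * x))) = (\<lambda>x. (1 - x) * sin (p * x) * cos (p * x))"
    using sin_double[of "p * _"] by (intro ext) (simp add: mult.assoc)
  moreover have "(\<lambda>x. (1 - x) * sin (p * x)) \<in> L2_space" "(\<lambda>x. cos (p * x)) \<in> L2_space"
    by (auto intro!: L2_space_continuous continuous_intros)
  ultimately show ?thesis by (simp only: ip_conv_integral)
qed

text \<open>The comparison of the two boundary value problems says nothing when the eigenvalues agree. Here both sides are
computed from the closed forms; the multiple of the cosine contained in \<open>psi1_snd\<close> is normalized exactly so that they match.\<close>
lemma ip_psi1_cosm_resonant:
  assumes "(n, m) \<in> Delta a b"
  shows "ip (psi1_snd a b s n) (cosm m) = - ip (phi2 a b s m) (phi1 n)"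
proof -
  define w where "w = (real n + 1/2) * pi"
  have w0: "0 < w" by (simp add: w_def add_nonneg_pos)
  have sw: "sin (2 * w) = 0"
  proof -
    have "2 * w = real (2 * n + 1) * pi" by (simp add: w_def algebra_simps)
    then show ?thesis by (simp only: sin_npi)
  qed
  have w2: "(2 * real n + 1)\<^sup>2 * pi\<^sup>2 = 4 * w\<^sup>2"
    by (simp add: w_def power2_eq_square algebra_simps)
  have "m \<in> Delta2 a b" using assms by (force simp: Delta2_def)
  then have phi: "phi2 a b s m = (\<lambda>x. s * mu m / w * ((1 - x) * sin (w * x)))"
    using partner2_eq[OF assms] by (intro ext) (simp add: phi2_def w_def partner2_def Let_def)
  have phi1: "phi1 n = (\<lambda>x. sqrt 2 * cos (w * x))"
    by (intro ext) (simp add: phi1_def w_def)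
  have rhs: "ip (phi2 a b s m) (phi1 n) = s * mu m * sqrt 2 / (4 * w\<^sup>2)"
    unfolding phi phi1 ip_scale_left ip_scale_right using w0 sw
    by (subst ip_linear_sin_cos) (simp_all add: power2_eq_square)
  show ?thesis
  proof (cases "m = 0")
    case True
    let ?c = "- s * sqrt 2 * (1/3 + 1 / (4 * w\<^sup>2))"
    have psi: "psi1_snd a b s n = (\<lambda>x. ?c + sqrt 2 * s * x - sqrt 2 / 2 * s * x\<^sup>2)"
      using psi1_snd_degenerate[OF assms] True w2 by (intro ext) simp
    have "smooth_on_unit (\<lambda>x. ?c * x + sqrt 2 * s * x\<^sup>2 / 2 - sqrt 2 / 6 * s * x ^ 3) (psi1_snd a b s n)"
      unfolding smooth_on_unit_def psi
      by (auto intro!: derivative_eq_intros continuous_intros simp: power2_eq_square)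
    from weak_deriv_eq[OF smooth_imp_weak_deriv[OF this], of 1]
    have "integral {0..1} (psi1_snd a b s n) = ?c + sqrt 2 * s / 2 - sqrt 2 / 6 * s" by simp
    then have "ip (psi1_snd a b s n) (cosm m) = ?c + sqrt 2 * s / 2 - sqrt 2 / 6 * s"
      using True cosm_L2[of m] psi1_snd_L2[of a b s n]
      by (simp add: ip_conv_integral) (simp add: cosm_def mu_def)
    then show ?thesis using rhs True by (simp add: mu_def algebra_simps)
  next
    case False
    define p where "p = real m * pi"
    have p0: "0 < p" using False by (simp add: p_def)
    have sp: "sin (2 * p) = 0"
      using sin_npi[of "2 * m"] by (simp add: p_def mult.assoc)
    let ?c = "- (2 * s) * (1 / (4 * w\<^sup>2) + 1 / (4 * p\<^sup>2))"
    have c: "(- (2 * s / pi\<^sup>2) * (1 / (2 * real n + 1)\<^sup>2 + 1 / (4 * (real m)\<^sup>2))) = ?c"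
    proof -
      have "1 / (4 * w\<^sup>2) = 1 / (2 * real n + 1)\<^sup>2 / pi\<^sup>2" unfolding w2[symmetric] by simp
      moreover have "1 / (4 * p\<^sup>2) = 1 / (4 * (real m)\<^sup>2) / pi\<^sup>2" by (simp add: p_def power_mult_distrib)
      ultimately show ?thesis by (simp add: add_divide_distrib algebra_simps)
    qed
    have cm: "cosm m = (\<lambda>x. sqrt 2 * cos (p * x))"
      using False by (intro ext) (simp add: cosm_def mu_def p_def)
    have psi: "psi1_snd a b s n = (\<lambda>x. sqrt 2 * s / p * ((1 - x) * sin (p * x)) + ?c * cosm m x)"
      unfolding psi1_snd_degenerate[OF assms, abs_def] if_not_P[OF False] c cm
      by (simp only: p_def mult.assoc)
    have L: "(\<lambda>x. sqrt 2 * s / p * ((1 - x) * sin (p * x))) \<in> L2_space"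
      using p0 by (auto intro!: L2_space_continuous continuous_intros)
    have 0: "ip (cosm m) (cosm m) = 1" using orthonormal_cosm by (simp add: orthonormal_def)
    have 1: "ip (\<lambda>x. (1 - x) * sin (p * x)) (cosm m) = sqrt 2 / (4 * p)"
      unfolding cm ip_scale_right using p0 sp by (subst ip_linear_sin_cos) simp_all
    have "ip (psi1_snd a b s n) (cosm m) = sqrt 2 * s / p * ip (\<lambda>x. (1 - x) * sin (p * x)) (cosm m) + ?c * ip (cosm m) (cosm m)"
      unfolding psi by (subst ip_add_left[OF L L2_space_scale[OF cosm_L2] cosm_L2]) (simp only: ip_scale_left)
    also have "\<dots> = (sqrt 2 * sqrt 2) * s / (4 * p\<^sup>2) + ?c"
      unfolding 0 1 power2_eq_square by (simp add: mult.commute mult.left_commute)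
    also have "\<dots> = s / (2 * p\<^sup>2) + ?c" by simp
    also have "\<dots> = - (2 * s / (4 * w\<^sup>2))" by (simp add: algebra_simps)
    finally have lhs: "ip (psi1_snd a b s n) (cosm m) = - (2 * s / (4 * w\<^sup>2))" .
    have "s * mu m * sqrt 2 = s * (sqrt 2 * sqrt 2)" using False by (simp add: mu_def)
    also have "\<dots> = 2 * s" by simp
    finally show ?thesis unfolding lhs rhs by (simp only:)
  qed
qed

text \<open>Equivalently, the generalized eigenvector \<open>(phi2 m, cosm m)\<close> is orthogonal to \<open>psi_1n\<close>. Pairing the equation of
\<open>psi1_snd\<close> with \<open>cosm m\<close> and that of \<open>phi2\<close> with \<open>phi1 n\<close> gives the same right-hand side with opposite signs of
\<open>lam1 a n - lam2 b m\<close>, which settles the case of distinct eigenvalues.\<close>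
lemma biorthogonal:
  "ip (psi1_snd a b s n) (cosm m) = - ip (phi2 a b s m) (phi1 n)"
proof (cases "(n, m) \<in> Delta a b")
  case True
  then show ?thesis by (rule ip_psi1_cosm_resonant)
next
  case False
  then have ne: "lam1 a n \<noteq> lam2 b m" by (simp add: Delta_iff)
  have z1: "resonance1 a b s n * ip (cosm (partner1 a b n)) (cosm m) = 0"
    using False partner1_in[of n a b] orthonormal_cosm by (auto simp: orthonormal_def)
  have "ip (\<lambda>x. (lam1 a n - b) * psi1_snd a b s n x - resonance1 a b s n * cosm (partner1 a b n) x) (cosm m)
      = (lam1 a n - b) * ip (psi1_snd a b s n) (cosm m) - resonance1 a b s n * ip (cosm (partner1 a b n)) (cosm m)"
    by (subst ip_diff_left[OF L2_space_scale[OF psi1_snd_L2] L2_space_scale[OF cosm_L2] cosm_L2])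
       (simp only: ip_scale_left)
  then have "(lam1 a n - b) * ip (psi1_snd a b s n) (cosm m) = - sqrt 2 * s * mu m - (real m * pi)\<^sup>2 * ip (psi1_snd a b s n) (cosm m)"
    using ip_second_deriv_cosm[OF smooth_imp_weak_deriv[OF smooth_psi1_snd[of a b s n]] smooth_imp_weak_deriv[OF smooth_psi1_snd'], of m] z1
    by (simp only: psi1_snd_ode(3,4); simp)
  then have 1: "(lam1 a n - lam2 b m) * ip (psi1_snd a b s n) (cosm m) = - sqrt 2 * s * mu m"
    by (simp add: lam2_def power_mult_distrib algebra_simps)
  let ?J = "if m \<in> Delta2 a b then sqrt 2 * s * mu m else 0"
  have z2: "?J * ip (phi1 (partner2 a b m)) (phi1 n) = 0"
    using False partner2_in[of m a b] orthonormal_phi1 by (auto simp: orthonormal_def)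
  have sm: "smooth_on_unit (deriv (phi2 a b s m)) (\<lambda>x. (lam2 b m - a) * phi2 a b s m x - ?J * phi1 (partner2 a b m) x)"
    unfolding smooth_on_unit_def
  proof (intro conjI ballI)
    show "(deriv (phi2 a b s m) has_real_derivative
      (lam2 b m - a) * phi2 a b s m x - ?J * phi1 (partner2 a b m) x) (at x within {0..1})" for x
      by (rule has_field_derivative_at_within, rule DERIV_cong[OF phi2_ode(2)]) simp
    show "continuous_on {0..1} (\<lambda>x. (lam2 b m - a) * phi2 a b s m x - ?J * phi1 (partner2 a b m) x)"
      using smooth_on_unit_continuous[OF smooth_phi2] smooth_on_unit_continuous[OF smooth_phi1]
      by (intro continuous_intros)
  qed
  have "ip (\<lambda>x. (lam2 b m - a) * phi2 a b s m x - ?J * phi1 (partner2 a b m) x) (phi1 n)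
      = (lam2 b m - a) * ip (phi2 a b s m) (phi1 n) - ?J * ip (phi1 (partner2 a b m)) (phi1 n)"
    by (subst ip_diff_left[OF L2_space_scale[OF phi2_L2] L2_space_scale[OF phi1_L2] phi1_L2])
       (simp only: ip_scale_left)
  then have "(lam2 b m - a) * ip (phi2 a b s m) (phi1 n) = - sqrt 2 * (s * mu m) - ((real n + 1/2) * pi)\<^sup>2 * ip (phi2 a b s m) (phi1 n)"
    using ip_second_deriv_phi1[OF smooth_imp_weak_deriv[OF smooth_phi2] smooth_imp_weak_deriv[OF sm] phi2_ode(3), where n=n] z2
    by (simp only: phi2_ode(4); simp)
  then have "(lam2 b m - a) * ip (phi2 a b s m) (phi1 n) = - sqrt 2 * (s * mu m) - (a - lam1 a n) * ip (phi2 a b s m) (phi1 n)"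
    by (simp only: lam1_def power_mult_distrib) simp
  then have 2: "(lam2 b m - lam1 a n) * ip (phi2 a b s m) (phi1 n) = - sqrt 2 * s * mu m"
    by (simp add: algebra_simps)
  have "(lam1 a n - lam2 b m) * (ip (psi1_snd a b s n) (cosm m) + ip (phi2 a b s m) (phi1 n)) = 0"
    using 1 2 by (simp add: algebra_simps)
  then show ?thesis using ne by simp
qed

section \<open>Bounds on the eigenfunctions\<close>

text \<open>Hence the frequency \<open>w = sqrt (p^2 + c)\<close> of an eigenfunction stays within 1 of the unperturbed frequency \<open>p\<close>,
and the denominators \<open>cos w\<close>, \<open>sin w\<close> in the closed forms stay away from 0.\<close>
lemma sqrt_close:
  fixes p c :: real
  assumes "0 < p" "\<bar>c\<bar> \<le> p" "0 \<le> p\<^sup>2 + c"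
  shows "\<bar>sqrt (p\<^sup>2 + c) - p\<bar> \<le> 1"
proof -
  define w where "w = sqrt (p\<^sup>2 + c)"
  have w: "0 \<le> w" "w\<^sup>2 = p\<^sup>2 + c" using assms(3) by (simp_all add: w_def)
  have "(w - p) * (w + p) = c" using w(2) by (simp add: power2_eq_square algebra_simps)
  then have "\<bar>w - p\<bar> * (w + p) = \<bar>c\<bar>" using w(1) assms(1) by (auto simp: abs_mult)
  also have "\<dots> \<le> 1 * (w + p)" using assms(2) w(1) by simp
  finally have "\<bar>w - p\<bar> \<le> 1"
    by (rule mult_right_le_imp_le) (use w(1) assms(1) in linarith)
  then show ?thesis by (simp add: w_def)
qed

lemma cos_ge_half:
  fixes e :: real
  assumes "\<bar>e\<bar> \<le> 1" shows "1/2 \<le> cos e"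
proof -
  have "\<bar>sin (e/2)\<bar> \<le> 1/2"
    using abs_sin_x_le_abs_x[of "e/2"] assms by simp
  then have "\<bar>sin (e/2)\<bar>\<^sup>2 \<le> (1/2)\<^sup>2" by (intro power_mono) auto
  then have "(sin (e/2))\<^sup>2 \<le> 1/4" by (simp add: power2_eq_square)
  then show ?thesis using cos_double_sin[of "e/2"] by simp
qed

lemma abs_cos_near:
  assumes "\<bar>w - real m * pi\<bar> \<le> 1" shows "1/2 \<le> \<bar>cos w\<bar>"
proof -
  have "cos w = cos (real m * pi + (w - real m * pi))" by simp
  also have "\<dots> = (-1) ^ m * cos (w - real m * pi)" unfolding cos_add by simp
  finally have "\<bar>cos w\<bar> = \<bar>cos (w - real m * pi)\<bar>" by (simp add: abs_mult power_abs)
  then show ?thesis using cos_ge_half[OF assms] by simp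
qed

lemma abs_sin_near:
  assumes "\<bar>w - (real n + 1/2) * pi\<bar> \<le> 1" shows "1/2 \<le> \<bar>sin w\<bar>"
proof -
  let ?p = "(real n + 1/2) * pi"
  have "sin w = sin (?p + (w - ?p))" by simp
  also have "\<dots> = sin ?p * cos (w - ?p)" unfolding sin_add cos_half_pi_odd(1) by simp
  finally have "\<bar>sin w\<bar> = \<bar>cos (w - ?p)\<bar>" by (simp only: abs_mult cos_half_pi_odd(2); simp)
  then show ?thesis using cos_ge_half[OF assms] by simp
qed

text \<open>The finitely many remaining functions are bounded by compactness, so closed forms have to be studied for large indices only.\<close>
lemma uniform_bound_from_tail:
  fixes f :: "nat \<Rightarrow> real \<Rightarrow> real"
  assumes "\<And>m. continuous_on {0..1} (f m)" "\<And>m x. m0 \<le> m \<Longrightarrow> x \<in> {0..1} \<Longrightarrow> \<bar>f m x\<bar> \<le> C0"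
  obtains C where "0 < C" "\<And>m x. x \<in> {0..1} \<Longrightarrow> \<bar>f m x\<bar> \<le> C"
proof -
  have "\<exists>B. 0 < B \<and> (\<forall>x\<in>{0..1}. \<bar>f m x\<bar> \<le> B)" for m
  proof -
    have "bounded (f m ` {0..1})"
      using assms(1) by (intro compact_imp_bounded compact_continuous_image) auto
    then show ?thesis unfolding bounded_pos by (auto simp: real_norm_def)
  qed
  then obtain B where B: "\<And>m. 0 < B m" "\<And>m x. x \<in> {0..1} \<Longrightarrow> \<bar>f m x\<bar> \<le> B m" by metis
  let ?C = "\<bar>C0\<bar> + 1 + (\<Sum>m<m0. B m)"
  have s: "0 \<le> (\<Sum>m<m0. B m)" using B(1) by (intro sum_nonneg less_imp_le)
  show thesis
  proof (rule that[of ?C])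
    show "0 < ?C" using s by linarith
    fix m and x :: real assume x: "x \<in> {0..1}"
    show "\<bar>f m x\<bar> \<le> ?C"
    proof (cases "m < m0")
      case True
      then have "B m \<le> (\<Sum>m<m0. B m)"
        using B(1) by (intro member_le_sum) (auto intro: less_imp_le)
      then show ?thesis using B(2)[OF x, of m] by linarith
    next
      case False
      then show ?thesis using assms(2)[OF _ x, of m] s by linarith
    qed
  qed
qed

lemma ratio_le_2:
  fixes w c t :: real
  assumes "\<bar>c\<bar> \<le> K" "1/2 \<le> \<bar>d\<bar>" "\<bar>t\<bar> \<le> 1"
  shows "\<bar>c / d * t\<bar> \<le> 2 * K"
proof -
  have "\<bar>c\<bar> / \<bar>d\<bar> \<le> K / (1/2)"
    using assms by (intro frac_le) auto
  then have "\<bar>c / d\<bar> \<le> 2 * K" by (simp add: abs_divide)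
  then have "\<bar>c / d\<bar> * \<bar>t\<bar> \<le> 2 * K * 1" using assms by (intro mult_mono) auto
  then show ?thesis by (simp add: abs_mult)
qed

text \<open>For large \<open>m\<close> the function is \<open>1/w\<close> times a bounded one with \<open>w\<close> comparable to \<open>m\<close>, and differentiation removes the factor \<open>1/w\<close>.\<close>
lemma phi2_bounds:
  obtains C where "0 < C"
    "\<And>m x. x \<in> {0..1} \<Longrightarrow> (real m + 1) * \<bar>phi2 a b s m x\<bar> \<le> C"
    "\<And>m x. x \<in> {0..1} \<Longrightarrow> \<bar>deriv (phi2 a b s m) x\<bar> \<le> C"
proof -
  have "finite (Delta2 a b)" by (simp add: Delta2_def finite_Delta)
  then obtain m1 where m1: "\<And>m. m \<in> Delta2 a b \<Longrightarrow> m < m1"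
    using finite_nat_set_iff_bounded by auto
  obtain m2 :: nat where m2: "\<bar>a - b\<bar> \<le> real m2" using real_arch_simple by blast
  \<comment> \<open>beyond m1 there is no resonance, beyond m2 the trigonometric form applies and the frequency shift is small\<close>
  define m0 where "m0 = m1 + m2 + 1"
  have tail: "\<bar>(real m + 1) * phi2 a b s m x\<bar> \<le> 2 * (\<bar>s\<bar> * 4) \<and> \<bar>deriv (phi2 a b s m) x\<bar> \<le> 2 * (\<bar>s\<bar> * 2)"
    if m: "m0 \<le> m" for m x
  proof -
    define p where "p = real m * pi"
    have m_ge: "1 \<le> real m" "\<bar>a - b\<bar> \<le> real m" using m m2 by (simp_all add: m0_def)
    have p: "2 * real m \<le> p" "0 < p"
      using m_ge mult_left_mono[OF pi_ge_two, of "real m"] by (simp_all add: p_def)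
    have c: "\<bar>a - b\<bar> \<le> p" using p m_ge by linarith
    have mD: "m \<notin> Delta2 a b" using m m1[of m] by (auto simp: m0_def)
    have "p * 1 < p * p" using p m_ge by (intro mult_strict_left_mono) auto
    then have "b - a < p\<^sup>2" using c by (simp add: power2_eq_square)
    then have lt: "b - a < (real m)\<^sup>2 * pi\<^sup>2" by (simp add: p_def power_mult_distrib)
    define w where "w = sqrt ((real m)\<^sup>2 * pi\<^sup>2 - (b - a))"
    have w_eq: "w = sqrt (p\<^sup>2 + (a - b))" by (simp add: w_def p_def power_mult_distrib)
    have wp: "\<bar>w - p\<bar> \<le> 1"
      unfolding w_eq using p c lt by (intro sqrt_close) (auto simp: p_def power_mult_distrib)
    then have w_ge: "real m + 1 \<le> 2 * w" "0 < w" using p m_ge by linarith+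
    have cw: "1/2 \<le> \<bar>cos w\<bar>" using abs_cos_near[of w m] wp by (simp add: p_def)
    have phi: "phi2 a b s m = (\<lambda>x. - (s * mu m / (w * cos w)) * sin (w * (1 - x)))"
      using phi2_oscillating(2)[OF mD lt] by (auto simp: w_def)
    have d: "deriv (phi2 a b s m) x = s * mu m / cos w * cos (w * (1 - x))"
      unfolding phi by (rule DERIV_imp_deriv, rule DERIV_cong[OF DERIV_reflected(3)]) (use w_ge(2) in simp)
    have smu: "\<bar>s * mu m\<bar> \<le> \<bar>s\<bar> * 2" unfolding abs_mult by (intro mult_left_mono abs_mu_le) simp
    have "\<bar>(real m + 1) / w\<bar> \<le> 2" using w_ge by (simp add: divide_le_eq)
    then have "\<bar>s * mu m\<bar> * \<bar>(real m + 1) / w\<bar> \<le> \<bar>s\<bar> * 2 * 2" using smu by (intro mult_mono) auto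
    then have K: "\<bar>- (s * mu m * ((real m + 1) / w))\<bar> \<le> \<bar>s\<bar> * 4" by (simp add: abs_mult)
    have "(real m + 1) * phi2 a b s m x = - (s * mu m * ((real m + 1) / w)) / cos w * sin (w * (1 - x))"
      unfolding phi by simp
    then show ?thesis
      unfolding d using ratio_le_2[OF K cw abs_sin_le_one] ratio_le_2[OF smu cw abs_cos_le_one] by metis
  qed
  have c1: "continuous_on {0..1} (\<lambda>x. (real m + 1) * phi2 a b s m x)" for m
    using smooth_on_unit_continuous[OF smooth_phi2] by (intro continuous_intros)
  have c2: "continuous_on {0..1} (deriv (phi2 a b s m))" for m
    using smooth_phi2 by (simp add: smooth_on_unit_def)
  obtain C1 where C1: "0 < C1" "\<And>m x. x \<in> {0..1} \<Longrightarrow> \<bar>(real m + 1) * phi2 a b s m x\<bar> \<le> C1"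
    by (rule uniform_bound_from_tail[where f="\<lambda>m x. (real m + 1) * phi2 a b s m x" and ?m0.0=m0 and ?C0.0="2 * (\<bar>s\<bar> * 4)", OF c1]) (use tail in blast, blast)
  obtain C2 where C2: "0 < C2" "\<And>m x. x \<in> {0..1} \<Longrightarrow> \<bar>deriv (phi2 a b s m) x\<bar> \<le> C2"
    by (rule uniform_bound_from_tail[where f="\<lambda>m. deriv (phi2 a b s m)" and ?m0.0=m0 and ?C0.0="2 * (\<bar>s\<bar> * 2)", OF c2]) (use tail in blast, blast)
  show thesis
  proof (rule that[of "C1 + C2"])
    fix m and x :: real assume x: "x \<in> {0..1}"
    show "(real m + 1) * \<bar>phi2 a b s m x\<bar> \<le> C1 + C2"
      using C1(2)[OF x, of m] C2(1) by (simp add: abs_mult)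
    show "\<bar>deriv (phi2 a b s m) x\<bar> \<le> C1 + C2"
      using C2(2)[OF x, of m] C1(1) by simp
  qed (use C1 C2 in simp)
qed

lemma psi1_snd_bounds:
  obtains C where "0 < C"
    "\<And>n x. x \<in> {0..1} \<Longrightarrow> (real n + 1) * \<bar>psi1_snd a b s n x\<bar> \<le> C"
    "\<And>n x. x \<in> {0..1} \<Longrightarrow> \<bar>deriv (psi1_snd a b s n) x\<bar> \<le> C"
proof -
  have "finite (Delta1 a b)" by (simp add: Delta1_def finite_Delta)
  then obtain m1 where m1: "\<And>n. n \<in> Delta1 a b \<Longrightarrow> n < m1"
    using finite_nat_set_iff_bounded by auto
  obtain m2 :: nat where m2: "\<bar>a - b\<bar> \<le> real m2" using real_arch_simple by blast
  define m0 where "m0 = m1 + m2 + 1"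
  have tail: "\<bar>(real n + 1) * psi1_snd a b s n x\<bar> \<le> 2 * (\<bar>s\<bar> * 4) \<and> \<bar>deriv (psi1_snd a b s n) x\<bar> \<le> 2 * (\<bar>s\<bar> * 2)"
    if n: "m0 \<le> n" for n x
  proof -
    define p where "p = (real n + 1/2) * pi"
    have n_ge: "1 \<le> real n" "\<bar>a - b\<bar> \<le> real n" using n m2 by (simp_all add: m0_def)
    have p: "2 * real n + 1 \<le> p" "0 < p"
      using n_ge mult_left_mono[OF pi_ge_two, of "real n + 1/2"] by (simp_all add: p_def)
    have c: "\<bar>b - a\<bar> \<le> p" using p n_ge by linarith
    have nD: "n \<notin> Delta1 a b" using n m1[of n] by (auto simp: m0_def)
    have "p * 1 < p * p" using p n_ge by (intro mult_strict_left_mono) auto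
    then have "a - b < p\<^sup>2" using c by (simp add: power2_eq_square)
    then have lt: "lam1 a n < b" by (simp add: lam1_def p_def power_mult_distrib)
    define w where "w = sqrt (b - lam1 a n)"
    have w_eq: "w = sqrt (p\<^sup>2 + (b - a))" unfolding w_def p_def lam1_def power_mult_distrib by simp
    have wp: "\<bar>w - p\<bar> \<le> 1"
      unfolding w_eq using p c \<open>a - b < p\<^sup>2\<close> by (intro sqrt_close) auto
    then have w_ge: "real n + 1 \<le> 2 * w" "0 < w" using p n_ge by linarith+
    have cw: "1/2 \<le> \<bar>sin w\<bar>" using abs_sin_near[of w n] wp by (simp add: p_def)
    have psi: "psi1_snd a b s n = (\<lambda>x. sqrt 2 * s / (w * sin w) * cos (w * (1 - x)))"
      using psi1_snd_oscillating(2)[OF nD lt] by (auto simp: w_def)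
    have d: "deriv (psi1_snd a b s n) x = sqrt 2 * s / sin w * sin (w * (1 - x))"
      unfolding psi by (rule DERIV_imp_deriv, rule DERIV_cong[OF DERIV_reflected(4)]) (use w_ge(2) in simp)
    have smu: "\<bar>sqrt 2 * s\<bar> \<le> \<bar>s\<bar> * 2" unfolding abs_mult using mult_right_mono[OF sqrt2_le, of "\<bar>s\<bar>"] by simp
    have "\<bar>(real n + 1) / w\<bar> \<le> 2" using w_ge by (simp add: divide_le_eq)
    then have "\<bar>sqrt 2 * s\<bar> * \<bar>(real n + 1) / w\<bar> \<le> \<bar>s\<bar> * 2 * 2" using smu by (intro mult_mono) auto
    then have K: "\<bar>sqrt 2 * s * ((real n + 1) / w)\<bar> \<le> \<bar>s\<bar> * 4" by (simp add: abs_mult)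
    have "(real n + 1) * psi1_snd a b s n x = sqrt 2 * s * ((real n + 1) / w) / sin w * cos (w * (1 - x))"
      unfolding psi by simp
    then show ?thesis
      unfolding d using ratio_le_2[OF K cw abs_cos_le_one] ratio_le_2[OF smu cw abs_sin_le_one] by metis
  qed
  have c1: "continuous_on {0..1} (\<lambda>x. (real n + 1) * psi1_snd a b s n x)" for n
    using smooth_on_unit_continuous[OF smooth_psi1_snd] by (intro continuous_intros)
  have c2: "continuous_on {0..1} (deriv (psi1_snd a b s n))" for n
    using smooth_psi1_snd by (simp add: smooth_on_unit_def)
  obtain C1 where C1: "0 < C1" "\<And>m x. x \<in> {0..1} \<Longrightarrow> \<bar>(real m + 1) * psi1_snd a b s m x\<bar> \<le> C1"
    by (rule uniform_bound_from_tail[where f="\<lambda>m x. (real m + 1) * psi1_snd a b s m x" and ?m0.0=m0 and ?C0.0="2 * (\<bar>s\<bar> * 4)", OF c1]) (use tail in blast, blast)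
  obtain C2 where C2: "0 < C2" "\<And>m x. x \<in> {0..1} \<Longrightarrow> \<bar>deriv (psi1_snd a b s m) x\<bar> \<le> C2"
    by (rule uniform_bound_from_tail[where f="\<lambda>m. deriv (psi1_snd a b s m)" and ?m0.0=m0 and ?C0.0="2 * (\<bar>s\<bar> * 2)", OF c2]) (use tail in blast, blast)
  show thesis
  proof (rule that[of "C1 + C2"])
    fix m and x :: real assume x: "x \<in> {0..1}"
    show "(real m + 1) * \<bar>psi1_snd a b s m x\<bar> \<le> C1 + C2"
      using C1(2)[OF x, of m] C2(1) by (simp add: abs_mult)
    show "\<bar>deriv (psi1_snd a b s m) x\<bar> \<le> C1 + C2"
      using C2(2)[OF x, of m] C1(1) by simp
  qed (use C1 C2 in simp)
qed

text \<open>Integration by parts against \<open>1 - x\<close>, which is 1 at 0 and 0 at 1.\<close>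
lemma weak_deriv_boundary_bound:
  assumes "weak_deriv g g'"
  shows "\<bar>g 0\<bar> \<le> norm_L2 g + norm_L2 g'"
proof -
  have s: "smooth_on_unit (\<lambda>x. 1 - x) (\<lambda>x. -1)"
    unfolding smooth_on_unit_def by (auto intro!: derivative_eq_intros)
  have L: "(\<lambda>x::real. 1 - x) \<in> L2_space" "(\<lambda>x::real. - 1 :: real) \<in> L2_space" "g \<in> L2_space" "g' \<in> L2_space"
    using assms weak_deriv_L2 by (auto intro!: L2_space_continuous continuous_intros)
  have "g 0 = - ip g' (\<lambda>x. 1 - x) - ip g (\<lambda>x. - 1)"
    using weak_deriv_by_parts[OF assms s] by simp
  moreover have "\<bar>ip g' (\<lambda>x. 1 - x)\<bar> \<le> norm_L2 g' * 1"
    by (rule order_trans[OF ip_Cauchy_Schwarz[OF L(4,1)]])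
       (intro mult_left_mono norm_L2_bound norm_L2_nonneg continuous_intros, auto)
  moreover have "\<bar>ip g (\<lambda>x. - 1)\<bar> \<le> norm_L2 g * 1"
    by (rule order_trans[OF ip_Cauchy_Schwarz[OF L(3,2)]])
       (intro mult_left_mono norm_L2_bound norm_L2_nonneg continuous_intros, auto)
  ultimately show ?thesis by linarith
qed

lemma orthonormal_ip_bound:
  assumes "orthonormal e" "f \<in> L2_space"
  shows "\<bar>ip f (e n)\<bar> \<le> norm_L2 f"
proof -
  have "norm_L2 (e n) = 1" using assms(1) by (simp add: norm_L2_conv_ip orthonormal_def)
  then show ?thesis using ip_Cauchy_Schwarz[OF assms(2) orthonormal_L2[OF assms(1)], of n] by simp
qed

lemma ip_psi1_bound:
  obtains C where "0 < C" "\<And>n f. f \<in> L2_space \<Longrightarrow> (real n + 1) * \<bar>ip f (psi1_snd a b s n)\<bar> \<le> C * norm_L2 f"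
proof -
  obtain C where C: "0 < C" "\<And>n x. x \<in> {0..1} \<Longrightarrow> (real n + 1) * \<bar>psi1_snd a b s n x\<bar> \<le> C"
    using psi1_snd_bounds[of a b s] by metis
  show thesis
  proof (rule that[OF C(1)])
    fix n f assume f: "f \<in> L2_space"
    have c: "continuous_on {0..1} (\<lambda>x. (real n + 1) * psi1_snd a b s n x)"
      using smooth_on_unit_continuous[OF smooth_psi1_snd] by (intro continuous_intros)
    have "(real n + 1) * \<bar>ip f (psi1_snd a b s n)\<bar> = \<bar>ip f (\<lambda>x. (real n + 1) * psi1_snd a b s n x)\<bar>"
      by (simp only: ip_scale_right abs_mult; simp)
    also have "\<dots> \<le> norm_L2 f * norm_L2 (\<lambda>x. (real n + 1) * psi1_snd a b s n x)"
      by (rule ip_Cauchy_Schwarz[OF f L2_space_continuous[OF c]])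
    also have "\<dots> \<le> norm_L2 f * C"
      by (intro mult_left_mono norm_L2_nonneg norm_L2_bound[OF _ c]) (use C(2) in \<open>simp add: abs_mult\<close>)
    finally show "(real n + 1) * \<bar>ip f (psi1_snd a b s n)\<bar> \<le> C * norm_L2 f" by (simp add: mult.commute)
  qed
qed

lemma sq_le_half_pi_sq: "(real n + 1)\<^sup>2 \<le> ((real n + 1/2) * pi)\<^sup>2"
proof -
  have "2 * (real n + 1/2) \<le> (real n + 1/2) * pi"
    using mult_left_mono[OF pi_ge_two, of "real n + 1/2"] by simp
  then show ?thesis by (intro power_mono) auto
qed

lemma lam1_growth: "(real n + 1)\<^sup>2 \<le> a - lam1 a n"
  using sq_le_half_pi_sq[of n] by (simp add: lam1_def power_mult_distrib)

lemma abs_resonance1_le: "\<bar>resonance1 a b s n\<bar> \<le> 4 * \<bar>s\<bar>"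
proof -
  have "\<bar>sqrt 2 * mu k\<bar> \<le> 2 * 2" for k
    unfolding abs_mult using sqrt2_le abs_mu_le[of k] by (intro mult_mono) auto
  then have "\<bar>sqrt 2 * mu k\<bar> * \<bar>s\<bar> \<le> 4 * \<bar>s\<bar>" for k by (intro mult_right_mono) auto
  moreover have "\<bar>sqrt 2 * s * mu k\<bar> = \<bar>sqrt 2 * mu k\<bar> * \<bar>s\<bar>" for k by (simp add: abs_mult)
  ultimately show ?thesis by simp
qed

text \<open>Compared with \<open>ip_psi1_bound\<close>, one integration by parts gains a power of \<open>n\<close>: the equation of \<open>psi1_snd\<close> gives a factor \<open>lam1 a n - b\<close> of
order \<open>n^2\<close>, while the boundary term, the derivative and the resonance term stay bounded.\<close>
lemma ip_psi1_bound_H1: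
  obtains C where "0 < C" "\<And>n g g'. weak_deriv g g' \<Longrightarrow>
     (real n + 1)\<^sup>2 * \<bar>ip g (psi1_snd a b s n)\<bar> \<le> C * (norm_L2 g + norm_L2 g')"
proof -
  obtain C1 where C1: "0 < C1" "\<And>n f. f \<in> L2_space \<Longrightarrow> (real n + 1) * \<bar>ip f (psi1_snd a b s n)\<bar> \<le> C1 * norm_L2 f"
    using ip_psi1_bound[of a b s] by metis
  obtain C2 where C2: "0 < C2" "\<And>n x. x \<in> {0..1} \<Longrightarrow> \<bar>deriv (psi1_snd a b s n) x\<bar> \<le> C2"
    using psi1_snd_bounds[of a b s] by metis
  define C where "C = 2 * \<bar>s\<bar> + C2 + 4 * \<bar>s\<bar> + \<bar>a - b\<bar> * C1"
  show thesis
  proof (rule that[of C])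
    show "0 < C" using C1(1) C2(1) by (simp add: C_def add_pos_nonneg add_nonneg_pos)
    fix n g g' assume g: "weak_deriv g g'"
    let ?i = "ip g (psi1_snd a b s n)" and ?S = "norm_L2 g + norm_L2 g'"
    have L: "g \<in> L2_space" "g' \<in> L2_space" using g weak_deriv_L2 by blast+
    have S: "norm_L2 g \<le> ?S" "norm_L2 g' \<le> ?S" "0 \<le> ?S" by simp_all
    have dc: "continuous_on {0..1} (deriv (psi1_snd a b s n))"
      using smooth_psi1_snd by (simp add: smooth_on_unit_def)
    have "(lam1 a n - b) * ?i = - sqrt 2 * s * g 0 - ip g' (deriv (psi1_snd a b s n)) + resonance1 a b s n * ip g (cosm (partner1 a b n))"
      using ip_deriv_psi1_snd[OF g, of a b s n] by linarith
    then have "\<bar>(lam1 a n - b) * ?i\<bar> \<le> \<bar>sqrt 2 * s * g 0\<bar> + \<bar>ip g' (deriv (psi1_snd a b s n))\<bar> + \<bar>resonance1 a b s n * ip g (cosm (partner1 a b n))\<bar>"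
      by linarith
    also have "\<bar>sqrt 2 * s * g 0\<bar> \<le> 2 * \<bar>s\<bar> * ?S"
      unfolding abs_mult using weak_deriv_boundary_bound[OF g] sqrt2_le
      by (intro mult_mono) auto
    also have "\<bar>ip g' (deriv (psi1_snd a b s n))\<bar> \<le> ?S * C2"
      by (rule order_trans[OF ip_Cauchy_Schwarz[OF L(2) L2_space_continuous[OF dc]]])
         (intro mult_mono norm_L2_bound[OF C2(2) dc] S, simp_all)
    also have "\<bar>resonance1 a b s n * ip g (cosm (partner1 a b n))\<bar> \<le> 4 * \<bar>s\<bar> * ?S"
      unfolding abs_mult using order_trans[OF orthonormal_ip_bound[OF orthonormal_cosm L(1)] S(1)]
      by (intro mult_mono abs_resonance1_le) auto
    finally have 1: "\<bar>lam1 a n - b\<bar> * \<bar>?i\<bar> \<le> (2 * \<bar>s\<bar> + C2 + 4 * \<bar>s\<bar>) * ?S"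
      unfolding abs_mult by (simp add: algebra_simps)
    have "1 * \<bar>?i\<bar> \<le> (real n + 1) * \<bar>?i\<bar>" by (intro mult_right_mono) auto
    also have "\<dots> \<le> C1 * ?S"
      by (rule order_trans[OF C1(2)[OF L(1)]]) (use C1(1) S in simp)
    finally have i: "\<bar>?i\<bar> \<le> C1 * ?S" by simp
    have "(real n + 1)\<^sup>2 * \<bar>?i\<bar> \<le> (\<bar>lam1 a n - b\<bar> + \<bar>a - b\<bar>) * \<bar>?i\<bar>"
      using lam1_growth[of n a] by (intro mult_right_mono) auto
    also have "\<dots> \<le> (2 * \<bar>s\<bar> + C2 + 4 * \<bar>s\<bar>) * ?S + \<bar>a - b\<bar> * (C1 * ?S)"
      using add_mono[OF 1 mult_left_mono[OF i abs_ge_zero[of "a - b"]]] by (simp only: distrib_right)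
    also have "\<dots> = C * ?S" by (simp add: C_def algebra_simps)
    finally show "(real n + 1)\<^sup>2 * \<bar>?i\<bar> \<le> C * ?S" .
  qed
qed

section \<open>Modal expansions on the domain of the generator\<close>

lemma summable_inverse_squares: "summable (\<lambda>n. 1 / (real n + 1)\<^sup>2)"
proof -
  have "summable (\<lambda>n. inverse (real (Suc n) ^ 2))"
    using inverse_power_summable[of 2, where 'a = real] by (subst summable_Suc_iff) auto
  then show ?thesis by (simp add: inverse_eq_divide add.commute)
qed

text \<open>With square-summable \<open>q\<close> this makes \<open>q n / (n + 1)\<close> summable.\<close>
lemma div_Suc_le_squares:
  fixes q :: real
  assumes "0 \<le> q"
  shows "q / (real n + 1) \<le> q\<^sup>2 + 1 / (real n + 1)\<^sup>2"
proof -
  let ?r = "1 / (real n + 1)"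
  have "2 * q * ?r \<le> q\<^sup>2 + ?r\<^sup>2"
    using zero_le_power2[of "q - ?r"] by (simp add: power2_diff)
  moreover have "0 \<le> q * ?r" using assms by simp
  ultimately show ?thesis by (simp add: power_divide)
qed

text \<open>Membership of \<open>(y, g)\<close> in the domain of the generator, with the first and second derivatives as explicit
arguments.\<close>
definition in_domain :: "real \<Rightarrow> (real \<Rightarrow> real) \<Rightarrow> (real \<Rightarrow> real) \<Rightarrow> (real \<Rightarrow> real) \<Rightarrow>
    (real \<Rightarrow> real) \<Rightarrow> (real \<Rightarrow> real) \<Rightarrow> (real \<Rightarrow> real) \<Rightarrow> bool" where
  "in_domain s y y' y'' g g' g'' \<longleftrightarrow>
     smooth_on_unit y y' \<and> weak_deriv y' y'' \<and> smooth_on_unit g g' \<and> weak_deriv g' g'' \<and>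
     y 1 = 0 \<and> y' 0 = s * g 0 \<and> g' 0 = 0 \<and> g' 1 = 0"

lemma in_domainD:
  assumes "in_domain s y y' y'' g g' g''"
  shows "smooth_on_unit y y'" "weak_deriv y y'" "weak_deriv y' y''" "smooth_on_unit g g'" "weak_deriv g g'" "weak_deriv g' g''"
     "y 1 = 0" "y' 0 = s * g 0" "g' 0 = 0" "g' 1 = 0"
     "y \<in> L2_space" "y' \<in> L2_space" "y'' \<in> L2_space" "g \<in> L2_space" "g' \<in> L2_space" "g'' \<in> L2_space"
proof -
  show "smooth_on_unit y y'" "weak_deriv y' y''" "smooth_on_unit g g'" "weak_deriv g' g''"
     "y 1 = 0" "y' 0 = s * g 0" "g' 0 = 0" "g' 1 = 0"
    using assms unfolding in_domain_def by blast+
  then show "weak_deriv y y'" "weak_deriv g g'" 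
     "y \<in> L2_space" "y' \<in> L2_space" "y'' \<in> L2_space" "g \<in> L2_space" "g' \<in> L2_space" "g'' \<in> L2_space"
    using smooth_imp_weak_deriv weak_deriv_L2 by blast+
qed

text \<open>The coordinates of the second derivative are square-summable and exceed those of \<open>g\<close> by a factor of order \<open>m^2\<close>.\<close>
lemma summable_mode2:
  assumes "in_domain s y y' y'' g g' g''"
  shows "summable (\<lambda>m. (real m + 1) * \<bar>ip g (cosm m)\<bar>)"
proof (rule summable_comparison_test'[where N = 1])
  note D = in_domainD[OF assms]
  show "summable (\<lambda>m. (ip g'' (cosm m))\<^sup>2 + 1 / (real m + 1)\<^sup>2)"
    by (intro summable_add Bessel(1)[OF orthonormal_cosm] D summable_inverse_squares)
  fix m :: nat assume m: "1 \<le> m"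
  let ?z = "\<bar>ip g (cosm m)\<bar>" and ?q = "\<bar>ip g'' (cosm m)\<bar>"
  have "(real m * pi)\<^sup>2 * ?z = ?q"
    using ip_second_deriv_cosm[OF D(5,6), of m] D(9,10) by (simp add: abs_mult)
  moreover have "(real m + 1)\<^sup>2 \<le> (real m * pi)\<^sup>2"
  proof (rule power_mono)
    show "real m + 1 \<le> real m * pi" using m mult_left_mono[OF pi_ge_two, of "real m"] by linarith
  qed simp
  then have "(real m + 1)\<^sup>2 * ?z \<le> (real m * pi)\<^sup>2 * ?z" by (intro mult_right_mono) auto
  ultimately have "(real m + 1) * ?z \<le> ?q / (real m + 1)"
    by (simp add: le_divide_eq power2_eq_square mult.assoc mult.left_commute) (simp add: mult.commute mult.left_commute)
  then show "norm ((real m + 1) * ?z) \<le> (ip g'' (cosm m))\<^sup>2 + 1 / (real m + 1)\<^sup>2"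
    using div_Suc_le_squares[of ?q m] by simp
qed

text \<open>Off the finite resonant set, the coordinate is that of the image under the generator divided by \<open>lam1 a n\<close>. That image
has a square-summable part from \<open>phi1\<close> and a part of order \<open>1/n\<close> from \<open>psi1_snd\<close>. One writes the relation
with \<open>a - lam1 a n\<close>, which is positive and at least \<open>(n + 1)^2\<close>, in place of \<open>- lam1 a n\<close>.\<close>
lemma summable_mode1:
  assumes "in_domain s y y' y'' g g' g''"
  shows "summable (\<lambda>n. (real n + 1) * \<bar>mode1 a b s n y g\<bar>)"
proof -
  note D = in_domainD[OF assms]
  obtain C where C: "0 < C" "\<And>n f. f \<in> L2_space \<Longrightarrow> (real n + 1) * \<bar>ip f (psi1_snd a b s n)\<bar> \<le> C * norm_L2 f"
    using ip_psi1_bound[of a b s] by metis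
  have "finite (Delta1 a b)" by (simp add: Delta1_def finite_Delta)
  then obtain n1 where n1: "\<And>n. n \<in> Delta1 a b \<Longrightarrow> n < n1"
    using finite_nat_set_iff_bounded by auto
  \<comment> \<open>(h, k) is the image of (y, g) under the generator\<close>
  define h where "h = (\<lambda>x. y'' x + a * y x)"
  define k where "k = (\<lambda>x. g'' x + b * g x)"
  have L: "h \<in> L2_space" "k \<in> L2_space"
    unfolding h_def k_def using D by (auto intro!: L2_space_add L2_space_scale)
  let ?w = "\<lambda>n. 1 / (real n + 1)\<^sup>2"
  let ?b = "\<lambda>n. ((ip h (phi1 n))\<^sup>2 + ?w n) + C * norm_L2 k * ?w n
       + \<bar>a\<bar> * ((ip y (phi1 n))\<^sup>2 + ?w n) + \<bar>a\<bar> * (C * norm_L2 g * ?w n)"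
  show ?thesis
  proof (rule summable_comparison_test'[where N = n1])
    show "summable ?b"
      by (intro summable_add summable_mult Bessel(1)[OF orthonormal_phi1] L D summable_inverse_squares)
    fix n assume n: "n1 \<le> n"
    let ?x = "mode1 a b s n y g" and ?r = "real n + 1"
    have "n \<notin> Delta1 a b" using n n1[of n] by auto
    then have "lam1 a n * ?x = mode1 a b s n h k"
      using mode1_generator[OF D(2,3,7,5,6,9,10,8), of a b n] by (simp add: h_def k_def)
    then have "(a - lam1 a n) * ?x = a * ?x - mode1 a b s n h k" by (simp add: algebra_simps)
    then have "\<bar>(a - lam1 a n) * ?x\<bar> = \<bar>a * ip y (phi1 n) + a * ip g (psi1_snd a b s n) - (ip h (phi1 n) + ip k (psi1_snd a b s n))\<bar>"
      by (simp add: mode1_def distrib_left)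
    also have "\<dots> \<le> \<bar>a\<bar> * \<bar>ip y (phi1 n)\<bar> + \<bar>a\<bar> * \<bar>ip g (psi1_snd a b s n)\<bar> + \<bar>ip h (phi1 n)\<bar> + \<bar>ip k (psi1_snd a b s n)\<bar>"
      unfolding abs_mult[symmetric] by linarith
    finally have 1: "(a - lam1 a n) * \<bar>?x\<bar> \<le> \<bar>a\<bar> * \<bar>ip y (phi1 n)\<bar> + \<bar>a\<bar> * \<bar>ip g (psi1_snd a b s n)\<bar> + \<bar>ip h (phi1 n)\<bar> + \<bar>ip k (psi1_snd a b s n)\<bar>" (is "_ \<le> ?Q")
      using order_trans[OF zero_le_power2 lam1_growth[of n a]] by (simp add: abs_mult)
    have "?r\<^sup>2 * \<bar>?x\<bar> \<le> (a - lam1 a n) * \<bar>?x\<bar>"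
      by (intro mult_right_mono lam1_growth) auto
    with 1 have "?r * (?r * \<bar>?x\<bar>) \<le> ?Q" by (simp add: power2_eq_square mult.assoc)
    then have "?r * \<bar>?x\<bar> \<le> ?Q / ?r" by (simp add: le_divide_eq mult.commute)
    also have "\<dots> = \<bar>ip h (phi1 n)\<bar> / ?r + \<bar>ip k (psi1_snd a b s n)\<bar> / ?r + \<bar>a\<bar> * (\<bar>ip y (phi1 n)\<bar> / ?r) + \<bar>a\<bar> * (\<bar>ip g (psi1_snd a b s n)\<bar> / ?r)"
      by (simp add: add_divide_distrib)
    also have "\<dots> \<le> ?b n"
    proof -
      have p: "\<bar>ip f (psi1_snd a b s n)\<bar> / ?r \<le> C * norm_L2 f * ?w n" if "f \<in> L2_space" for f
      proof -
        have "\<bar>ip f (psi1_snd a b s n)\<bar> \<le> C * norm_L2 f / ?r"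
          using C(2)[OF that, of n] by (simp add: le_divide_eq mult.commute)
        then have "\<bar>ip f (psi1_snd a b s n)\<bar> / ?r \<le> C * norm_L2 f / ?r / ?r"
          by (intro divide_right_mono) auto
        then show ?thesis by (simp add: power2_eq_square)
      qed
      have q: "\<bar>ip f (phi1 n)\<bar> / ?r \<le> (ip f (phi1 n))\<^sup>2 + ?w n" for f
        using div_Suc_le_squares[of "\<bar>ip f (phi1 n)\<bar>" n] by simp
      show ?thesis
        by (intro add_mono mult_left_mono p q L D abs_ge_zero)
    qed
    finally show "norm (?r * \<bar>?x\<bar>) \<le> ?b n" by simp
  qed
qed

lemma smooth_deriv_unique:
  assumes "smooth_on_unit f f'" "smooth_on_unit h h'" "\<And>x. x \<in> {0..1} \<Longrightarrow> f x = h x" "x \<in> {0..1}"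
  shows "f' x = h' x"
proof -
  have 1: "(f has_real_derivative f' x) (at x within {0..1})"
    using assms(1,4) by (simp add: smooth_on_unit_def)
  have "(h has_real_derivative h' x) (at x within {0..1})"
    using assms(2,4) by (simp add: smooth_on_unit_def)
  then have "(f has_real_derivative h' x) (at x within {0..1})"
    by (rule has_field_derivative_transform_within[of _ _ _ _ 1]) (use assms(3,4) in auto)
  then show ?thesis using Dx_eq[OF 1 assms(4)] Dx_eq[of f "h' x" x] assms(4) by simp
qed

lemma smooth_on_unit_scale:
  assumes "smooth_on_unit f f'" shows "smooth_on_unit (\<lambda>x. c * f x) (\<lambda>x. c * f' x)"
  using assms unfolding smooth_on_unit_def by (auto intro!: DERIV_cmult continuous_intros)

lemma smooth_on_unit_add:
  assumes "smooth_on_unit f f'" "smooth_on_unit h h'"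
  shows "smooth_on_unit (\<lambda>x. f x + h x) (\<lambda>x. f' x + h' x)"
  using assms unfolding smooth_on_unit_def by (auto intro!: DERIV_add continuous_intros)

lemma le_real_Suc_mult: "0 \<le> u \<Longrightarrow> u \<le> (real n + 1) * u"
  using mult_right_mono[of 1 "real n + 1" u] by simp

definition dcosm :: "nat \<Rightarrow> real \<Rightarrow> real" where
  "dcosm m x = - (real m * pi * (mu m * sin (real m * pi * x)))"

definition dphi1 :: "nat \<Rightarrow> real \<Rightarrow> real" where
  "dphi1 n x = - ((real n + 1/2) * pi) * sin_half n x"

lemma abs_dcosm_le: "\<bar>dcosm m x\<bar> \<le> 2 * pi * (real m + 1)"
proof -
  have "\<bar>mu m * sin (real m * pi * x)\<bar> \<le> 2 * 1"
    unfolding abs_mult by (intro mult_mono abs_mu_le abs_sin_le_one) auto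
  then have "(real m * pi) * \<bar>mu m * sin (real m * pi * x)\<bar> \<le> ((real m + 1) * pi) * (2 * 1)"
    by (intro mult_mono) auto
  then show ?thesis unfolding dcosm_def abs_minus_cancel abs_mult[of "real m * pi"] by (simp add: mult_ac)
qed

lemma abs_dphi1_le: "\<bar>dphi1 n x\<bar> \<le> 2 * pi * (real n + 1)"
proof -
  have "\<bar>dphi1 n x\<bar> = ((real n + 1/2) * pi) * \<bar>sin_half n x\<bar>"
    by (simp add: dphi1_def abs_mult)
  also have "\<dots> \<le> ((real n + 1) * pi) * 2"
    by (intro mult_mono trig_abs_le) auto
  finally show ?thesis by (simp add: mult_ac)
qed

lemma modes2_smooth_series:
  assumes "summable (\<lambda>m. (real m + 1) * \<bar>c m\<bar>)"
  shows "smooth_on_unit (\<lambda>x. \<Sum>m. c m * cosm m x) (\<lambda>x. \<Sum>m. c m * dcosm m x)"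
proof (rule C1_series[where A = "\<lambda>m. 2 * pi * ((real m + 1) * \<bar>c m\<bar>)"])
  show "smooth_on_unit (\<lambda>x. c k * cosm k x) (\<lambda>x. c k * dcosm k x)" for k
    unfolding dcosm_def by (rule smooth_on_unit_scale[OF smooth_cosm])
  show "\<forall>x\<in>{0..1}. \<bar>c k * dcosm k x\<bar> \<le> 2 * pi * ((real k + 1) * \<bar>c k\<bar>)" for k
    using mult_left_mono[OF abs_dcosm_le, of "\<bar>c k\<bar>" k] by (simp add: abs_mult mult_ac)
  show "\<forall>x\<in>{0..1}. \<bar>c k * cosm k x\<bar> \<le> 2 * pi * ((real k + 1) * \<bar>c k\<bar>)" for k
  proof
    fix x :: real
    have "\<bar>c k * cosm k x\<bar> \<le> \<bar>c k\<bar> * 2" unfolding abs_mult by (intro mult_left_mono trig_abs_le) auto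
    also have "\<dots> \<le> ((real k + 1) * \<bar>c k\<bar>) * (2 * pi)"
      using pi_ge_two by (intro mult_mono le_real_Suc_mult) auto
    finally show "\<bar>c k * cosm k x\<bar> \<le> 2 * pi * ((real k + 1) * \<bar>c k\<bar>)" by (simp add: mult_ac)
  qed
qed (rule summable_mult[OF assms])

lemma modes1_smooth_series:
  assumes "summable (\<lambda>m. (real m + 1) * \<bar>c m\<bar>)"
  shows "smooth_on_unit (\<lambda>x. \<Sum>m. c m * phi1 m x) (\<lambda>x. \<Sum>m. c m * dphi1 m x)"
proof (rule C1_series[where A = "\<lambda>m. 2 * pi * ((real m + 1) * \<bar>c m\<bar>)"])
  show "smooth_on_unit (\<lambda>x. c k * phi1 k x) (\<lambda>x. c k * dphi1 k x)" for k
    unfolding dphi1_def by (rule smooth_on_unit_scale[OF smooth_phi1])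
  show "\<forall>x\<in>{0..1}. \<bar>c k * dphi1 k x\<bar> \<le> 2 * pi * ((real k + 1) * \<bar>c k\<bar>)" for k
    using mult_left_mono[OF abs_dphi1_le, of "\<bar>c k\<bar>" k] by (simp add: abs_mult mult_ac)
  show "\<forall>x\<in>{0..1}. \<bar>c k * phi1 k x\<bar> \<le> 2 * pi * ((real k + 1) * \<bar>c k\<bar>)" for k
  proof
    fix x :: real
    have "\<bar>c k * phi1 k x\<bar> \<le> \<bar>c k\<bar> * 2" unfolding abs_mult by (intro mult_left_mono trig_abs_le) auto
    also have "\<dots> \<le> ((real k + 1) * \<bar>c k\<bar>) * (2 * pi)"
      using pi_ge_two by (intro mult_mono le_real_Suc_mult) auto
    finally show "\<bar>c k * phi1 k x\<bar> \<le> 2 * pi * ((real k + 1) * \<bar>c k\<bar>)" by (simp add: mult_ac)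
  qed
qed (rule summable_mult[OF assms])

lemma summable_of_weighted:
  assumes "summable (\<lambda>m. (real m + 1) * \<bar>c m\<bar>)"
  shows "summable (\<lambda>m. \<bar>c m\<bar>)"
  by (rule summable_comparison_test'[OF assms, of 0]) (use le_real_Suc_mult[of "\<bar>c _\<bar>"] in auto)

lemma phi2_smooth_series:
  assumes "summable (\<lambda>m. \<bar>c m\<bar>)"
  shows "smooth_on_unit (\<lambda>x. \<Sum>m. c m * phi2 a b s m x) (\<lambda>x. \<Sum>m. c m * deriv (phi2 a b s m) x)"
    and "(\<lambda>m. c m * ip (phi2 a b s m) (phi1 n)) sums ip (\<lambda>x. \<Sum>m. c m * phi2 a b s m x) (phi1 n)"
proof -
  obtain C where C: "0 < C" "\<And>m x. x \<in> {0..1} \<Longrightarrow> (real m + 1) * \<bar>phi2 a b s m x\<bar> \<le> C"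
    "\<And>m x. x \<in> {0..1} \<Longrightarrow> \<bar>deriv (phi2 a b s m) x\<bar> \<le> C"
    using phi2_bounds[of a b s] by metis
  have b1: "\<forall>x\<in>{0..1}. \<bar>c k * phi2 a b s k x\<bar> \<le> \<bar>c k\<bar> * C" for k
    unfolding abs_mult
    by (intro ballI mult_left_mono order_trans[OF le_real_Suc_mult[of "\<bar>phi2 a b s k _\<bar>" k] C(2)]) auto
  have b2: "\<forall>x\<in>{0..1}. \<bar>c k * deriv (phi2 a b s k) x\<bar> \<le> \<bar>c k\<bar> * C" for k
    unfolding abs_mult by (intro ballI mult_left_mono C(3)) auto
  have sm: "smooth_on_unit (\<lambda>x. c k * phi2 a b s k x) (\<lambda>x. c k * deriv (phi2 a b s k) x)" for k
    by (rule smooth_on_unit_scale[OF smooth_phi2])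
  show "smooth_on_unit (\<lambda>x. \<Sum>m. c m * phi2 a b s m x) (\<lambda>x. \<Sum>m. c m * deriv (phi2 a b s m) x)"
    by (rule C1_series[OF sm b1 b2 summable_mult2[OF assms]])
  show "(\<lambda>m. c m * ip (phi2 a b s m) (phi1 n)) sums ip (\<lambda>x. \<Sum>m. c m * phi2 a b s m x) (phi1 n)"
    using ip_series_sums[OF smooth_on_unit_continuous[OF sm] b1 summable_mult2[OF assms] phi1_L2]
    by (simp only: ip_scale_left)
qed

text \<open>The difference of \<open>g\<close> and its cosine series is continuous and orthogonal to the cosine system, hence 0. The weighted
summability allows term-by-term differentiation.\<close>
lemma expansion2:
  assumes "in_domain s y y' y'' g g' g''" "x \<in> {0..1}"
  shows "g x = (\<Sum>m. ip g (cosm m) * cosm m x)" "g' x = (\<Sum>m. ip g (cosm m) * dcosm m x)"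
proof -
  note D = in_domainD[OF assms(1)]
  let ?G = "\<lambda>x. \<Sum>m. ip g (cosm m) * cosm m x"
  note S = summable_mode2[OF assms(1)]
  note sm = modes2_smooth_series[OF S]
  have cG: "continuous_on {0..1} ?G" and cg: "continuous_on {0..1} g"
    using smooth_on_unit_continuous sm D(4) by blast+
  have "ip (\<lambda>x. g x - ?G x) (cosm m) = 0" for m
    using orthonormal_series(1)[OF orthonormal_cosm _ summable_of_weighted[OF S], of 2 m] trig_abs_le(1)
      cG cg cosm_L2[of m]
    by (simp add: ip_diff_left L2_space_continuous)
  then have "g x - ?G x = 0" if "x \<in> {0..1}" for x
    by (rule cosm_complete[OF continuous_on_diff[OF cg cG] _ that])
  then have eq: "g x = ?G x" if "x \<in> {0..1}" for x using that by simp
  show "g x = ?G x" by (rule eq[OF assms(2)])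
  show "g' x = (\<Sum>m. ip g (cosm m) * dcosm m x)"
    by (rule smooth_deriv_unique[OF D(4) sm eq assms(2)])
qed

text \<open>The first component of the expansion of \<open>(y, g)\<close> along the generalized eigenvectors. The \<open>phi1 n\<close>-coefficient of the second
series is \<open>- ip g (psi1_snd n)\<close> by biorthogonality and by the expansion of \<open>g\<close>, so that the difference of both sides
is orthogonal to every \<open>phi1 n\<close>.\<close>
lemma expansion1:
  assumes "in_domain s y y' y'' g g' g''" "x \<in> {0..1}"
  shows "y x = (\<Sum>n. mode1 a b s n y g * phi1 n x) + (\<Sum>m. ip g (cosm m) * phi2 a b s m x)"
    and "y' x = (\<Sum>n. mode1 a b s n y g * dphi1 n x) + (\<Sum>m. ip g (cosm m) * deriv (phi2 a b s m) x)"
proof -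
  note D = in_domainD[OF assms(1)]
  let ?P = "\<lambda>x. \<Sum>n. mode1 a b s n y g * phi1 n x" and ?Q = "\<lambda>x. \<Sum>m. ip g (cosm m) * phi2 a b s m x"
  note S1 = summable_mode1[OF assms(1), of a b]
  note S2 = summable_mode2[OF assms(1)]
  note smP = modes1_smooth_series[OF S1]
  note smQ = phi2_smooth_series(1)[OF summable_of_weighted[OF S2], of a b s]
  note sm = smooth_on_unit_add[OF smP smQ]
  have c: "continuous_on {0..1} ?P" "continuous_on {0..1} ?Q" "continuous_on {0..1} y"
    using smooth_on_unit_continuous smP smQ D(1) by blast+
  have L: "?P \<in> L2_space" "?Q \<in> L2_space" "(\<lambda>x. ?P x + ?Q x) \<in> L2_space"
    using c by (auto intro!: L2_space_continuous continuous_intros)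
  have z: "ip (\<lambda>x. y x - (?P x + ?Q x)) (phi1 n) = 0" for n
  proof -
    have "(\<lambda>m. ip (\<lambda>x. ip g (cosm m) * cosm m x) (psi1_snd a b s n)) sums
        ip (\<lambda>x. \<Sum>m. ip g (cosm m) * cosm m x) (psi1_snd a b s n)"
    proof (rule ip_series_sums[OF _ _ _ psi1_snd_L2])
      show "continuous_on {0..1} (\<lambda>x. ip g (cosm k) * cosm k x)" for k
        by (rule smooth_on_unit_continuous[OF smooth_on_unit_scale[OF smooth_cosm]])
      show "\<forall>x\<in>{0..1}. \<bar>ip g (cosm k) * cosm k x\<bar> \<le> \<bar>ip g (cosm k)\<bar> * 2" for k
        unfolding abs_mult by (intro ballI mult_left_mono trig_abs_le) auto
      show "summable (\<lambda>k. \<bar>ip g (cosm k)\<bar> * 2)"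
        by (rule summable_mult2[OF summable_of_weighted[OF S2]])
    qed
    also have "ip (\<lambda>x. \<Sum>m. ip g (cosm m) * cosm m x) (psi1_snd a b s n) = ip g (psi1_snd a b s n)"
      by (rule ip_cong) (simp_all add: expansion2(1)[OF assms(1)])
    finally have "(\<lambda>m. ip g (cosm m) * - ip (phi2 a b s m) (phi1 n)) sums ip g (psi1_snd a b s n)"
      by (simp only: ip_scale_left ip_commute[of "cosm _"] biorthogonal)
    then have "(\<lambda>m. ip g (cosm m) * ip (phi2 a b s m) (phi1 n)) sums - ip g (psi1_snd a b s n)"
      using sums_minus by fastforce
    then have Q: "ip ?Q (phi1 n) = - ip g (psi1_snd a b s n)"
      using phi2_smooth_series(2)[OF summable_of_weighted[OF S2], of a b s n] sums_unique2 by blast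
    have P: "ip ?P (phi1 n) = mode1 a b s n y g"
      using orthonormal_series(1)[OF orthonormal_phi1 _ summable_of_weighted[OF S1], of 2 n] trig_abs_le(2) by simp
    show ?thesis
      using D L P Q phi1_L2[of n] by (simp add: ip_diff_left ip_add_left mode1_def)
  qed
  have c3: "continuous_on {0..1} (\<lambda>x. y x - (?P x + ?Q x))" using c by (intro continuous_intros)
  have eq: "y x = ?P x + ?Q x" if "x \<in> {0..1}" for x
  proof (cases "x = 1")
    case True
    then show ?thesis by (simp add: D(7) phi1_at_1 phi2_ode(3))
  next
    case False
    then show ?thesis using phi1_complete[OF c3 z, of x] that by simp
  qed
  show "y x = ?P x + ?Q x" by (rule eq[OF assms(2)])
  show "y' x = (\<Sum>n. mode1 a b s n y g * dphi1 n x) + (\<Sum>m. ip g (cosm m) * deriv (phi2 a b s m) x)"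
    by (rule smooth_deriv_unique[OF D(1) sm eq assms(2)])
qed

section \<open>Equivalence of the modal norm and the energy norm\<close>

lemma sum_squares_le: "(p + q)\<^sup>2 \<le> 2 * p\<^sup>2 + 2 * (q::real)\<^sup>2"
  using zero_le_power2[of "p - q"] by (simp add: power2_diff power2_sum)

text \<open>Up to factors of order \<open>n\<close>, the coordinates of \<open>y\<close> and \<open>g\<close> are the sine coefficients of \<open>y'\<close> and \<open>g'\<close>, so Bessel's
inequality applies. The contribution of \<open>psi1_snd\<close> is of order \<open>1/n\<close> after weighting, hence square-summable.\<close>
lemma H1_lower:
  "\<exists>C>0. \<forall>y y' g g'. weak_deriv y y' \<longrightarrow> y 1 = 0 \<longrightarrow> weak_deriv g g' \<longrightarrow>
       summable (\<lambda>n. ((real n + 1) * mode1 a b s n y g)\<^sup>2) \<and>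
       summable (\<lambda>m. ((real m + 1) * ip g (cosm m))\<^sup>2) \<and>
       (\<Sum>n. ((real n + 1) * mode1 a b s n y g)\<^sup>2) + (\<Sum>m. ((real m + 1) * ip g (cosm m))\<^sup>2)
         \<le> C * (ip y' y' + ip g g + ip g' g')"
proof -
  obtain C1 where C1: "0 < C1" "\<And>n g g'. weak_deriv g g' \<Longrightarrow>
     (real n + 1)\<^sup>2 * \<bar>ip g (psi1_snd a b s n)\<bar> \<le> C1 * (norm_L2 g + norm_L2 g')"
    using ip_psi1_bound_H1[of a b s] by metis
  let ?w = "\<lambda>n. 1 / (real n + 1)\<^sup>2"
  define W where "W = (\<Sum>n. ?w n)"
  have W: "0 \<le> W" unfolding W_def by (intro suminf_nonneg summable_inverse_squares) simp
  define C where "C = 3 + 4 * C1\<^sup>2 * W"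
  show ?thesis
  proof (intro exI[of _ C] conjI[of "0 < C"] allI impI)
    show "0 < C" using W by (simp add: C_def add_pos_nonneg)
    fix y y' g g' assume y: "weak_deriv y y'" "y 1 = 0" and g: "weak_deriv g g'"
    have L: "y \<in> L2_space" "y' \<in> L2_space" "g \<in> L2_space" "g' \<in> L2_space"
      using y(1) g weak_deriv_L2 by blast+
    let ?S = "norm_L2 g + norm_L2 g'"
    have S2: "?S\<^sup>2 \<le> 2 * (ip g g + ip g' g')"
      using sum_squares_le[of "norm_L2 g" "norm_L2 g'"] by (simp add: norm_L2_power2)
    let ?f1 = "\<lambda>n. ((real n + 1) * mode1 a b s n y g)\<^sup>2"
    let ?b1 = "\<lambda>n. 2 * (ip y' (sin_half n))\<^sup>2 + 2 * C1\<^sup>2 * ?S\<^sup>2 * ?w n"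
    have b1s: "summable ?b1"
      by (intro summable_add summable_mult Bessel(1)[OF orthonormal_sin_half] L summable_inverse_squares)
    have f1: "?f1 n \<le> ?b1 n" for n
    proof -
      let ?r = "real n + 1"
      have "?f1 n = (?r * ip y (phi1 n) + ?r * ip g (psi1_snd a b s n))\<^sup>2"
        by (simp add: mode1_def distrib_left)
      also have "\<dots> \<le> 2 * (?r * ip y (phi1 n))\<^sup>2 + 2 * (?r * ip g (psi1_snd a b s n))\<^sup>2"
        by (rule sum_squares_le)
      also have "(?r * ip y (phi1 n))\<^sup>2 \<le> (ip y' (sin_half n))\<^sup>2"
      proof -
        have "?r\<^sup>2 * (ip y (phi1 n))\<^sup>2 \<le> ((real n + 1/2) * pi)\<^sup>2 * (ip y (phi1 n))\<^sup>2"
          by (intro mult_right_mono sq_le_half_pi_sq) simp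
        also have "\<dots> = (ip y' (sin_half n))\<^sup>2"
          unfolding ip_deriv_sin_half[OF y] by (simp add: power_mult_distrib)
        finally show ?thesis by (simp add: power_mult_distrib)
      qed
      also have "(?r * ip g (psi1_snd a b s n))\<^sup>2 \<le> C1\<^sup>2 * ?S\<^sup>2 * ?w n"
      proof -
        have "?r * (?r * \<bar>ip g (psi1_snd a b s n)\<bar>) \<le> C1 * ?S"
          using C1(2)[OF g, of n] by (simp add: power2_eq_square mult.assoc)
        then have "?r * \<bar>ip g (psi1_snd a b s n)\<bar> \<le> C1 * ?S / ?r"
          by (simp add: le_divide_eq mult.commute)
        then have "(?r * \<bar>ip g (psi1_snd a b s n)\<bar>)\<^sup>2 \<le> (C1 * ?S / ?r)\<^sup>2"
          by (intro power_mono) auto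
        then show ?thesis by (simp add: power_mult_distrib power_divide)
      qed
      finally show ?thesis by simp
    qed
    have f1s: "summable ?f1"
      by (rule summable_comparison_test'[OF b1s, of 0]) (use f1 in simp)
    have "(\<Sum>n. ?f1 n) \<le> (\<Sum>n. ?b1 n)" by (rule suminf_le[OF f1 f1s b1s])
    also have "\<dots> = 2 * (\<Sum>n. (ip y' (sin_half n))\<^sup>2) + 2 * C1\<^sup>2 * ?S\<^sup>2 * W"
    proof -
      note s1 = Bessel(1)[OF orthonormal_sin_half L(2)]
      show ?thesis
        unfolding W_def suminf_add[OF summable_mult[OF s1] summable_mult[OF summable_inverse_squares], symmetric]
          suminf_mult[OF s1] suminf_mult[OF summable_inverse_squares] by (rule refl)
    qed
    also have "\<dots> \<le> 2 * ip y' y' + 2 * C1\<^sup>2 * (2 * (ip g g + ip g' g')) * W"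
      by (intro add_mono mult_left_mono mult_right_mono Bessel(2)[OF orthonormal_sin_half] L S2 W) auto
    finally have sum1: "(\<Sum>n. ?f1 n) \<le> 2 * ip y' y' + 2 * C1\<^sup>2 * (2 * (ip g g + ip g' g')) * W" .
    let ?f2 = "\<lambda>m. ((real m + 1) * ip g (cosm m))\<^sup>2"
    let ?b2 = "\<lambda>j. (ip g' (sin_int j))\<^sup>2"
    have b2s: "summable ?b2" by (rule Bessel(1)[OF orthonormal_sin_int L(4)])
    have f2: "?f2 (Suc j) \<le> ?b2 j" for j
    proof -
      have "real j + 1 \<le> real j * pi + pi" 
        using mult_left_mono[OF pi_ge_two, of "real j"] pi_ge_two by linarith
      then have "(real (Suc j) + 1) \<le> real (Suc j) * pi"
        using mult_left_mono[OF pi_ge_two, of "real (Suc j)"] by simp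
      then have "(real (Suc j) + 1)\<^sup>2 * (ip g (cosm (Suc j)))\<^sup>2 \<le> (real (Suc j) * pi)\<^sup>2 * (ip g (cosm (Suc j)))\<^sup>2"
        by (intro mult_right_mono power_mono) auto
      also have "\<dots> = ?b2 j" unfolding ip_deriv_sin_int[OF g] by (simp add: power_mult_distrib)
      finally show ?thesis by (simp add: power_mult_distrib)
    qed
    have f2s': "summable (\<lambda>j. ?f2 (Suc j))"
      by (rule summable_comparison_test'[OF b2s, of 0]) (use f2 in simp)
    then have f2s: "summable ?f2" by (rule iffD1[OF summable_Suc_iff])
    have "(\<Sum>m. ?f2 m) = ?f2 0 + (\<Sum>j. ?f2 (Suc j))"
      using suminf_split_head[OF f2s] by simp
    also have "?f2 0 \<le> ip g g"
      using power_mono[OF orthonormal_ip_bound[OF orthonormal_cosm L(3), of 0], of 2] by (simp add: norm_L2_power2)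
    also have "(\<Sum>j. ?f2 (Suc j)) \<le> (\<Sum>j. ?b2 j)" by (rule suminf_le[OF f2 f2s' b2s])
    also have "(\<Sum>j. ?b2 j) \<le> ip g' g'" by (rule Bessel(2)[OF orthonormal_sin_int L(4)])
    finally have sum2: "(\<Sum>m. ?f2 m) \<le> ip g g + ip g' g'" by simp
    have "(\<Sum>n. ?f1 n) + (\<Sum>m. ?f2 m) \<le> 2 * ip y' y' + (1 + 4 * C1\<^sup>2 * W) * (ip g g + ip g' g')"
      using sum1 sum2 by (simp add: algebra_simps)
    also have "\<dots> \<le> C * ip y' y' + C * (ip g g + ip g' g')"
      using W ip_nonneg[of g] ip_nonneg[of g'] ip_nonneg[of y'] by (intro add_mono mult_right_mono) (auto simp: C_def)
    finally show "summable ?f1 \<and> summable ?f2 \<and> (\<Sum>n. ?f1 n) + (\<Sum>m. ?f2 m) \<le> C * (ip y' y' + ip g g + ip g' g')"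
      using f1s f2s by (simp add: algebra_simps)
  qed
qed

text \<open>Cauchy--Schwarz with the weight \<open>n + 1\<close>.\<close>
lemma summable_abs_bound:
  fixes c :: "nat \<Rightarrow> real"
  assumes "summable (\<lambda>m. \<bar>c m\<bar>)" "summable (\<lambda>m. ((real m + 1) * c m)\<^sup>2)"
  shows "(\<Sum>m. \<bar>c m\<bar>)\<^sup>2 \<le> (\<Sum>n. 1 / (real n + 1)\<^sup>2) * (\<Sum>m. ((real m + 1) * c m)\<^sup>2)"
proof -
  let ?w = "\<lambda>n. 1 / (real n + 1)\<^sup>2" and ?u = "\<lambda>m. ((real m + 1) * c m)\<^sup>2"
  have "(\<Sum>m<N. \<bar>c m\<bar>) \<le> sqrt ((\<Sum>n. ?w n) * (\<Sum>m. ?u m))" for N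
  proof (rule real_le_rsqrt)
    have "(\<Sum>m<N. \<bar>c m\<bar>)\<^sup>2 = (\<Sum>m<N. (1 / (real m + 1)) * ((real m + 1) * \<bar>c m\<bar>))\<^sup>2"
      by (rule arg_cong[of _ _ "\<lambda>x. x\<^sup>2"], rule sum.cong) (auto simp: add_pos_nonneg)
    also have "\<dots> \<le> (\<Sum>m<N. (1 / (real m + 1))\<^sup>2) * (\<Sum>m<N. ((real m + 1) * \<bar>c m\<bar>)\<^sup>2)"
      by (rule Cauchy_Schwarz_ineq_sum)
    also have "\<dots> = (\<Sum>m<N. ?w m) * (\<Sum>m<N. ?u m)" by (simp add: power_divide power_mult_distrib)
    also have "\<dots> \<le> (\<Sum>n. ?w n) * (\<Sum>m. ?u m)"
      by (intro mult_mono sum_le_suminf summable_inverse_squares assms suminf_nonneg sum_nonneg) auto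
    finally show "(\<Sum>m<N. \<bar>c m\<bar>)\<^sup>2 \<le> (\<Sum>n. ?w n) * (\<Sum>m. ?u m)" .
  qed
  then have "(\<Sum>m. \<bar>c m\<bar>) \<le> sqrt ((\<Sum>n. ?w n) * (\<Sum>m. ?u m))"
    by (rule suminf_le_const[OF assms(1)])
  then have "(\<Sum>m. \<bar>c m\<bar>)\<^sup>2 \<le> (sqrt ((\<Sum>n. ?w n) * (\<Sum>m. ?u m)))\<^sup>2"
    by (intro power_mono suminf_nonneg assms) auto
  also have "\<dots> = (\<Sum>n. ?w n) * (\<Sum>m. ?u m)"
    by (intro real_sqrt_pow2 mult_nonneg_nonneg suminf_nonneg summable_inverse_squares assms) auto
  finally show ?thesis .
qed

lemma ip_add_square_le:
  assumes "p \<in> L2_space" "q \<in> L2_space"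
  shows "ip (\<lambda>x. p x + q x) (\<lambda>x. p x + q x) \<le> 2 * ip p p + 2 * ip q q"
proof -
  have "0 \<le> ip (\<lambda>x. p x - q x) (\<lambda>x. p x - q x)" by (rule ip_nonneg)
  also have "\<dots> = ip p p - 2 * ip p q + ip q q"
    using assms by (simp add: ip_diff_left ip_diff_right L2_space_diff ip_commute[of q p])
  finally have 1: "2 * ip p q \<le> ip p p + ip q q" by simp
  have "ip (\<lambda>x. p x + q x) (\<lambda>x. p x + q x) = ip p p + 2 * ip p q + ip q q"
    using assms by (simp add: ip_add_left ip_add_right L2_space_add ip_commute[of q p])
  then show ?thesis using 1 by linarith
qed

text \<open>The differentiated expansions consist of sine series, whose norms are computed by Parseval, and of a series in the
derivatives of \<open>phi2\<close>. The latter are not orthogonal but uniformly bounded, and their coefficients are absolutely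
summable with a bound in terms of the weighted square sum.\<close>
lemma H1_upper:
  "\<exists>C>0. \<forall>y y' y'' g g' g''. in_domain s y y' y'' g g' g'' \<longrightarrow>
       ip y' y' + ip g g + ip g' g' \<le>
       C * ((\<Sum>n. ((real n + 1) * mode1 a b s n y g)\<^sup>2) + (\<Sum>m. ((real m + 1) * ip g (cosm m))\<^sup>2))"
proof -
  obtain C0 where C0: "\<forall>y y' g g'. weak_deriv y y' \<longrightarrow> y 1 = 0 \<longrightarrow> weak_deriv g g' \<longrightarrow>
       summable (\<lambda>n. ((real n + 1) * mode1 a b s n y g)\<^sup>2) \<and>
       summable (\<lambda>m. ((real m + 1) * ip g (cosm m))\<^sup>2) \<and>
       (\<Sum>n. ((real n + 1) * mode1 a b s n y g)\<^sup>2) + (\<Sum>m. ((real m + 1) * ip g (cosm m))\<^sup>2)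
         \<le> C0 * (ip y' y' + ip g g + ip g' g')"
    using H1_lower[of a b s] by blast
  obtain C1 where C1: "0 < C1" "\<And>m x. x \<in> {0..1} \<Longrightarrow> \<bar>deriv (phi2 a b s m) x\<bar> \<le> C1"
    using phi2_bounds[of a b s] by metis
  define W where "W = (\<Sum>n. 1 / (real n + 1)\<^sup>2)"
  have W: "0 \<le> W" unfolding W_def by (intro suminf_nonneg summable_inverse_squares) simp
  define C where "C = 2 * pi\<^sup>2 + (2 * C1\<^sup>2 * W + 1 + pi\<^sup>2)"
  show ?thesis
  proof (intro exI[of _ C] conjI[of "0 < C"] allI impI)
    show "0 < C" using W by (simp add: C_def add_pos_nonneg)
    fix y y' y'' g g' g'' assume dom: "in_domain s y y' y'' g g' g''"
    note D = in_domainD[OF dom]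
    let ?x = "\<lambda>n. mode1 a b s n y g" and ?z = "\<lambda>m. ip g (cosm m)"
    let ?f1 = "\<lambda>n. ((real n + 1) * ?x n)\<^sup>2" and ?f2 = "\<lambda>m. ((real m + 1) * ?z m)\<^sup>2"
    have fs: "summable ?f1" "summable ?f2" using C0[rule_format, OF D(2,7,5)] by blast+
    have E0: "0 \<le> (\<Sum>n. ?f1 n)" "0 \<le> (\<Sum>n. ?f2 n)" using fs by (auto intro: suminf_nonneg)
    note S1 = summable_mode1[OF dom, of a b] and S2 = summable_mode2[OF dom]
    have gg: "ip g g \<le> (\<Sum>m. ?f2 m)"
    proof -
      let ?G = "\<lambda>x. \<Sum>m. ?z m * cosm m x"
      have "(\<lambda>m. (?z m)\<^sup>2) sums ip ?G ?G"
        using orthonormal_series(2)[OF orthonormal_cosm _ summable_of_weighted[OF S2], of 2] trig_abs_le(1) by simp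
      also have "ip ?G ?G = ip g g" by (rule ip_cong) (simp_all add: expansion2(1)[OF dom])
      finally have s: "(\<lambda>m. (?z m)\<^sup>2) sums ip g g" .
      have "(?z m)\<^sup>2 \<le> ?f2 m" for m
        using power_mono[OF le_real_Suc_mult[of "\<bar>?z m\<bar>" m], of 2] by (simp add: power_mult_distrib)
      from suminf_le[OF this sums_summable[OF s] fs(2)] show ?thesis
        using sums_unique[OF s] by simp
    qed
    \<comment> \<open>the constant mode drops out of the derivative, hence the shift of the index\<close>
    have g'g': "ip g' g' \<le> pi\<^sup>2 * (\<Sum>m. ?f2 m)"
    proof -
      let ?a = "\<lambda>j. - (real (Suc j) * pi) * ?z (Suc j)"
      have sa: "summable (\<lambda>j. \<bar>?a j\<bar>)"
      proof (rule summable_comparison_test'[where N = 0])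
        show "summable (\<lambda>j. pi * ((real (Suc j) + 1) * \<bar>?z (Suc j)\<bar>))"
          by (rule summable_mult[OF iffD2[OF summable_Suc_iff S2]])
        fix j :: nat
        have "\<bar>?a j\<bar> = pi * (real (Suc j) * \<bar>?z (Suc j)\<bar>)" by (simp add: abs_mult)
        also have "\<dots> \<le> pi * ((real (Suc j) + 1) * \<bar>?z (Suc j)\<bar>)"
          by (intro mult_left_mono mult_right_mono) auto
        finally show "norm \<bar>?a j\<bar> \<le> pi * ((real (Suc j) + 1) * \<bar>?z (Suc j)\<bar>)" by simp
      qed
      let ?G = "\<lambda>x. \<Sum>j. ?a j * sin_int j x"
      have s: "(\<lambda>j. (?a j)\<^sup>2) sums ip ?G ?G"
        using orthonormal_series(2)[OF orthonormal_sin_int _ sa, of 2] trig_abs_le(4) by simp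
      have "g' x = ?G x" if x: "x \<in> {0..1}" for x
      proof -
        have eq: "?z (Suc j) * dcosm (Suc j) x = ?a j * sin_int j x" for j
          by (simp add: dcosm_def sin_int_def mu_def algebra_simps)
        have "summable (\<lambda>m. ?z m * dcosm m x)"
        proof (rule summable_comparison_test'[where N = 0])
          show "summable (\<lambda>m. 2 * pi * ((real m + 1) * \<bar>?z m\<bar>))" by (rule summable_mult[OF S2])
          show "norm (?z m * dcosm m x) \<le> 2 * pi * ((real m + 1) * \<bar>?z m\<bar>)" for m
            using mult_left_mono[OF abs_dcosm_le, of "\<bar>?z m\<bar>" m x] by (simp add: abs_mult algebra_simps)
        qed
        from suminf_split_head[OF this] have "(\<Sum>m. ?z m * dcosm m x) = (\<Sum>j. ?z (Suc j) * dcosm (Suc j) x)"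
          by (simp add: dcosm_def)
        then show ?thesis using expansion2(2)[OF dom x] by (simp only: eq)
      qed
      then have "ip g' g' = ip ?G ?G" by (intro ip_cong) auto
      then have s': "(\<lambda>j. (?a j)\<^sup>2) sums ip g' g'" using s by simp
      have fs': "summable (\<lambda>j. ?f2 (Suc j))" by (rule iffD2[OF summable_Suc_iff fs(2)])
      have "(?a j)\<^sup>2 \<le> pi\<^sup>2 * ?f2 (Suc j)" for j
      proof -
        have "(real (Suc j))\<^sup>2 * (?z (Suc j))\<^sup>2 \<le> (real (Suc j) + 1)\<^sup>2 * (?z (Suc j))\<^sup>2"
          by (intro mult_right_mono power_mono) auto
        from mult_left_mono[OF this, of "pi\<^sup>2"] show ?thesis by (simp add: power_mult_distrib mult_ac)
      qed
      from suminf_le[OF this sums_summable[OF s'] summable_mult[OF fs']]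
      have "ip g' g' \<le> pi\<^sup>2 * (\<Sum>j. ?f2 (Suc j))"
        using sums_unique[OF s'] suminf_mult[OF fs', of "pi\<^sup>2"] by simp
      also have "(\<Sum>j. ?f2 (Suc j)) \<le> (\<Sum>m. ?f2 m)"
        using suminf_split_head[OF fs(2)] by simp
      finally show ?thesis by (simp add: mult_left_mono)
    qed
    \<comment> \<open>P is the part along the first family, Q the part along the second\<close>
    have y'y': "ip y' y' \<le> 2 * (pi\<^sup>2 * (\<Sum>n. ?f1 n)) + 2 * (C1\<^sup>2 * (W * (\<Sum>m. ?f2 m)))"
    proof -
      let ?a = "\<lambda>n. - ((real n + 1/2) * pi) * ?x n"
      let ?P = "\<lambda>x. \<Sum>n. ?a n * sin_half n x" and ?Q = "\<lambda>x. \<Sum>m. ?z m * deriv (phi2 a b s m) x"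
      have sa: "summable (\<lambda>n. \<bar>?a n\<bar>)"
      proof (rule summable_comparison_test'[where N = 0])
        show "summable (\<lambda>n. pi * ((real n + 1) * \<bar>?x n\<bar>))" by (rule summable_mult[OF S1])
        fix n :: nat
        have "\<bar>?a n\<bar> = pi * ((real n + 1/2) * \<bar>?x n\<bar>)" by (simp add: abs_mult)
        also have "\<dots> \<le> pi * ((real n + 1) * \<bar>?x n\<bar>)"
          by (intro mult_left_mono mult_right_mono) auto
        finally show "norm \<bar>?a n\<bar> \<le> pi * ((real n + 1) * \<bar>?x n\<bar>)" by simp
      qed
      have sP: "(\<lambda>n. (?a n)\<^sup>2) sums ip ?P ?P"
        using orthonormal_series(2)[OF orthonormal_sin_half _ sa, of 2] trig_abs_le(3) by simp
      have "(?a n)\<^sup>2 \<le> pi\<^sup>2 * ?f1 n" for n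
      proof -
        have "(real n + 1/2)\<^sup>2 * (?x n)\<^sup>2 \<le> (real n + 1)\<^sup>2 * (?x n)\<^sup>2"
          by (intro mult_right_mono power_mono) auto
        from mult_left_mono[OF this, of "pi\<^sup>2"] show ?thesis
          by (simp only: power_mult_distrib power2_minus mult.assoc) (simp add: mult_ac)
      qed
      from suminf_le[OF this sums_summable[OF sP] summable_mult[OF fs(1)]]
      have PP: "ip ?P ?P \<le> pi\<^sup>2 * (\<Sum>n. ?f1 n)"
        using sums_unique[OF sP] suminf_mult[OF fs(1), of "pi\<^sup>2"] by simp
      have cP: "continuous_on {0..1} ?P"
      proof (rule unit_interval_series_limit(2)[where A = "\<lambda>n. \<bar>?a n\<bar> * 2"])
        show "continuous_on {0..1} (\<lambda>x. ?a k * sin_half k x)" for k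
          using orthonormal_sin_half by (intro continuous_intros) (simp add: orthonormal_def)
        show "\<forall>x\<in>{0..1}. \<bar>?a k * sin_half k x\<bar> \<le> \<bar>?a k\<bar> * 2" for k
          unfolding abs_mult[of "?a k"] by (intro ballI mult_left_mono trig_abs_le) auto
      qed (rule summable_mult2[OF sa])
      have cQ: "continuous_on {0..1} ?Q"
        using phi2_smooth_series(1)[OF summable_of_weighted[OF S2], of a b s] by (simp add: smooth_on_unit_def)
      have Qb: "\<bar>?Q x\<bar> \<le> C1 * (\<Sum>m. \<bar>?z m\<bar>)" if "x \<in> {0..1}" for x
      proof -
        have b: "norm (?z m * deriv (phi2 a b s m) x) \<le> C1 * \<bar>?z m\<bar>" for m
          using mult_left_mono[OF C1(2)[OF that], of "\<bar>?z m\<bar>" m] by (simp add: abs_mult mult.commute)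
        have "norm (?Q x) \<le> (\<Sum>m. C1 * \<bar>?z m\<bar>)"
          by (rule norm_suminf_le[OF b summable_mult[OF summable_of_weighted[OF S2]]])
        then show ?thesis by (simp add: suminf_mult summable_of_weighted[OF S2])
      qed
      have QQ: "ip ?Q ?Q \<le> C1\<^sup>2 * (W * (\<Sum>m. ?f2 m))"
      proof -
        have "ip ?Q ?Q \<le> (C1 * (\<Sum>m. \<bar>?z m\<bar>))\<^sup>2" by (rule ip_bound[OF Qb cQ])
        also have "\<dots> = C1\<^sup>2 * (\<Sum>m. \<bar>?z m\<bar>)\<^sup>2" by (simp add: power_mult_distrib)
        also have "\<dots> \<le> C1\<^sup>2 * (W * (\<Sum>m. ?f2 m))"
          unfolding W_def by (intro mult_left_mono summable_abs_bound summable_of_weighted[OF S2] fs) auto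
        finally show ?thesis .
      qed
      have L: "?P \<in> L2_space" "?Q \<in> L2_space" using cP cQ L2_space_continuous by blast+
      have "?x n * dphi1 n x = ?a n * sin_half n x" for n x by (simp add: dphi1_def)
      then have "ip y' y' = ip (\<lambda>x. ?P x + ?Q x) (\<lambda>x. ?P x + ?Q x)"
        by (intro ip_cong) (simp_all only: expansion1(2)[OF dom, of _ a b])
      also have "\<dots> \<le> 2 * ip ?P ?P + 2 * ip ?Q ?Q"
        by (rule ip_add_square_le[OF L])
      finally show ?thesis using PP QQ by linarith
    qed
    have "ip y' y' + ip g g + ip g' g' \<le> 2 * pi\<^sup>2 * (\<Sum>n. ?f1 n) + (2 * C1\<^sup>2 * W + 1 + pi\<^sup>2) * (\<Sum>m. ?f2 m)"
      using y'y' gg g'g' by (simp add: algebra_simps)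
    also have "\<dots> \<le> C * (\<Sum>n. ?f1 n) + C * (\<Sum>m. ?f2 m)"
      using W E0 by (intro add_mono mult_right_mono) (auto simp: C_def add_nonneg_nonneg)
    finally show "ip y' y' + ip g g + ip g' g' \<le> C * ((\<Sum>n. ?f1 n) + (\<Sum>m. ?f2 m))"
      by (simp add: distrib_left)
  qed
qed

section \<open>Decay of forced linear systems\<close>

text \<open>A bound for the size of a forcing term, relative to \<open>exp (-\<delta> t)\<close>, by a constant \<open>B\<close> plus a function \<open>G'\<close>
with primitive \<open>G\<close>. Only the total mass \<open>R\<close> of \<open>G'\<close> matters, so \<open>G'\<close> may be unbounded near 0; the primitive is
taken as the datum in order to avoid improper integrals.\<close>
definition forcing_profile :: "real \<Rightarrow> real \<Rightarrow> real \<Rightarrow> (real \<Rightarrow> real) \<Rightarrow> (real \<Rightarrow> real) \<Rightarrow> bool" where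
  "forcing_profile T B R G G' \<longleftrightarrow> 0 \<le> T \<and> 0 \<le> B \<and> continuous_on {0..T} G \<and> G 0 = 0 \<and>
     (\<forall>t\<in>{0<..<T}. (G has_real_derivative G' t) (at t)) \<and> (\<forall>t\<in>{0..T}. 0 \<le> G t \<and> G t \<le> R)"

lemma forcing_profile_nonneg: "forcing_profile T B R G G' \<Longrightarrow> 0 \<le> R"
  unfolding forcing_profile_def by force

text \<open>The function \<open>exp (- l t) * w t\<close> has derivative \<open>exp (- l t) * r t\<close>, whose modulus is at most the derivative of
\<open>exp (q t) * (B / q + G t)\<close> with \<open>q = - Re l - \<delta>\<close>. The mean value inequality compares the two.\<close>
lemma scalar_decay_sharp:
  fixes w r :: "real \<Rightarrow> complex" and l :: complex
  assumes F: "forcing_profile T B R G G'"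
    and c: "continuous_on {0..T} w"
    and d: "\<And>t. t \<in> {0<..<T} \<Longrightarrow> (w has_vector_derivative l * w t + r t) (at t)"
    and l: "Re l < - \<delta>"
    and r: "\<And>t. t \<in> {0<..<T} \<Longrightarrow> cmod (r t) \<le> exp (- \<delta> * t) * (B + G' t)"
    and t: "t \<in> {0..T}"
  shows "cmod (w t) \<le> exp (Re l * t) * cmod (w 0) + exp (- \<delta> * t) * (B / (- Re l - \<delta>) + R)"
proof -
  define q where "q = - Re l - \<delta>"
  have q: "0 < q" "Re l = - q - \<delta>" using l by (simp_all add: q_def)
  have B: "0 \<le> B" and G: "0 \<le> G t" "G t \<le> R" "G 0 = 0" "continuous_on {0..T} G"
    using F t by (auto simp: forcing_profile_def)
  define h where "h = (\<lambda>t. exp (- l * of_real t) * w t)"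
  define \<Phi> where "\<Phi> = (\<lambda>t. exp (q * t) * (B / q + G t))"
  have hb: "cmod (h t) \<le> cmod (w 0) + \<Phi> t"
  proof (cases "t = 0")
    case True
    then show ?thesis using B q G by (simp add: h_def \<Phi>_def)
  next
    case False
    have "norm (h t - h 0) \<le> \<Phi> t - \<Phi> 0"
    proof (rule differentiable_bound_general)
      show "0 < t" using False t by simp
      have sub: "{0..t} \<subseteq> {0..T}" using t by auto
      show "continuous_on {0..t} h"
        unfolding h_def by (intro continuous_intros continuous_on_subset[OF c sub])
      show "continuous_on {0..t} \<Phi>"
        unfolding \<Phi>_def by (intro continuous_intros continuous_on_subset[OF G(4) sub])
      fix x assume x: "0 < x" "x < t"
      then have xT: "x \<in> {0<..<T}" using t by simp
      have e: "((\<lambda>t. exp (- l * of_real t)) has_vector_derivative - l * exp (- l * of_real x)) (at x)"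
      proof -
        have "((\<lambda>z. exp (- l * z)) has_field_derivative - l * exp (- l * of_real x)) (at (complex_of_real x))"
          by (auto intro!: derivative_eq_intros)
        from has_vector_derivative_real_field[OF this] show ?thesis .
      qed
      show "(h has_vector_derivative exp (- l * of_real x) * r x) (at x)"
        unfolding h_def using has_vector_derivative_mult[OF e d[OF xT]]
        by (simp add: algebra_simps)
      have "(G has_real_derivative G' x) (at x)" using F xT by (simp add: forcing_profile_def)
      then have "(\<Phi> has_real_derivative exp (q * x) * (B + q * G x + G' x)) (at x)"
        unfolding \<Phi>_def using q(1) by (auto intro!: derivative_eq_intros simp: algebra_simps)
      then show "(\<Phi> has_vector_derivative exp (q * x) * (B + q * G x + G' x)) (at x)"
        by (simp add: has_real_derivative_iff_has_vector_derivative)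
      have "cmod (exp (- l * of_real x) * r x) = exp (- Re l * x) * cmod (r x)"
        by (simp add: norm_mult norm_exp_eq_Re)
      also have "\<dots> \<le> exp (- Re l * x) * (exp (- \<delta> * x) * (B + G' x))"
        by (intro mult_left_mono r[OF xT]) simp
      also have "\<dots> = exp (q * x) * (B + G' x)"
        unfolding mult.assoc[symmetric] exp_add[symmetric] q(2) by (simp add: algebra_simps)
      also have "\<dots> \<le> exp (q * x) * (B + q * G x + G' x)"
        using F xT q by (intro mult_left_mono) (auto simp: forcing_profile_def)
      finally show "norm (exp (- l * of_real x) * r x) \<le> exp (q * x) * (B + q * G x + G' x)" .
    qed
    moreover have "0 \<le> \<Phi> 0" "h 0 = w 0" using B q G by (simp_all add: \<Phi>_def h_def)
    moreover have "norm (h t) \<le> norm (h t - h 0) + norm (h 0)"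
      using norm_triangle_ineq[of "h t - h 0" "h 0"] by simp
    ultimately show ?thesis by simp
  qed
  have "w t = exp (l * of_real t) * h t"
    by (simp add: h_def mult.assoc[symmetric] flip: exp_add)
  then have "cmod (w t) = exp (Re l * t) * cmod (h t)" by (simp add: norm_mult norm_exp_eq_Re)
  also have "\<dots> \<le> exp (Re l * t) * (cmod (w 0) + \<Phi> t)"
    by (intro mult_left_mono hb) simp
  also have "\<dots> = exp (Re l * t) * cmod (w 0) + exp (- \<delta> * t) * (B / q + G t)"
  proof -
    have "exp (Re l * t) * exp (q * t) = exp (- \<delta> * t)"
      unfolding exp_add[symmetric] q(2) by (simp add: algebra_simps)
    then show ?thesis by (simp add: \<Phi>_def distrib_left mult.assoc[symmetric])
  qed
  also have "\<dots> \<le> exp (Re l * t) * cmod (w 0) + exp (- \<delta> * t) * (B / q + R)"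
    using G by (intro add_mono mult_left_mono) auto
  finally show ?thesis by (simp add: q_def)
qed

lemma scalar_decay:
  fixes w r :: "real \<Rightarrow> complex" and l :: complex
  assumes F: "forcing_profile T B R G G'"
    and c: "continuous_on {0..T} w"
    and d: "\<And>t. t \<in> {0<..<T} \<Longrightarrow> (w has_vector_derivative l * w t + r t) (at t)"
    and l: "Re l < - \<delta>"
    and r: "\<And>t. t \<in> {0<..<T} \<Longrightarrow> cmod (r t) \<le> exp (- \<delta> * t) * (B + G' t)"
    and t: "t \<in> {0..T}"
  shows "cmod (w t) \<le> exp (- \<delta> * t) * (cmod (w 0) + B / (- Re l - \<delta>) + R)"
proof -
  have "Re l * t \<le> - \<delta> * t" using t l by (intro mult_right_mono) auto
  then have "exp (Re l * t) * cmod (w 0) \<le> exp (- \<delta> * t) * cmod (w 0)"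
    by (intro mult_right_mono) auto
  then show ?thesis
    using scalar_decay_sharp[OF F c d l r t] by (simp add: algebra_simps)
qed

definition forced_linear_ode :: "nat \<Rightarrow> (nat \<Rightarrow> nat \<Rightarrow> 'a) \<Rightarrow> real \<Rightarrow> (nat \<Rightarrow> real \<Rightarrow> 'a::real_normed_field) \<Rightarrow> (nat \<Rightarrow> real \<Rightarrow> 'a) \<Rightarrow> bool" where
  "forced_linear_ode n U T w r \<longleftrightarrow> (\<forall>i<n. continuous_on {0..T} (w i) \<and>
     (\<forall>t\<in>{0<..<T}. (w i has_vector_derivative (\<Sum>j<n. U i j * w j t) + r i t) (at t)))"

text \<open>The components with index in \<open>I\<close> of every solution decay at the rate \<open>\<delta>\<close>, with a constant independent of the
solution and of the time horizon. The index set is what allows a triangular system to be solved component by component.\<close>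
definition uniform_decay :: "nat \<Rightarrow> (nat \<Rightarrow> nat \<Rightarrow> 'a::real_normed_field) \<Rightarrow> real \<Rightarrow> real \<Rightarrow> nat set \<Rightarrow> bool" where
  "uniform_decay n U \<delta> K I \<longleftrightarrow> (\<forall>T w r B R G G' W.
     forcing_profile T B R G G' \<longrightarrow> forced_linear_ode n U T w r \<longrightarrow>
     (\<forall>i<n. \<forall>t\<in>{0<..<T}. norm (r i t) \<le> exp (- \<delta> * t) * (B + G' t)) \<longrightarrow>
     (\<forall>i<n. norm (w i 0) \<le> W) \<longrightarrow>
     (\<forall>i\<in>I. \<forall>t\<in>{0..T}. norm (w i t) \<le> K * exp (- \<delta> * t) * (W + B + R)))"

text \<open>Row \<open>i\<close> is a scalar equation in which the components below it, which are already known to decay, act as an additional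
forcing term of constant type.\<close>
lemma triangular_decay_step:
  fixes U :: "nat \<Rightarrow> nat \<Rightarrow> complex"
  assumes diag: "\<And>i. i < n \<Longrightarrow> Re (U i i) < - \<delta>" and tri: "\<And>i j. i < n \<Longrightarrow> j < i \<Longrightarrow> U i j = 0"
    and i: "i < n" and K: "0 < K" "uniform_decay n U \<delta> K {i<..<n}"
  shows "\<exists>K'>0. uniform_decay n U \<delta> K' {i..<n}"
proof -
  define q where "q = - Re (U i i) - \<delta>"
  have q: "0 < q" using diag[OF i] by (simp add: q_def)
  define S where "S = (\<Sum>j\<in>{i<..<n}. cmod (U i j))"
  have S: "0 \<le> S" unfolding S_def by (intro sum_nonneg) simp
  define K' where "K' = K + (1 + (S * K + 1) / q + 1)"
  have SK: "0 \<le> (S * K + 1) / q" using S K q by simp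
  have K': "0 < K'" "K \<le> K'" using K(1) SK by (simp_all add: K'_def)
  show ?thesis
  proof (intro exI[of _ K'] conjI K'(1))
    show "uniform_decay n U \<delta> K' {i..<n}"
      unfolding uniform_decay_def
    proof (intro allI impI ballI)
      fix T B R W t :: real and w r :: "nat \<Rightarrow> real \<Rightarrow> complex" and G G' :: "real \<Rightarrow> real" and k
      assume F: "forcing_profile T B R G G'" and ode: "forced_linear_ode n U T w r"
        and r: "\<forall>i<n. \<forall>t\<in>{0<..<T}. norm (r i t) \<le> exp (- \<delta> * t) * (B + G' t)"
        and w0: "\<forall>i<n. norm (w i 0) \<le> W" and k: "k \<in> {i..<n}" and t: "t \<in> {0..T}"
      have BR: "0 \<le> B" "0 \<le> R" using F forcing_profile_nonneg[OF F] by (auto simp: forcing_profile_def)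
      have W: "0 \<le> W" using w0 i order_trans[OF norm_ge_zero] by blast
      define V where "V = W + B + R"
      have V: "0 \<le> V" "W \<le> V" "B \<le> V" "R \<le> V" using BR W by (simp_all add: V_def)
      have rest: "norm (w j x) \<le> K * exp (- \<delta> * x) * V" if "j \<in> {i<..<n}" "x \<in> {0..T}" for j x
        using K(2) F ode r w0 that unfolding uniform_decay_def V_def by blast
      show "norm (w k t) \<le> K' * exp (- \<delta> * t) * (W + B + R)"
      proof (cases "k = i")
        case False
        then have "norm (w k t) \<le> K * exp (- \<delta> * t) * V" using rest k t by auto
        also have "\<dots> \<le> K' * exp (- \<delta> * t) * V" using K' V by (intro mult_right_mono) auto
        finally show ?thesis by (simp add: V_def)
      next
        case True
        define \<rho> where "\<rho> = (\<lambda>x. (\<Sum>j\<in>{i<..<n}. U i j * w j x) + r i x)"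
        define B' where "B' = S * K * V + B"
        have B': "0 \<le> B'" using S K V BR by (simp add: B'_def)
        have F': "forcing_profile T B' R G G'" using F B' by (simp add: forcing_profile_def)
        have "norm (w i t) \<le> exp (- \<delta> * t) * (cmod (w i 0) + B' / (- Re (U i i) - \<delta>) + R)"
        proof (rule scalar_decay[OF F' _ _ diag[OF i] _ t])
          show "continuous_on {0..T} (w i)" using ode i by (simp add: forced_linear_ode_def)
          fix x assume x: "x \<in> {0<..<T}"
          have "(\<Sum>j<n. U i j * w j x) = U i i * w i x + (\<Sum>j\<in>{i<..<n}. U i j * w j x)"
          proof -
            let ?f = "\<lambda>j. U i j * w j x"
            have "sum ?f {..<n} = sum ?f ({..<Suc i} \<union> {i<..<n})"
              using i by (intro sum.cong) auto
            also have "\<dots> = sum ?f {..<Suc i} + sum ?f {i<..<n}"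
              by (intro sum.union_disjoint) auto
            finally have "sum ?f {..<n} = sum ?f {..<i} + ?f i + sum ?f {i<..<n}" by simp
            moreover have "(\<Sum>j<i. U i j * w j x) = 0" using tri[OF i] by simp
            ultimately show ?thesis by simp
          qed
          moreover have "(w i has_vector_derivative (\<Sum>j<n. U i j * w j x) + r i x) (at x)"
            using ode i x unfolding forced_linear_ode_def by blast
          ultimately show "(w i has_vector_derivative U i i * w i x + \<rho> x) (at x)"
            by (simp only: \<rho>_def add.assoc)
          have "cmod (\<rho> x) \<le> cmod (\<Sum>j\<in>{i<..<n}. U i j * w j x) + cmod (r i x)"
            unfolding \<rho>_def by (rule norm_triangle_ineq)
          also have "cmod (\<Sum>j\<in>{i<..<n}. U i j * w j x) \<le> (\<Sum>j\<in>{i<..<n}. cmod (U i j) * (K * exp (- \<delta> * x) * V))"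
            by (rule sum_norm_le) (unfold norm_mult, intro mult_left_mono rest, use x in auto)
          also have "\<dots> = exp (- \<delta> * x) * (S * K * V)"
            by (simp add: S_def sum_distrib_right sum_distrib_left mult_ac)
          also have "cmod (r i x) \<le> exp (- \<delta> * x) * (B + G' x)" using r i x by blast
          finally show "cmod (\<rho> x) \<le> exp (- \<delta> * x) * (B' + G' x)"
            by (simp add: B'_def algebra_simps)
        qed
        also have "cmod (w i 0) + B' / (- Re (U i i) - \<delta>) + R \<le> K' * V"
        proof -
          have "B' \<le> (S * K + 1) * V" using V by (simp add: B'_def distrib_right)
          then have "B' / q \<le> (S * K + 1) * V / q" using q by (intro divide_right_mono) auto
          moreover have "cmod (w i 0) \<le> V" using w0 i V by force
          moreover have "0 \<le> K * V" using K V by simp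
          ultimately have "cmod (w i 0) + B' / q + R \<le> K * V + (V + (S * K + 1) / q * V + V)"
            using V by simp
          then show ?thesis by (simp add: K'_def q_def algebra_simps)
        qed
        finally show ?thesis using True by (simp add: V_def mult_ac)
      qed
    qed
  qed
qed

lemma triangular_decay:
  fixes U :: "nat \<Rightarrow> nat \<Rightarrow> complex"
  assumes diag: "\<And>i. i < n \<Longrightarrow> Re (U i i) < - \<delta>" and tri: "\<And>i j. i < n \<Longrightarrow> j < i \<Longrightarrow> U i j = 0"
  shows "\<exists>K>0. uniform_decay n U \<delta> K {..<n}"
proof -
  have "\<exists>K>0. uniform_decay n U \<delta> K {n - k..<n}" if "k \<le> n" for k
    using that
  proof (induction k)
    case 0
    show ?case by (rule exI[of _ 1]) (simp add: uniform_decay_def)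
  next
    case (Suc k)
    then obtain K where K: "0 < K" "uniform_decay n U \<delta> K {n - k..<n}" by auto
    have "{n - Suc k<..<n} = {n - k..<n}" using Suc.prems by auto
    then have K': "uniform_decay n U \<delta> K {n - Suc k<..<n}" using K(2) by simp
    show ?case
      by (rule triangular_decay_step[OF diag tri _ K(1) K']) (use Suc.prems in auto)
  qed
  from this[of n] show ?thesis by (simp add: lessThan_atLeast0)
qed

text \<open>Schur triangulation over the complex numbers, \<open>Q A = U Q\<close>: the variable \<open>w = Q x\<close> satisfies a triangular system whose
diagonal consists of the eigenvalues of \<open>A\<close>.\<close>
lemma matrix_decay:
  fixes A :: "real Matrix.mat"
  assumes A: "A \<in> carrier_mat n n" and H: "eigenvalues_left_of (- \<delta>) A"
  shows "\<exists>K>0. uniform_decay n (\<lambda>i j. A $$ (i, j)) \<delta> K {..<n}"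
proof -
  define Ac where "Ac = map_mat complex_of_real A"
  have Ac: "Ac \<in> carrier_mat n n" using A by (simp add: Ac_def)
  obtain es where es: "char_poly Ac = (\<Prod>a\<leftarrow>es. [:- a, 1:])" "length es = n"
    using char_poly_factorized[OF Ac] by blast
  obtain U P Q where sd: "schur_decomposition Ac es = (U, P, Q)" by (cases "schur_decomposition Ac es")
  have sim: "similar_mat_wit Ac U P Q" and ut: "upper_triangular U" and dg: "diag_mat U = es"
    using schur_decomposition[OF Ac es(1) sd] by auto
  note S = similar_mat_witD2[OF Ac sim]
  have QA: "Q * Ac = U * Q"
  proof -
    have "Q * Ac = Q * (P * U * Q)" using S(3) by simp
    also have "P * U * Q = P * (U * Q)" by (rule assoc_mult_mat[OF S(6,5,7)])
    also have "Q * (P * (U * Q)) = (Q * P) * (U * Q)"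
      by (rule assoc_mult_mat[OF S(7,6) mult_carrier_mat[OF S(5,7)], symmetric])
    also have "\<dots> = U * Q"
      unfolding S(2) by (rule left_mult_one_mat[OF mult_carrier_mat[OF S(5,7)]])
    finally show ?thesis .
  qed
  define u where "u = (\<lambda>i j. U $$ (i, j))"
  have "Re (u i i) < - \<delta>" if "i < n" for i
  proof -
    have "u i i = es ! i" using dg that S(5) by (auto simp: diag_mat_def u_def)
    then have "u i i \<in> set es" using that es(2) by simp
    then have "poly (char_poly Ac) (u i i) = 0"
      unfolding es(1) poly_prod_list by (auto simp: prod_list_zero_iff image_iff intro!: bexI[of _ "u i i"])
    then have "u i i \<in> spectrum Ac"
      using eigenvalue_root_char_poly[OF Ac] by (simp add: spectrum_def)
    then show ?thesis using H by (auto simp: eigenvalues_left_of_def Ac_def)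
  qed
  moreover have "u i j = 0" if "i < n" "j < i" for i j
    using ut that S(5) by (auto simp: u_def)
  ultimately obtain K where K: "0 < K" "uniform_decay n u \<delta> K {..<n}"
    using triangular_decay[of n u \<delta>] by blast
  \<comment> \<open>crude bounds for the norms of the change of basis and of its inverse\<close>
  define c where "c = 1 + (\<Sum>i<n. \<Sum>j<n. cmod (Q $$ (i, j)))"
  define d where "d = 1 + (\<Sum>i<n. \<Sum>j<n. cmod (P $$ (i, j)))"
  have rowsum: "(\<Sum>j<n. cmod (X $$ (i, j))) \<le> 1 + (\<Sum>i<n. \<Sum>j<n. cmod (X $$ (i, j)))" if "i < n" for X :: "complex Matrix.mat" and i
    using member_le_sum[of i "{..<n}" "\<lambda>i. \<Sum>j<n. cmod (X $$ (i, j))"] that by (simp add: sum_nonneg)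
  have cd: "0 < c" "0 < d" unfolding c_def d_def by (simp_all add: add_pos_nonneg sum_nonneg)
  have lin: "cmod (\<Sum>j<n. X $$ (i, j) * f j) \<le> (1 + (\<Sum>i<n. \<Sum>j<n. cmod (X $$ (i, j)))) * b"
    if "i < n" "\<And>j. j < n \<Longrightarrow> cmod (f j) \<le> b" "0 \<le> b" for X :: "complex Matrix.mat" and i f b
  proof -
    have "cmod (\<Sum>j<n. X $$ (i, j) * f j) \<le> (\<Sum>j<n. cmod (X $$ (i, j)) * b)"
      using that by (intro sum_norm_le) (auto simp: norm_mult intro!: mult_left_mono)
    also have "\<dots> = (\<Sum>j<n. cmod (X $$ (i, j))) * b" by (simp add: sum_distrib_right)
    also have "\<dots> \<le> (1 + (\<Sum>i<n. \<Sum>j<n. cmod (X $$ (i, j)))) * b"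
      by (intro mult_right_mono rowsum that)
    finally show ?thesis .
  qed
  show ?thesis
  proof (intro exI[of _ "d * K * c"] conjI)
    show "0 < d * K * c" using cd K by simp
    show "uniform_decay n (\<lambda>i j. A $$ (i, j)) \<delta> (d * K * c) {..<n}"
      unfolding uniform_decay_def
    proof (intro allI impI ballI)
      fix T B R W t :: real and x r :: "nat \<Rightarrow> real \<Rightarrow> real" and G G' :: "real \<Rightarrow> real" and i
      assume F: "forcing_profile T B R G G'" and ode: "forced_linear_ode n (\<lambda>i j. A $$ (i, j)) T x r"
        and r: "\<forall>i<n. \<forall>t\<in>{0<..<T}. norm (r i t) \<le> exp (- \<delta> * t) * (B + G' t)"
        and x0: "\<forall>i<n. norm (x i 0) \<le> W" and i: "i \<in> {..<n}" and t: "t \<in> {0..T}"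
      have BR: "0 \<le> B" "0 \<le> R" using F forcing_profile_nonneg[OF F] by (auto simp: forcing_profile_def)
      have W: "0 \<le> W" using x0 i order_trans[OF norm_ge_zero] by blast
      define w where "w = (\<lambda>i t. \<Sum>j<n. Q $$ (i, j) * complex_of_real (x j t))"
      define \<rho> where "\<rho> = (\<lambda>i t. \<Sum>j<n. Q $$ (i, j) * complex_of_real (r j t))"
      have F': "forcing_profile T (c * B) (c * R) (\<lambda>t. c * G t) (\<lambda>t. c * G' t)"
        using F cd by (auto simp: forcing_profile_def intro!: continuous_intros derivative_eq_intros)
      have ode': "forced_linear_ode n u T w \<rho>"
        unfolding forced_linear_ode_def
      proof (intro allI impI conjI ballI)
        fix k assume k: "k < n"
        show "continuous_on {0..T} (w k)"
          unfolding w_def using ode by (auto simp: forced_linear_ode_def intro!: continuous_intros)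
        fix s assume s: "s \<in> {0<..<T}"
        have "((\<lambda>t. Q $$ (k, j) * complex_of_real (x j t)) has_vector_derivative
            Q $$ (k, j) * complex_of_real ((\<Sum>l<n. A $$ (j, l) * x l s) + r j s)) (at s)" if "j < n" for j
          using ode that s
          by (intro bounded_linear.has_vector_derivative[OF bounded_linear_mult_right]
              bounded_linear.has_vector_derivative[OF bounded_linear_of_real]) (auto simp: forced_linear_ode_def)
        then have "(w k has_vector_derivative
            (\<Sum>j<n. Q $$ (k, j) * complex_of_real ((\<Sum>l<n. A $$ (j, l) * x l s) + r j s))) (at s)"
          unfolding w_def by (intro has_vector_derivative_sum) auto
        also have "(\<Sum>j<n. Q $$ (k, j) * complex_of_real ((\<Sum>l<n. A $$ (j, l) * x l s) + r j s))
            = (\<Sum>j<n. Q $$ (k, j) * (\<Sum>l<n. Ac $$ (j, l) * complex_of_real (x l s))) + \<rho> k s"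
          using A by (simp add: \<rho>_def distrib_left sum.distrib Ac_def)
        also have "(\<Sum>j<n. Q $$ (k, j) * (\<Sum>l<n. Ac $$ (j, l) * complex_of_real (x l s)))
            = (\<Sum>l<n. (Q * Ac) $$ (k, l) * complex_of_real (x l s))"
        proof -
          have "(Q * Ac) $$ (k, l) = (\<Sum>j<n. Q $$ (k, j) * Ac $$ (j, l))" if "l < n" for l
            using k that S Ac by (simp add: scalar_prod_def lessThan_atLeast0)
          then have "(\<Sum>l<n. (Q * Ac) $$ (k, l) * complex_of_real (x l s)) = (\<Sum>l<n. \<Sum>j<n. Q $$ (k, j) * Ac $$ (j, l) * complex_of_real (x l s))"
            by (simp add: sum_distrib_right)
          also have "\<dots> = (\<Sum>j<n. \<Sum>l<n. Q $$ (k, j) * Ac $$ (j, l) * complex_of_real (x l s))"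
            by (rule sum.swap)
          finally show ?thesis by (simp add: sum_distrib_left mult.assoc)
        qed
        also have "(\<Sum>l<n. (Q * Ac) $$ (k, l) * complex_of_real (x l s)) = (\<Sum>j<n. u k j * w j s)"
        proof -
          have "(U * Q) $$ (k, l) = (\<Sum>j<n. u k j * Q $$ (j, l))" if "l < n" for l
            using k that S by (simp add: scalar_prod_def lessThan_atLeast0 u_def)
          then have "(\<Sum>l<n. (Q * Ac) $$ (k, l) * complex_of_real (x l s)) = (\<Sum>l<n. \<Sum>j<n. u k j * Q $$ (j, l) * complex_of_real (x l s))"
            by (simp add: sum_distrib_right QA)
          also have "\<dots> = (\<Sum>j<n. \<Sum>l<n. u k j * Q $$ (j, l) * complex_of_real (x l s))"
            by (rule sum.swap)
          finally show ?thesis by (simp add: sum_distrib_left mult.assoc w_def)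
        qed
        finally show "(w k has_vector_derivative (\<Sum>j<n. u k j * w j s) + \<rho> k s) (at s)" .
      qed
      have "\<forall>i<n. \<forall>t\<in>{0<..<T}. norm (\<rho> i t) \<le> exp (- \<delta> * t) * (c * B + c * G' t)"
      proof (intro allI impI ballI)
        fix k s assume k: "k < n" and s: "s \<in> {0<..<T}"
        have b: "norm (r j s) \<le> exp (- \<delta> * s) * (B + G' s)" if "j < n" for j using r that s by blast
        have "0 \<le> exp (- \<delta> * s) * (B + G' s)" using b[OF k] order_trans[OF norm_ge_zero] by blast
        then have "norm (\<rho> k s) \<le> c * (exp (- \<delta> * s) * (B + G' s))"
          unfolding \<rho>_def c_def using b by (intro lin[OF k]) auto
        then show "norm (\<rho> k s) \<le> exp (- \<delta> * s) * (c * B + c * G' s)" by (simp add: algebra_simps)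
      qed
      moreover have "\<forall>i<n. norm (w i 0) \<le> c * W"
        unfolding w_def c_def using x0 W by (intro allI impI lin) auto
      ultimately have wb: "norm (w j t) \<le> K * exp (- \<delta> * t) * (c * W + c * B + c * R)" if "j < n" for j
        using K(2) F' ode' t that unfolding uniform_decay_def by blast
      have "(\<Sum>j<n. P $$ (i, j) * w j t) = complex_of_real (x i t)"
      proof -
        have "(\<Sum>j<n. P $$ (i, j) * w j t) = (\<Sum>j<n. \<Sum>l<n. P $$ (i, j) * Q $$ (j, l) * complex_of_real (x l t))"
          by (simp add: w_def sum_distrib_left mult.assoc)
        also have "\<dots> = (\<Sum>l<n. \<Sum>j<n. P $$ (i, j) * Q $$ (j, l) * complex_of_real (x l t))"
          by (rule sum.swap)
        also have "\<dots> = (\<Sum>l<n. (P * Q) $$ (i, l) * complex_of_real (x l t))"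
        proof (rule sum.cong[OF refl])
          fix l assume "l \<in> {..<n}"
          then have "(P * Q) $$ (i, l) = (\<Sum>j<n. P $$ (i, j) * Q $$ (j, l))"
            using i S(6,7) by (simp add: scalar_prod_def lessThan_atLeast0)
          then show "(\<Sum>j<n. P $$ (i, j) * Q $$ (j, l) * complex_of_real (x l t)) = (P * Q) $$ (i, l) * complex_of_real (x l t)"
            by (simp only: sum_distrib_right)
        qed
        also have "\<dots> = (\<Sum>l<n. if l = i then complex_of_real (x l t) else 0)"
          unfolding S(1) using i by (intro sum.cong) auto
        also have "\<dots> = complex_of_real (x i t)" using i by simp
        finally show ?thesis .
      qed
      then have "norm (x i t) = cmod (\<Sum>j<n. P $$ (i, j) * w j t)" by simp
      also have "\<dots> \<le> d * (K * exp (- \<delta> * t) * (c * W + c * B + c * R))"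
        unfolding d_def using wb i K cd BR W by (intro lin) auto
      also have "\<dots> = d * K * c * exp (- \<delta> * t) * (W + B + R)" by (simp add: algebra_simps)
      finally show "norm (x i t) \<le> d * K * c * exp (- \<delta> * t) * (W + B + R)" .
    qed
  qed
qed

section \<open>The stacked vectors and matrices\<close>

lemma Delta_bij:
  shows "inj_on fst (Delta a b)" "inj_on snd (Delta a b)"
    "card (Delta1 a b) = N_Delta a b" "card (Delta2 a b) = N_Delta a b"
proof -
  show 1: "inj_on fst (Delta a b)"
    by (rule inj_onI) (metis Delta_snd_unique prod.collapse)
  show 2: "inj_on snd (Delta a b)"
    by (rule inj_onI) (metis Delta_fst_unique prod.collapse)
  show "card (Delta1 a b) = N_Delta a b" "card (Delta2 a b) = N_Delta a b"
    unfolding Delta1_def Delta2_def N_Delta_def using 1 2 by (simp_all add: card_image)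
qed

lemma finite_Delta12: "finite (Delta1 a b)" "finite (Delta2 a b)"
  by (simp_all add: Delta1_def Delta2_def finite_Delta)

text \<open>The partner map is increasing, so the two sorted enumerations run through the pairs of equal eigenvalues in parallel.\<close>
lemma sorted_Delta2: "sorted_list_of_set (Delta2 a b) = map (partner1 a b) (sorted_list_of_set (Delta1 a b))"
proof (rule sorted_distinct_set_unique)
  let ?l = "sorted_list_of_set (Delta1 a b)"
  have mono: "partner1 a b i < partner1 a b j" if "i \<in> Delta1 a b" "j \<in> Delta1 a b" "i < j" for i j
    using Delta_mono[OF partner1_in partner1_in] that by blast
  show "sorted (map (partner1 a b) ?l)"
    unfolding sorted_map
    by (rule sorted_wrt_mono_rel[OF _ sorted_sorted_list_of_set])
       (metis finite_Delta12(1) le_neq_implies_less less_imp_le mono order_refl set_sorted_list_of_set)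
  have "inj_on (partner1 a b) (Delta1 a b)"
    by (rule inj_onI) (metis linorder_neqE_nat mono nat_neq_iff)
  then show "distinct (map (partner1 a b) ?l)"
    by (simp add: distinct_map finite_Delta12)
  show "set (sorted_list_of_set (Delta2 a b)) = set (map (partner1 a b) ?l)"
  proof -
    have "Delta2 a b = partner1 a b ` Delta1 a b"
      unfolding Delta2_def Delta1_def image_image
      by (intro image_cong refl) (metis partner1_eq prod.collapse)
    then show ?thesis by (simp add: finite_Delta12)
  qed
qed simp_all

locale stack_layout =
  fixes a b s :: real and N0 M0 :: nat
  assumes D1: "\<forall>n \<in> Delta1 a b. n \<le> N0" and D2: "\<forall>m \<in> Delta2 a b. m \<le> M0"
begin

definition p where "p = (!) (perm1 a b N0)"
definition q where "q = (!) (perm2 a b M0)"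

lemma N_Delta_le: "N_Delta a b \<le> N0 + 1" "N_Delta a b \<le> M0 + 1"
proof -
  have "card (Delta1 a b) \<le> card {0..N0}" using D1 by (intro card_mono) auto
  then show "N_Delta a b \<le> N0 + 1" by (simp add: Delta_bij)
  have "card (Delta2 a b) \<le> card {0..M0}" using D2 by (intro card_mono) auto
  then show "N_Delta a b \<le> M0 + 1" by (simp add: Delta_bij)
qed

lemma perm_set:
  "set (perm1 a b N0) = {0..N0}" "set (perm2 a b M0) = {0..M0}"
  "length (perm1 a b N0) = N0 + 1" "length (perm2 a b M0) = M0 + 1"
proof -
  show "set (perm1 a b N0) = {0..N0}" "set (perm2 a b M0) = {0..M0}"
    using D1 D2 by (auto simp: perm1_def perm2_def finite_Delta12)
  have "card ({0..N0} - Delta1 a b) = card {0..N0} - card (Delta1 a b)"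
    using D1 by (intro card_Diff_subset finite_Delta12) auto
  then show "length (perm1 a b N0) = N0 + 1"
    using N_Delta_le by (simp add: perm1_def Delta_bij)
  have "card ({0..M0} - Delta2 a b) = card {0..M0} - card (Delta2 a b)"
    using D2 by (intro card_Diff_subset finite_Delta12) auto
  then show "length (perm2 a b M0) = M0 + 1"
    using N_Delta_le by (simp add: perm2_def Delta_bij)
qed

lemma pq_image: "p ` {0..<N0 + 1} = {0..N0}" "q ` {0..<M0 + 1} = {0..M0}"
proof -
  have "set xs = (!) xs ` {0..<length xs}" for xs :: "nat list"
    by (auto simp: in_set_conv_nth)
  from this[of "perm1 a b N0"] this[of "perm2 a b M0"] show "p ` {0..<N0 + 1} = {0..N0}" "q ` {0..<M0 + 1} = {0..M0}"
    unfolding p_def q_def perm_set by simp_all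
qed

lemma pq_Delta: "i < N_Delta a b \<Longrightarrow> (p i, q i) \<in> Delta a b"
proof -
  assume i: "i < N_Delta a b"
  let ?l = "sorted_list_of_set (Delta1 a b)"
  have l: "length ?l = N_Delta a b" by (simp add: Delta_bij)
  have "p i = ?l ! i" "q i = partner1 a b (?l ! i)"
    using i l by (simp_all add: p_def q_def perm1_def perm2_def nth_append sorted_Delta2)
  moreover have "?l ! i \<in> Delta1 a b" using nth_mem[of i ?l] i l by (simp add: finite_Delta12)
  ultimately show ?thesis using partner1_in by simp
qed

lemma p_not_Delta: "N_Delta a b \<le> i \<Longrightarrow> i < N0 + 1 \<Longrightarrow> p i \<notin> Delta1 a b"
proof -
  assume i: "N_Delta a b \<le> i" "i < N0 + 1"
  let ?l = "sorted_list_of_set (Delta1 a b)" and ?r = "sorted_list_of_set ({0..N0} - Delta1 a b)"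
  have l: "length ?l = N_Delta a b" by (simp add: Delta_bij)
  have lr: "length ?l + length ?r = N0 + 1" using perm_set(3) unfolding perm1_def length_append .
  have "p i = ?r ! (i - N_Delta a b)" using i l by (simp add: p_def perm1_def nth_append)
  moreover have "?r ! (i - N_Delta a b) \<in> set ?r" using i l lr by (intro nth_mem) linarith
  ultimately show ?thesis by simp
qed

text \<open>The stacked vector lists one entry per mode; \<open>idx\<close> names the mode in each position, \<open>Inl\<close> for the first family and \<open>Inr\<close> for the second.\<close>
definition idx :: "(nat + nat) list" where
  "idx = concat (map (\<lambda>i. [Inl (p i), Inr (q i)]) [0..<N_Delta a b])
      @ map (\<lambda>i. Inl (p i)) [N_Delta a b..<N0 + 1] @ map (\<lambda>i. Inr (q i)) [N_Delta a b..<M0 + 1]"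

lemma stack_idx: "stack a b N0 M0 w1 w2 = vec_of_list (map (case_sum w1 w2) idx)"
  unfolding stack_def idx_def p_def q_def map_append map_concat by (simp add: comp_def del: vec_of_list_map)

lemma length_idx: "length idx = N0 + M0 + 2"
proof -
  have "length (concat (map (\<lambda>i. [Inl (p i), Inr (q i)]) [0..<k])) = 2 * k" for k
    by (induction k) auto
  then show ?thesis unfolding idx_def using N_Delta_le by simp
qed

lemma set_idx: "set idx = Inl ` {0..N0} \<union> Inr ` {0..M0}"
proof -
  have "set idx = (Inl ` p ` {0..<N_Delta a b} \<union> Inl ` p ` {N_Delta a b..<N0 + 1})
     \<union> (Inr ` q ` {0..<N_Delta a b} \<union> Inr ` q ` {N_Delta a b..<M0 + 1})"
    unfolding idx_def by auto
  also have "\<dots> = Inl ` p ` {0..<N0 + 1} \<union> Inr ` q ` {0..<M0 + 1}"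
    unfolding image_Un[symmetric] ivl_disj_un_two(3)[OF le0 N_Delta_le(1)] ivl_disj_un_two(3)[OF le0 N_Delta_le(2)] by (rule refl)
  finally show ?thesis unfolding pq_image .
qed

lemma distinct_idx: "distinct idx"
proof (rule card_distinct)
  have "card (Inl ` {0..N0} \<union> Inr ` {0..M0} :: (nat + nat) set) = card (Inl ` {0..N0} :: (nat + nat) set) + card (Inr ` {0..M0} :: (nat + nat) set)"
    by (rule card_Un_disjoint) auto
  then show "card (set idx) = length idx"
    unfolding set_idx length_idx by (simp add: card_image)
qed

lemma dim_stack [simp]: "dim_vec (stack a b N0 M0 w1 w2) = N0 + M0 + 2"
  by (simp add: stack_idx length_idx del: vec_of_list_map)

lemma stack_carrier [simp]: "stack a b N0 M0 w1 w2 \<in> carrier_vec (N0 + M0 + 2)"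
  by (rule carrier_vecI) simp

lemma stack_index: "i < N0 + M0 + 2 \<Longrightarrow> stack a b N0 M0 w1 w2 $ i = case_sum w1 w2 (idx ! i)"
  unfolding stack_idx vec_of_list_index by (simp add: length_idx)

lemma idx_cases:
  assumes "i < N0 + M0 + 2"
  obtains n where "idx ! i = Inl n" "n \<le> N0" | m where "idx ! i = Inr m" "m \<le> M0"
proof -
  have "idx ! i \<in> Inl ` {0..N0} \<union> Inr ` {0..M0}"
    using nth_mem[of i idx] assms by (simp add: length_idx set_idx)
  then show thesis using that by auto
qed

lemma idx_surj1: "n \<le> N0 \<Longrightarrow> \<exists>i<N0 + M0 + 2. idx ! i = Inl n"
  using set_idx length_idx by (metis atLeastAtMost_iff imageI in_set_conv_nth le0 UnI1)

lemma idx_surj2: "m \<le> M0 \<Longrightarrow> \<exists>i<N0 + M0 + 2. idx ! i = Inr m"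
  using set_idx length_idx by (metis atLeastAtMost_iff imageI in_set_conv_nth le0 UnI2)

lemma stack_scalar_prod:
  "stack a b N0 M0 k1 k2 \<bullet> stack a b N0 M0 w1 w2 = (\<Sum>n\<le>N0. k1 n * w1 n) + (\<Sum>m\<le>M0. k2 m * w2 m)"
proof -
  let ?f = "\<lambda>t. case_sum k1 k2 t * case_sum w1 w2 t"
  have "stack a b N0 M0 k1 k2 \<bullet> stack a b N0 M0 w1 w2 = (\<Sum>i\<in>{0..<length idx}. ?f (idx ! i))"
    unfolding scalar_prod_def dim_stack length_idx by (intro sum.cong) (simp_all add: stack_index)
  also have "\<dots> = sum_list (map ?f idx)" by (simp add: sum_list_sum_nth)
  also have "\<dots> = sum ?f (set idx)" by (rule sum_list_distinct_conv_sum_set[OF distinct_idx])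
  also have "\<dots> = sum ?f (Inl ` {0..N0}) + sum ?f (Inr ` {0..M0})"
    unfolding set_idx by (rule sum.union_disjoint) auto
  also have "\<dots> = (\<Sum>n\<le>N0. k1 n * w1 n) + (\<Sum>m\<le>M0. k2 m * w2 m)"
    by (simp add: sum.reindex atLeast0AtMost)
  finally show ?thesis .
qed

end

text \<open>A block-diagonal matrix acts blockwise on a vector that is cut in the same way.\<close>
lemma diag_block_mat_mult_vec:
  fixes ps :: "('a::semiring_0 Matrix.mat \<times> 'a list) list"
  assumes "\<And>A l. (A, l) \<in> set ps \<Longrightarrow> A \<in> carrier_mat (length l) (length l)"
  shows "diag_block_mat (map fst ps) \<in> carrier_mat (length (concat (map snd ps))) (length (concat (map snd ps))) \<and>
    diag_block_mat (map fst ps) *\<^sub>v vec_of_list (concat (map snd ps))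
     = vec_of_list (concat (map (\<lambda>(A, l). list_of_vec (A *\<^sub>v vec_of_list l)) ps))"
  using assms
proof (induction ps)
  case Nil
  then show ?case by (intro conjI eq_vecI) auto
next
  case (Cons x ps)
  obtain A l where x: "x = (A, l)" by (cases x)
  have append: "vec_of_list (xs @ ys) = vec_of_list xs @\<^sub>v vec_of_list ys" for xs ys :: "'a list"
    by (rule eq_vecI) (simp_all add: vec_of_list_index nth_append)
  let ?D = "diag_block_mat (map fst ps)" and ?v = "vec_of_list (concat (map snd ps))"
  let ?n = "length l" and ?m = "length (concat (map snd ps))"
  have A: "A \<in> carrier_mat ?n ?n" using Cons.prems[of A l] x by simp
  have IH: "?D \<in> carrier_mat ?m ?m"
    "?D *\<^sub>v ?v = vec_of_list (concat (map (\<lambda>(A, l). list_of_vec (A *\<^sub>v vec_of_list l)) ps))"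
    using Cons by auto
  have d: "diag_block_mat (map fst (x # ps)) = four_block_mat A (0\<^sub>m ?n ?m) (0\<^sub>m ?m ?n) ?D"
    using A IH(1) by (simp add: x Let_def)
  have "four_block_mat A (0\<^sub>m ?n ?m) (0\<^sub>m ?m ?n) ?D *\<^sub>v (vec_of_list l @\<^sub>v ?v) = A *\<^sub>v vec_of_list l @\<^sub>v ?D *\<^sub>v ?v"
    using A IH(1) by (intro mult_mat_vec_split) (auto intro: carrier_vecI)
  moreover have "four_block_mat A (0\<^sub>m ?n ?m) (0\<^sub>m ?m ?n) ?D \<in> carrier_mat (?n + ?m) (?n + ?m)"
    using A IH(1) by (intro four_block_carrier_mat)
  ultimately show ?case
    unfolding d by (simp add: x append IH(2) vec_list)
qed

context stack_layout
begin

text \<open>This identifies the matrix with the action of the generator on the slow coordinates, so that permutations and blocks do not appear again.\<close>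
lemma A1_mult_stack:
  "A1 a b s N0 M0 \<in> carrier_mat (N0 + M0 + 2) (N0 + M0 + 2)"
  "A1 a b s N0 M0 *\<^sub>v stack a b N0 M0 w1 w2 = stack a b N0 M0
     (\<lambda>n. lam1 a n * w1 n - (if n \<in> Delta1 a b then sqrt 2 * s * mu (partner1 a b n) else 0) * w2 (partner1 a b n))
     (\<lambda>m. lam2 b m * w2 m)"
proof -
  define ps where "ps = map (\<lambda>i. (jordan_block_M a s (p i) (q i), [w1 (p i), w2 (q i)])) [0..<N_Delta a b]
      @ map (\<lambda>i. (mat_of_rows_list 1 [[lam1 a (p i)]], [w1 (p i)])) [N_Delta a b..<N0 + 1]
      @ map (\<lambda>i. (mat_of_rows_list 1 [[lam2 b (q i)]], [w2 (q i)])) [N_Delta a b..<M0 + 1]"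
  have carr: "A \<in> carrier_mat (length l) (length l)" if "(A, l) \<in> set ps" for A l
    using that by (auto simp: ps_def jordan_block_M_def mat_of_rows_list_def)
  have A: "A1 a b s N0 M0 = diag_block_mat (map fst ps)"
    by (simp add: A1_def ps_def p_def q_def comp_def)
  have concat_single: "concat (map (\<lambda>i. [f i]) xs) = map f xs" for f :: "nat \<Rightarrow> real" and xs
    by (induction xs) auto
  have S: "stack a b N0 M0 w1 w2 = vec_of_list (concat (map snd ps))"
    by (simp add: stack_def ps_def p_def q_def comp_def concat_single del: vec_of_list_map)
  let ?w1 = "\<lambda>n. lam1 a n * w1 n - (if n \<in> Delta1 a b then sqrt 2 * s * mu (partner1 a b n) else 0) * w2 (partner1 a b n)"
  let ?w2 = "\<lambda>m. lam2 b m * w2 m"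
  have b1: "list_of_vec (mat_of_rows_list 1 [[c]] *\<^sub>v vec_of_list [d]) = [c * d]" for c d :: real
  proof -
    have "mat_of_rows_list 1 [[c]] *\<^sub>v vec_of_list [d] = vec_of_list [c * d]"
      by (rule eq_vecI) (auto simp: mat_of_rows_list_def scalar_prod_def vec_of_list_index simp del: vec_of_list_Cons)
    then show ?thesis by (simp only: list_vec)
  qed
  have b2: "list_of_vec (jordan_block_M a s (p i) (q i) *\<^sub>v vec_of_list [w1 (p i), w2 (q i)]) = [?w1 (p i), ?w2 (q i)]"
    if "i < N_Delta a b" for i
  proof -
    have D: "(p i, q i) \<in> Delta a b" by (rule pq_Delta[OF that])
    then have "p i \<in> Delta1 a b" "partner1 a b (p i) = q i" "lam1 a (p i) = lam2 b (q i)"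
      using partner1_eq[OF D] by (auto simp: Delta_iff intro: Delta1I)
    then have e: "jordan_block_M a s (p i) (q i) *\<^sub>v vec_of_list [w1 (p i), w2 (q i)] = vec_of_list [?w1 (p i), ?w2 (q i)]"
      by (intro eq_vecI)
         (auto simp: jordan_block_M_def mat_of_rows_list_def scalar_prod_def vec_of_list_index less_Suc_eq numeral_2_eq_2 simp del: vec_of_list_Cons)
    show ?thesis unfolding e by (rule list_vec)
  qed
  have 1: "map (\<lambda>(A, l). list_of_vec (A *\<^sub>v vec_of_list l)) ps =
      map (\<lambda>i. [?w1 (p i), ?w2 (q i)]) [0..<N_Delta a b] @ map (\<lambda>i. [?w1 (p i)]) [N_Delta a b..<N0 + 1]
      @ map (\<lambda>i. [?w2 (q i)]) [N_Delta a b..<M0 + 1]"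
    unfolding ps_def map_append map_map comp_def prod.case
  proof (intro arg_cong2[of _ _ _ _ append] map_cong refl)
    fix i assume "i \<in> set [0..<N_Delta a b]"
    then show "list_of_vec (jordan_block_M a s (p i) (q i) *\<^sub>v vec_of_list [w1 (p i), w2 (q i)]) = [?w1 (p i), ?w2 (q i)]"
      by (intro b2) simp
  next
    fix i assume "i \<in> set [N_Delta a b..<N0 + 1]"
    then have "p i \<notin> Delta1 a b" by (intro p_not_Delta) auto
    then show "list_of_vec (mat_of_rows_list 1 [[lam1 a (p i)]] *\<^sub>v vec_of_list [w1 (p i)]) = [?w1 (p i)]"
      unfolding b1 by simp
  next
    fix i
    show "list_of_vec (mat_of_rows_list 1 [[lam2 b (q i)]] *\<^sub>v vec_of_list [w2 (q i)]) = [?w2 (q i)]"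
      by (rule b1)
  qed
  have len: "length (concat (map snd ps)) = N0 + M0 + 2"
    using arg_cong[OF S, of dim_vec] by simp
  note main = diag_block_mat_mult_vec[of ps, OF carr]
  show "A1 a b s N0 M0 \<in> carrier_mat (N0 + M0 + 2) (N0 + M0 + 2)"
    using main unfolding A len by blast
  have "A1 a b s N0 M0 *\<^sub>v stack a b N0 M0 w1 w2 = vec_of_list (concat (map (\<lambda>(A, l). list_of_vec (A *\<^sub>v vec_of_list l)) ps))"
    using main unfolding A S by blast
  also have "\<dots> = stack a b N0 M0 ?w1 ?w2"
    unfolding 1 stack_def concat_append concat_single p_def q_def by (rule refl)
  finally show "A1 a b s N0 M0 *\<^sub>v stack a b N0 M0 w1 w2 = stack a b N0 M0 ?w1 ?w2" .
qed

lemma C1_mult: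
  assumes "X \<in> carrier_vec (N0 + M0 + 2)"
  shows "(C1 meas \<xi> a b s N0 M0 *\<^sub>v X) $ 0 = stack a b N0 M0 (c1 meas \<xi>) (c2 meas \<xi> a b s) \<bullet> X"
  by (simp add: C1_def)

lemma mult_mat_vec_index:
  assumes "A \<in> carrier_mat n n" "i < n" "X \<in> carrier_vec n"
  shows "(A *\<^sub>v X) $ i = (\<Sum>j<n. A $$ (i, j) * X $ j)"
  using assms by (simp add: scalar_prod_def lessThan_atLeast0)

lemma observer_matrix:
  assumes L: "L \<in> carrier_vec (N0 + M0 + 2)"
  shows "A1 a b s N0 M0 - col_mat L * C1 meas \<xi> a b s N0 M0 \<in> carrier_mat (N0 + M0 + 2) (N0 + M0 + 2)"
    and "i < N0 + M0 + 2 \<Longrightarrow> j < N0 + M0 + 2 \<Longrightarrow>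
      (A1 a b s N0 M0 - col_mat L * C1 meas \<xi> a b s N0 M0) $$ (i, j)
        = A1 a b s N0 M0 $$ (i, j) - L $ i * stack a b N0 M0 (c1 meas \<xi>) (c2 meas \<xi> a b s) $ j"
proof -
  let ?n = "N0 + M0 + 2"
  have c: "col_mat L \<in> carrier_mat ?n 1" by (rule carrier_matI) (use L in \<open>simp_all add: col_mat_def\<close>)
  have C: "C1 meas \<xi> a b s N0 M0 \<in> carrier_mat 1 ?n" by (rule carrier_matI) (simp_all add: C1_def)
  have m: "col_mat L * C1 meas \<xi> a b s N0 M0 \<in> carrier_mat ?n ?n" by (rule mult_carrier_mat[OF c C])
  then show "A1 a b s N0 M0 - col_mat L * C1 meas \<xi> a b s N0 M0 \<in> carrier_mat ?n ?n"
    by (rule minus_carrier_mat)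
  assume i: "i < ?n" and j: "j < ?n"
  have "(col_mat L * C1 meas \<xi> a b s N0 M0) $$ (i, j) = (\<Sum>k\<in>{0..<1}. col_mat L $$ (i, k) * C1 meas \<xi> a b s N0 M0 $$ (k, j))"
    using c C i j by (simp add: scalar_prod_def)
  also have "\<dots> = L $ i * stack a b N0 M0 (c1 meas \<xi>) (c2 meas \<xi> a b s) $ j"
    using L i j by (simp add: col_mat_def mat_of_cols_def C1_def)
  finally show "(A1 a b s N0 M0 - col_mat L * C1 meas \<xi> a b s N0 M0) $$ (i, j)
        = A1 a b s N0 M0 $$ (i, j) - L $ i * stack a b N0 M0 (c1 meas \<xi>) (c2 meas \<xi> a b s) $ j"
    using i j carrier_matD[OF c] carrier_matD[OF C] by (subst index_minus_mat(1)) simp_all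
qed

lemma controller_matrix:
  fixes ku :: real
  assumes Kx: "Kx \<in> carrier_vec (N0 + M0 + 2)"
  defines "F \<equiv> A1a a b s N0 M0 - B1a a b s N0 M0 * gain_K Kx ku"
  shows "F \<in> carrier_mat (N0 + M0 + 3) (N0 + M0 + 3)"
    and "i < N0 + M0 + 2 \<Longrightarrow> j < N0 + M0 + 2 \<Longrightarrow> F $$ (i, j) = A1 a b s N0 M0 $$ (i, j) - B1v a b s N0 M0 $ i * Kx $ j"
    and "i < N0 + M0 + 2 \<Longrightarrow> F $$ (i, N0 + M0 + 2) = B1u a b s N0 M0 $ i - B1v a b s N0 M0 $ i * ku"
    and "j < N0 + M0 + 2 \<Longrightarrow> F $$ (N0 + M0 + 2, j) = - Kx $ j"
    and "F $$ (N0 + M0 + 2, N0 + M0 + 2) = - ku"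
proof -
  let ?n = "N0 + M0 + 2"
  have one: "vec_of_list [1] \<in> carrier_vec 1" "vec_of_list [ku] \<in> carrier_vec 1" by (auto intro: carrier_vecI)
  have Bd: "B1v a b s N0 M0 \<in> carrier_vec ?n" "B1u a b s N0 M0 \<in> carrier_vec ?n"
    unfolding B1v_def B1u_def by (rule stack_carrier)+
  have A: "A1a a b s N0 M0 \<in> carrier_mat (?n + 1) (?n + 1)"
    unfolding A1a_def using Bd by (intro four_block_carrier_mat A1_mult_stack) simp_all
  have B: "B1a a b s N0 M0 \<in> carrier_mat (?n + 1) 1" by (rule carrier_matI) (use Bd in \<open>simp_all add: B1a_def col_mat_def\<close>)
  have K: "gain_K Kx ku \<in> carrier_mat 1 (?n + 1)" by (rule carrier_matI) (use Kx in \<open>simp_all add: gain_K_def\<close>)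
  have m: "B1a a b s N0 M0 * gain_K Kx ku \<in> carrier_mat (?n + 1) (?n + 1)" by (rule mult_carrier_mat[OF B K])
  then have "F \<in> carrier_mat (?n + 1) (?n + 1)" unfolding F_def by (rule minus_carrier_mat)
  then show "F \<in> carrier_mat (N0 + M0 + 3) (N0 + M0 + 3)" by (simp add: numeral_3_eq_3)
  have BK: "(B1a a b s N0 M0 * gain_K Kx ku) $$ (i, j) = (B1v a b s N0 M0 @\<^sub>v vec_of_list [1]) $ i * (Kx @\<^sub>v vec_of_list [ku]) $ j"
    if i: "i < ?n + 1" and j: "j < ?n + 1" for i j
  proof -
    have "(B1a a b s N0 M0 * gain_K Kx ku) $$ (i, j) = (\<Sum>k\<in>{0..<1}. B1a a b s N0 M0 $$ (i, k) * gain_K Kx ku $$ (k, j))"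
      using B K i j by (simp add: scalar_prod_def)
    also have "\<dots> = (B1v a b s N0 M0 @\<^sub>v vec_of_list [1]) $ i * (Kx @\<^sub>v vec_of_list [ku]) $ j"
      using Bd Kx i j by (simp add: B1a_def col_mat_def mat_of_cols_def gain_K_def)
    finally show ?thesis .
  qed
  have Fij: "F $$ (i, j) = A1a a b s N0 M0 $$ (i, j) - (B1v a b s N0 M0 @\<^sub>v vec_of_list [1]) $ i * (Kx @\<^sub>v vec_of_list [ku]) $ j"
    if i: "i < ?n + 1" and j: "j < ?n + 1" for i j
    unfolding F_def BK[OF i j, symmetric]
    by (rule index_minus_mat(1)) (use i j carrier_matD[OF B] carrier_matD[OF K] in simp_all)
  have A1c: "A1 a b s N0 M0 \<in> carrier_mat ?n ?n" by (rule A1_mult_stack)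
  have app: "(v @\<^sub>v vec_of_list [c]) $ i = v $ i" "(v @\<^sub>v vec_of_list [c]) $ ?n = c"
    if "v \<in> carrier_vec ?n" "i < ?n" for v c i
    using that by (simp_all add: append_vec_def vec_of_list_index del: vec_of_list_Cons)
  have app': "(v @\<^sub>v vec_of_list [c]) $ ?n = c"
    if "v \<in> carrier_vec ?n" for v c
    using that app(2)[OF that, of 0] by simp
  show "F $$ (i, j) = A1 a b s N0 M0 $$ (i, j) - B1v a b s N0 M0 $ i * Kx $ j" if "i < ?n" "j < ?n"
    using that Fij[of i j] Bd Kx A1c by (simp add: app A1a_def)
  show "F $$ (i, ?n) = B1u a b s N0 M0 $ i - B1v a b s N0 M0 $ i * ku" if "i < ?n"
    using that Fij[of i ?n] Bd Kx A1c by (simp add: app app' A1a_def col_mat_def mat_of_cols_def)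
  show "F $$ (?n, j) = - Kx $ j" if "j < ?n"
    using that Fij[of ?n j] Bd Kx A1c by (simp add: app app' A1a_def)
  show "F $$ (?n, ?n) = - ku"
    using Fij[of ?n ?n] Bd Kx A1c by (simp add: app' A1a_def)
qed

end

section \<open>The small-gain argument\<close>

lemma real_mode_decay:
  fixes x r :: "real \<Rightarrow> real"
  assumes c: "continuous_on {0..T} x"
    and d: "\<And>t. t \<in> {0<..<T} \<Longrightarrow> (x has_real_derivative l * x t + r t) (at t)"
    and l: "l < - \<delta>" and B: "0 \<le> B"
    and r: "\<And>t. t \<in> {0<..<T} \<Longrightarrow> \<bar>r t\<bar> \<le> exp (- \<delta> * t) * B"
    and t: "t \<in> {0..T}"
  shows "\<bar>x t\<bar> \<le> exp (l * t) * \<bar>x 0\<bar> + exp (- \<delta> * t) * (B / (- l - \<delta>))"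
proof -
  have F: "forcing_profile T B 0 (\<lambda>_. 0) (\<lambda>_. 0)" using t B by (auto simp: forcing_profile_def)
  have d': "((\<lambda>t. complex_of_real (x t)) has_vector_derivative of_real l * of_real (x t) + of_real (r t)) (at t)"
    if "t \<in> {0<..<T}" for t
  proof -
    have "(x has_vector_derivative l * x t + r t) (at t)"
      using d[OF that] by (simp add: has_real_derivative_iff_has_vector_derivative)
    from bounded_linear.has_vector_derivative[OF bounded_linear_of_real this] show ?thesis by simp
  qed
  have "cmod (of_real (x t)) \<le> exp (Re (of_real l) * t) * cmod (of_real (x 0))
      + exp (- \<delta> * t) * (B / (- Re (of_real l) - \<delta>) + 0)"
    by (rule scalar_decay_sharp[OF F _ d' _ _ t]) (use c l r in \<open>auto intro!: continuous_intros\<close>)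
  then show ?thesis by simp
qed

lemma exp_minus_le_inverse: "0 < y \<Longrightarrow> exp (- y) \<le> 1 / (y::real)"
proof -
  assume y: "0 < y"
  have "y \<le> exp y" using exp_ge_add_one_self[of y] by linarith
  then show ?thesis using y by (simp add: exp_minus field_simps)
qed

text \<open>Initial values of fast modes contribute \<open>\<Sum> k n * exp (- (p n * t))\<close>, where \<open>k\<close> need not be summable and the series
may diverge at 0. Its primitive \<open>\<Sum> k n / p n * (1 - exp (- (p n * t)))\<close> is nevertheless bounded, so it is a
forcing term of finite mass.\<close>
lemma relaxation_series:
  fixes k p :: "nat \<Rightarrow> real"
  assumes p: "\<And>n. 0 < p n" and k: "\<And>n. 0 \<le> k n" and s: "summable (\<lambda>n. k n / p n)"
  defines "G \<equiv> \<lambda>t. \<Sum>n. k n / p n * (1 - exp (- (p n * t)))"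
    and "G' \<equiv> \<lambda>t. \<Sum>n. k n * exp (- (p n * t))"
  shows "0 < t \<Longrightarrow> summable (\<lambda>n. k n * exp (- (p n * t)))"
    and "forcing_profile T B R g g' \<Longrightarrow> forcing_profile T B (R + (\<Sum>n. k n / p n)) (\<lambda>t. g t + G t) (\<lambda>t. g' t + G' t)"
proof -
  have kp: "0 \<le> k n / p n" for n using p[of n] k[of n] by simp
  have pn: "p n \<noteq> 0" for n using p[of n] by simp
  show sum': "summable (\<lambda>n. k n * exp (- (p n * t)))" if t: "0 < t" for t
  proof (rule summable_comparison_test'[where N = 0])
    show "summable (\<lambda>n. 1 / t * (k n / p n))" by (rule summable_mult[OF s])
    fix n
    have "k n * exp (- (p n * t)) \<le> k n * (1 / (p n * t))"
      using p[of n] t by (intro mult_left_mono exp_minus_le_inverse k) simp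
    then show "norm (k n * exp (- (p n * t))) \<le> 1 / t * (k n / p n)"
      using k[of n] by (simp add: mult.commute)
  qed
  let ?f = "\<lambda>n t. k n / p n * (1 - exp (- (p n * t)))"
  have fb: "0 \<le> ?f n t" "?f n t \<le> k n / p n" if "0 \<le> t" for n t
  proof -
    have "exp (- (p n * t)) \<le> 1" using p[of n] that by simp
    then have *: "0 \<le> 1 - exp (- (p n * t))" "1 - exp (- (p n * t)) \<le> 1" by simp_all
    show "0 \<le> ?f n t" by (rule mult_nonneg_nonneg[OF kp *(1)])
    show "?f n t \<le> k n / p n" using mult_left_mono[OF *(2) kp[of n]] by simp
  qed
  have fn: "norm (?f n t) \<le> k n / p n" if "0 \<le> t" for n t
    unfolding real_norm_def abs_of_nonneg[OF fb(1)[OF that]] by (rule fb(2)[OF that])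
  have sf: "summable (\<lambda>n. ?f n t)" if "0 \<le> t" for t
    by (rule summable_comparison_test'[OF s fn[OF that]])
  have cG: "continuous_on {0..T} G"
  proof -
    have "uniform_limit {0..T} (\<lambda>n x. \<Sum>i<n. ?f i x) (\<lambda>x. \<Sum>i. ?f i x) sequentially"
      by (rule Weierstrass_m_test[OF fn s]) simp
    then show ?thesis
      unfolding G_def
      by (rule uniform_limit_theorem[rotated]) (auto intro!: always_eventually continuous_intros simp: pn)
  qed
  have dG: "(G has_real_derivative G' t) (at t)" if t: "0 < t" for t
  proof -
    let ?S = "{t / 2..}"
    have "uniform_limit ?S (\<lambda>n x. \<Sum>i<n. k i * exp (- (p i * x))) (\<lambda>x. \<Sum>i. k i * exp (- (p i * x))) sequentially"
    proof (rule Weierstrass_m_test[OF _ sum'[of "t / 2"]])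
      fix n x assume x: "x \<in> ?S"
      then have "p n * (t / 2) \<le> p n * x" using p[of n] by simp
      then have "k n * exp (- (p n * x)) \<le> k n * exp (- (p n * (t / 2)))"
        by (intro mult_left_mono k) simp
      then show "norm (k n * exp (- (p n * x))) \<le> k n * exp (- (p n * (t / 2)))" using k[of n] by simp
    qed (use t in simp)
    then have uc: "uniformly_convergent_on ?S (\<lambda>n x. \<Sum>i<n. k i * exp (- (p i * x)))"
      unfolding uniformly_convergent_on_def by blast
    have der: "(?f n has_field_derivative k n * exp (- (p n * x))) (at x within ?S)" for n x
      using p[of n] by (auto intro!: derivative_eq_intros simp: field_simps)
    show ?thesis
      unfolding G_def G'_def
    proof (rule has_field_derivative_series'(2)[OF _ der uc])
      show "t \<in> ?S" "t \<in> interior ?S" using t by simp_all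
      show "summable (\<lambda>n. ?f n t)" using t by (intro sf) simp
    qed simp
  qed
  have G0: "G 0 = 0" by (simp add: G_def)
  have Gb: "0 \<le> G t" "G t \<le> (\<Sum>n. k n / p n)" if "0 \<le> t" for t
    unfolding G_def using fb[OF that] sf[OF that] s by (auto intro!: suminf_nonneg suminf_le)
  show "forcing_profile T B (R + (\<Sum>n. k n / p n)) (\<lambda>t. g t + G t) (\<lambda>t. g' t + G' t)"
    if "forcing_profile T B R g g'"
    using that cG dG G0 Gb
    by (auto simp: forcing_profile_def intro!: continuous_intros DERIV_add add_mono)
qed

lemma forcing_profile_scale:
  assumes "forcing_profile T B R G G'" "0 \<le> c" "0 \<le> B'"
  shows "forcing_profile T B' (c * R) (\<lambda>t. c * G t) (\<lambda>t. c * G' t)"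
  using assms by (auto simp: forcing_profile_def intro!: continuous_intros DERIV_cmult mult_left_mono)

text \<open>The maximum of finitely many continuous functions over a compact interval is attained.\<close>
lemma sup_attained_family:
  fixes Z :: "nat \<Rightarrow> real \<Rightarrow> real"
  assumes "0 \<le> T" "\<forall>i\<le>n. continuous_on {0..T} (Z i)"
  shows "\<exists>i\<le>n. \<exists>t\<in>{0..T}. \<forall>j\<le>n. \<forall>s\<in>{0..T}. \<bar>Z j s\<bar> \<le> \<bar>Z i t\<bar>"
proof -
  have "\<exists>t\<in>{0..T}. \<forall>s\<in>{0..T}. \<bar>Z i s\<bar> \<le> \<bar>Z i t\<bar>" if "i \<le> n" for i
    using assms that by (intro continuous_attains_sup) (auto intro!: continuous_intros)
  then obtain \<tau> where \<tau>: "\<And>i. i \<le> n \<Longrightarrow> \<tau> i \<in> {0..T}" "\<And>i s. i \<le> n \<Longrightarrow> s \<in> {0..T} \<Longrightarrow> \<bar>Z i s\<bar> \<le> \<bar>Z i (\<tau> i)\<bar>"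
    by metis
  let ?V = "(\<lambda>i. \<bar>Z i (\<tau> i)\<bar>) ` {..n}"
  have "Max ?V \<in> ?V" by (rule Max_in) auto
  then obtain i where i: "Max ?V = \<bar>Z i (\<tau> i)\<bar>" "i \<in> {..n}" by (rule imageE)
  have "\<bar>Z j s\<bar> \<le> \<bar>Z i (\<tau> i)\<bar>" if "j \<le> n" "s \<in> {0..T}" for j s
    unfolding i(1)[symmetric] by (rule order_trans[OF \<tau>(2)[OF that] Max_ge]) (use that in auto)
  then show ?thesis using i(2) \<tau>(1) by (intro exI[of _ i] conjI bexI[of _ "\<tau> i"]) auto
qed

text \<open>The closed loop of the estimation error \<open>E\<close>, the controlled state \<open>Z\<close> and the unmodelled output \<open>g\<close>. The hypothesis on \<open>g\<close>
says that a decay bound \<open>U\<close> for \<open>Z\<close> costs \<open>\<Gamma> * U\<close> in \<open>g\<close>, up to a forcing term of mass \<open>R\<close>.\<close>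
definition small_gain_estimate :: "nat \<Rightarrow> (nat \<Rightarrow> nat \<Rightarrow> real) \<Rightarrow> (nat \<Rightarrow> nat \<Rightarrow> real) \<Rightarrow> (nat \<Rightarrow> real) \<Rightarrow> (nat \<Rightarrow> real)
    \<Rightarrow> real \<Rightarrow> real \<Rightarrow> real \<Rightarrow> bool" where
  "small_gain_estimate n Ao F L cc \<delta> K \<gamma> \<longleftrightarrow> (\<forall>\<Gamma> T E Z g R G G' W.
     0 \<le> \<Gamma> \<longrightarrow> \<Gamma> \<le> \<gamma> \<longrightarrow> forcing_profile T 0 R G G' \<longrightarrow>
     forced_linear_ode n Ao T E (\<lambda>i t. - L i * g t) \<longrightarrow>
     forced_linear_ode (Suc n) F T Z (\<lambda>i t. (if i < n then L i else 0) * ((\<Sum>j<n. cc j * E j t) + g t)) \<longrightarrow>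
     (\<forall>U\<ge>0. (\<forall>i\<le>n. \<forall>t\<in>{0..T}. \<bar>Z i t\<bar> \<le> U * exp (- \<delta> * t)) \<longrightarrow>
        (\<forall>t\<in>{0<..<T}. \<bar>g t\<bar> \<le> exp (- \<delta> * t) * (\<Gamma> * U + G' t))) \<longrightarrow>
     (\<forall>i<n. \<bar>E i 0\<bar> \<le> W) \<longrightarrow> (\<forall>i\<le>n. \<bar>Z i 0\<bar> \<le> W) \<longrightarrow>
     (\<forall>t\<in>{0..T}. (\<forall>i<n. \<bar>E i t\<bar> \<le> K * exp (- \<delta> * t) * (W + R)) \<and>
        (\<forall>i\<le>n. \<bar>Z i t\<bar> \<le> K * exp (- \<delta> * t) * (W + R))))"

text \<open>Let \<open>U\<close> be the largest value of \<open>exp (\<delta> t) * |Z i t|\<close> on the finite time interval; it exists by compactness. Feeding it through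
\<open>g\<close>, then \<open>E\<close>, then \<open>Z\<close> yields \<open>U \<le> K3 * (W + R + \<Gamma> * U)\<close>, and \<open>K3 * \<Gamma> \<le> 1/2\<close> lets the last term be absorbed.
The resulting bound does not involve the length of the interval.\<close>
lemma small_gain:
  fixes Ao F :: "nat \<Rightarrow> nat \<Rightarrow> real" and L cc :: "nat \<Rightarrow> real"
  assumes K1: "0 < K1" "uniform_decay n Ao \<delta> K1 {..<n}"
    and K2: "0 < K2" "uniform_decay (Suc n) F \<delta> K2 {..<Suc n}"
  shows "\<exists>K>0. \<exists>\<gamma>>0. small_gain_estimate n Ao F L cc \<delta> K \<gamma>"
proof -
  define l where "l = 1 + (\<Sum>i<n. \<bar>L i\<bar>)"
  define cS where "cS = 1 + (\<Sum>i<n. \<bar>cc i\<bar>)"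
  have l: "1 \<le> l" and cS: "1 \<le> cS" by (simp_all add: l_def cS_def sum_nonneg)
  have Ll: "\<bar>L i\<bar> \<le> l" if "i < n" for i
    using member_le_sum[of i "{..<n}" "\<lambda>i. \<bar>L i\<bar>"] that by (simp add: l_def)
  \<comment> \<open>the gain from the size of g to the size of Z, directly and through E\<close>
  define K3 where "K3 = K2 * (l + l\<^sup>2 * cS * K1)"
  have K3: "0 < K3" using K1 K2 l cS by (simp add: K3_def add_pos_pos)
  define K where "K = 2 * K3 + 2 * (K1 * l)"
  define \<gamma> where "\<gamma> = 1 / (2 * K3)"
  show ?thesis
    unfolding small_gain_estimate_def
  proof (rule exI[of _ K], intro conjI, goal_cases)
    case 1
    show "0 < K" using K3 K1 l by (simp add: K_def add_pos_pos)
  next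
    case 2
    show ?case
    proof (rule exI[of _ \<gamma>], intro conjI allI impI, goal_cases)
      case 1
      show "0 < \<gamma>" using K3 by (simp add: \<gamma>_def)
    next
      case (2 \<Gamma> T E Z g R G G' W)
      then have \<Gamma>: "0 \<le> \<Gamma>" "\<Gamma> \<le> \<gamma>" and F: "forcing_profile T 0 R G G'"
        and odeE: "forced_linear_ode n Ao T E (\<lambda>i t. - L i * g t)"
        and odeZ: "forced_linear_ode (Suc n) F T Z (\<lambda>i t. (if i < n then L i else 0) * ((\<Sum>j<n. cc j * E j t) + g t))"
        and gb: "\<And>U. 0 \<le> U \<Longrightarrow> (\<forall>i\<le>n. \<forall>t\<in>{0..T}. \<bar>Z i t\<bar> \<le> U * exp (- \<delta> * t)) \<Longrightarrow>
          (\<forall>t\<in>{0<..<T}. \<bar>g t\<bar> \<le> exp (- \<delta> * t) * (\<Gamma> * U + G' t))"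
        and E0: "\<And>i. i < n \<Longrightarrow> \<bar>E i 0\<bar> \<le> W" and Z0: "\<And>i. i \<le> n \<Longrightarrow> \<bar>Z i 0\<bar> \<le> W"
        by blast+
      have T: "0 \<le> T" using F by (simp add: forcing_profile_def)
      have R: "0 \<le> R" by (rule forcing_profile_nonneg[OF F])
      have W: "0 \<le> W" using Z0[of 0] by simp
      have cZ: "\<forall>i\<le>n. continuous_on {0..T} (\<lambda>t. exp (\<delta> * t) * Z i t)"
        using odeZ by (auto simp: forced_linear_ode_def intro!: continuous_intros)
      obtain i0 t0 where i0: "i0 \<le> n" "t0 \<in> {0..T}"
        "\<forall>j\<le>n. \<forall>s\<in>{0..T}. \<bar>exp (\<delta> * s) * Z j s\<bar> \<le> \<bar>exp (\<delta> * t0) * Z i0 t0\<bar>"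
        using sup_attained_family[OF T cZ] by blast
      define U where "U = \<bar>exp (\<delta> * t0) * Z i0 t0\<bar>"
      have U: "i0 \<le> n" "t0 \<in> {0..T}" "U = \<bar>exp (\<delta> * t0) * Z i0 t0\<bar>"
        "\<And>i t. i \<le> n \<Longrightarrow> t \<in> {0..T} \<Longrightarrow> \<bar>exp (\<delta> * t) * Z i t\<bar> \<le> U"
        using i0 by (auto simp: U_def)
      have U0: "0 \<le> U" using U(3) by simp
      have "\<bar>Z i t\<bar> \<le> U * exp (- \<delta> * t)" if "i \<le> n" "t \<in> {0..T}" for i t
      proof -
        have "\<bar>Z i t\<bar> = \<bar>exp (\<delta> * t) * Z i t\<bar> * exp (- \<delta> * t)"
          by (simp add: abs_mult exp_minus)
        also have "\<dots> \<le> U * exp (- \<delta> * t)" by (intro mult_right_mono U(4) that) simp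
        finally show ?thesis .
      qed
      then have gU: "\<bar>g t\<bar> \<le> exp (- \<delta> * t) * (\<Gamma> * U + G' t)" if "t \<in> {0<..<T}" for t
        using gb[OF U0] that by blast
      \<comment> \<open>the total size of what drives E\<close>
      define H where "H = W + R + \<Gamma> * U"
      have \<Gamma>U: "0 \<le> \<Gamma> * U" using \<Gamma> U0 by simp
      have H: "0 \<le> H" "W \<le> H" "R + \<Gamma> * U \<le> H" "\<Gamma> * U + R \<le> H" using W R \<Gamma>U by (simp_all add: H_def)
      have F1: "forcing_profile T (l * (\<Gamma> * U)) (l * R) (\<lambda>t. l * G t) (\<lambda>t. l * G' t)"
        using l \<Gamma>U by (intro forcing_profile_scale[OF F]) auto
      have lH: "W + l * (\<Gamma> * U) + l * R \<le> l * H"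
        using mult_right_mono[OF l W] by (simp add: H_def distrib_left)
      have E: "\<bar>E i t\<bar> \<le> K1 * exp (- \<delta> * t) * (l * H)" if i: "i < n" and t: "t \<in> {0..T}" for i t
      proof -
        have "norm (- L i * g t) \<le> exp (- \<delta> * t) * (l * (\<Gamma> * U) + l * G' t)"
          if "i < n" "t \<in> {0<..<T}" for i t
        proof -
          have "norm (- L i * g t) \<le> l * (exp (- \<delta> * t) * (\<Gamma> * U + G' t))"
            unfolding real_norm_def abs_mult abs_minus_cancel using Ll[OF that(1)] gU[OF that(2)] l
            by (intro mult_mono) auto
          then show ?thesis by (simp add: algebra_simps)
        qed
        then have "norm (E i t) \<le> K1 * exp (- \<delta> * t) * (W + l * (\<Gamma> * U) + l * R)"
          using K1(2) F1 odeE E0 i t unfolding uniform_decay_def real_norm_def by blast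
        also have "\<dots> \<le> K1 * exp (- \<delta> * t) * (l * H)" using lH K1 by (intro mult_left_mono) auto
        finally show ?thesis by simp
      qed
      \<comment> \<open>the bound for the injection of E into Z\<close>
      define b where "b = l * (cS * (K1 * (l * H)))"
      have b: "0 \<le> b" using l cS K1 H by (simp add: b_def)
      have F2: "forcing_profile T (b + l * (\<Gamma> * U)) (l * R) (\<lambda>t. l * G t) (\<lambda>t. l * G' t)"
        using l \<Gamma>U b by (intro forcing_profile_scale[OF F]) auto
      have Z: "\<bar>Z i t\<bar> \<le> K3 * exp (- \<delta> * t) * H" if i: "i \<le> n" and t: "t \<in> {0..T}" for i t
      proof -
        have "norm ((if i < n then L i else 0) * ((\<Sum>j<n. cc j * E j t) + g t)) \<le> exp (- \<delta> * t) * (b + l * (\<Gamma> * U) + l * G' t)"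
          if t: "t \<in> {0<..<T}" for i t
        proof -
          have "\<bar>\<Sum>j<n. cc j * E j t\<bar> \<le> (\<Sum>j<n. \<bar>cc j\<bar> * (K1 * exp (- \<delta> * t) * (l * H)))"
            by (rule order_trans[OF sum_abs], rule sum_mono, unfold abs_mult, intro mult_left_mono E) (use t in auto)
          also have "\<dots> \<le> cS * (K1 * exp (- \<delta> * t) * (l * H))"
            unfolding sum_distrib_right[symmetric] using K1 l H by (intro mult_right_mono) (auto simp: cS_def)
          finally have "\<bar>(\<Sum>j<n. cc j * E j t) + g t\<bar> \<le> cS * (K1 * exp (- \<delta> * t) * (l * H)) + exp (- \<delta> * t) * (\<Gamma> * U + G' t)"
            using gU[OF t] by linarith
          moreover have "\<bar>if i < n then L i else 0\<bar> \<le> l" using Ll l by auto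
          ultimately have "\<bar>if i < n then L i else 0\<bar> * \<bar>(\<Sum>j<n. cc j * E j t) + g t\<bar>
             \<le> l * (cS * (K1 * exp (- \<delta> * t) * (l * H)) + exp (- \<delta> * t) * (\<Gamma> * U + G' t))"
            using l by (intro mult_mono) auto
          also have "\<dots> = exp (- \<delta> * t) * (b + l * (\<Gamma> * U) + l * G' t)" by (simp add: b_def algebra_simps)
          finally show ?thesis unfolding real_norm_def abs_mult .
        qed
        then have "norm (Z i t) \<le> K2 * exp (- \<delta> * t) * (W + (b + l * (\<Gamma> * U)) + l * R)"
          using K2(2) F2 odeZ Z0 i t unfolding uniform_decay_def real_norm_def less_Suc_eq_le lessThan_Suc_atMost atMost_iff by blast
        also have "W + (b + l * (\<Gamma> * U)) + l * R \<le> l * H + b" using lH by simp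
        also have "l * H + b = (l + l\<^sup>2 * cS * K1) * H" by (simp add: b_def power2_eq_square algebra_simps)
        finally show ?thesis using K2 by (simp add: K3_def mult_ac)
      qed
      have "U \<le> K3 * H"
      proof -
        have "U = exp (\<delta> * t0) * \<bar>Z i0 t0\<bar>" using U(3) by (simp add: abs_mult)
        also have "\<dots> \<le> exp (\<delta> * t0) * (K3 * exp (- \<delta> * t0) * H)" by (intro mult_left_mono Z U) simp
        also have "\<dots> = K3 * H" by (simp add: exp_minus field_simps)
        finally show ?thesis .
      qed
      moreover have "K3 * (\<Gamma> * U) \<le> U / 2"
      proof -
        have "K3 * \<Gamma> \<le> 1 / 2" using \<Gamma>(2) K3 by (simp add: \<gamma>_def field_simps)
        from mult_right_mono[OF this U0] show ?thesis by simp
      qed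
      ultimately have UB: "U \<le> 2 * K3 * (W + R)" by (simp add: H_def distrib_left)
      have "K3 * (\<Gamma> * U) \<le> K3 * (W + R)" using \<open>K3 * (\<Gamma> * U) \<le> U / 2\<close> UB by simp
      then have "\<Gamma> * U \<le> W + R" using K3 by simp
      then have H2: "H \<le> 2 * (W + R)" by (simp add: H_def)
      have WR: "0 \<le> W + R" using W R by simp
      have le: "c * exp (- \<delta> * t) * (W + R) \<le> K * exp (- \<delta> * t) * (W + R)" if "c \<le> K" for c t
        using that WR by (intro mult_right_mono) auto
      show ?case
      proof (intro ballI conjI allI impI)
        fix t i assume t: "t \<in> {0..T}" and i: "i < n"
        have "\<bar>E i t\<bar> \<le> K1 * exp (- \<delta> * t) * (l * H)" by (rule E[OF i t])
        also have "\<dots> \<le> K1 * exp (- \<delta> * t) * (l * (2 * (W + R)))"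
          using K1 l H2 by (intro mult_left_mono) auto
        also have "\<dots> = (2 * (K1 * l)) * exp (- \<delta> * t) * (W + R)" by (simp add: mult_ac)
        also have "\<dots> \<le> K * exp (- \<delta> * t) * (W + R)" using K3 by (intro le) (simp add: K_def)
        finally show "\<bar>E i t\<bar> \<le> K * exp (- \<delta> * t) * (W + R)" .
      next
        fix t i assume t: "t \<in> {0..T}" and i: "i \<le> n"
        have "\<bar>Z i t\<bar> \<le> K3 * exp (- \<delta> * t) * H" by (rule Z[OF i t])
        also have "\<dots> \<le> K3 * exp (- \<delta> * t) * (2 * (W + R))"
          using K3 H2 by (intro mult_left_mono) auto
        also have "\<dots> = (2 * K3) * exp (- \<delta> * t) * (W + R)" by (simp add: mult_ac)
        also have "\<dots> \<le> K * exp (- \<delta> * t) * (W + R)" using K1 l by (intro le) (simp add: K_def)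
        finally show "\<bar>Z i t\<bar> \<le> K * exp (- \<delta> * t) * (W + R)" .
      qed
    qed
  qed
qed

section \<open>The plant in modal coordinates\<close>

text \<open>Differentiability and continuity in the norm are preserved by pairing with a fixed function, by the Cauchy--Schwarz
inequality.\<close>
lemma L2_classical_ip:
  assumes cl: "L2_classical w w'" and w: "\<And>t. 0 \<le> t \<Longrightarrow> w t \<in> L2_space" and w': "\<And>t. 0 < t \<Longrightarrow> w' t \<in> L2_space"
    and \<psi>: "\<psi> \<in> L2_space"
  shows "0 < t \<Longrightarrow> ((\<lambda>t. ip (w t) \<psi>) has_real_derivative ip (w' t) \<psi>) (at t)"
    and "continuous_on {0..} (\<lambda>t. ip (w t) \<psi>)"
proof -
  show D: "((\<lambda>t. ip (w t) \<psi>) has_real_derivative ip (w' t) \<psi>) (at t)" if t: "0 < t" for t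
  proof -
    let ?q = "\<lambda>h x. (w (t + h) x - w t x) / h - w' t x"
    have lim: "((\<lambda>h. norm_L2 (?q h)) \<longlongrightarrow> 0) (at 0)"
      using cl t by (simp add: L2_classical_def L2_tendsto_def)
    have "((\<lambda>h. (ip (w (t + h)) \<psi> - ip (w t) \<psi>) / h - ip (w' t) \<psi>) \<longlongrightarrow> 0) (at 0)"
    proof (rule Lim_null_comparison)
      show "((\<lambda>h. norm_L2 (?q h) * norm_L2 \<psi>) \<longlongrightarrow> 0) (at 0)"
        using tendsto_mult_right[OF lim, of "norm_L2 \<psi>"] by simp
      have "norm ((ip (w (t + h)) \<psi> - ip (w t) \<psi>) / h - ip (w' t) \<psi>) \<le> norm_L2 (?q h) * norm_L2 \<psi>"
        if "dist h 0 < t" for h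
      proof -
        have th: "0 \<le> t + h" using that by (simp add: dist_real_def)
        have q: "?q h = (\<lambda>x. (1 / h) * (w (t + h) x - w t x) - w' t x)" by simp
        have L1: "(\<lambda>x. w (t + h) x - w t x) \<in> L2_space"
          using L2_space_diff[OF w[OF th] w[of t]] t by simp
        note L = L1 L2_space_scale[OF L1, of "1 / h"]
        have "ip (?q h) \<psi> = (ip (w (t + h)) \<psi> - ip (w t) \<psi>) / h - ip (w' t) \<psi>"
          unfolding q ip_diff_left[OF L(2) w'[OF t] \<psi>] ip_scale_left
          using ip_diff_left[OF w[OF th] w[of t] \<psi>] t by simp
        moreover have "?q h \<in> L2_space" unfolding q by (rule L2_space_diff[OF L(2) w'[OF t]])
        ultimately show ?thesis using ip_Cauchy_Schwarz[of "?q h" \<psi>] \<psi> by simp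
      qed
      then show "\<forall>\<^sub>F h in at 0. norm ((ip (w (t + h)) \<psi> - ip (w t) \<psi>) / h - ip (w' t) \<psi>) \<le> norm_L2 (?q h) * norm_L2 \<psi>"
        using t by (auto simp: eventually_at)
    qed
    then show ?thesis unfolding DERIV_def LIM_zero_iff .
  qed
  show "continuous_on {0..} (\<lambda>t. ip (w t) \<psi>)"
    unfolding continuous_on_def
  proof
    fix t :: real assume "t \<in> {0..}"
    then consider "t = 0" | "0 < t" by fastforce
    then show "((\<lambda>t. ip (w t) \<psi>) \<longlongrightarrow> ip (w t) \<psi>) (at t within {0..})"
    proof cases
      case 1
      have lim: "((\<lambda>t. norm_L2 (\<lambda>x. w t x - w 0 x)) \<longlongrightarrow> 0) (at_right 0)"
        using cl by (simp add: L2_classical_def L2_tendsto_def)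
      have "((\<lambda>t. ip (w t) \<psi> - ip (w 0) \<psi>) \<longlongrightarrow> 0) (at_right 0)"
      proof (rule Lim_null_comparison)
        show "((\<lambda>t. norm_L2 (\<lambda>x. w t x - w 0 x) * norm_L2 \<psi>) \<longlongrightarrow> 0) (at_right 0)"
          using tendsto_mult_right[OF lim, of "norm_L2 \<psi>"] by simp
        have "norm (ip (w t) \<psi> - ip (w 0) \<psi>) \<le> norm_L2 (\<lambda>x. w t x - w 0 x) * norm_L2 \<psi>" if "0 < t" for t
          using ip_Cauchy_Schwarz[OF L2_space_diff[OF w[of t] w[of 0]] \<psi>] ip_diff_left[OF w[of t] w[of 0] \<psi>] that by simp
        then show "\<forall>\<^sub>F t in at_right 0. norm (ip (w t) \<psi> - ip (w 0) \<psi>) \<le> norm_L2 (\<lambda>x. w t x - w 0 x) * norm_L2 \<psi>"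
          by (auto intro: eventually_mono[OF eventually_at_right_less])
      qed
      then show ?thesis using 1 unfolding LIM_zero_iff by (simp add: at_within_Ici_at_right)
    next
      case 2
      then have "isCont (\<lambda>t. ip (w t) \<psi>) t" using DERIV_isCont[OF D] by blast
      then show ?thesis unfolding isCont_def by (rule tendsto_within_subset) simp
    qed
  qed
qed

lemma deriv_varphi: "deriv varphi = (\<lambda>x. 1 - x)" "deriv (deriv varphi) = (\<lambda>x. - 1)"
proof -
  have "(varphi has_real_derivative 1 - x) (at x)" for x
    unfolding varphi_def by (auto intro!: derivative_eq_intros)
  then show 1: "deriv varphi = (\<lambda>x. 1 - x)" using DERIV_imp_deriv by blast
  have "((\<lambda>x. 1 - x) has_real_derivative - 1) (at x)" for x :: real
    by (auto intro!: derivative_eq_intros)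
  then show "deriv (deriv varphi) = (\<lambda>x. - 1)" unfolding 1 using DERIV_imp_deriv by blast
qed

lemma smooth_varphi: "smooth_on_unit varphi (\<lambda>x. 1 - x)" "smooth_on_unit (\<lambda>x. 1 - x) (\<lambda>x. - 1)"
  unfolding smooth_on_unit_def varphi_def by (auto intro!: derivative_eq_intros continuous_intros)

lemma alpha_eq: "alpha b = (\<lambda>x. - 1 + b * varphi x)"
  by (rule ext) (simp add: alpha_def deriv_varphi)

lemma varphi_L2: "varphi \<in> L2_space" "(\<lambda>x. 1 - x) \<in> L2_space" "alpha b \<in> L2_space" "beta \<in> L2_space"
proof -
  have c: "continuous_on {0..1} varphi" by (rule smooth_on_unit_continuous[OF smooth_varphi(1)])
  show "varphi \<in> L2_space" "(\<lambda>x. 1 - x) \<in> L2_space" "alpha b \<in> L2_space" "beta \<in> L2_space"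
    unfolding alpha_eq beta_def[abs_def] by (auto intro!: L2_space_continuous continuous_intros c)
qed

lemma input_coefficients:
  "alpha1 a b s n = ip (alpha b) (psi1_snd a b s n)" "alpha2 b m = ip (alpha b) (cosm m)"
  "beta1 a b s n = ip beta (psi1_snd a b s n)" "beta2 m = ip beta (cosm m)"
  by (simp_all add: alpha1_def alpha2_def beta1_def beta2_def inner_H0_def ip_def psi1_def psi2_def cosm_def)

text \<open>The factor \<open>n + 1\<close> for the first family comes from \<open>psi1_snd = O(1/n)\<close>; it compensates the growth of the output coefficients.\<close>
lemma input_bounds:
  "\<exists>C>0. \<forall>n. (real n + 1) * (\<bar>alpha1 a b s n\<bar> + \<bar>beta1 a b s n\<bar>) \<le> C \<and> \<bar>alpha2 b n\<bar> + \<bar>beta2 n\<bar> \<le> C"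
proof -
  obtain C1 where C1: "0 < C1" "\<And>n f. f \<in> L2_space \<Longrightarrow> (real n + 1) * \<bar>ip f (psi1_snd a b s n)\<bar> \<le> C1 * norm_L2 f"
    using ip_psi1_bound[of a b s] by metis
  let ?S = "norm_L2 (alpha b) + norm_L2 beta"
  let ?C = "(C1 + 1) * ?S + 1"
  have S: "0 \<le> ?S" by simp
  have "(real n + 1) * (\<bar>alpha1 a b s n\<bar> + \<bar>beta1 a b s n\<bar>) \<le> ?C \<and> \<bar>alpha2 b n\<bar> + \<bar>beta2 n\<bar> \<le> ?C" for n
  proof
    have "(real n + 1) * (\<bar>alpha1 a b s n\<bar> + \<bar>beta1 a b s n\<bar>) \<le> C1 * ?S"
      using C1(2)[OF varphi_L2(3), of n b] C1(2)[OF varphi_L2(4), of n] by (simp add: input_coefficients distrib_left)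
    moreover have "?C = C1 * ?S + ?S + 1" by (simp add: distrib_right)
    ultimately show "(real n + 1) * (\<bar>alpha1 a b s n\<bar> + \<bar>beta1 a b s n\<bar>) \<le> ?C" using S by linarith
    have "\<bar>alpha2 b n\<bar> + \<bar>beta2 n\<bar> \<le> ?S"
      unfolding input_coefficients by (intro add_mono orthonormal_ip_bound orthonormal_cosm varphi_L2)
    moreover have "0 \<le> C1 * ?S" using C1 S by simp
    ultimately show "\<bar>alpha2 b n\<bar> + \<bar>beta2 n\<bar> \<le> ?C" by (simp add: distrib_right)
  qed
  moreover have "0 < ?C" using C1 S by (simp add: add_nonneg_pos)
  ultimately show ?thesis by blast
qed

lemma measure_at_smooth:
  assumes "smooth_on_unit f f'" "\<xi> \<in> {0..1}"
  shows "measure_at meas \<xi> f = (case meas of Dirichlet \<Rightarrow> f \<xi> | Neumann \<Rightarrow> f' \<xi>)"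
  using Dx_eq[of f "f' \<xi>" \<xi>] assms by (cases meas) (auto simp: smooth_on_unit_def)

lemma smooth_phi1_dphi1: "smooth_on_unit (phi1 n) (dphi1 n)"
  unfolding dphi1_def[abs_def] by (rule smooth_phi1)

text \<open>Both kinds of measurement are covered by the larger bound, that of the derivative.\<close>
lemma output_bounds:
  assumes "\<xi> \<in> {0..1}"
  shows "\<exists>C>0. \<forall>n. \<bar>c1 meas \<xi> n\<bar> \<le> C * (real n + 1) \<and> \<bar>c2 meas \<xi> a b s n\<bar> \<le> C"
proof -
  obtain C where C: "0 < C" "\<And>m x. x \<in> {0..1} \<Longrightarrow> (real m + 1) * \<bar>phi2 a b s m x\<bar> \<le> C"
    "\<And>m x. x \<in> {0..1} \<Longrightarrow> \<bar>deriv (phi2 a b s m) x\<bar> \<le> C"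
    using phi2_bounds[of a b s] by metis
  have "\<bar>c1 meas \<xi> n\<bar> \<le> (C + 2 * pi) * (real n + 1)" for n
  proof -
    have "2 * 1 \<le> 2 * pi * (real n + 1)" using pi_ge_two by (intro mult_mono) auto
    then have "\<bar>c1 meas \<xi> n\<bar> \<le> 2 * pi * (real n + 1)"
      using abs_dphi1_le[of n \<xi>] trig_abs_le(2)[of n \<xi>]
      unfolding c1_def measure_at_smooth[OF smooth_phi1_dphi1 assms] by (cases meas) auto
    moreover have "0 \<le> C * (real n + 1)" using C by simp
    ultimately show ?thesis by (simp add: distrib_right)
  qed
  moreover have "\<bar>c2 meas \<xi> a b s n\<bar> \<le> C + 2 * pi" for n
  proof -
    have "\<bar>phi2 a b s n \<xi>\<bar> \<le> C"
      by (rule order_trans[OF le_real_Suc_mult C(2)[OF assms]]) simp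
    then have "\<bar>c2 meas \<xi> a b s n\<bar> \<le> C"
      using C(3)[OF assms, of n]
      unfolding c2_def measure_at_smooth[OF smooth_phi2 assms] by (cases meas) auto
    then show ?thesis using pi_gt_zero by linarith
  qed
  moreover have "0 < C + 2 * pi" using C(1) pi_gt_zero by linarith
  ultimately show ?thesis by blast
qed

lemma measurement_expansion:
  assumes "in_domain s y y' y'' g g' g''" "\<xi> \<in> {0..1}"
  shows "measure_at meas \<xi> y = (\<Sum>n. c1 meas \<xi> n * mode1 a b s n y g) + (\<Sum>m. c2 meas \<xi> a b s m * ip g (cosm m))"
    and "summable (\<lambda>n. \<bar>c1 meas \<xi> n * mode1 a b s n y g\<bar>)"
    and "summable (\<lambda>m. \<bar>c2 meas \<xi> a b s m * ip g (cosm m)\<bar>)"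
proof -
  obtain C where C: "0 < C" "\<And>n. \<bar>c1 meas \<xi> n\<bar> \<le> C * (real n + 1)" "\<And>n. \<bar>c2 meas \<xi> a b s n\<bar> \<le> C"
    using output_bounds[OF assms(2), of meas a b s] by blast
  show "measure_at meas \<xi> y = (\<Sum>n. c1 meas \<xi> n * mode1 a b s n y g) + (\<Sum>m. c2 meas \<xi> a b s m * ip g (cosm m))"
    unfolding measure_at_smooth[OF in_domainD(1)[OF assms(1)] assms(2)] c1_def c2_def
      measure_at_smooth[OF smooth_phi1_dphi1 assms(2)] measure_at_smooth[OF smooth_phi2 assms(2)]
    using expansion1[OF assms, of a b] by (cases meas) (simp_all add: mult.commute)
  show "summable (\<lambda>n. \<bar>c1 meas \<xi> n * mode1 a b s n y g\<bar>)"
  proof (rule summable_comparison_test'[OF summable_mult[OF summable_mode1[OF assms(1), of a b], of C], of 0])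
    fix n
    show "norm \<bar>c1 meas \<xi> n * mode1 a b s n y g\<bar> \<le> C * ((real n + 1) * \<bar>mode1 a b s n y g\<bar>)"
      using mult_right_mono[OF C(2), of "\<bar>mode1 a b s n y g\<bar>" n] by (simp add: abs_mult mult.assoc)
  qed
  show "summable (\<lambda>m. \<bar>c2 meas \<xi> a b s m * ip g (cosm m)\<bar>)"
  proof (rule summable_comparison_test'[OF summable_mult[OF summable_of_weighted[OF summable_mode2[OF assms(1)]], of C], of 0])
    fix m
    show "norm \<bar>c2 meas \<xi> a b s m * ip g (cosm m)\<bar> \<le> C * \<bar>ip g (cosm m)\<bar>"
      using mult_right_mono[OF C(3), of "\<bar>ip g (cosm m)\<bar>" m] by (simp add: abs_mult)
  qed
qed

text \<open>This converts a strict inequality at the first fast index, where \<open>X = R\<close>, into a quadratic lower bound at all later ones.\<close>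
lemma shifted_gap:
  fixes X R q :: real
  assumes "0 < R" "0 < q" "R \<le> X"
  shows "q / (R + q) * X \<le> X - R + q"
proof -
  have "(X - R + q) * (R + q) - q * X = R * (X - R) + q * q"
    by (simp add: algebra_simps)
  moreover have "0 \<le> R * (X - R) + q * q" using assms by simp
  ultimately have "q * X \<le> (X - R + q) * (R + q)" by linarith
  then show ?thesis using assms by (simp add: divide_le_eq mult.commute)
qed

lemma lam1_gap:
  assumes "lam1 a (N0 + 1) < - \<delta>"
  shows "\<exists>\<kappa>>0. \<forall>n>N0. \<kappa> * (real n + 1)\<^sup>2 \<le> - lam1 a n - \<delta>"
proof -
  let ?X = "\<lambda>n. ((real n + 1/2) * pi)\<^sup>2"
  let ?R = "?X (N0 + 1)" and ?q = "- lam1 a (N0 + 1) - \<delta>"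
  have R: "0 < ?R" by (simp add: add_nonneg_pos)
  have q: "0 < ?q" using assms by simp
  have lam: "lam1 a n = a - ?X n" for n by (simp add: lam1_def power_mult_distrib)
  have "?q / (?R + ?q) * (real n + 1)\<^sup>2 \<le> - lam1 a n - \<delta>" if "N0 < n" for n
  proof -
    \<comment> \<open>monotonicity of the eigenvalues reduces the claim to the first fast index\<close>
    have "?R \<le> ?X n" using that by (intro power_mono mult_right_mono) auto
    from shifted_gap[OF R q this] have "?q / (?R + ?q) * ?X n \<le> - lam1 a n - \<delta>" unfolding lam by simp
    moreover have "?q / (?R + ?q) * (real n + 1)\<^sup>2 \<le> ?q / (?R + ?q) * ?X n"
      by (intro mult_left_mono sq_le_half_pi_sq divide_nonneg_pos less_imp_le[OF q] add_pos_pos[OF R q])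
    ultimately show ?thesis by linarith
  qed
  moreover have "0 < ?q / (?R + ?q)" by (rule divide_pos_pos[OF q add_pos_pos[OF R q]])
  ultimately show ?thesis by blast
qed

lemma lam2_gap:
  assumes "lam2 b (M0 + 1) < - \<delta>"
  shows "\<exists>\<kappa>>0. \<forall>m>M0. \<kappa> * (real m + 1)\<^sup>2 \<le> - lam2 b m - \<delta>"
proof -
  let ?X = "\<lambda>m. (real m * pi)\<^sup>2"
  let ?R = "?X (M0 + 1)" and ?q = "- lam2 b (M0 + 1) - \<delta>"
  have R: "0 < ?R" by (simp add: add_nonneg_pos)
  have q: "0 < ?q" using assms by simp
  have lam: "lam2 b m = b - ?X m" for m by (simp add: lam2_def power_mult_distrib)
  have "?q / (?R + ?q) * (real m + 1)\<^sup>2 \<le> - lam2 b m - \<delta>" if "M0 < m" for m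
  proof -
    have "?R \<le> ?X m" using that by (intro power_mono mult_right_mono) auto
    from shifted_gap[OF R q this] have "?q / (?R + ?q) * ?X m \<le> - lam2 b m - \<delta>" unfolding lam by simp
    moreover have "(real m + 1)\<^sup>2 \<le> ?X m"
    proof (rule power_mono)
      show "real m + 1 \<le> real m * pi"
        using that mult_left_mono[OF pi_ge_two, of "real m"] by linarith
    qed simp
    then have "?q / (?R + ?q) * (real m + 1)\<^sup>2 \<le> ?q / (?R + ?q) * ?X m"
      by (intro mult_left_mono divide_nonneg_pos less_imp_le[OF q] add_pos_pos[OF R q])
    ultimately show ?thesis by linarith
  qed
  moreover have "0 < ?q / (?R + ?q)" by (rule divide_pos_pos[OF q add_pos_pos[OF R q]])
  ultimately show ?thesis by blast
qed

lemma norm_H1_ip: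
  assumes "y \<in> H2_space" "z \<in> H2_space"
  shows "(norm_H1 (y, z))\<^sup>2 = ip (Dx y) (Dx y) + ip z z + ip (Dx z) (Dx z)"
proof -
  have L: "Dx y \<in> L2_space" "Dx z \<in> L2_space" "z \<in> L2_space"
    using H2_space_smooth[OF assms(1)] H2_space_smooth[OF assms(2)] weak_deriv_L2 smooth_imp_weak_deriv by blast+
  have "inner_H1 (y, z) (y, z) = ip (Dx y) (Dx y) + ip z z + ip (Dx z) (Dx z)"
    using integrable_ip[OF L(1,1)] integrable_ip[OF L(2,2)] integrable_ip[OF L(3,3)]
    by (simp add: inner_H1_def ip_def)
  moreover have "0 \<le> ip (Dx y) (Dx y) + ip z z + ip (Dx z) (Dx z)"
    using ip_nonneg[of "Dx y"] ip_nonneg[of z] ip_nonneg[of "Dx z"] by linarith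
  ultimately show ?thesis by (simp add: norm_H1_def)
qed

lemma ip_shift_square_le:
  assumes "f \<in> L2_space" "continuous_on {0..1} h" "\<And>x. x \<in> {0..1} \<Longrightarrow> \<bar>h x\<bar> \<le> 1"
  shows "ip (\<lambda>x. f x + c * h x) (\<lambda>x. f x + c * h x) \<le> 2 * ip f f + 2 * c\<^sup>2"
proof -
  have L: "(\<lambda>x. c * h x) \<in> L2_space" by (rule L2_space_scale[OF L2_space_continuous[OF assms(2)]])
  have "ip (\<lambda>x. c * h x) (\<lambda>x. c * h x) = c\<^sup>2 * ip h h"
    unfolding ip_scale_left ip_scale_right by (simp add: power2_eq_square)
  also have "\<dots> \<le> c\<^sup>2 * 1\<^sup>2" by (intro mult_left_mono ip_bound[OF assms(3,2)]) auto
  finally show ?thesis using ip_add_square_le[OF assms(1) L] by simp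
qed

lemma abs_varphi_le: "x \<in> {0..1} \<Longrightarrow> \<bar>varphi x\<bar> \<le> 1"
proof -
  assume x: "x \<in> {0..1}"
  then have "0 \<le> x * (2 - x)" "x * (2 - x) \<le> 2" using mult_mono[of x 1 "2 - x" 2] by auto
  then show ?thesis by (simp add: varphi_def power2_eq_square algebra_simps abs_le_iff)
qed

lemma square_bounds_combine:
  fixes A B C B' C' w :: real
  assumes "0 \<le> A" "B \<le> 2 * B' + 2 * w" "C \<le> 2 * C' + 2 * w"
  shows "A + B + C \<le> 2 * (A + B' + C') + 4 * w"
  using assms by (simp add: distrib_left)

text \<open>The state is homogenized here: subtracting \<open>u * varphi\<close> moves the boundary input of \<open>z\<close> into the interior, at the price of
the derivative \<open>v\<close> of \<open>u\<close> as a second input.\<close>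
locale plant =
  fixes a b s :: real and y0 z0 :: "real \<Rightarrow> real" and u v :: "real \<Rightarrow> real" and y z :: "real \<Rightarrow> real \<Rightarrow> real"
  assumes P: "plant_solution a b s y0 z0 u y z" and uv: "C0_C1_solution u v"
begin

definition zt where "zt t x = z t x - u t * varphi x"
definition zt' where "zt' t x = Dx (z t) x - u t * (1 - x)"
definition zt'' where "zt'' t x = Dx (Dx (z t)) x - u t * - 1"

lemma H2: "0 \<le> t \<Longrightarrow> y t \<in> H2_space" "0 \<le> t \<Longrightarrow> z t \<in> H2_space"
  using P by (auto simp: plant_solution_def)

lemma domain:
  assumes "0 \<le> t"
  shows "in_domain s (y t) (Dx (y t)) (Dx (Dx (y t))) (zt t) (zt' t) (zt'' t)"
proof -
  note Y = H2_space_smooth[OF H2(1)[OF assms]] and Z = H2_space_smooth[OF H2(2)[OF assms]]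
  have "smooth_on_unit (zt t) (zt' t)"
    using smooth_on_unit_add[OF Z(1) smooth_on_unit_scale[OF smooth_varphi(1), of "- u t"]]
    by (simp add: zt_def[abs_def] zt'_def[abs_def])
  moreover have "weak_deriv (zt' t) (zt'' t)"
    using weak_deriv_add_scale[OF Z(2) smooth_imp_weak_deriv[OF smooth_varphi(2)], of "- u t"]
    by (simp add: zt'_def[abs_def] zt''_def[abs_def])
  ultimately show ?thesis
    using P assms Y unfolding in_domain_def plant_solution_def
    by (simp add: zt_def zt'_def varphi_def)
qed

lemma L2_facts:
  assumes "0 \<le> t"
  shows "y t \<in> L2_space" "z t \<in> L2_space" "Dx (Dx (y t)) \<in> L2_space" "Dx (Dx (z t)) \<in> L2_space"
    "Dx (y t) \<in> L2_space" "Dx (z t) \<in> L2_space"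
  using H2_space_smooth[OF H2(1)[OF assms]] H2_space_smooth[OF H2(2)[OF assms]] weak_deriv_L2 smooth_imp_weak_deriv
  by blast+

lemma generator_L2:
  assumes "0 < t"
  shows "(\<lambda>x. Dx (Dx (y t)) x + a * y t x) \<in> L2_space" "(\<lambda>x. Dx (Dx (z t)) x + b * z t x) \<in> L2_space"
  using L2_facts[of t] assms by (auto intro!: L2_space_add L2_space_scale)

definition X1 where "X1 n t = mode1 a b s n (y t) (zt t)"
definition X2 where "X2 m t = ip (zt t) (cosm m)"

lemma ip_zt: "0 \<le> t \<Longrightarrow> \<psi> \<in> L2_space \<Longrightarrow> ip (zt t) \<psi> = ip (z t) \<psi> + u t * ip beta \<psi>"
proof -
  assume t: "0 \<le> t" and \<psi>: "\<psi> \<in> L2_space"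
  have "zt t = (\<lambda>x. z t x + u t * beta x)" by (simp add: zt_def[abs_def] beta_def)
  then show ?thesis
    using ip_add_left[OF L2_facts(2)[OF t] L2_space_scale[OF varphi_L2(4)] \<psi>] by (simp only: ip_scale_left)
qed

lemma ip_generator:
  assumes t: "0 < t" and \<psi>: "\<psi> \<in> L2_space"
  shows "ip (\<lambda>x. Dx (Dx (z t)) x + b * z t x) \<psi> = ip (\<lambda>x. zt'' t x + b * zt t x) \<psi> + u t * ip (alpha b) \<psi>"
proof -
  have t0: "0 \<le> t" using t by simp
  have L: "(\<lambda>x. zt'' t x + b * zt t x) \<in> L2_space"
    using in_domainD(14,16)[OF domain[OF t0]] by (auto intro!: L2_space_add L2_space_scale)
  have "(\<lambda>x. Dx (Dx (z t)) x + b * z t x) = (\<lambda>x. (zt'' t x + b * zt t x) + u t * alpha b x)"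
    by (rule ext) (simp add: zt''_def zt_def alpha_eq algebra_simps)
  then show ?thesis
    using ip_add_left[OF L L2_space_scale[OF varphi_L2(3)] \<psi>] by (simp only: ip_scale_left)
qed

lemma derivative_ip:
  assumes "\<psi> \<in> L2_space"
  shows "0 < t \<Longrightarrow> ((\<lambda>t. ip (y t) \<psi>) has_real_derivative ip (\<lambda>x. Dx (Dx (y t)) x + a * y t x) \<psi>) (at t)"
    "continuous_on {0..} (\<lambda>t. ip (y t) \<psi>)"
    "0 < t \<Longrightarrow> ((\<lambda>t. ip (zt t) \<psi>) has_real_derivative
        ip (\<lambda>x. zt'' t x + b * zt t x) \<psi> + ip (alpha b) \<psi> * u t + ip beta \<psi> * v t) (at t)"
    "continuous_on {0..} (\<lambda>t. ip (zt t) \<psi>)"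
proof -
  have cy: "L2_classical y (\<lambda>t x. Dx (Dx (y t)) x + a * y t x)" and cz: "L2_classical z (\<lambda>t x. Dx (Dx (z t)) x + b * z t x)"
    using P by (auto simp: plant_solution_def)
  show "0 < t \<Longrightarrow> ((\<lambda>t. ip (y t) \<psi>) has_real_derivative ip (\<lambda>x. Dx (Dx (y t)) x + a * y t x) \<psi>) (at t)"
    "continuous_on {0..} (\<lambda>t. ip (y t) \<psi>)"
    by (rule L2_classical_ip[OF cy L2_facts(1) generator_L2(1) assms]; simp)+
  have u: "continuous_on {0..} u" "\<And>t. 0 < t \<Longrightarrow> (u has_real_derivative v t) (at t)"
    using uv by (auto simp: C0_C1_solution_def)
  have eq: "ip (zt t) \<psi> = ip (z t) \<psi> + u t * ip beta \<psi>" if "0 \<le> t" for t by (rule ip_zt[OF that assms])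
  show "continuous_on {0..} (\<lambda>t. ip (zt t) \<psi>)"
  proof -
    have "continuous_on {0..} (\<lambda>t. ip (z t) \<psi>)"
      by (rule L2_classical_ip(2)[OF cz L2_facts(2) generator_L2(2) assms]; simp)
    then have "continuous_on {0..} (\<lambda>t. ip (z t) \<psi> + u t * ip beta \<psi>)"
      using u(1) by (intro continuous_intros)
    then show ?thesis by (subst continuous_on_cong[OF refl eq]) auto
  qed
  show "((\<lambda>t. ip (zt t) \<psi>) has_real_derivative
        ip (\<lambda>x. zt'' t x + b * zt t x) \<psi> + ip (alpha b) \<psi> * u t + ip beta \<psi> * v t) (at t)" if t: "0 < t"
  proof -
    have "((\<lambda>t. ip (z t) \<psi>) has_real_derivative ip (\<lambda>x. Dx (Dx (z t)) x + b * z t x) \<psi>) (at t)"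
      by (rule L2_classical_ip(1)[OF cz L2_facts(2) generator_L2(2) assms t]; simp)
    then have "((\<lambda>t. ip (z t) \<psi> + u t * ip beta \<psi>) has_real_derivative
        ip (\<lambda>x. zt'' t x + b * zt t x) \<psi> + ip (alpha b) \<psi> * u t + ip beta \<psi> * v t) (at t)"
      using u(2)[OF t] ip_generator[OF t assms] by (auto intro!: derivative_eq_intros)
    then show ?thesis
      by (rule has_field_derivative_transform_within[where d = t])
         (use t in \<open>auto simp: dist_real_def intro!: eq[symmetric]\<close>)
  qed
qed

lemma X1_ode:
  "continuous_on {0..} (X1 n)"
  "0 < t \<Longrightarrow> (X1 n has_real_derivative (lam1 a n * X1 n t - resonance1 a b s n * X2 (partner1 a b n) t)
     + (alpha1 a b s n * u t + beta1 a b s n * v t)) (at t)"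
proof -
  have X1: "X1 n = (\<lambda>t. ip (y t) (phi1 n) + ip (zt t) (psi1_snd a b s n))"
    by (rule ext) (simp add: X1_def mode1_def)
  show "continuous_on {0..} (X1 n)"
    unfolding X1 by (intro continuous_intros derivative_ip phi1_L2 psi1_snd_L2)
  assume t: "0 < t"
  note D = in_domainD[OF domain, of t]
  have "(X1 n has_real_derivative mode1 a b s n (\<lambda>x. Dx (Dx (y t)) x + a * y t x) (\<lambda>x. zt'' t x + b * zt t x)
      + (alpha1 a b s n * u t + beta1 a b s n * v t)) (at t)"
    unfolding X1 mode1_def input_coefficients
    by (rule DERIV_cong[OF DERIV_add[OF derivative_ip(1)[OF phi1_L2 t] derivative_ip(3)[OF psi1_snd_L2 t]]]) simp
  then show "(X1 n has_real_derivative (lam1 a n * X1 n t - resonance1 a b s n * X2 (partner1 a b n) t)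
     + (alpha1 a b s n * u t + beta1 a b s n * v t)) (at t)"
    using mode1_generator[OF D(2,3,7,5,6,9,10,8), of a b n] t unfolding X1_def X2_def by simp
qed

lemma X2_ode:
  "continuous_on {0..} (X2 m)"
  "0 < t \<Longrightarrow> (X2 m has_real_derivative lam2 b m * X2 m t + (alpha2 b m * u t + beta2 m * v t)) (at t)"
proof -
  have X2: "X2 m = (\<lambda>t. ip (zt t) (cosm m))" by (rule ext) (simp add: X2_def)
  show "continuous_on {0..} (X2 m)" unfolding X2 by (rule derivative_ip(4)[OF cosm_L2])
  assume t: "0 < t"
  note D = in_domainD[OF domain, of t]
  show "(X2 m has_real_derivative lam2 b m * X2 m t + (alpha2 b m * u t + beta2 m * v t)) (at t)"
    using derivative_ip(3)[OF cosm_L2 t, of m] mode2_generator[OF D(5,6,9,10), of b m] t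
    unfolding X2 input_coefficients by (simp add: add.assoc)
qed

text \<open>Passing between \<open>z\<close> and the homogenized \<open>zt\<close> costs a factor and a multiple of \<open>u^2\<close>, in either direction.\<close>
lemma H1_norm_upper:
  assumes "0 \<le> t"
  shows "(norm_H1 (y t, z t))\<^sup>2 \<le> 2 * (ip (Dx (y t)) (Dx (y t)) + ip (zt t) (zt t) + ip (zt' t) (zt' t)) + 4 * (u t)\<^sup>2"
proof -
  note D = in_domainD[OF domain[OF assms]]
  have "z t = (\<lambda>x. zt t x + u t * varphi x)" "Dx (z t) = (\<lambda>x. zt' t x + u t * (1 - x))"
    by (simp_all add: zt_def[abs_def] zt'_def[abs_def])
  then have "ip (z t) (z t) \<le> 2 * ip (zt t) (zt t) + 2 * (u t)\<^sup>2" "ip (Dx (z t)) (Dx (z t)) \<le> 2 * ip (zt' t) (zt' t) + 2 * (u t)\<^sup>2"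
    using ip_shift_square_le[OF D(14) smooth_on_unit_continuous[OF smooth_varphi(1)] abs_varphi_le, of "u t"]
      ip_shift_square_le[OF D(15) smooth_on_unit_continuous[OF smooth_varphi(2)], of "u t"] by auto
  then show ?thesis
    unfolding norm_H1_ip[OF H2(1)[OF assms] H2(2)[OF assms]] by (rule square_bounds_combine[OF ip_nonneg])
qed

lemma H1_norm_lower:
  assumes "0 \<le> t"
  shows "ip (Dx (y t)) (Dx (y t)) + ip (zt t) (zt t) + ip (zt' t) (zt' t) \<le> 2 * (norm_H1 (y t, z t))\<^sup>2 + 4 * (u t)\<^sup>2"
proof -
  have "zt t = (\<lambda>x. z t x + - u t * varphi x)" "zt' t = (\<lambda>x. Dx (z t) x + - u t * (1 - x))"
    by (simp_all add: zt_def[abs_def] zt'_def[abs_def])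
  then have "ip (zt t) (zt t) \<le> 2 * ip (z t) (z t) + 2 * (u t)\<^sup>2" "ip (zt' t) (zt' t) \<le> 2 * ip (Dx (z t)) (Dx (z t)) + 2 * (u t)\<^sup>2"
    using ip_shift_square_le[OF L2_facts(2)[OF assms] smooth_on_unit_continuous[OF smooth_varphi(1)] abs_varphi_le, of "- u t"]
      ip_shift_square_le[OF L2_facts(6)[OF assms] smooth_on_unit_continuous[OF smooth_varphi(2)], of "- u t"] by auto
  then show ?thesis
    unfolding norm_H1_ip[OF H2(1)[OF assms] H2(2)[OF assms]] by (rule square_bounds_combine[OF ip_nonneg])
qed

end

section \<open>Families of stable modes\<close>

definition inv_sq :: "nat \<Rightarrow> real" where
  "inv_sq m = 1 / (real m + 1)\<^sup>2"

lemma inv_sq_summable: "summable inv_sq"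
  unfolding inv_sq_def[abs_def] by (rule summable_inverse_squares)

lemma inv_sq_pos: "0 < inv_sq m"
  by (simp add: inv_sq_def add_nonneg_pos)

lemma inv_sq_cancel: "(real m + 1)\<^sup>2 * inv_sq m = 1"
  by (simp add: inv_sq_def add_nonneg_eq_0_iff)

lemma inverse_gap_le:
  assumes "0 < \<kappa>" "\<kappa> * (real m + 1)\<^sup>2 \<le> p"
  shows "0 < p" "1 / p \<le> inv_sq m / \<kappa>"
proof -
  have r: "0 < \<kappa> * (real m + 1)\<^sup>2" using assms(1) by (simp add: add_nonneg_pos)
  then show "0 < p" using assms(2) by linarith
  have "1 / p \<le> 1 / (\<kappa> * (real m + 1)\<^sup>2)" using r assms(2) by (intro divide_left_mono) auto
  then show "1 / p \<le> inv_sq m / \<kappa>" by (simp add: inv_sq_def mult.commute)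
qed

text \<open>All modes above \<open>K0\<close> decay faster than \<open>\<delta>\<close>, with a quadratically growing margin.\<close>
locale mode_gap =
  fixes \<delta> \<kappa> :: real and K0 :: nat and lam :: "nat \<Rightarrow> real"
  assumes \<kappa>: "0 < \<kappa>" and gap: "\<And>m. K0 < m \<Longrightarrow> \<kappa> * (real m + 1)\<^sup>2 \<le> - lam m - \<delta>"
begin

text \<open>Below the threshold the value is 1, so that the rate is positive for all indices, as series over all of them require.\<close>
definition rate where "rate m = (if K0 < m then - lam m - \<delta> else 1)"

lemma rate_pos: "0 < rate m"
  using inverse_gap_le(1)[OF \<kappa> gap, of m] by (simp add: rate_def)

lemma exp_lam: "K0 < m \<Longrightarrow> exp (lam m * t) = exp (- \<delta> * t) * exp (- (rate m * t))"
  unfolding exp_add[symmetric] by (simp add: rate_def algebra_simps)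

lemma weights_summable:
  assumes Q0: "0 \<le> Q" and Q: "\<And>m. 0 \<le> w m" "\<And>m. K0 < m \<Longrightarrow> w m \<le> Q"
  defines "g \<equiv> \<lambda>m. if K0 < m then w m else 0"
  shows "summable (\<lambda>m. g m / rate m)" "(\<Sum>m. g m / rate m) \<le> Q / \<kappa> * (\<Sum>m. inv_sq m)" "\<And>m. 0 \<le> g m"
proof -
  show g0: "0 \<le> g m" for m using Q by (simp add: g_def)
  have gr: "g m / rate m \<le> Q / \<kappa> * inv_sq m" for m
  proof (cases "K0 < m")
    case True
    have "g m / rate m \<le> Q * (1 / rate m)"
      using Q(2)[of m] rate_pos[of m] True by (simp add: g_def divide_right_mono)
    also have "\<dots> \<le> Q * (inv_sq m / \<kappa>)"
      using inverse_gap_le(2)[OF \<kappa> gap[OF True]] True by (intro mult_left_mono Q0) (simp add: rate_def)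
    finally show ?thesis by simp
  next
    case False
    then show ?thesis using Q0 \<kappa> inv_sq_pos[of m] by (simp add: g_def)
  qed
  show s: "summable (\<lambda>m. g m / rate m)"
  proof (rule summable_comparison_test'[OF summable_mult[OF inv_sq_summable, of "Q / \<kappa>"], of 0])
    show "norm (g m / rate m) \<le> Q / \<kappa> * inv_sq m" for m
      using gr[of m] g0[of m] rate_pos[of m] by simp
  qed
  show "(\<Sum>m. g m / rate m) \<le> Q / \<kappa> * (\<Sum>m. inv_sq m)"
    using suminf_le[OF gr s summable_mult[OF inv_sq_summable]] suminf_mult[OF inv_sq_summable, of "Q / \<kappa>"] by simp
qed

end

text \<open>The forcing \<open>f m\<close> is of size \<open>\<sigma> m * U\<close>, where \<open>\<sigma> m\<close> is the input coefficient of the mode and \<open>U\<close> is the decay bound of the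
input.\<close>
locale mode_family = mode_gap \<delta> \<kappa> K0 lam
  for \<delta> \<kappa> :: real and K0 :: nat and lam :: "nat \<Rightarrow> real" +
  fixes T U :: real and \<sigma> :: "nat \<Rightarrow> real" and f :: "nat \<Rightarrow> real \<Rightarrow> real"
  assumes U: "0 \<le> U" and \<sigma>: "\<And>m. 0 \<le> \<sigma> m"
    and f: "\<And>m t. t \<in> {0<..<T} \<Longrightarrow> \<bar>f m t\<bar> \<le> exp (- \<delta> * t) * (\<sigma> m * U)"
begin

lemma forced_bound:
  assumes c: "continuous_on {0..T} x" and m: "K0 < m"
    and d: "\<And>t. t \<in> {0<..<T} \<Longrightarrow> (x has_real_derivative lam m * x t + f m t) (at t)"
    and t: "t \<in> {0..T}"
  shows "\<bar>x t\<bar> \<le> exp (- \<delta> * t) * (exp (- (rate m * t)) * \<bar>x 0\<bar> + \<sigma> m * inv_sq m / \<kappa> * U)"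
proof -
  have p: "0 < - lam m - \<delta>" "1 / (- lam m - \<delta>) \<le> inv_sq m / \<kappa>" using inverse_gap_le[OF \<kappa> gap[OF m]] by auto
  have "\<bar>x t\<bar> \<le> exp (lam m * t) * \<bar>x 0\<bar> + exp (- \<delta> * t) * (\<sigma> m * U / (- lam m - \<delta>))"
    by (rule real_mode_decay[OF c d _ _ f t]) (use p U \<sigma>[of m] in auto)
  also have "\<sigma> m * U / (- lam m - \<delta>) \<le> \<sigma> m * inv_sq m / \<kappa> * U"
    using mult_left_mono[OF p(2), of "\<sigma> m * U"] U \<sigma>[of m] by (simp add: mult_ac)
  finally show ?thesis unfolding exp_lam[OF m] by (simp add: algebra_simps)
qed

lemma free_bound:
  assumes c: "continuous_on {0..T} x" and m: "K0 < m"
    and d: "\<And>t. t \<in> {0<..<T} \<Longrightarrow> (x has_real_derivative lam m * x t) (at t)"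
    and t: "t \<in> {0..T}"
  shows "\<bar>x t\<bar> \<le> exp (- \<delta> * t) * (exp (- (rate m * t)) * \<bar>x 0\<bar>)"
proof -
  have p: "0 < - lam m - \<delta>" using inverse_gap_le[OF \<kappa> gap[OF m]] by auto
  have "\<bar>x t\<bar> \<le> exp (lam m * t) * \<bar>x 0\<bar> + exp (- \<delta> * t) * (0 / (- lam m - \<delta>))"
    by (rule real_mode_decay[where r = "\<lambda>_. 0", OF c _ _ _ _ t]) (use p d in auto)
  then show ?thesis by (simp add: exp_lam[OF m])
qed

text \<open>The output of the family minus the slow modes and minus the observer's copies \<open>xh\<close> of the modes up to \<open>k\<close>. For those modes
the forcing cancels in the difference with the copy. Beyond \<open>k\<close> the forcing remains, but its effect
is bounded by the tail of \<open>\<Sum> inv_sq\<close>, since \<open>|c m| * \<sigma> m\<close> is bounded.\<close>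
lemma observed_tail:
  fixes X xh :: "nat \<Rightarrow> real \<Rightarrow> real" and c :: "nat \<Rightarrow> real"
  assumes X: "\<And>m. K0 < m \<Longrightarrow> continuous_on {0..T} (X m)"
      "\<And>m t. K0 < m \<Longrightarrow> t \<in> {0<..<T} \<Longrightarrow> (X m has_real_derivative lam m * X m t + f m t) (at t)"
    and xh: "\<And>m. m \<in> {K0 + 1..k} \<Longrightarrow> continuous_on {0..T} (xh m)"
      "\<And>m t. m \<in> {K0 + 1..k} \<Longrightarrow> t \<in> {0<..<T} \<Longrightarrow> (xh m has_real_derivative lam m * xh m t + f m t) (at t)"
    and k: "K0 \<le> k" and C: "\<And>m. \<bar>c m\<bar> * \<sigma> m \<le> C"
    and Q: "0 \<le> Q" "\<And>m. K0 < m \<Longrightarrow> \<bar>c m\<bar> * (\<bar>X m 0\<bar> + (if m \<le> k then \<bar>xh m 0\<bar> else 0)) \<le> Q"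
  defines "g \<equiv> \<lambda>m. if K0 < m then \<bar>c m\<bar> * (\<bar>X m 0\<bar> + (if m \<le> k then \<bar>xh m 0\<bar> else 0)) else 0"
  assumes t: "t \<in> {0<..<T}" and S: "(\<lambda>m. c m * X m t) sums S"
  shows "\<bar>S - (\<Sum>m\<le>K0. c m * X m t) - (\<Sum>m = K0 + 1..k. c m * xh m t)\<bar>
        \<le> exp (- \<delta> * t) * ((\<Sum>m. g m * exp (- (rate m * t))) + C / \<kappa> * (\<Sum>m. inv_sq (m + Suc k)) * U)"
proof -
  have w: "0 \<le> \<bar>c m\<bar> * (\<bar>X m 0\<bar> + (if m \<le> k then \<bar>xh m 0\<bar> else 0))" for m by simp
  have s: "summable (\<lambda>m. g m / rate m)"
    unfolding g_def by (rule weights_summable(1)[where w = "\<lambda>m. \<bar>c m\<bar> * (\<bar>X m 0\<bar> + (if m \<le> k then \<bar>xh m 0\<bar> else 0))", OF Q(1) w Q(2)])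
  have g0: "0 \<le> g m" for m by (simp add: g_def)
  have t': "t \<in> {0..T}" "0 < t" using t by auto
  \<comment> \<open>the terms to be subtracted, arranged as a series: plant modes up to K0, copies up to k, nothing beyond\<close>
  define l where "l = (\<lambda>m. if m \<le> K0 then X m t else if m \<le> k then xh m t else 0)"
  define q where "q = (\<lambda>m. if k < m then C / \<kappa> * inv_sq m else 0)"
  have "(\<lambda>m. c m * l m) sums (\<Sum>m\<le>k. c m * l m)"
    by (rule sums_finite) (use k in \<open>auto simp: l_def\<close>)
  also have "(\<Sum>m\<le>k. c m * l m) = (\<Sum>m\<le>K0. c m * X m t) + (\<Sum>m = K0 + 1..k. c m * xh m t)"
  proof -
    have "{..k} = {..K0} \<union> {K0 + 1..k}" using k by auto
    then have "(\<Sum>m\<le>k. c m * l m) = (\<Sum>m\<in>{..K0} \<union> {K0 + 1..k}. c m * l m)" by simp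
    also have "\<dots> = (\<Sum>m\<le>K0. c m * l m) + (\<Sum>m = K0 + 1..k. c m * l m)"
      by (rule sum.union_disjoint) auto
    finally show ?thesis by (simp add: l_def)
  qed
  finally have sums: "(\<lambda>m. c m * X m t - c m * l m) sums
      (S - ((\<Sum>m\<le>K0. c m * X m t) + (\<Sum>m = K0 + 1..k. c m * xh m t)))"
    by (rule sums_diff[OF S])
  have C0: "0 \<le> C" using order_trans[OF _ C[of 0]] \<sigma>[of 0] by simp
  have b: "norm (c m * X m t - c m * l m) \<le> exp (- \<delta> * t) * (g m * exp (- (rate m * t)) + q m * U)" for m
  proof -
    consider "m \<le> K0" | "K0 < m" "m \<le> k" | "K0 < m" "k < m" by linarith
    then show ?thesis
    proof cases
      case 1
      then show ?thesis using k by (simp add: l_def q_def g_def)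
    next
      case 2
      then have mk: "m \<in> {K0 + 1..k}" by simp
      have "\<bar>X m t - xh m t\<bar> \<le> exp (- \<delta> * t) * (exp (- (rate m * t)) * \<bar>X m 0 - xh m 0\<bar>)"
      proof (rule free_bound[OF _ 2(1) _ t'(1)])
        show "continuous_on {0..T} (\<lambda>t. X m t - xh m t)"
          by (intro continuous_intros X(1) xh(1) mk 2)
        show "((\<lambda>t. X m t - xh m t) has_real_derivative lam m * (X m t - xh m t)) (at t)" if "t \<in> {0<..<T}" for t
          by (rule DERIV_cong[OF DERIV_diff[OF X(2)[OF 2(1) that] xh(2)[OF mk that]]]) (simp add: algebra_simps)
      qed
      also have "\<dots> \<le> exp (- \<delta> * t) * (exp (- (rate m * t)) * (\<bar>X m 0\<bar> + \<bar>xh m 0\<bar>))"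
        by (intro mult_left_mono) auto
      finally have "\<bar>c m\<bar> * \<bar>X m t - xh m t\<bar> \<le> \<bar>c m\<bar> * (exp (- \<delta> * t) * (exp (- (rate m * t)) * (\<bar>X m 0\<bar> + \<bar>xh m 0\<bar>)))"
        by (intro mult_left_mono) auto
      then show ?thesis
        using 2 by (simp add: l_def q_def g_def mult_ac flip: abs_mult right_diff_distrib)
    next
      case 3
      have "\<bar>X m t\<bar> \<le> exp (- \<delta> * t) * (exp (- (rate m * t)) * \<bar>X m 0\<bar> + \<sigma> m * inv_sq m / \<kappa> * U)"
        by (rule forced_bound[OF X(1)[OF 3(1)] 3(1) X(2)[OF 3(1)] t'(1)])
      then have "\<bar>c m\<bar> * \<bar>X m t\<bar> \<le> \<bar>c m\<bar> * (exp (- \<delta> * t) * (exp (- (rate m * t)) * \<bar>X m 0\<bar> + \<sigma> m * inv_sq m / \<kappa> * U))"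
        by (intro mult_left_mono) auto
      also have "\<dots> = exp (- \<delta> * t) * (g m * exp (- (rate m * t)) + (\<bar>c m\<bar> * \<sigma> m) * (inv_sq m / \<kappa> * U))"
        using 3 by (simp add: g_def algebra_simps)
      also have "\<dots> \<le> exp (- \<delta> * t) * (g m * exp (- (rate m * t)) + C * (inv_sq m / \<kappa> * U))"
        using C[of m] U \<kappa> inv_sq_pos[of m] by (intro mult_left_mono add_left_mono mult_right_mono) auto
      finally show ?thesis using 3 by (simp add: l_def q_def abs_mult mult_ac)
    qed
  qed
  have sg: "summable (\<lambda>m. g m * exp (- (rate m * t)))"
    by (rule relaxation_series(1)[OF rate_pos g0 s t'(2)])
  have sq: "summable q"
    by (rule summable_comparison_test'[OF summable_mult[OF inv_sq_summable, of "C / \<kappa>"], of 0])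
       (use C0 \<kappa> inv_sq_pos in \<open>auto simp: q_def less_imp_le\<close>)
  have qs: "(\<Sum>m. q m) = C / \<kappa> * (\<Sum>m. inv_sq (m + Suc k))"
  proof -
    have "(\<Sum>m. q m) = (\<Sum>m. q (m + Suc k)) + (\<Sum>i<Suc k. q i)"
      by (rule suminf_split_initial_segment[OF sq])
    also have "(\<Sum>i<Suc k. q i) = 0" by (intro sum.neutral) (auto simp: q_def)
    also have "(\<Sum>m. q (m + Suc k)) = (\<Sum>m. C / \<kappa> * inv_sq (m + Suc k))" by (simp add: q_def)
    also have "\<dots> = C / \<kappa> * (\<Sum>m. inv_sq (m + Suc k))"
      by (rule suminf_mult) (use inv_sq_summable in \<open>simp only: summable_iff_shift\<close>)
    finally show ?thesis by simp
  qed
  have sb: "summable (\<lambda>m. exp (- \<delta> * t) * (g m * exp (- (rate m * t)) + q m * U))"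
    by (intro summable_mult summable_add sg summable_mult2 sq)
  have "norm (\<Sum>m. c m * X m t - c m * l m) \<le> (\<Sum>m. exp (- \<delta> * t) * (g m * exp (- (rate m * t)) + q m * U))"
    by (rule norm_suminf_le[OF b sb])
  also have "\<dots> = exp (- \<delta> * t) * ((\<Sum>m. g m * exp (- (rate m * t))) + (\<Sum>m. q m) * U)"
    by (simp only: suminf_mult[OF summable_add[OF sg summable_mult2[OF sq]]] suminf_add[OF sg summable_mult2[OF sq], symmetric]
        suminf_mult2[OF sq, symmetric])
  finally show "\<bar>S - (\<Sum>m\<le>K0. c m * X m t) - (\<Sum>m = K0 + 1..k. c m * xh m t)\<bar>
        \<le> exp (- \<delta> * t) * ((\<Sum>m. g m * exp (- (rate m * t))) + C / \<kappa> * (\<Sum>m. inv_sq (m + Suc k)) * U)"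
    using sums_unique[OF sums] by (simp add: qs diff_diff_eq)
qed

lemma pointwise_square_bound:
  assumes c: "continuous_on {0..T} x" and m: "K0 < m"
    and d: "\<And>t. t \<in> {0<..<T} \<Longrightarrow> (x has_real_derivative lam m * x t + f m t) (at t)"
    and t: "t \<in> {0..T}" and C: "\<sigma> m \<le> C"
  shows "((real m + 1) * x t)\<^sup>2 \<le> exp (- 2 * \<delta> * t) * (2 * ((real m + 1) * x 0)\<^sup>2 + 2 * (C / \<kappa> * U)\<^sup>2 * inv_sq m)"
proof -
  let ?r = "real m + 1"
  have t0: "0 \<le> t" using t by simp
  have "exp (- (rate m * t)) * \<bar>x 0\<bar> \<le> 1 * \<bar>x 0\<bar>"
    using rate_pos[of m] t0 by (intro mult_right_mono) auto
  moreover have "\<sigma> m * inv_sq m / \<kappa> * U \<le> C / \<kappa> * U * inv_sq m"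
    using mult_right_mono[OF C, of "inv_sq m / \<kappa> * U"] U \<kappa> inv_sq_pos[of m] by (simp add: mult_ac)
  ultimately have "exp (- (rate m * t)) * \<bar>x 0\<bar> + \<sigma> m * inv_sq m / \<kappa> * U \<le> \<bar>x 0\<bar> + C / \<kappa> * U * inv_sq m"
    by linarith
  then have "exp (- \<delta> * t) * (exp (- (rate m * t)) * \<bar>x 0\<bar> + \<sigma> m * inv_sq m / \<kappa> * U) \<le> exp (- \<delta> * t) * (\<bar>x 0\<bar> + C / \<kappa> * U * inv_sq m)"
    by (intro mult_left_mono) auto
  with forced_bound[OF c m d t] have "\<bar>x t\<bar> \<le> exp (- \<delta> * t) * (\<bar>x 0\<bar> + C / \<kappa> * U * inv_sq m)"
    by linarith
  then have "?r * \<bar>x t\<bar> \<le> ?r * (exp (- \<delta> * t) * (\<bar>x 0\<bar> + C / \<kappa> * U * inv_sq m))"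
    by (intro mult_left_mono) auto
  moreover have "r * (e * (A + B * w)) = e * (r * A + B * (r * w))" for r e A B w :: real
    by (simp add: algebra_simps)
  ultimately have "?r * \<bar>x t\<bar> \<le> exp (- \<delta> * t) * (?r * \<bar>x 0\<bar> + C / \<kappa> * U * (?r * inv_sq m))"
    by (simp only:)
  then have "(?r * \<bar>x t\<bar>)\<^sup>2 \<le> (exp (- \<delta> * t) * (?r * \<bar>x 0\<bar> + C / \<kappa> * U * (?r * inv_sq m)))\<^sup>2"
    by (intro power_mono) auto
  also have "\<dots> = (exp (- \<delta> * t))\<^sup>2 * (?r * \<bar>x 0\<bar> + C / \<kappa> * U * (?r * inv_sq m))\<^sup>2"
    by (rule power_mult_distrib)
  also have "(exp (- \<delta> * t))\<^sup>2 = exp (- 2 * \<delta> * t)"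
    by (simp add: power2_eq_square flip: exp_add)
  also have "(?r * \<bar>x 0\<bar> + C / \<kappa> * U * (?r * inv_sq m))\<^sup>2 \<le> 2 * (?r * \<bar>x 0\<bar>)\<^sup>2 + 2 * (C / \<kappa> * U * (?r * inv_sq m))\<^sup>2"
    by (rule sum_squares_le)
  also have "(C / \<kappa> * U * (?r * inv_sq m))\<^sup>2 = (C / \<kappa> * U)\<^sup>2 * inv_sq m"
  proof -
    have "(?r * inv_sq m)\<^sup>2 = (?r\<^sup>2 * inv_sq m) * inv_sq m" by (simp add: power2_eq_square mult_ac)
    then have "(?r * inv_sq m)\<^sup>2 = inv_sq m" by (simp only: inv_sq_cancel mult_1_left)
    then show ?thesis by (simp only: power_mult_distrib[of "C / \<kappa> * U"])
  qed
  finally show ?thesis by (simp add: power_mult_distrib mult_ac)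
qed

text \<open>The slow modes enter only through their decay bound \<open>Y\<close>; the fast ones are summed from the pointwise bound.\<close>
lemma energy_bound:
  assumes X: "\<And>m. K0 < m \<Longrightarrow> continuous_on {0..T} (X m)"
      "\<And>m t. K0 < m \<Longrightarrow> t \<in> {0<..<T} \<Longrightarrow> (X m has_real_derivative lam m * X m t + f m t) (at t)"
    and C: "\<And>m. \<sigma> m \<le> C" and t: "t \<in> {0..T}"
    and s0: "summable (\<lambda>m. ((real m + 1) * X m 0)\<^sup>2)" and s: "summable (\<lambda>m. ((real m + 1) * X m t)\<^sup>2)"
    and low: "\<And>m. m \<le> K0 \<Longrightarrow> \<bar>X m t\<bar> \<le> exp (- \<delta> * t) * Y"
  shows "(\<Sum>m. ((real m + 1) * X m t)\<^sup>2) \<le> exp (- 2 * \<delta> * t) *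
     (2 * (\<Sum>m. ((real m + 1) * X m 0)\<^sup>2) + 2 * (C / \<kappa> * U)\<^sup>2 * (\<Sum>m. inv_sq m) + (real K0 + 1) * ((real K0 + 1) * Y)\<^sup>2)"
proof -
  let ?e = "exp (- 2 * \<delta> * t)"
  \<comment> \<open>a finitely supported majorant for the slow modes\<close>
  define h where "h = (\<lambda>m. if m \<le> K0 then ((real K0 + 1) * Y)\<^sup>2 else 0)"
  have hs: "h sums (\<Sum>m\<le>K0. h m)" by (rule sums_finite) (auto simp: h_def)
  have hsum: "(\<Sum>m. h m) = (real K0 + 1) * ((real K0 + 1) * Y)\<^sup>2"
  proof -
    have "(\<Sum>m\<le>K0. h m) = (real K0 + 1) * ((real K0 + 1) * Y)\<^sup>2"
      by (simp add: h_def add.commute)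
    then show ?thesis using sums_unique[OF hs] by simp
  qed
  let ?b = "\<lambda>m. 2 * ((real m + 1) * X m 0)\<^sup>2 + 2 * (C / \<kappa> * U)\<^sup>2 * inv_sq m + h m"
  have b: "((real m + 1) * X m t)\<^sup>2 \<le> ?e * ?b m" for m
  proof (cases "m \<le> K0")
    case True
    have "(real m + 1) * \<bar>X m t\<bar> \<le> (real K0 + 1) * (exp (- \<delta> * t) * Y)"
      using True low[OF True] by (intro mult_mono) auto
    then have "((real m + 1) * \<bar>X m t\<bar>)\<^sup>2 \<le> (exp (- \<delta> * t) * ((real K0 + 1) * Y))\<^sup>2"
      by (intro power_mono) (auto simp: mult_ac)
    also have "\<dots> = (exp (- \<delta> * t))\<^sup>2 * ((real K0 + 1) * Y)\<^sup>2" by (rule power_mult_distrib)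
    also have "(exp (- \<delta> * t))\<^sup>2 = ?e" by (simp add: power2_eq_square flip: exp_add)
    also have "?e * ((real K0 + 1) * Y)\<^sup>2 \<le> ?e * ?b m"
      using True inv_sq_pos[of m] by (intro mult_left_mono) (auto simp: h_def)
    finally show ?thesis by (simp add: power_mult_distrib)
  next
    case False
    then show ?thesis
      using pointwise_square_bound[OF X(1) _ X(2) t C, of m] by (simp add: h_def)
  qed
  have s1: "summable (\<lambda>m. 2 * ((real m + 1) * X m 0)\<^sup>2)" by (rule summable_mult[OF s0])
  have s2: "summable (\<lambda>m. 2 * (C / \<kappa> * U)\<^sup>2 * inv_sq m)" by (rule summable_mult[OF inv_sq_summable])
  have s3: "summable h" by (rule sums_summable[OF hs])
  have sb: "summable ?b" by (intro summable_add s1 s2 s3)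
  have "(\<Sum>m. ((real m + 1) * X m t)\<^sup>2) \<le> (\<Sum>m. ?e * ?b m)"
    by (rule suminf_le[OF b s summable_mult[OF sb]])
  also have "\<dots> = ?e * (\<Sum>m. ?b m)" by (rule suminf_mult[OF sb])
  also have "(\<Sum>m. ?b m) = (\<Sum>m. 2 * ((real m + 1) * X m 0)\<^sup>2) + (\<Sum>m. 2 * (C / \<kappa> * U)\<^sup>2 * inv_sq m) + (\<Sum>m. h m)"
    using suminf_add[OF summable_add[OF s1 s2] s3] suminf_add[OF s1 s2] by simp
  finally show ?thesis
    unfolding hsum suminf_mult[OF s0] suminf_mult[OF inv_sq_summable] .
qed

end

section \<open>The finite-dimensional part of the closed loop\<close>

lemma product_sum_uminus: "- (x + y) * l = - (l * x) - l * y" for x y l :: real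
  by (simp add: algebra_simps)

lemma cancel_input:
  fixes A B D el l S g p q :: real
  assumes "D = A - B" "el = - (l * S) - l * g"
  shows "(A + p + q) - (B + p + q - el) = (D - l * S) + - l * g"
  using assms by simp

text \<open>\<open>St\<close> stacks the slow coordinates of the plant, \<open>E\<close> is their deviation from the estimate \<open>X\<close>, and \<open>Z\<close> is the estimate
extended by \<open>u\<close>. The residual \<open>g\<close> is the part of the measurement explained neither by the slow coordinates nor by the
observer's fast modes, and \<open>e\<close> is the output error that drives the observer.\<close>
locale closed_loop = stack_layout a b s N0 M0 + plant a b s y0 z0 u v y z
  for a b s :: real and N0 M0 :: nat and y0 z0 :: "real \<Rightarrow> real" and u v :: "real \<Rightarrow> real"
    and y z :: "real \<Rightarrow> real \<Rightarrow> real" +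
  fixes meas :: measurement and \<xi> :: real and N M :: nat and Kx L :: "real Matrix.vec" and ku :: real
    and X :: "real \<Rightarrow> real Matrix.vec" and x1 x2 :: "nat \<Rightarrow> real \<Rightarrow> real"
  assumes \<xi>: "\<xi> \<in> {0..1}" and NM: "N0 \<le> N" "M0 \<le> M"
    and Kx: "Kx \<in> carrier_vec (N0 + M0 + 2)" and L: "L \<in> carrier_vec (N0 + M0 + 2)"
    and v: "v = (\<lambda>t. - (Kx \<bullet> X t) - ku * u t)"
    and ctrl: "controller_solution meas \<xi> a b s N0 M0 N M Kx ku L (\<lambda>t. measure_at meas \<xi> (y t)) u X x1 x2"
begin

definition cc where "cc = stack a b N0 M0 (c1 meas \<xi>) (c2 meas \<xi> a b s)"
definition St where "St t = stack a b N0 M0 (\<lambda>n. X1 n t) (\<lambda>m. X2 m t)"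
definition E where "E i t = St t $ i - X t $ i"
definition Z where "Z i t = (if i < N0 + M0 + 2 then X t $ i else u t)"
definition g where "g t = measure_at meas \<xi> (y t) - (\<Sum>m\<le>N0. c1 meas \<xi> m * X1 m t) - (\<Sum>m\<le>M0. c2 meas \<xi> a b s m * X2 m t)
   - (\<Sum>m = N0 + 1..N. c1 meas \<xi> m * x1 m t) - (\<Sum>m = M0 + 1..M. c2 meas \<xi> a b s m * x2 m t)"
definition e where "e t = (C1 meas \<xi> a b s N0 M0 *\<^sub>v X t) $ 0
                   + (\<Sum>n = N0 + 1..N. c1 meas \<xi> n * x1 n t)
                   + (\<Sum>m = M0 + 1..M. c2 meas \<xi> a b s m * x2 m t) - measure_at meas \<xi> (y t)"

lemma controller:
  "C0_C1_solution u v" "\<And>t. 0 \<le> t \<Longrightarrow> X t \<in> carrier_vec (N0 + M0 + 2)"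
  "\<And>i. i < N0 + M0 + 2 \<Longrightarrow> C0_C1_solution (\<lambda>t. X t $ i)
     (\<lambda>t. (A1 a b s N0 M0 *\<^sub>v X t + u t \<cdot>\<^sub>v B1u a b s N0 M0 + v t \<cdot>\<^sub>v B1v a b s N0 M0 - e t \<cdot>\<^sub>v L) $ i)"
  "\<And>n. n \<in> {N0 + 1..N} \<Longrightarrow> C0_C1_solution (x1 n) (\<lambda>t. lam1 a n * x1 n t + alpha1 a b s n * u t + beta1 a b s n * v t)"
  "\<And>m. m \<in> {M0 + 1..M} \<Longrightarrow> C0_C1_solution (x2 m) (\<lambda>t. lam2 b m * x2 m t + alpha2 b m * u t + beta2 m * v t)"
  using ctrl unfolding controller_solution_def Let_def v e_def by blast+

lemma scalar_prod_sum: "w \<in> carrier_vec (N0 + M0 + 2) \<Longrightarrow> (x :: real Matrix.vec) \<bullet> w = (\<Sum>i<N0 + M0 + 2. x $ i * w $ i)"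
  by (simp add: scalar_prod_def lessThan_atLeast0)

lemma St_carrier: "St t \<in> carrier_vec (N0 + M0 + 2)"
  unfolding St_def by (rule stack_carrier)

text \<open>The output error splits into the part seen through the finite-dimensional error and the residual.\<close>
lemma innovation:
  assumes "0 \<le> t"
  shows "e t = - ((\<Sum>j<N0 + M0 + 2. cc $ j * E j t) + g t)"
proof -
  have "(\<Sum>j<N0 + M0 + 2. cc $ j * E j t) = cc \<bullet> St t - cc \<bullet> X t"
    unfolding scalar_prod_sum[OF St_carrier] scalar_prod_sum[OF controller(2)[OF assms]]
    by (simp add: E_def right_diff_distrib sum_subtractf)
  moreover have "cc \<bullet> St t = (\<Sum>m\<le>N0. c1 meas \<xi> m * X1 m t) + (\<Sum>m\<le>M0. c2 meas \<xi> a b s m * X2 m t)"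
    unfolding cc_def St_def by (rule stack_scalar_prod)
  moreover have "(C1 meas \<xi> a b s N0 M0 *\<^sub>v X t) $ 0 = cc \<bullet> X t"
    unfolding cc_def by (rule C1_mult[OF controller(2)[OF assms]])
  ultimately show ?thesis unfolding e_def g_def by simp
qed

lemma X_ode:
  assumes i: "i < N0 + M0 + 2"
  shows "continuous_on {0..} (\<lambda>t. X t $ i)"
    and "0 < t \<Longrightarrow> ((\<lambda>t. X t $ i) has_real_derivative (\<Sum>j<N0 + M0 + 2. A1 a b s N0 M0 $$ (i, j) * X t $ j)
      + u t * B1u a b s N0 M0 $ i + v t * B1v a b s N0 M0 $ i - e t * L $ i) (at t)"
proof -
  note c = controller(3)[OF i]
  show "continuous_on {0..} (\<lambda>t. X t $ i)" using c by (simp add: C0_C1_solution_def)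
  assume t: "0 < t"
  then have Xc: "X t \<in> carrier_vec (N0 + M0 + 2)" by (intro controller) simp
  have dims: "dim_vec (B1u a b s N0 M0) = N0 + M0 + 2" "dim_vec (B1v a b s N0 M0) = N0 + M0 + 2" "dim_vec L = N0 + M0 + 2"
    "dim_row (A1 a b s N0 M0) = N0 + M0 + 2"
    using L A1_mult_stack(1) unfolding B1u_def B1v_def by auto
  have "(A1 a b s N0 M0 *\<^sub>v X t + u t \<cdot>\<^sub>v B1u a b s N0 M0 + v t \<cdot>\<^sub>v B1v a b s N0 M0 - e t \<cdot>\<^sub>v L) $ i
      = (A1 a b s N0 M0 *\<^sub>v X t) $ i + u t * B1u a b s N0 M0 $ i + v t * B1v a b s N0 M0 $ i - e t * L $ i"
    using i by (simp add: dims del: index_mult_mat_vec)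
  moreover have "(A1 a b s N0 M0 *\<^sub>v X t) $ i = (\<Sum>j<N0 + M0 + 2. A1 a b s N0 M0 $$ (i, j) * X t $ j)"
    by (rule mult_mat_vec_index[OF A1_mult_stack(1) i Xc])
  moreover have "((\<lambda>t. X t $ i) has_real_derivative
      (A1 a b s N0 M0 *\<^sub>v X t + u t \<cdot>\<^sub>v B1u a b s N0 M0 + v t \<cdot>\<^sub>v B1v a b s N0 M0 - e t \<cdot>\<^sub>v L) $ i) (at t)"
    using c t unfolding C0_C1_solution_def by blast
  ultimately show "((\<lambda>t. X t $ i) has_real_derivative (\<Sum>j<N0 + M0 + 2. A1 a b s N0 M0 $$ (i, j) * X t $ j)
      + u t * B1u a b s N0 M0 $ i + v t * B1v a b s N0 M0 $ i - e t * L $ i) (at t)"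
    by (simp only:)
qed

lemma St_ode:
  assumes i: "i < N0 + M0 + 2"
  shows "continuous_on {0..} (\<lambda>t. St t $ i)"
    and "0 < t \<Longrightarrow> ((\<lambda>t. St t $ i) has_real_derivative (\<Sum>j<N0 + M0 + 2. A1 a b s N0 M0 $$ (i, j) * St t $ j)
      + u t * B1u a b s N0 M0 $ i + v t * B1v a b s N0 M0 $ i) (at t)"
proof -
  have mult: "(\<Sum>j<N0 + M0 + 2. A1 a b s N0 M0 $$ (i, j) * St t $ j) = case_sum
     (\<lambda>n. lam1 a n * X1 n t - resonance1 a b s n * X2 (partner1 a b n) t) (\<lambda>m. lam2 b m * X2 m t) (idx ! i)" for t
    unfolding mult_mat_vec_index[OF A1_mult_stack(1) i St_carrier, symmetric]
    unfolding St_def A1_mult_stack(2) stack_index[OF i] by (rule refl)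
  have St: "(\<lambda>t. St t $ i) = (\<lambda>t. case_sum (\<lambda>n. X1 n t) (\<lambda>m. X2 m t) (idx ! i))"
    unfolding St_def stack_index[OF i] by (rule refl)
  have B: "B1u a b s N0 M0 $ i = case_sum (alpha1 a b s) (alpha2 b) (idx ! i)" "B1v a b s N0 M0 $ i = case_sum (beta1 a b s) beta2 (idx ! i)"
    unfolding B1u_def B1v_def stack_index[OF i] by (rule refl)+
  show "continuous_on {0..} (\<lambda>t. St t $ i)"
    unfolding St by (rule idx_cases[OF i]) (simp_all add: X1_ode(1) X2_ode(1))
  assume t: "0 < t"
  show "((\<lambda>t. St t $ i) has_real_derivative (\<Sum>j<N0 + M0 + 2. A1 a b s N0 M0 $$ (i, j) * St t $ j)
      + u t * B1u a b s N0 M0 $ i + v t * B1v a b s N0 M0 $ i) (at t)"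
  proof (rule idx_cases[OF i])
    fix n assume n: "idx ! i = Inl n"
    show ?thesis unfolding St mult B n sum.case
      by (rule DERIV_cong[OF X1_ode(2)[OF t]]) (simp add: mult.commute)
  next
    fix m assume m: "idx ! i = Inr m"
    show ?thesis unfolding St mult B m sum.case
      by (rule DERIV_cong[OF X2_ode(2)[OF t]]) (simp add: mult.commute)
  qed
qed

text \<open>The input terms are common to the plant and the observer and cancel.\<close>
lemma E_ode:
  "forced_linear_ode (N0 + M0 + 2) (\<lambda>i j. (A1 a b s N0 M0 - col_mat L * C1 meas \<xi> a b s N0 M0) $$ (i, j)) T E (\<lambda>i t. - L $ i * g t)"
  unfolding forced_linear_ode_def
proof (intro allI impI conjI ballI)
  fix i assume i: "i < N0 + M0 + 2"
  have "continuous_on {0..} (E i)"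
    unfolding E_def[abs_def] by (intro continuous_intros X_ode St_ode i)
  then show "continuous_on {0..T} (E i)" by (rule continuous_on_subset) auto
  fix t assume "t \<in> {0<..<T}"
  then have t: "0 < t" by simp
  let ?n = "N0 + M0 + 2" and ?A = "A1 a b s N0 M0"
  let ?O = "A1 a b s N0 M0 - col_mat L * C1 meas \<xi> a b s N0 M0"
  have O: "(\<Sum>j<?n. ?O $$ (i, j) * E j t) = (\<Sum>j<?n. ?A $$ (i, j) * E j t) - L $ i * (\<Sum>j<?n. cc $ j * E j t)"
  proof -
    have "(\<Sum>j<?n. ?O $$ (i, j) * E j t) = (\<Sum>j<?n. ?A $$ (i, j) * E j t - L $ i * (cc $ j * E j t))"
    proof (rule sum.cong[OF refl])
      fix j assume "j \<in> {..<?n}"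
      then have "?O $$ (i, j) = ?A $$ (i, j) - L $ i * cc $ j"
        unfolding cc_def by (intro observer_matrix(2)[OF L i]) simp
      then show "?O $$ (i, j) * E j t = ?A $$ (i, j) * E j t - L $ i * (cc $ j * E j t)"
        by (simp add: left_diff_distrib mult.assoc)
    qed
    then show ?thesis by (simp only: sum_subtractf sum_distrib_left)
  qed
  have "(E i has_real_derivative ((\<Sum>j<?n. ?A $$ (i, j) * St t $ j) + u t * B1u a b s N0 M0 $ i + v t * B1v a b s N0 M0 $ i)
      - ((\<Sum>j<?n. ?A $$ (i, j) * X t $ j) + u t * B1u a b s N0 M0 $ i + v t * B1v a b s N0 M0 $ i - e t * L $ i)) (at t)"
    unfolding E_def[abs_def] by (rule DERIV_diff[OF St_ode(2)[OF i t] X_ode(2)[OF i t]])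
  moreover have "(\<Sum>j<?n. ?A $$ (i, j) * E j t) = (\<Sum>j<?n. ?A $$ (i, j) * St t $ j) - (\<Sum>j<?n. ?A $$ (i, j) * X t $ j)"
    by (simp add: E_def right_diff_distrib sum_subtractf)
  moreover have "e t * L $ i = - (L $ i * (\<Sum>j<?n. cc $ j * E j t)) - L $ i * g t"
    unfolding innovation[OF less_imp_le[OF t]] by (rule product_sum_uminus)
  ultimately have "(E i has_real_derivative (\<Sum>j<?n. ?O $$ (i, j) * E j t) + - L $ i * g t) (at t)"
    unfolding O by (rule DERIV_cong[OF _ cancel_input])
  then show "(E i has_vector_derivative (\<Sum>j<?n. ?O $$ (i, j) * E j t) + - L $ i * g t) (at t)"
    by (simp add: has_real_derivative_iff_has_vector_derivative)
qed

lemma u_ode: "continuous_on {0..} u" "0 < t \<Longrightarrow> (u has_real_derivative v t) (at t)"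
  using controller(1) by (auto simp: C0_C1_solution_def)

lemma Z_ode:
  "forced_linear_ode (Suc (N0 + M0 + 2)) (\<lambda>i j. (A1a a b s N0 M0 - B1a a b s N0 M0 * gain_K Kx ku) $$ (i, j)) T Z
     (\<lambda>i t. (if i < N0 + M0 + 2 then L $ i else 0) * ((\<Sum>j<N0 + M0 + 2. cc $ j * E j t) + g t))"
  unfolding forced_linear_ode_def
proof (intro allI impI conjI ballI)
  let ?n = "N0 + M0 + 2" and ?A = "A1 a b s N0 M0"
  let ?F = "A1a a b s N0 M0 - B1a a b s N0 M0 * gain_K Kx ku"
  fix i assume i: "i < Suc ?n"
  show "continuous_on {0..T} (Z i)"
  proof (cases "i < ?n")
    case True
    then have "Z i = (\<lambda>t. X t $ i)" by (simp add: Z_def[abs_def])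
    then show ?thesis using continuous_on_subset[OF X_ode(1)[OF True], of "{0..T}"] by auto
  next
    case False
    then have "Z i = u" by (auto simp: Z_def)
    then show ?thesis using continuous_on_subset[OF u_ode(1), of "{0..T}"] by auto
  qed
  fix t assume "t \<in> {0<..<T}"
  then have t: "0 < t" by simp
  have v_eq: "v t = - (\<Sum>j<?n. Kx $ j * X t $ j) - ku * u t"
    using scalar_prod_sum[OF controller(2), of t Kx] t by (simp add: v)
  have sum_Suc: "(\<Sum>j<Suc ?n. ?F $$ (i, j) * Z j t) = (\<Sum>j<?n. ?F $$ (i, j) * X t $ j) + ?F $$ (i, ?n) * u t"
    by (simp add: Z_def)
  show "(Z i has_vector_derivative (\<Sum>j<Suc ?n. ?F $$ (i, j) * Z j t)
      + (if i < ?n then L $ i else 0) * ((\<Sum>j<?n. cc $ j * E j t) + g t)) (at t)"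
  proof (cases "i < ?n")
    case True
    then have Zi: "Z i = (\<lambda>t. X t $ i)" by (simp add: Z_def[abs_def])
    have "(\<Sum>j<?n. ?F $$ (i, j) * X t $ j) = (\<Sum>j<?n. ?A $$ (i, j) * X t $ j - B1v a b s N0 M0 $ i * (Kx $ j * X t $ j))"
      by (intro sum.cong refl) (simp add: controller_matrix(2)[OF Kx True] left_diff_distrib mult.assoc del: index_minus_mat)
    then have "(\<Sum>j<?n. ?F $$ (i, j) * X t $ j) = (\<Sum>j<?n. ?A $$ (i, j) * X t $ j) - B1v a b s N0 M0 $ i * (\<Sum>j<?n. Kx $ j * X t $ j)"
      by (simp only: sum_subtractf sum_distrib_left)
    then have "(\<Sum>j<Suc ?n. ?F $$ (i, j) * Z j t) = (\<Sum>j<?n. ?A $$ (i, j) * X t $ j) + u t * B1u a b s N0 M0 $ i + v t * B1v a b s N0 M0 $ i"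
      unfolding sum_Suc controller_matrix(3)[OF Kx True] v_eq by (simp add: algebra_simps)
    moreover have "- (e t * L $ i) = L $ i * ((\<Sum>j<?n. cc $ j * E j t) + g t)"
      unfolding innovation[OF less_imp_le[OF t]] by (simp only: product_sum_uminus) (simp only: distrib_left minus_diff_eq minus_minus diff_minus_eq_add add.commute)
    ultimately have "(Z i has_real_derivative (\<Sum>j<Suc ?n. ?F $$ (i, j) * Z j t)
      + (if i < ?n then L $ i else 0) * ((\<Sum>j<?n. cc $ j * E j t) + g t)) (at t)"
      unfolding Zi using X_ode(2)[OF True t] True by (simp only: if_True) (simp only: diff_conv_add_uminus)
    then show ?thesis by (simp only: has_real_derivative_iff_has_vector_derivative)
  next
    case False
    then have iN: "i = ?n" using i by simp
    have Zi: "Z i = u" using False by (auto simp: Z_def)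
    have "(\<Sum>j<?n. ?F $$ (i, j) * X t $ j) = (\<Sum>j<?n. - (Kx $ j * X t $ j))"
      unfolding iN by (rule sum.cong[OF refl]) (simp only: lessThan_iff controller_matrix(4)[OF Kx] mult_minus_left)
    then have "(\<Sum>j<?n. ?F $$ (i, j) * X t $ j) = - (\<Sum>j<?n. Kx $ j * X t $ j)"
      by (simp only: sum_negf)
    moreover have "?F $$ (i, ?n) = - ku"
      unfolding iN by (rule controller_matrix(5)[OF Kx])
    ultimately have "(\<Sum>j<Suc ?n. ?F $$ (i, j) * Z j t) = v t"
      unfolding sum_Suc v_eq by (simp only: mult_minus_left diff_conv_add_uminus)
    then show ?thesis
      using u_ode(2)[OF t] False unfolding Zi by (simp only: has_real_derivative_iff_has_vector_derivative if_False mult_zero_left add_0_right)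
  qed
qed

end

section \<open>Closed-loop estimates\<close>

context plant
begin

definition energy where
  "energy t = (\<Sum>n. ((real n + 1) * X1 n t)\<^sup>2) + (\<Sum>m. ((real m + 1) * X2 m t)\<^sup>2)"

lemma energy_summable:
  assumes "0 \<le> t"
  shows "summable (\<lambda>n. ((real n + 1) * X1 n t)\<^sup>2)" "summable (\<lambda>m. ((real m + 1) * X2 m t)\<^sup>2)"
  using H1_lower[of a b s] in_domainD(2,7,5)[OF domain[OF assms]] unfolding X1_def X2_def by blast+

lemma mode_le_energy:
  assumes "0 \<le> t"
  shows "((real m + 1) * X1 m t)\<^sup>2 \<le> energy t" "((real m + 1) * X2 m t)\<^sup>2 \<le> energy t"
proof -
  have "((real m + 1) * X1 m t)\<^sup>2 \<le> (\<Sum>n. ((real n + 1) * X1 n t)\<^sup>2)"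
    "((real m + 1) * X2 m t)\<^sup>2 \<le> (\<Sum>m. ((real m + 1) * X2 m t)\<^sup>2)"
    using sum_le_suminf[OF energy_summable(1)[OF assms], of "{m}"] sum_le_suminf[OF energy_summable(2)[OF assms], of "{m}"]
    by auto
  moreover have "0 \<le> (\<Sum>n. ((real n + 1) * X1 n t)\<^sup>2)" "0 \<le> (\<Sum>m. ((real m + 1) * X2 m t)\<^sup>2)"
    by (intro suminf_nonneg energy_summable[OF assms] zero_le_power2)+
  ultimately show "((real m + 1) * X1 m t)\<^sup>2 \<le> energy t" "((real m + 1) * X2 m t)\<^sup>2 \<le> energy t"
    unfolding energy_def by linarith+
qed

end

text \<open>The constant depends on \<open>a\<close>, \<open>b\<close>, \<open>s\<close> only; it has to be available before a solution is fixed.\<close>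
lemma energy_le_H1_norm:
  "\<exists>C>0. \<forall>y0 z0 u v y z t. plant a b s y0 z0 u v y z \<longrightarrow> 0 \<le> t \<longrightarrow>
     plant.energy a b s u y z t \<le> C * (2 * (norm_H1 (y t, z t))\<^sup>2 + 4 * (u t)\<^sup>2)"
proof -
  obtain C where C: "0 < C" "\<forall>y y' g g'. weak_deriv y y' \<longrightarrow> y 1 = 0 \<longrightarrow> weak_deriv g g' \<longrightarrow>
       summable (\<lambda>n. ((real n + 1) * mode1 a b s n y g)\<^sup>2) \<and>
       summable (\<lambda>m. ((real m + 1) * ip g (cosm m))\<^sup>2) \<and>
       (\<Sum>n. ((real n + 1) * mode1 a b s n y g)\<^sup>2) + (\<Sum>m. ((real m + 1) * ip g (cosm m))\<^sup>2)
         \<le> C * (ip y' y' + ip g g + ip g' g')"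
    using H1_lower[of a b s] by blast
  show ?thesis
  proof (intro exI[of _ C] conjI C(1) allI impI)
    fix y0 z0 u v y z and t :: real assume P: "plant a b s y0 z0 u v y z" and t: "0 \<le> t"
    interpret plant a b s y0 z0 u v y z by (rule P)
    have "energy t \<le> C * (ip (Dx (y t)) (Dx (y t)) + ip (zt t) (zt t) + ip (zt' t) (zt' t))"
      unfolding energy_def X1_def X2_def using C(2) in_domainD(2,7,5)[OF domain[OF t]] by blast
    also have "\<dots> \<le> C * (2 * (norm_H1 (y t, z t))\<^sup>2 + 4 * (u t)\<^sup>2)"
      by (intro mult_left_mono H1_norm_lower[OF t] less_imp_le[OF C(1)])
    finally show "energy t \<le> C * (2 * (norm_H1 (y t, z t))\<^sup>2 + 4 * (u t)\<^sup>2)" .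
  qed
qed

lemma H1_norm_le_energy:
  "\<exists>C>0. \<forall>y0 z0 u v y z t. plant a b s y0 z0 u v y z \<longrightarrow> 0 \<le> t \<longrightarrow>
     (norm_H1 (y t, z t))\<^sup>2 \<le> 2 * (C * plant.energy a b s u y z t) + 4 * (u t)\<^sup>2"
proof -
  obtain C where C: "0 < C" "\<forall>y y' y'' g g' g''. in_domain s y y' y'' g g' g'' \<longrightarrow>
       ip y' y' + ip g g + ip g' g' \<le>
       C * ((\<Sum>n. ((real n + 1) * mode1 a b s n y g)\<^sup>2) + (\<Sum>m. ((real m + 1) * ip g (cosm m))\<^sup>2))"
    using H1_upper[of s a b] by blast
  show ?thesis
  proof (intro exI[of _ C] conjI C(1) allI impI)
    fix y0 z0 u v y z and t :: real assume P: "plant a b s y0 z0 u v y z" and t: "0 \<le> t"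
    interpret plant a b s y0 z0 u v y z by (rule P)
    have "ip (Dx (y t)) (Dx (y t)) + ip (zt t) (zt t) + ip (zt' t) (zt' t) \<le> C * energy t"
      unfolding energy_def X1_def X2_def using C(2) domain[OF t] by blast
    then show "(norm_H1 (y t, z t))\<^sup>2 \<le> 2 * (C * energy t) + 4 * (u t)\<^sup>2"
      by (intro order_trans[OF H1_norm_upper[OF t] add_right_mono] mult_left_mono) auto
  qed
qed

text \<open>Every bound below is a multiple of the square root \<open>J\<close> of the initial value of the total energy. The factors depend
on the data of the problem alone. They are collected here, apart from any solution, so that the final constant can be named first:
\<open>cL\<close> bounds the weighted initial coordinates, \<open>rho\<close> the mass of the forcing by initial values, \<open>amp\<close> the
finite-dimensional part, \<open>resp\<close> the response of the fast modes to it, and \<open>tail_gain\<close> is the loop gain.\<close>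
locale gain_constants =
  fixes N0 M0 N M :: nat and Kx :: "real Matrix.vec" and ku \<kappa> K Cc Cb CL CU :: real
begin

definition gain where "gain = 1 + (\<Sum>i<N0 + M0 + 2. \<bar>Kx $ i\<bar>) + \<bar>ku\<bar>"
definition cL where "cL = 2 * sqrt CL"
definition rho where "rho = 2 * (Cc * (cL + real N + real M + 2) / \<kappa> * (\<Sum>m. inv_sq m))"
definition amp where "amp = K * (cL + 1 + rho)"
definition resp where "resp = Cb * gain / \<kappa> * amp"
definition tail_gain where
  "tail_gain = Cc * Cb * gain / \<kappa> * ((\<Sum>m. inv_sq (m + Suc N)) + (\<Sum>m. inv_sq (m + Suc M)))"
definition energy_const where
  "energy_const = 8 * CL + 4 * resp\<^sup>2 * (\<Sum>m. inv_sq m)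
     + (real N0 + 1) * ((real N0 + 1) * (2 * amp))\<^sup>2 + (real M0 + 1) * ((real M0 + 1) * (2 * amp))\<^sup>2"
definition total_const where
  "total_const = 2 * (CU * energy_const) + 5 * amp\<^sup>2 + real (N0 + M0 + 2) * amp\<^sup>2
     + real N * (2 * (real N + 1)\<^sup>2 + 2 * resp\<^sup>2) + real M * (2 * (real M + 1)\<^sup>2 + 2 * resp\<^sup>2)"

end

locale closed_loop_bounds =
  closed_loop a b s N0 M0 y0 z0 u v y z meas \<xi> N M Kx L ku X x1 x2 + gain_constants N0 M0 N M Kx ku \<kappa> K Cc Cb CL CU
  for a b s :: real and N0 M0 :: nat and y0 z0 :: "real \<Rightarrow> real" and u v :: "real \<Rightarrow> real"
    and y z :: "real \<Rightarrow> real \<Rightarrow> real" and meas :: measurement and \<xi> :: real and N M :: nat and Kx L :: "real Matrix.vec" and ku :: real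
    and X :: "real \<Rightarrow> real Matrix.vec" and x1 x2 :: "nat \<Rightarrow> real \<Rightarrow> real" and \<kappa> K Cc Cb CL CU :: real +
  fixes \<delta> \<gamma> :: real
  assumes \<kappa>: "0 < \<kappa>" and gap1: "\<And>n. N0 < n \<Longrightarrow> \<kappa> * (real n + 1)\<^sup>2 \<le> - lam1 a n - \<delta>"
    and gap2: "\<And>m. M0 < m \<Longrightarrow> \<kappa> * (real m + 1)\<^sup>2 \<le> - lam2 b m - \<delta>"
    and Cc: "0 < Cc" "\<And>n. \<bar>c1 meas \<xi> n\<bar> \<le> Cc * (real n + 1)" "\<And>m. \<bar>c2 meas \<xi> a b s m\<bar> \<le> Cc"
    and Cb: "0 < Cb" "\<And>n. (real n + 1) * (\<bar>alpha1 a b s n\<bar> + \<bar>beta1 a b s n\<bar>) \<le> Cb" "\<And>m. \<bar>alpha2 b m\<bar> + \<bar>beta2 m\<bar> \<le> Cb"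
    and CL: "0 < CL" "\<And>t. 0 \<le> t \<Longrightarrow> energy t \<le> CL * (2 * (norm_H1 (y t, z t))\<^sup>2 + 4 * (u t)\<^sup>2)"
    and CU: "0 < CU" "\<And>t. 0 \<le> t \<Longrightarrow> (norm_H1 (y t, z t))\<^sup>2 \<le> 2 * (CU * energy t) + 4 * (u t)\<^sup>2"
    and K: "0 < K" and SG: "small_gain_estimate (N0 + M0 + 2)
       (\<lambda>i j. (A1 a b s N0 M0 - col_mat L * C1 meas \<xi> a b s N0 M0) $$ (i, j))
       (\<lambda>i j. (A1a a b s N0 M0 - B1a a b s N0 M0 * gain_K Kx ku) $$ (i, j)) (\<lambda>i. L $ i) (\<lambda>j. cc $ j) \<delta> K \<gamma>"
    and small: "tail_gain \<le> \<gamma>"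
begin

sublocale gap1: mode_gap \<delta> \<kappa> N0 "lam1 a" by unfold_locales (use \<kappa> gap1 in auto)
sublocale gap2: mode_gap \<delta> \<kappa> M0 "lam2 b" by unfold_locales (use \<kappa> gap2 in auto)

lemma gain_ge_1: "1 \<le> gain"
  by (simp add: gain_def sum_nonneg)

lemma inv_sq_sum_pos: "0 < (\<Sum>m. inv_sq m)"
  by (rule suminf_pos[OF inv_sq_summable inv_sq_pos])

lemma consts_nonneg: "0 < cL" "0 \<le> rho" "0 < amp" "0 \<le> resp" "0 \<le> tail_gain"
proof -
  show cL: "0 < cL" using CL by (simp add: cL_def)
  show rho: "0 \<le> rho" using cL Cc(1) \<kappa> inv_sq_sum_pos by (simp add: rho_def)
  show amp: "0 < amp" using cL rho K by (simp add: amp_def)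
  show "0 \<le> resp" using amp Cb(1) gain_ge_1 \<kappa> by (simp add: resp_def)
  have tail: "0 \<le> (\<Sum>m. inv_sq (m + Suc k))" for k
    by (intro suminf_nonneg iffD2[OF summable_iff_shift] inv_sq_summable less_imp_le[OF inv_sq_pos])
  have "0 \<le> Cc * Cb * gain / \<kappa>" using Cb(1) Cc(1) gain_ge_1 \<kappa> by simp
  then show "0 \<le> tail_gain"
    unfolding tail_gain_def by (rule mult_nonneg_nonneg[OF _ add_nonneg_nonneg[OF tail tail]])
qed

definition f1 where "f1 n t = alpha1 a b s n * u t + beta1 a b s n * v t"
definition f2 where "f2 m t = alpha2 b m * u t + beta2 m * v t"
definition \<sigma>1 where "\<sigma>1 n = (\<bar>alpha1 a b s n\<bar> + \<bar>beta1 a b s n\<bar>) * gain"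
definition \<sigma>2 where "\<sigma>2 m = (\<bar>alpha2 b m\<bar> + \<bar>beta2 m\<bar>) * gain"

lemma sigma_bounds: "0 \<le> \<sigma>1 n" "0 \<le> \<sigma>2 n" "\<sigma>1 n \<le> Cb * gain" "\<sigma>2 n \<le> Cb * gain"
  "\<bar>c1 meas \<xi> n\<bar> * \<sigma>1 n \<le> Cc * Cb * gain" "\<bar>c2 meas \<xi> a b s n\<bar> * \<sigma>2 n \<le> Cc * Cb * gain"
proof -
  have g: "0 \<le> gain" using gain_ge_1 by simp
  let ?w1 = "\<bar>alpha1 a b s n\<bar> + \<bar>beta1 a b s n\<bar>" and ?w2 = "\<bar>alpha2 b n\<bar> + \<bar>beta2 n\<bar>"
  show "0 \<le> \<sigma>1 n" "0 \<le> \<sigma>2 n" using g by (simp_all add: \<sigma>1_def \<sigma>2_def)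
  have "?w1 \<le> (real n + 1) * ?w1" by (rule le_real_Suc_mult) simp
  with Cb(2)[of n] have "?w1 \<le> Cb" by linarith
  then show "\<sigma>1 n \<le> Cb * gain" unfolding \<sigma>1_def using g by (rule mult_right_mono)
  show "\<sigma>2 n \<le> Cb * gain" unfolding \<sigma>2_def using Cb(3)[of n] g by (rule mult_right_mono)
  have "\<bar>c1 meas \<xi> n\<bar> * ?w1 \<le> Cc * (real n + 1) * ?w1" using Cc(2) by (rule mult_right_mono) simp
  also have "\<dots> \<le> Cc * Cb" using mult_left_mono[OF Cb(2)[of n], of Cc] Cc(1) by (simp add: mult.assoc)
  finally show "\<bar>c1 meas \<xi> n\<bar> * \<sigma>1 n \<le> Cc * Cb * gain"
    unfolding \<sigma>1_def mult.assoc[symmetric] using g by (rule mult_right_mono)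
  have "\<bar>c2 meas \<xi> a b s n\<bar> * ?w2 \<le> Cc * Cb" using Cc(1,3) Cb(3) by (intro mult_mono) auto
  then show "\<bar>c2 meas \<xi> a b s n\<bar> * \<sigma>2 n \<le> Cc * Cb * gain"
    unfolding \<sigma>2_def mult.assoc[symmetric] using g by (rule mult_right_mono)
qed

text \<open>The summand 1 in \<open>gain\<close> covers \<open>u\<close>, the others cover the feedback law for \<open>v\<close>.\<close>
lemma input_decay:
  assumes t: "0 \<le> t" and U: "0 \<le> U" and Z: "\<And>i. i \<le> N0 + M0 + 2 \<Longrightarrow> \<bar>Z i t\<bar> \<le> U * exp (- \<delta> * t)"
  shows "\<bar>h * u t + k * v t\<bar> \<le> exp (- \<delta> * t) * ((\<bar>h\<bar> + \<bar>k\<bar>) * gain * U)"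
proof -
  let ?e = "U * exp (- \<delta> * t)" and ?S = "\<Sum>i<N0 + M0 + 2. \<bar>Kx $ i\<bar>"
  have e: "0 \<le> ?e" using U by simp
  have u: "\<bar>u t\<bar> \<le> ?e" using Z[of "N0 + M0 + 2"] by (simp add: Z_def)
  have "\<bar>Kx \<bullet> X t\<bar> \<le> ?S * ?e"
  proof -
    have "\<bar>Kx \<bullet> X t\<bar> \<le> (\<Sum>i<N0 + M0 + 2. \<bar>Kx $ i * X t $ i\<bar>)"
      unfolding scalar_prod_sum[OF controller(2)[OF t]] by (rule sum_abs)
    also have "\<dots> \<le> (\<Sum>i<N0 + M0 + 2. \<bar>Kx $ i\<bar> * ?e)"
    proof (rule sum_mono)
      fix i assume "i \<in> {..<N0 + M0 + 2}"
      then have "\<bar>X t $ i\<bar> \<le> ?e" using Z[of i] by (simp add: Z_def)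
      then show "\<bar>Kx $ i * X t $ i\<bar> \<le> \<bar>Kx $ i\<bar> * ?e" unfolding abs_mult by (rule mult_left_mono) simp
    qed
    also have "\<dots> = ?S * ?e" by (rule sum_distrib_right[symmetric])
    finally show ?thesis .
  qed
  moreover have "\<bar>ku * u t\<bar> \<le> \<bar>ku\<bar> * ?e" unfolding abs_mult by (rule mult_left_mono[OF u]) simp
  moreover have "\<bar>v t\<bar> \<le> \<bar>Kx \<bullet> X t\<bar> + \<bar>ku * u t\<bar>" by (simp add: v)
  moreover have "gain * ?e = ?e + ?S * ?e + \<bar>ku\<bar> * ?e" by (simp only: gain_def distrib_right mult_1_left)
  ultimately have v: "\<bar>v t\<bar> \<le> gain * ?e" using e by linarith
  have u': "\<bar>u t\<bar> \<le> gain * ?e" using u mult_right_mono[OF gain_ge_1 e] by linarith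
  have "\<bar>h * u t + k * v t\<bar> \<le> \<bar>h\<bar> * \<bar>u t\<bar> + \<bar>k\<bar> * \<bar>v t\<bar>"
    unfolding abs_mult[symmetric] by (rule abs_triangle_ineq)
  also have "\<dots> \<le> \<bar>h\<bar> * (gain * ?e) + \<bar>k\<bar> * (gain * ?e)"
    by (intro add_mono mult_left_mono u' v) auto
  finally show ?thesis by (simp add: algebra_simps)
qed

lemma families:
  assumes U: "0 \<le> U" and Z: "\<And>i t. i \<le> N0 + M0 + 2 \<Longrightarrow> t \<in> {0..T} \<Longrightarrow> \<bar>Z i t\<bar> \<le> U * exp (- \<delta> * t)"
  shows "mode_family \<delta> \<kappa> N0 (lam1 a) T U \<sigma>1 f1" "mode_family \<delta> \<kappa> M0 (lam2 b) T U \<sigma>2 f2"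
proof -
  have "\<bar>h * u t + k * v t\<bar> \<le> exp (- \<delta> * t) * ((\<bar>h\<bar> + \<bar>k\<bar>) * gain * U)" if "t \<in> {0<..<T}" for h k t
    using that by (intro input_decay U Z) auto
  then show "mode_family \<delta> \<kappa> N0 (lam1 a) T U \<sigma>1 f1" "mode_family \<delta> \<kappa> M0 (lam2 b) T U \<sigma>2 f2"
    by (unfold_locales; use U sigma_bounds in \<open>simp add: f1_def f2_def \<sigma>1_def \<sigma>2_def\<close>)+
qed

text \<open>Beyond \<open>N0\<close> there is no resonance, so the two families are decoupled.\<close>
lemma fast_modes:
  "continuous_on {0..T} (X1 n)" "continuous_on {0..T} (X2 n)"
  "N0 < n \<Longrightarrow> t \<in> {0<..<T} \<Longrightarrow> (X1 n has_real_derivative lam1 a n * X1 n t + f1 n t) (at t)"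
  "t \<in> {0<..<T} \<Longrightarrow> (X2 n has_real_derivative lam2 b n * X2 n t + f2 n t) (at t)"
proof -
  have sub: "{0..T} \<subseteq> {0..}" by auto
  show "continuous_on {0..T} (X1 n)" "continuous_on {0..T} (X2 n)"
    by (rule continuous_on_subset[OF X1_ode(1) sub] continuous_on_subset[OF X2_ode(1) sub])+
  show "(X1 n has_real_derivative lam1 a n * X1 n t + f1 n t) (at t)" if "N0 < n" "t \<in> {0<..<T}"
  proof -
    have "n \<notin> Delta1 a b" using D1 that(1) by force
    then show ?thesis using X1_ode(2)[of t n] that(2) by (simp add: f1_def)
  qed
  show "(X2 n has_real_derivative lam2 b n * X2 n t + f2 n t) (at t)" if "t \<in> {0<..<T}"
    using X2_ode(2)[of t n] that by (simp add: f2_def)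
qed

lemma observer_modes:
  "n \<in> {N0 + 1..N} \<Longrightarrow> continuous_on {0..T} (x1 n)" "m \<in> {M0 + 1..M} \<Longrightarrow> continuous_on {0..T} (x2 m)"
  "n \<in> {N0 + 1..N} \<Longrightarrow> t \<in> {0<..<T} \<Longrightarrow> (x1 n has_real_derivative lam1 a n * x1 n t + f1 n t) (at t)"
  "m \<in> {M0 + 1..M} \<Longrightarrow> t \<in> {0<..<T} \<Longrightarrow> (x2 m has_real_derivative lam2 b m * x2 m t + f2 m t) (at t)"
proof -
  have sub: "{0..T} \<subseteq> {0..}" by auto
  show "n \<in> {N0 + 1..N} \<Longrightarrow> continuous_on {0..T} (x1 n)" "m \<in> {M0 + 1..M} \<Longrightarrow> continuous_on {0..T} (x2 m)"
    using controller(4,5) unfolding C0_C1_solution_def by (blast intro: continuous_on_subset[OF _ sub])+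
  show "(x1 n has_real_derivative lam1 a n * x1 n t + f1 n t) (at t)" if "n \<in> {N0 + 1..N}" "t \<in> {0<..<T}"
    using controller(4)[OF that(1)] that(2) unfolding C0_C1_solution_def by (simp add: f1_def add.assoc)
  show "(x2 m has_real_derivative lam2 b m * x2 m t + f2 m t) (at t)" if "m \<in> {M0 + 1..M}" "t \<in> {0<..<T}"
    using controller(5)[OF that(1)] that(2) unfolding C0_C1_solution_def by (simp add: f2_def add.assoc)
qed


definition total where
  "total t = (norm_H1 (y t, z t))\<^sup>2 + (u t)\<^sup>2 + X t \<bullet> X t
     + (\<Sum>n = N0 + 1..N. (x1 n t)\<^sup>2) + (\<Sum>m = M0 + 1..M. (x2 m t)\<^sup>2)"

definition J where "J = sqrt (total 0)"

lemma X_norm: "0 \<le> t \<Longrightarrow> X t \<bullet> X t = (\<Sum>i<N0 + M0 + 2. (X t $ i)\<^sup>2)"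
  by (simp only: scalar_prod_sum[OF controller(2)] power2_eq_square)

lemma total_0: "0 \<le> total 0"
  "(norm_H1 (y 0, z 0))\<^sup>2 + (u 0)\<^sup>2 \<le> total 0" "(u 0)\<^sup>2 \<le> total 0" "i < N0 + M0 + 2 \<Longrightarrow> (X 0 $ i)\<^sup>2 \<le> total 0"
  "n \<in> {N0 + 1..N} \<Longrightarrow> (x1 n 0)\<^sup>2 \<le> total 0" "m \<in> {M0 + 1..M} \<Longrightarrow> (x2 m 0)\<^sup>2 \<le> total 0"
proof -
  have nn: "0 \<le> (norm_H1 (y 0, z 0))\<^sup>2" "0 \<le> (u 0)\<^sup>2" "0 \<le> X 0 \<bullet> X 0"
    "0 \<le> (\<Sum>n = N0 + 1..N. (x1 n 0)\<^sup>2)" "0 \<le> (\<Sum>m = M0 + 1..M. (x2 m 0)\<^sup>2)"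
    unfolding X_norm[OF order_refl] by (intro sum_nonneg zero_le_power2)+
  then show "0 \<le> total 0" "(norm_H1 (y 0, z 0))\<^sup>2 + (u 0)\<^sup>2 \<le> total 0" "(u 0)\<^sup>2 \<le> total 0"
    unfolding total_def by linarith+
  show "(X 0 $ i)\<^sup>2 \<le> total 0" if i: "i < N0 + M0 + 2"
  proof -
    have "(X 0 $ i)\<^sup>2 \<le> X 0 \<bullet> X 0"
      unfolding X_norm[OF order_refl] by (rule member_le_sum) (use i in auto)
    then show ?thesis unfolding total_def using nn by linarith
  qed
  show "(x1 n 0)\<^sup>2 \<le> total 0" if "n \<in> {N0 + 1..N}"
  proof -
    have "(x1 n 0)\<^sup>2 \<le> (\<Sum>n = N0 + 1..N. (x1 n 0)\<^sup>2)"
      by (rule member_le_sum[OF that]) auto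
    then show ?thesis unfolding total_def using nn by linarith
  qed
  show "(x2 m 0)\<^sup>2 \<le> total 0" if "m \<in> {M0 + 1..M}"
  proof -
    have "(x2 m 0)\<^sup>2 \<le> (\<Sum>m = M0 + 1..M. (x2 m 0)\<^sup>2)"
      by (rule member_le_sum[OF that]) auto
    then show ?thesis unfolding total_def using nn by linarith
  qed
qed

lemma J_square: "J\<^sup>2 = total 0"
  using total_0(1) by (simp add: J_def)

lemma J_nonneg: "0 \<le> J"
  using total_0(1) by (simp add: J_def)

lemma abs_le_J: "x\<^sup>2 \<le> total 0 \<Longrightarrow> \<bar>x\<bar> \<le> J"
  using abs_le_square_iff[of x J] J_nonneg by (simp add: J_square)

lemma energy_0: "energy 0 \<le> 4 * CL * J\<^sup>2" "energy 0 \<le> (cL * J)\<^sup>2"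
proof -
  have "energy 0 \<le> CL * (2 * (norm_H1 (y 0, z 0))\<^sup>2 + 4 * (u 0)\<^sup>2)" by (rule CL(2)) simp
  also have "\<dots> \<le> CL * (4 * total 0)"
  proof (intro mult_left_mono less_imp_le[OF CL(1)])
    have "0 \<le> (norm_H1 (y 0, z 0))\<^sup>2" by simp
    with total_0(2) show "2 * (norm_H1 (y 0, z 0))\<^sup>2 + 4 * (u 0)\<^sup>2 \<le> 4 * total 0" by linarith
  qed
  finally show "energy 0 \<le> 4 * CL * J\<^sup>2" by (simp add: J_square mult_ac)
  then show "energy 0 \<le> (cL * J)\<^sup>2" using CL(1) by (simp add: cL_def power_mult_distrib)
qed

lemma initial_modes: "(real m + 1) * \<bar>X1 m 0\<bar> \<le> cL * J" "(real m + 1) * \<bar>X2 m 0\<bar> \<le> cL * J"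
proof -
  have le: "(real m + 1) * \<bar>x\<bar> \<le> cL * J" if "((real m + 1) * x)\<^sup>2 \<le> energy 0" for x
  proof -
    have "((real m + 1) * x)\<^sup>2 \<le> (cL * J)\<^sup>2" using that energy_0(2) by linarith
    then have "\<bar>(real m + 1) * x\<bar> \<le> \<bar>cL * J\<bar>" by (simp only: abs_le_square_iff)
    then show ?thesis using consts_nonneg(1) J_nonneg by (simp add: abs_mult)
  qed
  show "(real m + 1) * \<bar>X1 m 0\<bar> \<le> cL * J" "(real m + 1) * \<bar>X2 m 0\<bar> \<le> cL * J"
    by (intro le mode_le_energy order_refl)+
qed

lemma initial_stack: "i < N0 + M0 + 2 \<Longrightarrow> \<bar>E i 0\<bar> \<le> (cL + 1) * J" "i \<le> N0 + M0 + 2 \<Longrightarrow> \<bar>Z i 0\<bar> \<le> (cL + 1) * J"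
proof -
  have J1: "J \<le> (cL + 1) * J" "cL * J + J = (cL + 1) * J" using consts_nonneg(1) J_nonneg by (simp_all add: distrib_right)
  show "\<bar>E i 0\<bar> \<le> (cL + 1) * J" if i: "i < N0 + M0 + 2"
  proof -
    have x: "\<bar>X1 m 0\<bar> \<le> cL * J" "\<bar>X2 m 0\<bar> \<le> cL * J" for m
      using order_trans[OF le_real_Suc_mult initial_modes(1)[of m]] order_trans[OF le_real_Suc_mult initial_modes(2)[of m]] by simp_all
    have "\<bar>St 0 $ i\<bar> \<le> cL * J"
      unfolding St_def stack_index[OF i] by (rule idx_cases[OF i]) (simp_all add: x)
    moreover have "\<bar>X 0 $ i\<bar> \<le> J" by (intro abs_le_J total_0 i)
    moreover have "\<bar>E i 0\<bar> \<le> \<bar>St 0 $ i\<bar> + \<bar>X 0 $ i\<bar>" unfolding E_def by (rule abs_triangle_ineq4)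
    ultimately show ?thesis using J1(2) by linarith
  qed
  show "\<bar>Z i 0\<bar> \<le> (cL + 1) * J" if "i \<le> N0 + M0 + 2"
  proof -
    have "\<bar>Z i 0\<bar> \<le> J" unfolding Z_def by (auto intro!: abs_le_J total_0)
    then show ?thesis using J1(1) by linarith
  qed
qed

definition W1 where "W1 m = (if N0 < m then \<bar>c1 meas \<xi> m\<bar> * (\<bar>X1 m 0\<bar> + (if m \<le> N then \<bar>x1 m 0\<bar> else 0)) else 0)"
definition W2 where "W2 m = (if M0 < m then \<bar>c2 meas \<xi> a b s m\<bar> * (\<bar>X2 m 0\<bar> + (if m \<le> M then \<bar>x2 m 0\<bar> else 0)) else 0)"
definition Q where "Q = Cc * (cL + real N + real M + 2) * J"

lemma Q_nonneg: "0 \<le> Q"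
  using Cc(1) consts_nonneg(1) J_nonneg by (simp add: Q_def)

text \<open>The growth of \<open>c1\<close> is absorbed by the weight \<open>n + 1\<close> in the initial energy of the plant. The observer's initial values
carry no such weight, but there are only finitely many, which is why \<open>N\<close> enters the bound.\<close>
lemma weight_bounds:
  "N0 < m \<Longrightarrow> \<bar>c1 meas \<xi> m\<bar> * (\<bar>X1 m 0\<bar> + (if m \<le> N then \<bar>x1 m 0\<bar> else 0)) \<le> Q"
  "M0 < m \<Longrightarrow> \<bar>c2 meas \<xi> a b s m\<bar> * (\<bar>X2 m 0\<bar> + (if m \<le> M then \<bar>x2 m 0\<bar> else 0)) \<le> Q"
proof -
  have J: "0 \<le> real N * J" "0 \<le> real M * J" "0 \<le> J" using J_nonneg by simp_all
  have Q: "Q = Cc * (cL * J + (real N * J + real M * J + 2 * J))"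
    by (simp add: Q_def algebra_simps)
  show "\<bar>c1 meas \<xi> m\<bar> * (\<bar>X1 m 0\<bar> + (if m \<le> N then \<bar>x1 m 0\<bar> else 0)) \<le> Q" if m: "N0 < m"
  proof -
    let ?h = "if m \<le> N then \<bar>x1 m 0\<bar> else 0"
    have "(real m + 1) * ?h \<le> (real N + 1) * J"
    proof (cases "m \<le> N")
      case True
      have "\<bar>x1 m 0\<bar> \<le> J" by (intro abs_le_J total_0) (use m True in simp)
      then show ?thesis using True by (simp, intro mult_mono) auto
    next
      case False
      then show ?thesis using J by simp
    qed
    then have "(real m + 1) * (\<bar>X1 m 0\<bar> + ?h) \<le> cL * J + (real N * J + real M * J + 2 * J)"
      unfolding distrib_left[of _ "\<bar>X1 m 0\<bar>" ?h] distrib_right[of "real N" 1 J] mult_1_left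
      using initial_modes(1)[of m] J by linarith
    then have "Cc * ((real m + 1) * (\<bar>X1 m 0\<bar> + ?h)) \<le> Q"
      unfolding Q by (intro mult_left_mono less_imp_le[OF Cc(1)])
    moreover have "\<bar>c1 meas \<xi> m\<bar> * (\<bar>X1 m 0\<bar> + ?h) \<le> Cc * (real m + 1) * (\<bar>X1 m 0\<bar> + ?h)"
      by (rule mult_right_mono[OF Cc(2)]) auto
    ultimately show ?thesis by (simp only: mult.assoc)
  qed
  show "\<bar>c2 meas \<xi> a b s m\<bar> * (\<bar>X2 m 0\<bar> + (if m \<le> M then \<bar>x2 m 0\<bar> else 0)) \<le> Q" if m: "M0 < m"
  proof -
    let ?h = "if m \<le> M then \<bar>x2 m 0\<bar> else 0"
    have "?h \<le> J"
    proof (cases "m \<le> M")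
      case True
      have "\<bar>x2 m 0\<bar> \<le> J" by (intro abs_le_J total_0) (use m True in simp)
      then show ?thesis using True by simp
    qed (use J in simp)
    moreover have "\<bar>X2 m 0\<bar> \<le> cL * J"
      by (rule order_trans[OF le_real_Suc_mult initial_modes(2)[of m]]) simp
    ultimately have "\<bar>X2 m 0\<bar> + ?h \<le> cL * J + (real N * J + real M * J + 2 * J)"
      using J by linarith
    then show ?thesis unfolding Q using Cc(1,3) by (intro mult_mono) auto
  qed
qed


definition G' where
  "G' t = 0 + (\<Sum>m. W1 m * exp (- (gap1.rate m * t))) + (\<Sum>m. W2 m * exp (- (gap2.rate m * t)))"

lemma profile: "0 \<le> T \<Longrightarrow> \<exists>R G. forcing_profile T 0 R G G' \<and> R \<le> rho * J"
proof -
  assume T: "0 \<le> T"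
  have n1: "0 \<le> \<bar>c1 meas \<xi> m\<bar> * (\<bar>X1 m 0\<bar> + (if m \<le> N then \<bar>x1 m 0\<bar> else 0))" for m by simp
  have n2: "0 \<le> \<bar>c2 meas \<xi> a b s m\<bar> * (\<bar>X2 m 0\<bar> + (if m \<le> M then \<bar>x2 m 0\<bar> else 0))" for m by simp
  note ws1 = gap1.weights_summable[where w = "\<lambda>m. \<bar>c1 meas \<xi> m\<bar> * (\<bar>X1 m 0\<bar> + (if m \<le> N then \<bar>x1 m 0\<bar> else 0))" and Q = Q]
  have s1: "summable (\<lambda>m. W1 m / gap1.rate m)"
    unfolding W1_def using Q_nonneg n1 weight_bounds(1) by (rule ws1(1))
  have s1': "(\<Sum>m. W1 m / gap1.rate m) \<le> Q / \<kappa> * (\<Sum>m. inv_sq m)"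
    unfolding W1_def using Q_nonneg n1 weight_bounds(1) by (rule ws1(2))
  note ws2 = gap2.weights_summable[where w = "\<lambda>m. \<bar>c2 meas \<xi> a b s m\<bar> * (\<bar>X2 m 0\<bar> + (if m \<le> M then \<bar>x2 m 0\<bar> else 0))" and Q = Q]
  have s2: "summable (\<lambda>m. W2 m / gap2.rate m)"
    unfolding W2_def using Q_nonneg n2 weight_bounds(2) by (rule ws2(1))
  have s2': "(\<Sum>m. W2 m / gap2.rate m) \<le> Q / \<kappa> * (\<Sum>m. inv_sq m)"
    unfolding W2_def using Q_nonneg n2 weight_bounds(2) by (rule ws2(2))
  have W: "0 \<le> W1 m" "0 \<le> W2 m" for m by (simp_all add: W1_def W2_def)
  \<comment> \<open>the forcing is the superposition of the two families, starting from the zero profile\<close>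
  have "forcing_profile T 0 0 (\<lambda>_. 0) (\<lambda>_. 0)" using T by (simp add: forcing_profile_def)
  from relaxation_series(2)[OF gap2.rate_pos W(2) s2 relaxation_series(2)[OF gap1.rate_pos W(1) s1 this]]
  have "\<exists>G. forcing_profile T 0 (0 + (\<Sum>m. W1 m / gap1.rate m) + (\<Sum>m. W2 m / gap2.rate m)) G G'"
    unfolding G'_def[abs_def] by blast
  moreover have "0 + (\<Sum>m. W1 m / gap1.rate m) + (\<Sum>m. W2 m / gap2.rate m) \<le> rho * J"
  proof -
    have "rho * J = 2 * (Q / \<kappa> * (\<Sum>m. inv_sq m))" by (simp add: rho_def Q_def)
    then show ?thesis using s1' s2' by linarith
  qed
  ultimately show ?thesis by blast
qed

text \<open>The two families share the same bound \<open>Cc * Cb * gain\<close> for the product of output and input coefficients.\<close>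
lemma g_bound:
  assumes U: "0 \<le> U" and Z: "\<And>i t. i \<le> N0 + M0 + 2 \<Longrightarrow> t \<in> {0..T} \<Longrightarrow> \<bar>Z i t\<bar> \<le> U * exp (- \<delta> * t)"
    and t: "t \<in> {0<..<T}"
  shows "\<bar>g t\<bar> \<le> exp (- \<delta> * t) * (tail_gain * U + G' t)"
proof -
  interpret F1: mode_family \<delta> \<kappa> N0 "lam1 a" T U \<sigma>1 f1 by (rule families(1)[OF U Z])
  interpret F2: mode_family \<delta> \<kappa> M0 "lam2 b" T U \<sigma>2 f2 by (rule families(2)[OF U Z])
  have t0: "0 \<le> t" using t by simp
  note ex = measurement_expansion[OF domain[OF t0] \<xi>, of meas a b, folded X1_def X2_def]
  define S1 where "S1 = (\<Sum>n. c1 meas \<xi> n * X1 n t)"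
  define S2 where "S2 = (\<Sum>m. c2 meas \<xi> a b s m * X2 m t)"
  have S: "(\<lambda>n. c1 meas \<xi> n * X1 n t) sums S1" "(\<lambda>m. c2 meas \<xi> a b s m * X2 m t) sums S2"
    unfolding S1_def S2_def by (rule summable_sums[OF summable_rabs_cancel] ex(2,3))+
  let ?C = "Cc * Cb * gain"
  let ?g1 = "S1 - (\<Sum>m\<le>N0. c1 meas \<xi> m * X1 m t) - (\<Sum>m = N0 + 1..N. c1 meas \<xi> m * x1 m t)"
  let ?g2 = "S2 - (\<Sum>m\<le>M0. c2 meas \<xi> a b s m * X2 m t) - (\<Sum>m = M0 + 1..M. c2 meas \<xi> a b s m * x2 m t)"
  have b1: "\<bar>?g1\<bar> \<le> exp (- \<delta> * t) * ((\<Sum>m. W1 m * exp (- (gap1.rate m * t))) + ?C / \<kappa> * (\<Sum>m. inv_sq (m + Suc N)) * U)"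
    unfolding W1_def
    using fast_modes(1,3) observer_modes(1,3) NM(1) sigma_bounds(5) Q_nonneg weight_bounds(1) t S(1)
    by (rule F1.observed_tail[where X = X1 and xh = x1 and c = "c1 meas \<xi>" and k = N and Q = Q])
  have b2: "\<bar>?g2\<bar> \<le> exp (- \<delta> * t) * ((\<Sum>m. W2 m * exp (- (gap2.rate m * t))) + ?C / \<kappa> * (\<Sum>m. inv_sq (m + Suc M)) * U)"
    unfolding W2_def
    using fast_modes(2,4) observer_modes(2,4) NM(2) sigma_bounds(6) Q_nonneg weight_bounds(2) t S(2)
    by (rule F2.observed_tail[where X = X2 and xh = x2 and c = "c2 meas \<xi> a b s" and k = M and Q = Q])
  have arith: "e * (A + d * p1 * U) + e * (B + d * p2 * U) = e * (d * (p1 + p2) * U + (0 + A + B))" for e A B d p1 p2 :: real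
    by (simp add: algebra_simps)
  have "g t = ?g1 + ?g2" unfolding g_def ex(1) S1_def S2_def by simp
  then have "\<bar>g t\<bar> \<le> \<bar>?g1\<bar> + \<bar>?g2\<bar>" by (simp only: abs_triangle_ineq)
  also note add_mono[OF b1 b2]
  finally show ?thesis unfolding G'_def tail_gain_def arith .
qed

text \<open>The horizon of the small-gain estimate is the time \<open>t\<close> itself; its bound is uniform in the horizon.\<close>
lemma finite_part_decay:
  assumes t: "0 \<le> t"
  shows "i < N0 + M0 + 2 \<Longrightarrow> \<bar>E i t\<bar> \<le> amp * J * exp (- \<delta> * t)"
    and "i \<le> N0 + M0 + 2 \<Longrightarrow> \<bar>Z i t\<bar> \<le> amp * J * exp (- \<delta> * t)"
proof -
  obtain R G where RG: "forcing_profile t 0 R G G'" "R \<le> rho * J" using profile[OF t] by blast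
  let ?n = "N0 + M0 + 2"
  have gb: "\<forall>U\<ge>0. (\<forall>i\<le>?n. \<forall>r\<in>{0..t}. \<bar>Z i r\<bar> \<le> U * exp (- \<delta> * r)) \<longrightarrow>
        (\<forall>r\<in>{0<..<t}. \<bar>g r\<bar> \<le> exp (- \<delta> * r) * (tail_gain * U + G' r))"
    by (intro allI impI ballI g_bound[where T = t]) auto
  have i0: "\<forall>i<?n. \<bar>E i 0\<bar> \<le> (cL + 1) * J" "\<forall>i\<le>?n. \<bar>Z i 0\<bar> \<le> (cL + 1) * J"
    using initial_stack by blast+
  have "\<forall>r\<in>{0..t}. (\<forall>i<?n. \<bar>E i r\<bar> \<le> K * exp (- \<delta> * r) * ((cL + 1) * J + R)) \<and>
        (\<forall>i\<le>?n. \<bar>Z i r\<bar> \<le> K * exp (- \<delta> * r) * ((cL + 1) * J + R))"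
    by (rule SG[unfolded small_gain_estimate_def, THEN spec, THEN spec, THEN spec, THEN spec, THEN spec, THEN spec, THEN spec, THEN spec, THEN spec, THEN mp, THEN mp, THEN mp, THEN mp, THEN mp, THEN mp, THEN mp, THEN mp,
          OF consts_nonneg(5) small RG(1) E_ode Z_ode gb i0])
  then have b: "\<forall>i<?n. \<bar>E i t\<bar> \<le> K * exp (- \<delta> * t) * ((cL + 1) * J + R)"
    "\<forall>i\<le>?n. \<bar>Z i t\<bar> \<le> K * exp (- \<delta> * t) * ((cL + 1) * J + R)" using t by auto
  have "K * exp (- \<delta> * t) * ((cL + 1) * J + R) \<le> K * exp (- \<delta> * t) * ((cL + 1) * J + rho * J)"
    using K RG(2) by (intro mult_left_mono) auto
  also have "\<dots> = amp * J * exp (- \<delta> * t)" by (simp add: amp_def algebra_simps)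
  finally have c: "K * exp (- \<delta> * t) * ((cL + 1) * J + R) \<le> amp * J * exp (- \<delta> * t)" .
  show "\<bar>E i t\<bar> \<le> amp * J * exp (- \<delta> * t)" if "i < ?n"
    using b(1) that c by (meson order_trans)
  show "\<bar>Z i t\<bar> \<le> amp * J * exp (- \<delta> * t)" if "i \<le> ?n"
    using b(2) that c by (meson order_trans)
qed


text \<open>A slow coordinate is the sum of its estimate and of the estimation error.\<close>
lemma slow_modes_decay:
  assumes t: "0 \<le> t"
  shows "m \<le> N0 \<Longrightarrow> \<bar>X1 m t\<bar> \<le> exp (- \<delta> * t) * (2 * (amp * J))"
    and "m \<le> M0 \<Longrightarrow> \<bar>X2 m t\<bar> \<le> exp (- \<delta> * t) * (2 * (amp * J))"
proof -
  have St: "\<bar>St t $ i\<bar> \<le> exp (- \<delta> * t) * (2 * (amp * J))" if i: "i < N0 + M0 + 2" for i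
  proof -
    have "St t $ i = E i t + Z i t" using i by (simp add: E_def Z_def)
    moreover have "\<bar>E i t\<bar> \<le> amp * J * exp (- \<delta> * t)" "\<bar>Z i t\<bar> \<le> amp * J * exp (- \<delta> * t)"
      using finite_part_decay[OF t, of i] i by auto
    moreover have "exp (- \<delta> * t) * (2 * (amp * J)) = 2 * (amp * J * exp (- \<delta> * t))" by (simp add: mult_ac)
    ultimately show ?thesis by linarith
  qed
  show "\<bar>X1 m t\<bar> \<le> exp (- \<delta> * t) * (2 * (amp * J))" if m: "m \<le> N0"
  proof -
    obtain i where i: "i < N0 + M0 + 2" "idx ! i = Inl m" using idx_surj1[OF m] by blast
    then have "St t $ i = X1 m t" unfolding St_def stack_index[OF i(1)] by simp
    then show ?thesis using St[OF i(1)] by simp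
  qed
  show "\<bar>X2 m t\<bar> \<le> exp (- \<delta> * t) * (2 * (amp * J))" if m: "m \<le> M0"
  proof -
    obtain i where i: "i < N0 + M0 + 2" "idx ! i = Inr m" using idx_surj2[OF m] by blast
    then have "St t $ i = X2 m t" unfolding St_def stack_index[OF i(1)] by simp
    then show ?thesis using St[OF i(1)] by simp
  qed
qed

lemma energy_decay:
  assumes t: "0 \<le> t"
  shows "energy t \<le> exp (- 2 * \<delta> * t) * (energy_const * J\<^sup>2)"
proof -
  have U: "0 \<le> amp * J" using consts_nonneg(3) J_nonneg by simp
  have Z: "\<bar>Z i r\<bar> \<le> amp * J * exp (- \<delta> * r)" if "i \<le> N0 + M0 + 2" "r \<in> {0..t}" for i r
    using finite_part_decay(2)[of r i] that by simp
  interpret F1: mode_family \<delta> \<kappa> N0 "lam1 a" t "amp * J" \<sigma>1 f1 by (rule families(1)[OF U Z])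
  interpret F2: mode_family \<delta> \<kappa> M0 "lam2 b" t "amp * J" \<sigma>2 f2 by (rule families(2)[OF U Z])
  let ?e = "exp (- 2 * \<delta> * t)" and ?S = "\<Sum>m. inv_sq m"
  let ?r = "Cb * gain / \<kappa> * (amp * J)"
  have tt: "t \<in> {0..t}" using t by simp
  have b1: "(\<Sum>m. ((real m + 1) * X1 m t)\<^sup>2) \<le> ?e * (2 * (\<Sum>m. ((real m + 1) * X1 m 0)\<^sup>2) + 2 * ?r\<^sup>2 * ?S
      + (real N0 + 1) * ((real N0 + 1) * (2 * (amp * J)))\<^sup>2)"
    using fast_modes(1,3) sigma_bounds(3) tt energy_summable(1)[OF order_refl] energy_summable(1)[OF t] slow_modes_decay(1)[OF t]
    by (rule F1.energy_bound)
  have b2: "(\<Sum>m. ((real m + 1) * X2 m t)\<^sup>2) \<le> ?e * (2 * (\<Sum>m. ((real m + 1) * X2 m 0)\<^sup>2) + 2 * ?r\<^sup>2 * ?S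
      + (real M0 + 1) * ((real M0 + 1) * (2 * (amp * J)))\<^sup>2)"
    using fast_modes(2,4) sigma_bounds(4) tt energy_summable(2)[OF order_refl] energy_summable(2)[OF t] slow_modes_decay(2)[OF t]
    by (rule F2.energy_bound)
  have split: "((real k + 1) * (2 * (amp * J)))\<^sup>2 = ((real k + 1) * (2 * amp))\<^sup>2 * J\<^sup>2" for k
    by (simp only: power_mult_distrib mult.assoc)
  have r: "?r\<^sup>2 = resp\<^sup>2 * J\<^sup>2" by (simp only: resp_def power_mult_distrib mult.assoc)
  have "energy t \<le> ?e * (2 * energy 0 + (4 * ?r\<^sup>2 * ?S + (real N0 + 1) * ((real N0 + 1) * (2 * (amp * J)))\<^sup>2
      + (real M0 + 1) * ((real M0 + 1) * (2 * (amp * J)))\<^sup>2))"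
    using add_mono[OF b1 b2] unfolding energy_def by (simp add: algebra_simps)
  also have "\<dots> \<le> ?e * (2 * (4 * CL * J\<^sup>2) + (4 * ?r\<^sup>2 * ?S + (real N0 + 1) * ((real N0 + 1) * (2 * (amp * J)))\<^sup>2
      + (real M0 + 1) * ((real M0 + 1) * (2 * (amp * J)))\<^sup>2))"
    by (intro mult_left_mono add_right_mono energy_0) auto
  also have "\<dots> = ?e * (energy_const * J\<^sup>2)"
    unfolding split r energy_const_def by (simp add: algebra_simps)
  finally show ?thesis .
qed

lemma observer_modes_decay:
  assumes t: "0 \<le> t"
  shows "n \<in> {N0 + 1..N} \<Longrightarrow> (x1 n t)\<^sup>2 \<le> exp (- 2 * \<delta> * t) * ((2 * (real N + 1)\<^sup>2 + 2 * resp\<^sup>2) * J\<^sup>2)"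
    and "m \<in> {M0 + 1..M} \<Longrightarrow> (x2 m t)\<^sup>2 \<le> exp (- 2 * \<delta> * t) * ((2 * (real M + 1)\<^sup>2 + 2 * resp\<^sup>2) * J\<^sup>2)"
proof -
  have U: "0 \<le> amp * J" using consts_nonneg(3) J_nonneg by simp
  have Z: "\<bar>Z i r\<bar> \<le> amp * J * exp (- \<delta> * r)" if "i \<le> N0 + M0 + 2" "r \<in> {0..t}" for i r
    using finite_part_decay(2)[of r i] that by simp
  interpret F1: mode_family \<delta> \<kappa> N0 "lam1 a" t "amp * J" \<sigma>1 f1 by (rule families(1)[OF U Z])
  interpret F2: mode_family \<delta> \<kappa> M0 "lam2 b" t "amp * J" \<sigma>2 f2 by (rule families(2)[OF U Z])
  have tt: "t \<in> {0..t}" using t by simp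
  have r: "Cb * gain / \<kappa> * (amp * J) = resp * J" by (simp add: resp_def)
  have fin: "w\<^sup>2 \<le> exp (- 2 * \<delta> * t) * ((2 * (real k + 1)\<^sup>2 + 2 * resp\<^sup>2) * J\<^sup>2)"
    if b: "((real m + 1) * w)\<^sup>2 \<le> exp (- 2 * \<delta> * t) * (2 * ((real m + 1) * w0)\<^sup>2 + 2 * (resp * J)\<^sup>2 * inv_sq m)"
      and w0: "w0\<^sup>2 \<le> total 0" and m: "m \<le> k" for m k w w0
  proof -
    have "1 * w\<^sup>2 \<le> (real m + 1)\<^sup>2 * w\<^sup>2" by (rule mult_right_mono) auto
    then have "w\<^sup>2 \<le> ((real m + 1) * w)\<^sup>2" by (simp add: power_mult_distrib)
    also note b
    also have "2 * ((real m + 1) * w0)\<^sup>2 + 2 * (resp * J)\<^sup>2 * inv_sq m \<le> 2 * ((real k + 1)\<^sup>2 * J\<^sup>2) + 2 * (resp * J)\<^sup>2 * 1"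
    proof (intro add_mono mult_left_mono)
      show "((real m + 1) * w0)\<^sup>2 \<le> (real k + 1)\<^sup>2 * J\<^sup>2"
        unfolding power_mult_distrib J_square using m w0 by (intro mult_mono power_mono) auto
      show "inv_sq m \<le> 1" by (simp add: inv_sq_def)
    qed auto
    also have "\<dots> = (2 * (real k + 1)\<^sup>2 + 2 * resp\<^sup>2) * J\<^sup>2" by (simp add: power_mult_distrib distrib_right)
    finally show ?thesis by simp
  qed
  show "(x1 n t)\<^sup>2 \<le> exp (- 2 * \<delta> * t) * ((2 * (real N + 1)\<^sup>2 + 2 * resp\<^sup>2) * J\<^sup>2)" if n: "n \<in> {N0 + 1..N}"
  proof (rule fin)
    show "((real n + 1) * x1 n t)\<^sup>2 \<le> exp (- 2 * \<delta> * t) * (2 * ((real n + 1) * x1 n 0)\<^sup>2 + 2 * (resp * J)\<^sup>2 * inv_sq n)"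
      by (rule F1.pointwise_square_bound[OF observer_modes(1)[OF n] _ observer_modes(3)[OF n] tt sigma_bounds(3), unfolded r]) (use n in auto)
    show "(x1 n 0)\<^sup>2 \<le> total 0" by (rule total_0(5)[OF n])
    show "n \<le> N" using n by simp
  qed
  show "(x2 m t)\<^sup>2 \<le> exp (- 2 * \<delta> * t) * ((2 * (real M + 1)\<^sup>2 + 2 * resp\<^sup>2) * J\<^sup>2)" if m: "m \<in> {M0 + 1..M}"
  proof (rule fin)
    show "((real m + 1) * x2 m t)\<^sup>2 \<le> exp (- 2 * \<delta> * t) * (2 * ((real m + 1) * x2 m 0)\<^sup>2 + 2 * (resp * J)\<^sup>2 * inv_sq m)"
      by (rule F2.pointwise_square_bound[OF observer_modes(2)[OF m] _ observer_modes(4)[OF m] tt sigma_bounds(4), unfolded r]) (use m in auto)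
    show "(x2 m 0)\<^sup>2 \<le> total 0" by (rule total_0(6)[OF m])
    show "m \<le> M" using m by simp
  qed
qed

text \<open>The energy controls the norm of the plant state up to the input \<open>u\<close>, which is the last component of \<open>Z\<close>.\<close>
lemma total_decay:
  assumes t: "0 \<le> t"
  shows "total t \<le> total_const * exp (- 2 * \<delta> * t) * total 0"
proof -
  let ?e = "exp (- 2 * \<delta> * t)" and ?A = "amp\<^sup>2 * J\<^sup>2"
  have sq: "w\<^sup>2 \<le> ?e * ?A" if "\<bar>w\<bar> \<le> amp * J * exp (- \<delta> * t)" for w
  proof -
    have "w\<^sup>2 \<le> (amp * J * exp (- \<delta> * t))\<^sup>2"
      using power_mono[OF that, of 2] by simp
    moreover have "(exp (- \<delta> * t))\<^sup>2 = ?e" by (simp add: power2_eq_square flip: exp_add)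
    ultimately show ?thesis by (simp add: power_mult_distrib mult_ac)
  qed
  have u: "(u t)\<^sup>2 \<le> ?e * ?A" using sq[OF finite_part_decay(2)[OF t, of "N0 + M0 + 2"]] by (simp add: Z_def)
  have X: "X t \<bullet> X t \<le> real (N0 + M0 + 2) * (?e * ?A)"
  proof -
    have "(\<Sum>i<N0 + M0 + 2. (X t $ i)\<^sup>2) \<le> real (card {..<N0 + M0 + 2}) * (?e * ?A)"
    proof (rule sum_bounded_above)
      fix i assume "i \<in> {..<N0 + M0 + 2}"
      then show "(X t $ i)\<^sup>2 \<le> ?e * ?A" using sq[OF finite_part_decay(2)[OF t, of i]] by (simp add: Z_def)
    qed
    then show ?thesis unfolding X_norm[OF t] card_lessThan .
  qed
  have sums: "sum f {k0 + 1..k} \<le> real k * B" if "\<And>n. n \<in> {k0 + 1..k} \<Longrightarrow> f n \<le> B" "0 \<le> B" for f k0 k B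
  proof -
    have "sum f {k0 + 1..k} \<le> real (card {k0 + 1..k}) * B" by (rule sum_bounded_above) (rule that(1))
    also have "\<dots> \<le> real k * B" using that(2) by (intro mult_right_mono) auto
    finally show ?thesis .
  qed
  have x1: "(\<Sum>n = N0 + 1..N. (x1 n t)\<^sup>2) \<le> real N * (?e * ((2 * (real N + 1)\<^sup>2 + 2 * resp\<^sup>2) * J\<^sup>2))"
    by (rule sums[OF observer_modes_decay(1)[OF t]]) auto
  have x2: "(\<Sum>m = M0 + 1..M. (x2 m t)\<^sup>2) \<le> real M * (?e * ((2 * (real M + 1)\<^sup>2 + 2 * resp\<^sup>2) * J\<^sup>2))"
    by (rule sums[OF observer_modes_decay(2)[OF t]]) auto
  have "CU * energy t \<le> CU * (?e * (energy_const * J\<^sup>2))"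
    by (intro mult_left_mono energy_decay[OF t] less_imp_le[OF CU(1)])
  then have "(norm_H1 (y t, z t))\<^sup>2 \<le> 2 * (CU * (?e * (energy_const * J\<^sup>2))) + 4 * (?e * ?A)"
    using CU(2)[OF t] u by linarith
  then have "total t \<le> 2 * (CU * (?e * (energy_const * J\<^sup>2))) + 4 * (?e * ?A) + ?e * ?A + real (N0 + M0 + 2) * (?e * ?A)
     + real N * (?e * ((2 * (real N + 1)\<^sup>2 + 2 * resp\<^sup>2) * J\<^sup>2)) + real M * (?e * ((2 * (real M + 1)\<^sup>2 + 2 * resp\<^sup>2) * J\<^sup>2))"
    unfolding total_def by (intro add_mono u X x1 x2)
  also have "\<dots> = total_const * ?e * J\<^sup>2"
    by (simp only: total_const_def) (simp add: algebra_simps)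
  finally show ?thesis unfolding J_square .
qed

end

section \<open>Exponential stability\<close>

lemma Dx_cong:
  assumes "smooth_on_unit f f'" "\<And>x. x \<in> {0..1} \<Longrightarrow> g x = f x" "x \<in> {0..1}"
  shows "Dx g x = f' x"
proof (rule Dx_eq[OF _ assms(3)])
  have "(f has_real_derivative f' x) (at x within {0..1})" using assms(1,3) by (simp add: smooth_on_unit_def)
  then show "(g has_real_derivative f' x) (at x within {0..1})"
    by (rule has_field_derivative_transform_within[where d = 1]) (simp_all add: assms(2) assms(3)[simplified])
qed

text \<open>The initial state of a solution is prescribed on the unit interval only, whereas \<open>Dx\<close> is applied to functions on the whole line.\<close>
lemma norm_H1_cong:
  assumes "y \<in> H2_space" "z \<in> H2_space" "y' \<in> H2_space" "z' \<in> H2_space"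
    and "\<And>x. x \<in> {0..1} \<Longrightarrow> y' x = y x" "\<And>x. x \<in> {0..1} \<Longrightarrow> z' x = z x"
  shows "(norm_H1 (y', z'))\<^sup>2 = (norm_H1 (y, z))\<^sup>2"
proof -
  have "ip (Dx y') (Dx y') = ip (Dx y) (Dx y)" "ip (Dx z') (Dx z') = ip (Dx z) (Dx z)"
    by (intro ip_cong Dx_cong[OF H2_space_smooth(1)[OF assms(1)] assms(5)] Dx_cong[OF H2_space_smooth(1)[OF assms(2)] assms(6)]; assumption)+
  moreover have "ip z' z' = ip z z" by (intro ip_cong assms(6))
  ultimately show ?thesis unfolding norm_H1_ip[OF assms(1,2)] norm_H1_ip[OF assms(3,4)] by simp
qed

lemma inv_sq_tail_small:
  assumes "0 < (\<epsilon> :: real)"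
  shows "\<exists>k0. \<forall>k\<ge>k0. (\<Sum>m. inv_sq (m + k)) < \<epsilon>"
proof -
  obtain k0 where "\<forall>k\<ge>k0. norm (\<Sum>m. inv_sq (m + k)) < \<epsilon>"
    using suminf_exist_split[OF assms inv_sq_summable] by blast
  then show ?thesis by (auto simp: abs_less_iff)
qed

theorem theorem4:
  fixes a b s \<xi>p \<delta> ku :: real
    and meas :: measurement
    and N0 M0 :: nat
    and Kx L :: "real Matrix.vec"
  assumes "s \<noteq> 0" and "\<xi>p \<in> {0..1}" and "\<delta> > 0"
    and "lam1 a (N0 + 1) < - \<delta>" and "lam2 b (M0 + 1) < - \<delta>"
    and "\<forall>n \<in> Delta1 a b. n \<le> N0" and "\<forall>m \<in> Delta2 a b. m \<le> M0"
    and "Theta a b \<inter> {0..N0} = {}"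
    and "\<forall>n \<in> {0..N0}. c1 meas \<xi>p n \<noteq> 0"
    and "\<forall>m \<in> {0..M0} - Delta2 a b. c2 meas \<xi>p a b s m \<noteq> 0"
    and "Kx \<in> carrier_vec (N0 + M0 + 2)" and "L \<in> carrier_vec (N0 + M0 + 2)"
    and "eigenvalues_left_of (- \<delta>) (A1a a b s N0 M0 - B1a a b s N0 M0 * gain_K Kx ku)"
    and "eigenvalues_left_of (- \<delta>) (A1 a b s N0 M0 - col_mat L * C1 meas \<xi>p a b s N0 M0)"
  shows "\<exists>N1 \<ge> N0. \<exists>M1 \<ge> M0. \<forall>N \<ge> N1. \<forall>M \<ge> M1. \<exists>C > 0.
    \<forall>y0 z0 u0 y z u X x1 x2.
      y0 \<in> H2_space \<longrightarrow> z0 \<in> H2_space \<longrightarrow> u 0 = u0 \<longrightarrow>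
      y0 1 = 0 \<longrightarrow> Dx z0 1 = 0 \<longrightarrow> Dx y0 0 = s * z0 0 \<longrightarrow> Dx z0 0 = u0 \<longrightarrow>
      plant_solution a b s y0 z0 u y z \<longrightarrow>
      controller_solution meas \<xi>p a b s N0 M0 N M Kx ku L (\<lambda>t. measure_at meas \<xi>p (y t)) u X x1 x2 \<longrightarrow>
      (\<forall>t \<ge> 0.
        (norm_H1 (y t, z t))\<^sup>2 + (u t)\<^sup>2 + X t \<bullet> X t
          + (\<Sum>n = N0 + 1..N. (x1 n t)\<^sup>2) + (\<Sum>m = M0 + 1..M. (x2 m t)\<^sup>2)
        \<le> C * exp (- 2 * \<delta> * t) *
          ((norm_H1 (y0, z0))\<^sup>2 + u0\<^sup>2 + X 0 \<bullet> X 0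
            + (\<Sum>n = N0 + 1..N. (x1 n 0)\<^sup>2) + (\<Sum>m = M0 + 1..M. (x2 m 0)\<^sup>2)))"
proof -
  interpret stack_layout a b s N0 M0 using assms(6,7) by unfold_locales
  note \<xi> = assms(2) and Kx = assms(11) and L = assms(12)
  let ?n = "N0 + M0 + 2"
  obtain K1 where K1: "0 < K1"
    "uniform_decay ?n (\<lambda>i j. (A1 a b s N0 M0 - col_mat L * C1 meas \<xi>p a b s N0 M0) $$ (i, j)) \<delta> K1 {..<?n}"
    using matrix_decay[OF observer_matrix(1)[OF L] assms(14)] by blast
  have n3: "N0 + M0 + 3 = Suc ?n" by simp
  obtain K2 where K2: "0 < K2"
    "uniform_decay (Suc ?n) (\<lambda>i j. (A1a a b s N0 M0 - B1a a b s N0 M0 * gain_K Kx ku) $$ (i, j)) \<delta> K2 {..<Suc ?n}"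
    using matrix_decay[OF controller_matrix(1)[OF Kx] assms(13)] unfolding n3 by blast
  obtain K \<gamma> where K: "0 < K" and \<gamma>: "0 < \<gamma>" and SG: "small_gain_estimate ?n
       (\<lambda>i j. (A1 a b s N0 M0 - col_mat L * C1 meas \<xi>p a b s N0 M0) $$ (i, j))
       (\<lambda>i j. (A1a a b s N0 M0 - B1a a b s N0 M0 * gain_K Kx ku) $$ (i, j)) (\<lambda>i. L $ i)
       (\<lambda>j. stack a b N0 M0 (c1 meas \<xi>p) (c2 meas \<xi>p a b s) $ j) \<delta> K \<gamma>"
    using small_gain[OF K1 K2] by blast
  obtain \<kappa>1 \<kappa>2 where k12: "0 < \<kappa>1" "\<forall>n>N0. \<kappa>1 * (real n + 1)\<^sup>2 \<le> - lam1 a n - \<delta>"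
    "0 < \<kappa>2" "\<forall>m>M0. \<kappa>2 * (real m + 1)\<^sup>2 \<le> - lam2 b m - \<delta>"
    using lam1_gap[OF assms(4)] lam2_gap[OF assms(5)] by blast
  define \<kappa> where "\<kappa> = min \<kappa>1 \<kappa>2"
  have \<kappa>: "0 < \<kappa>" using k12 by (simp add: \<kappa>_def)
  have gap1: "\<kappa> * (real n + 1)\<^sup>2 \<le> - lam1 a n - \<delta>" if "N0 < n" for n
  proof -
    have "\<kappa> * (real n + 1)\<^sup>2 \<le> \<kappa>1 * (real n + 1)\<^sup>2" by (rule mult_right_mono) (simp_all add: \<kappa>_def)
    also have "\<dots> \<le> - lam1 a n - \<delta>" using k12(2) that by blast
    finally show ?thesis .
  qed
  have gap2: "\<kappa> * (real m + 1)\<^sup>2 \<le> - lam2 b m - \<delta>" if "M0 < m" for m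
  proof -
    have "\<kappa> * (real m + 1)\<^sup>2 \<le> \<kappa>2 * (real m + 1)\<^sup>2" by (rule mult_right_mono) (simp_all add: \<kappa>_def)
    also have "\<dots> \<le> - lam2 b m - \<delta>" using k12(4) that by blast
    finally show ?thesis .
  qed
  obtain Cc where Cc: "0 < Cc" "\<forall>n. \<bar>c1 meas \<xi>p n\<bar> \<le> Cc * (real n + 1) \<and> \<bar>c2 meas \<xi>p a b s n\<bar> \<le> Cc"
    using output_bounds[OF \<xi>] by blast
  obtain Cb where Cb: "0 < Cb"
    "\<forall>n. (real n + 1) * (\<bar>alpha1 a b s n\<bar> + \<bar>beta1 a b s n\<bar>) \<le> Cb \<and> \<bar>alpha2 b n\<bar> + \<bar>beta2 n\<bar> \<le> Cb"
    using input_bounds[of a b s] by blast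
  obtain CL where CL: "0 < CL" "\<forall>y0 z0 u v y z t. plant a b s y0 z0 u v y z \<longrightarrow> 0 \<le> t \<longrightarrow>
     plant.energy a b s u y z t \<le> CL * (2 * (norm_H1 (y t, z t))\<^sup>2 + 4 * (u t)\<^sup>2)"
    using energy_le_H1_norm[of a b s] by blast
  obtain CU where CU: "0 < CU" "\<forall>y0 z0 u v y z t. plant a b s y0 z0 u v y z \<longrightarrow> 0 \<le> t \<longrightarrow>
     (norm_H1 (y t, z t))\<^sup>2 \<le> 2 * (CU * plant.energy a b s u y z t) + 4 * (u t)\<^sup>2"
    using H1_norm_le_energy[of a b s] by blast
  \<comment> \<open>the factor of the tail sums in tail_gain; it does not depend on N and M\<close>
  define D where "D = Cc * Cb * (1 + (\<Sum>i<?n. \<bar>Kx $ i\<bar>) + \<bar>ku\<bar>) / \<kappa>"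
  have D: "0 < D"
  proof -
    have "0 \<le> (\<Sum>i<?n. \<bar>Kx $ i\<bar>)" by (intro sum_nonneg) simp
    then have "0 < 1 + (\<Sum>i<?n. \<bar>Kx $ i\<bar>) + \<bar>ku\<bar>" by linarith
    then show ?thesis unfolding D_def using Cc(1) Cb(1) \<kappa> by (intro divide_pos_pos mult_pos_pos)
  qed
  have "0 < \<gamma> / (2 * D)" using D \<gamma> by simp
  then obtain k0 where k0: "\<forall>k\<ge>k0. (\<Sum>m. inv_sq (m + k)) < \<gamma> / (2 * D)"
    using inv_sq_tail_small by blast
  show ?thesis
  proof (intro exI[of _ "N0 + M0 + k0"] conjI allI impI)
    fix N M assume N: "N0 + M0 + k0 \<le> N" and M: "N0 + M0 + k0 \<le> M"
    interpret gain_constants N0 M0 N M Kx ku \<kappa> K Cc Cb CL CU .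
    have small: "tail_gain \<le> \<gamma>"
    proof -
      have "(\<Sum>m. inv_sq (m + Suc N)) < \<gamma> / (2 * D)" "(\<Sum>m. inv_sq (m + Suc M)) < \<gamma> / (2 * D)"
        using k0[rule_format, of "Suc N"] k0[rule_format, of "Suc M"] N M by auto
      then have "(\<Sum>m. inv_sq (m + Suc N)) + (\<Sum>m. inv_sq (m + Suc M)) \<le> \<gamma> / D" by simp
      then have "tail_gain \<le> D * (\<gamma> / D)"
        unfolding tail_gain_def gain_def D_def[symmetric] using D by (intro mult_left_mono) auto
      then show ?thesis using D by simp
    qed
    show "\<exists>C > 0.
    \<forall>y0 z0 u0 y z u X x1 x2.
      y0 \<in> H2_space \<longrightarrow> z0 \<in> H2_space \<longrightarrow> u 0 = u0 \<longrightarrow>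
      y0 1 = 0 \<longrightarrow> Dx z0 1 = 0 \<longrightarrow> Dx y0 0 = s * z0 0 \<longrightarrow> Dx z0 0 = u0 \<longrightarrow>
      plant_solution a b s y0 z0 u y z \<longrightarrow>
      controller_solution meas \<xi>p a b s N0 M0 N M Kx ku L (\<lambda>t. measure_at meas \<xi>p (y t)) u X x1 x2 \<longrightarrow>
      (\<forall>t \<ge> 0.
        (norm_H1 (y t, z t))\<^sup>2 + (u t)\<^sup>2 + X t \<bullet> X t
          + (\<Sum>n = N0 + 1..N. (x1 n t)\<^sup>2) + (\<Sum>m = M0 + 1..M. (x2 m t)\<^sup>2)
        \<le> C * exp (- 2 * \<delta> * t) *
          ((norm_H1 (y0, z0))\<^sup>2 + u0\<^sup>2 + X 0 \<bullet> X 0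
            + (\<Sum>n = N0 + 1..N. (x1 n 0)\<^sup>2) + (\<Sum>m = M0 + 1..M. (x2 m 0)\<^sup>2)))"
    \<comment> \<open>the maximum makes positivity evident\<close>
    proof (intro exI[of _ "max 1 total_const"] conjI allI impI)
      show "0 < max 1 total_const" by simp
      fix y0 z0 u0 y z u X x1 x2 and t :: real
      assume y0: "y0 \<in> H2_space" and z0: "z0 \<in> H2_space" and u0: "u 0 = u0"
        and P: "plant_solution a b s y0 z0 u y z"
        and ctrl: "controller_solution meas \<xi>p a b s N0 M0 N M Kx ku L (\<lambda>t. measure_at meas \<xi>p (y t)) u X x1 x2"
        and t: "0 \<le> t"
      \<comment> \<open>the right-hand side of the controller equation for u, so that u is continuously differentiable with derivative v\<close>
      define v where "v = (\<lambda>t. - (Kx \<bullet> X t) - ku * u t)"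
      have uv: "C0_C1_solution u v" using ctrl unfolding controller_solution_def Let_def v_def by blast
      have plant: "plant a b s y0 z0 u v y z" using P uv by unfold_locales
      have loop: "closed_loop a b s N0 M0 y0 z0 u v y z meas \<xi>p N M Kx L ku X x1 x2"
        by (intro closed_loop.intro closed_loop_axioms.intro stack_layout_axioms plant ctrl)
           (use \<xi> N M Kx L v_def in auto)
      interpret W: closed_loop_bounds a b s N0 M0 y0 z0 u v y z meas \<xi>p N M Kx L ku X x1 x2 \<kappa> K Cc Cb CL CU \<delta> \<gamma>
      proof (intro closed_loop_bounds.intro closed_loop_bounds_axioms.intro loop)
        show "0 < \<kappa>" "0 < Cc" "0 < Cb" "0 < CL" "0 < CU" "0 < K" by (fact \<kappa> Cc Cb CL CU K)+
        show "\<And>n. N0 < n \<Longrightarrow> \<kappa> * (real n + 1)\<^sup>2 \<le> - lam1 a n - \<delta>" by (rule gap1)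
        show "\<And>m. M0 < m \<Longrightarrow> \<kappa> * (real m + 1)\<^sup>2 \<le> - lam2 b m - \<delta>" by (rule gap2)
        show "\<And>n. \<bar>c1 meas \<xi>p n\<bar> \<le> Cc * (real n + 1)" "\<And>m. \<bar>c2 meas \<xi>p a b s m\<bar> \<le> Cc" using Cc by auto
        show "\<And>n. (real n + 1) * (\<bar>alpha1 a b s n\<bar> + \<bar>beta1 a b s n\<bar>) \<le> Cb" "\<And>m. \<bar>alpha2 b m\<bar> + \<bar>beta2 m\<bar> \<le> Cb" using Cb by auto
        show "\<And>t. 0 \<le> t \<Longrightarrow> plant.energy a b s u y z t \<le> CL * (2 * (norm_H1 (y t, z t))\<^sup>2 + 4 * (u t)\<^sup>2)"
          using CL(2) plant by blast
        show "\<And>t. 0 \<le> t \<Longrightarrow> (norm_H1 (y t, z t))\<^sup>2 \<le> 2 * (CU * plant.energy a b s u y z t) + 4 * (u t)\<^sup>2"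
          using CU(2) plant by blast
        show "tail_gain \<le> \<gamma>" by (rule small)
        show "small_gain_estimate ?n
           (\<lambda>i j. (A1 a b s N0 M0 - col_mat L * C1 meas \<xi>p a b s N0 M0) $$ (i, j))
           (\<lambda>i j. (A1a a b s N0 M0 - B1a a b s N0 M0 * gain_K Kx ku) $$ (i, j)) (\<lambda>i. L $ i)
           (\<lambda>j. closed_loop.cc a b s N0 M0 meas \<xi>p $ j) \<delta> K \<gamma>"
          using SG unfolding closed_loop.cc_def[OF loop] .
      qed
      have init: "\<And>x. x \<in> {0..1} \<Longrightarrow> y 0 x = y0 x" "\<And>x. x \<in> {0..1} \<Longrightarrow> z 0 x = z0 x"
        using P by (auto simp: plant_solution_def)
      have "(norm_H1 (y 0, z 0))\<^sup>2 = (norm_H1 (y0, z0))\<^sup>2"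
        by (rule norm_H1_cong[OF y0 z0 W.H2(1) W.H2(2) init]) auto
      then have total0: "W.total 0 = (norm_H1 (y0, z0))\<^sup>2 + u0\<^sup>2 + X 0 \<bullet> X 0
            + (\<Sum>n = N0 + 1..N. (x1 n 0)\<^sup>2) + (\<Sum>m = M0 + 1..M. (x2 m 0)\<^sup>2)"
        by (simp only: W.total_def u0)
      have "W.total t \<le> total_const * exp (- 2 * \<delta> * t) * W.total 0" by (rule W.total_decay[OF t])
      also have "\<dots> \<le> max 1 total_const * exp (- 2 * \<delta> * t) * W.total 0"
        by (intro mult_right_mono W.total_0(1)) auto
      finally show "(norm_H1 (y t, z t))\<^sup>2 + (u t)\<^sup>2 + X t \<bullet> X t
          + (\<Sum>n = N0 + 1..N. (x1 n t)\<^sup>2) + (\<Sum>m = M0 + 1..M. (x2 m t)\<^sup>2)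
        \<le> max 1 total_const * exp (- 2 * \<delta> * t) *
          ((norm_H1 (y0, z0))\<^sup>2 + u0\<^sup>2 + X 0 \<bullet> X 0
            + (\<Sum>n = N0 + 1..N. (x1 n 0)\<^sup>2) + (\<Sum>m = M0 + 1..M. (x2 m 0)\<^sup>2))"
        unfolding total0 unfolding W.total_def .
    qed
  qed simp_all
qed

end
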